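(* Let $(M,\omega)$ be a symplectic manifold, $\nabla$ a torsion-free symplectic connection on $M$, $E\to M$ a complex vector bundle with connection $\nabla^E$, and $\Omega=\sum_{i\ge1}\lambda^i\Omega_i$ a formal series of closed two-forms on $M$. Let $\star$ and $\star'$ be the associated Fedosov deformations of $C^\infty(M)[[\lambda]]$ and $\Gamma^\infty(\mathrm{End}(E))[[\lambda]]$ (built with the same $\Omega$), and let $\tau,\tau',\tau^E$ be the corresponding Fedosov-Taylor series, as described in the context. Then the definitions $$A\bullet's=\sigma(\tau'(A)\circ\tau^E(s)),\qquad s\bullet f=\sigma(\tau^E(s)\circ\tau(f))$$ for $A\in\Gamma^\infty(\mathrm{End}(E))[[\lambda]]$, $s\in\Gamma^\infty(E)[[\lambda]]$, $f\in C^\infty(M)[[\lambda]]$ make $\Gamma^\infty(E)[[\lambda]]$ into a bimodule for $\star'$ and $\star$: $\bullet'$ is a left module structure over $(\Gamma^\infty(\mathrm{End}(E))[[\lambda]],\star')$, $\bullet$ is a right module structure over $(C^\infty(M)[[\lambda]],\star)$, and the two actions commute.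
   Context: Spaces (all bundles complexified, $\lambda$ a formal parameter): $\mathcal W=\prod_{s\ge0}\Gamma^\infty(\bigvee^sT^*M)[[\lambda]]$, $\mathcal W\otimes\Lambda^\bullet=\prod_s\Gamma^\infty(\bigvee^sT^*M\otimes\bigwedge^\bullet T^*M)[[\lambda]]$, and $\mathcal W\otimes\Lambda^\bullet\otimes\mathcal E$, $\mathcal W\otimes\Lambda^\bullet\otimes\mathcal End(\mathcal E)$ are defined the same way with an additional tensor factor $E$, respectively $\mathrm{End}(E)$. $\mathcal W\otimes\Lambda^\bullet$ is regarded as a subalgebra of $\mathcal W\otimes\Lambda^\bullet\otimes\mathcal End(\mathcal E)$. Degrees: $\deg_s,\deg_a,\deg_\lambda$ are the symmetric, antisymmetric and $\lambda$-degree; the total degree is $\mathrm{Deg}=2\deg_\lambda+\deg_s$. $\ker\deg_a$ means the elements of antisymmetric degree $0$. $\sigma$ is the projection onto the part of symmetric and antisymmetric degree $0$. Operators: $\delta=(1\otimes dx^i)\,i_s(\partial_i)$ and $\delta^*=(dx^i\otimes1)\,i_a(\partial_i)$, with $i_s,i_a$ the symmetric and antisymmetric insertions (in $\delta$ the form $dx^i$ multiplies in the $\bigwedge$ factor, in $\delta^*$ in the $\bigvee$ factor). $\delta^{-1}a=\frac1{k+l}\delta^*a$ if $\deg_sa=ka$, $\deg_aa=la$ with $k+l\neq0$, and $\delta^{-1}a=0$ if $k=l=0$. Covariant derivatives: $D=(1\otimes dx^i)\nabla_{\partial_i}$ on $\mathcal W\otimes\Lambda^\bullet$ (so $D(f\otimes\alpha)=\nabla_{\partial_i}f\otimes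 dx^i\wedge\alpha+f\otimes d\alpha$), and $D^E$, $D'$ are its extensions to the $E$- and $\mathrm{End}(E)$-valued spaces using $\nabla^E$ and the induced connection $\nabla^{\mathrm{End}(E)}$. Fiberwise Weyl product: $f\circ g=\mu\circ e^{\frac{\mathrm i\lambda}{2}\Lambda^{kl}i_s(\partial_k)\otimes i_s(\partial_l)}(f\otimes g)$ for $f,g\in\mathcal W$, with $\mu$ the symmetric product and $\Lambda^{kl}=-\omega^{kl}$ the Poisson tensor ($\omega^{kl}$ the inverse matrix of $\omega_{kl}$, where $\omega=\frac12\omega_{kl}dx^k\wedge dx^l$). It is extended by $\wedge$ on forms, composition in $\mathrm{End}(E)$, and the actions $(f\otimes\alpha\otimes A)\circ(g\otimes\beta\otimes s)=f\circ g\otimes\alpha\wedge\beta\otimes As$, $(g\otimes\beta\otimes s)\circ(h\otimes\gamma)=g\circ h\otimes\beta\wedge\gamma\otimes s$; thus $\mathcal W\otimes\Lambda^\bullet\otimes\mathcal E$ is a bimodule for the algebras $\mathcal W\otimes\Lambda^\bullet\otimes\mathcal End(\mathcal E)$ and $\mathcal W\otimes\Lambda^\bullet$. $\mathrm{ad}$ is the super-commutator (graded by $\deg_a$) with respect to $\circ$; for $r\in\mathcal W\otimes\Lambda^1$ it is also defined on $\mathcal W\otimes\Lambda^\bullet\otimes\mathcal E$, where $r$ acts from both sides. Expressions with $1/\lambda$ are understood after allowing negative powers of $\lambda$. Curvatures: $R=\frac14\omega_{lm}R^m_{kij}\,dx^l\vee dx^k\otimes dx^i\wedge dx^j$ with $R(\partial_i,\partial_j)\partial_k=R^m_{kij}\partial_m$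 the curvature of $\nabla$; $R^E=\frac12dx^i\wedge dx^j\otimes R^E_{ij}$ with $R^E_{ij}=R^E(\partial_i,\partial_j)$ the curvature endomorphisms of $\nabla^E$. Fedosov elements: by Fedosov's theorem there are unique $r\in\mathcal W\otimes\Lambda^1$ and $r'\in\mathcal W\otimes\Lambda^1\otimes\mathcal End(\mathcal E)$ of total degree $\ge3$ with $\delta r=R+Dr+\frac{\mathrm i}{\lambda}r\circ r+\Omega$, $\delta^{-1}r=0$, and $\delta r'=R-\mathrm i\lambda R^E+D'r'+\frac{\mathrm i}{\lambda}r'\circ r'+\Omega$, $\delta^{-1}r'=0$. Set $r^E=\frac{\mathrm i}{\lambda}(r'-r)$ (which contains no negative powers of $\lambda$). Fedosov derivatives: $\mathcal D=-\delta+D+\frac{\mathrm i}{\lambda}\mathrm{ad}(r)$ on $\mathcal W\otimes\Lambda^\bullet$, $\mathcal D'=-\delta+D'+\frac{\mathrm i}{\lambda}\mathrm{ad}(r')$ on $\mathcal W\otimes\Lambda^\bullet\otimes\mathcal End(\mathcal E)$, and $\mathcal D^E=-\delta+D^E+\frac{\mathrm i}{\lambda}\mathrm{ad}(r)+r^E$ on $\mathcal W\otimes\Lambda^\bullet\otimes\mathcal E$ ($r^E$ acting by $\circ$-left multiplication). The maps $\sigma:\ker\mathcal D\cap\ker\deg_a\to C^\infty(M)[[\lambda]]$, $\sigma:\ker\mathcal D'\cap\ker\deg_a\to\Gamma^\infty(\mathrm{End}(E))[[\lambda]]$, $\sigma:\ker\mathcal D^E\cap\ker\deg_a\to\Gamma^\infty(E)[[\lambda]]$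 are bijections, with inverses (Fedosov-Taylor series) denoted $\tau$, $\tau'$, $\tau^E$. The deformed products are $f\star g=\sigma(\tau(f)\circ\tau(g))$ on $C^\infty(M)[[\lambda]]$ and $A\star'B=\sigma(\tau'(A)\circ\tau'(B))$ on $\Gamma^\infty(\mathrm{End}(E))[[\lambda]]$; both are associative. *)

theory Defs
  imports "HOL-Analysis.Analysis" "HOL-Library.Function_Algebras"
    "HOL-Computational_Algebra.Formal_Power_Series"
begin

section \<open>Complex vector spaces\<close>

class complex_space = ab_group_add +
  fixes scaleC :: "complex \<Rightarrow> 'a \<Rightarrow> 'a" (infixr "*\<^sub>C" 75)
  assumes scaleC_add_right: "a *\<^sub>C (x + y) = a *\<^sub>C x + a *\<^sub>C y"
    and scaleC_add_left: "(a + b) *\<^sub>C x = a *\<^sub>C x + b *\<^sub>C x"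
    and scaleC_scaleC: "a *\<^sub>C (b *\<^sub>C x) = (a * b) *\<^sub>C x"
    and scaleC_one: "1 *\<^sub>C x = x"

instantiation complex :: complex_space
begin
definition scaleC_complex :: "complex \<Rightarrow> complex \<Rightarrow> complex"
  where "scaleC_complex a x = a * x"
instance by standard (simp_all add: scaleC_complex_def algebra_simps)
end

instantiation "fun" :: (type, complex_space) complex_space
begin
definition scaleC_fun :: "complex \<Rightarrow> ('a \<Rightarrow> 'b) \<Rightarrow> 'a \<Rightarrow> 'b"
  where "scaleC_fun a f = (\<lambda>x. a *\<^sub>C f x)"
instance
  by standard (simp_all add: scaleC_fun_def fun_eq_iff scaleC_add_right scaleC_add_left
      scaleC_scaleC scaleC_one)
end


section \<open>Smooth manifolds\<close>

fun Ck_on :: "nat \<Rightarrow> 'a::euclidean_space set \<Rightarrow> ('a \<Rightarrow> 'b::real_normed_vector) \<Rightarrow> bool" where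
  "Ck_on 0 S f \<longleftrightarrow> continuous_on S f"
| "Ck_on (Suc k) S f \<longleftrightarrow> (\<forall>x\<in>S. f differentiable (at x)) \<and>
     (\<forall>v. Ck_on k S (\<lambda>x. frechet_derivative f (at x) v))"

text \<open>Only used for open \<open>S\<close>.\<close>

definition smooth_on :: "'a::euclidean_space set \<Rightarrow> ('a \<Rightarrow> 'b::real_normed_vector) \<Rightarrow> bool"
  where "smooth_on S f \<longleftrightarrow> (\<forall>k. Ck_on k S f)"

text \<open>The manifold is the whole (Hausdorff, second countable) type \<open>'m\<close>. A chart is a pair of
  its domain and its coordinate map; values of the map off the domain are irrelevant.\<close>

type_synonym ('m, 'n) chart = "'m set \<times> ('m \<Rightarrow> real ^ 'n)"

definition chart_inv :: "('m, 'n::finite) chart \<Rightarrow> real ^ 'n \<Rightarrow> 'm"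
  where "chart_inv c = inv_into (fst c) (snd c)"

definition is_chart :: "('m::topological_space, 'n::finite) chart \<Rightarrow> bool"
  where "is_chart c \<longleftrightarrow> open (fst c) \<and> open (snd c ` fst c) \<and>
    homeomorphism (fst c) (snd c ` fst c) (snd c) (chart_inv c)"

definition smooth_atlas :: "('m::topological_space, 'n::finite) chart set \<Rightarrow> bool"
  where "smooth_atlas \<A> \<longleftrightarrow> (\<forall>c\<in>\<A>. is_chart c) \<and> (\<Union>c\<in>\<A>. fst c) = UNIV \<and>
    (\<forall>c\<in>\<A>. \<forall>d\<in>\<A>. smooth_on (snd c ` (fst c \<inter> fst d)) (snd d \<circ> chart_inv c))"

definition smooth_fun ::
    "('m, 'n::finite) chart set \<Rightarrow> 'm set \<Rightarrow> ('m \<Rightarrow> 'b::real_normed_vector) \<Rightarrow> bool"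
  where "smooth_fun \<A> U f \<longleftrightarrow> (\<forall>c\<in>\<A>. smooth_on (snd c ` (U \<inter> fst c)) (f \<circ> chart_inv c))"

text \<open>A tangent vector at \<open>p\<close> is the family of its component vectors in all the charts around
  \<open>p\<close>, related by the Jacobians of the coordinate changes (and \<open>0\<close> for all other charts).\<close>

type_synonym ('m, 'n) tvec = "('m, 'n) chart \<Rightarrow> real ^ 'n"

definition jacobian :: "('m, 'n::finite) chart \<Rightarrow> ('m, 'n) chart \<Rightarrow> 'm \<Rightarrow> real ^ 'n \<Rightarrow> real ^ 'n"
  where "jacobian c d p = frechet_derivative (snd d \<circ> chart_inv c) (at (snd c p))"

definition tangent_space :: "('m, 'n::finite) chart set \<Rightarrow> 'm \<Rightarrow> ('m, 'n) tvec set"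
  where "tangent_space \<A> p = {v.
    (\<forall>c\<in>\<A>. \<forall>d\<in>\<A>. p \<in> fst c \<inter> fst d \<longrightarrow> v d = jacobian c d p (v c)) \<and>
    (\<forall>c. \<not> (c \<in> \<A> \<and> p \<in> fst c) \<longrightarrow> v c = 0)}"

definition tscale :: "real \<Rightarrow> ('m, 'n::finite) tvec \<Rightarrow> ('m, 'n) tvec"
  where "tscale a v = (\<lambda>c. a *\<^sub>R v c)"

text \<open>The local vector field on \<open>fst c\<close> whose components in the chart \<open>c\<close> are constantly
  \<open>u\<close>; in particular the coordinate fields.\<close>

definition const_field :: "('m, 'n::finite) chart set \<Rightarrow> ('m, 'n) chart \<Rightarrow> real ^ 'n \<Rightarrow> 'm \<Rightarrow> ('m, 'n) tvec"
  where "const_field \<A> c u p =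
    (\<lambda>d. if c \<in> \<A> \<and> d \<in> \<A> \<and> p \<in> fst c \<inter> fst d then jacobian c d p u else 0)"

definition coord :: "('m, 'n::finite) chart set \<Rightarrow> ('m, 'n) chart \<Rightarrow> 'n \<Rightarrow> 'm \<Rightarrow> ('m, 'n) tvec"
  where "coord \<A> c i = const_field \<A> c (axis i 1)"

definition vector_field :: "('m, 'n::finite) chart set \<Rightarrow> 'm set \<Rightarrow> ('m \<Rightarrow> ('m, 'n) tvec) \<Rightarrow> bool"
  where "vector_field \<A> U X \<longleftrightarrow> (\<forall>p\<in>U. X p \<in> tangent_space \<A> p) \<and>
    (\<forall>c\<in>\<A>. smooth_fun \<A> (U \<inter> fst c) (\<lambda>p. X p c))"

text \<open>Some chart around \<open>p\<close>. It is only used to evaluate coordinate expressions that do not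
  depend on the choice of local coordinates.\<close>

definition chart_at :: "('m, 'n::finite) chart set \<Rightarrow> 'm \<Rightarrow> ('m, 'n) chart"
  where "chart_at \<A> p = (SOME c. c \<in> \<A> \<and> p \<in> fst c)"

definition dirderiv ::
    "('m, 'n::finite) chart set \<Rightarrow> ('m, 'n) tvec \<Rightarrow> ('m \<Rightarrow> 'b::real_normed_vector) \<Rightarrow> 'm \<Rightarrow> 'b"
  where "dirderiv \<A> v f p = (let c = chart_at \<A> p in
    frechet_derivative (f \<circ> chart_inv c) (at (snd c p)) (v c))"

definition lie_bracket ::
    "('m, 'n::finite) chart set \<Rightarrow> ('m \<Rightarrow> ('m, 'n) tvec) \<Rightarrow> ('m \<Rightarrow> ('m, 'n) tvec) \<Rightarrow> 'm \<Rightarrow> ('m, 'n) tvec"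
  where "lie_bracket \<A> X Y p =
    (\<lambda>d. if d \<in> \<A> \<and> p \<in> fst d
         then dirderiv \<A> (X p) (\<lambda>q. Y q d) p - dirderiv \<A> (Y p) (\<lambda>q. X q d) p else 0)"


section \<open>Complex vector bundles\<close>

text \<open>The fibres \<open>E p\<close> are finite-dimensional subspaces of a complex vector space \<open>'e\<close>, which only
  serves as a common type for them: no relation between different fibres is required. Local
  trivializations are given as local frames, that is, as triples of an open domain, the rank over
  it, and the frame sections.\<close>

type_synonym ('m, 'e) frame = "'m set \<times> nat \<times> (nat \<Rightarrow> 'm \<Rightarrow> 'e)"

definition combination_on ::
    "('m, 'n::finite) chart set \<Rightarrow> 'm set \<Rightarrow> nat \<Rightarrow> (nat \<Rightarrow> 'm \<Rightarrow> 'e::complex_space) \<Rightarrow> ('m \<Rightarrow> 'e) \<Rightarrow> bool"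
  where "combination_on \<A> U k e s \<longleftrightarrow> (\<exists>g :: nat \<Rightarrow> 'm \<Rightarrow> complex.
    (\<forall>i<k. smooth_fun \<A> U (g i)) \<and> (\<forall>p\<in>U. s p = (\<Sum>i<k. g i p *\<^sub>C e i p)))"

definition vector_bundle ::
    "('m::topological_space, 'n::finite) chart set \<Rightarrow> ('m \<Rightarrow> 'e::complex_space set) \<Rightarrow> ('m, 'e) frame set \<Rightarrow> bool"
  where "vector_bundle \<A> E F \<longleftrightarrow>
    (\<forall>p. 0 \<in> E p \<and> (\<forall>x\<in>E p. \<forall>y\<in>E p. x + y \<in> E p) \<and> (\<forall>a. \<forall>x\<in>E p. a *\<^sub>C x \<in> E p)) \<and>
    (\<forall>p. \<exists>(U, k, e)\<in>F. p \<in> U) \<and>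
    (\<forall>(U, k, e)\<in>F. open U \<and> (\<forall>p\<in>U. (\<forall>i<k. e i p \<in> E p) \<and>
       (\<forall>x\<in>E p. \<exists>!a :: nat \<Rightarrow> complex. (\<forall>i\<ge>k. a i = 0) \<and> x = (\<Sum>i<k. a i *\<^sub>C e i p)))) \<and>
    (\<forall>(U, k, e)\<in>F. \<forall>(V, l, f)\<in>F. \<forall>i<k. combination_on \<A> (U \<inter> V) l f (e i))"

definition smooth_section ::
    "('m, 'n::finite) chart set \<Rightarrow> ('m \<Rightarrow> 'e::complex_space set) \<Rightarrow> ('m, 'e) frame set \<Rightarrow> 'm set \<Rightarrow> ('m \<Rightarrow> 'e) \<Rightarrow> bool"
  where "smooth_section \<A> E F U s \<longleftrightarrow> (\<forall>p\<in>U. s p \<in> E p) \<and>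
    (\<forall>(V, k, e)\<in>F. combination_on \<A> (U \<inter> V) k e s)"

text \<open>Endomorphisms of a fibre are extended by \<open>0\<close> off the fibre, so that equality of
  endomorphisms is equality of functions.\<close>

definition End_fibre :: "('m \<Rightarrow> 'e::complex_space set) \<Rightarrow> 'm \<Rightarrow> ('e \<Rightarrow> 'e) set"
  where "End_fibre E p = {A. (\<forall>x\<in>E p. A x \<in> E p) \<and>
    (\<forall>x\<in>E p. \<forall>y\<in>E p. A (x + y) = A x + A y) \<and>
    (\<forall>a. \<forall>x\<in>E p. A (a *\<^sub>C x) = a *\<^sub>C A x) \<and> (\<forall>x. x \<notin> E p \<longrightarrow> A x = 0)}"

definition id_End :: "('m \<Rightarrow> 'e::complex_space set) \<Rightarrow> 'm \<Rightarrow> 'e \<Rightarrow> 'e"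
  where "id_End E p = (\<lambda>x. if x \<in> E p then x else 0)"

definition smooth_End ::
    "('m, 'n::finite) chart set \<Rightarrow> ('m \<Rightarrow> 'e::complex_space set) \<Rightarrow> ('m, 'e) frame set \<Rightarrow> 'm set \<Rightarrow> ('m \<Rightarrow> 'e \<Rightarrow> 'e) \<Rightarrow> bool"
  where "smooth_End \<A> E F U A \<longleftrightarrow> (\<forall>p\<in>U. A p \<in> End_fibre E p) \<and>
    (\<forall>(V, k, e)\<in>F. \<forall>i<k. smooth_section \<A> E F (U \<inter> V) (\<lambda>p. A p (e i p)))"


section \<open>Connections\<close>

text \<open>Connections are operators on local sections: \<open>N X s\<close> is the covariant derivative of \<open>s\<close>
  along \<open>X\<close> wherever both are smooth, and it is compatible with restriction to open sets
  (second clause).\<close>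

definition linear_connection ::
    "('m::topological_space, 'n::finite) chart set \<Rightarrow> ('m \<Rightarrow> 'e::complex_space set) \<Rightarrow> ('m, 'e) frame set \<Rightarrow>
      (('m \<Rightarrow> ('m, 'n) tvec) \<Rightarrow> ('m \<Rightarrow> 'e) \<Rightarrow> 'm \<Rightarrow> 'e) \<Rightarrow> bool"
  where "linear_connection \<A> E F N \<longleftrightarrow>
    (\<forall>U X s. open U \<longrightarrow> vector_field \<A> U X \<longrightarrow> smooth_section \<A> E F U s \<longrightarrow>
      smooth_section \<A> E F U (N X s) \<and>
      (\<forall>Y t. (\<forall>p\<in>U. Y p = X p \<and> t p = s p) \<longrightarrow> (\<forall>p\<in>U. N Y t p = N X s p)) \<and>
      (\<forall>Y. vector_field \<A> U Y \<longrightarrow> (\<forall>p\<in>U. N (X + Y) s p = N X s p + N Y s p)) \<and>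
      (\<forall>f. smooth_fun \<A> U f \<longrightarrow>
         (\<forall>p\<in>U. N (\<lambda>q. tscale (f q) (X q)) s p = of_real (f p) *\<^sub>C N X s p)) \<and>
      (\<forall>t. smooth_section \<A> E F U t \<longrightarrow> (\<forall>p\<in>U. N X (s + t) p = N X s p + N X t p)) \<and>
      (\<forall>f. smooth_fun \<A> U f \<longrightarrow> (\<forall>p\<in>U. N X (\<lambda>q. f q *\<^sub>C s q) p =
         dirderiv \<A> (X p) f p *\<^sub>C s p + f p *\<^sub>C N X s p)))"

definition affine_connection ::
    "('m::topological_space, 'n::finite) chart set \<Rightarrow>
      (('m \<Rightarrow> ('m, 'n) tvec) \<Rightarrow> ('m \<Rightarrow> ('m, 'n) tvec) \<Rightarrow> 'm \<Rightarrow> ('m, 'n) tvec) \<Rightarrow> bool"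
  where "affine_connection \<A> N \<longleftrightarrow>
    (\<forall>U X Z. open U \<longrightarrow> vector_field \<A> U X \<longrightarrow> vector_field \<A> U Z \<longrightarrow>
      vector_field \<A> U (N X Z) \<and>
      (\<forall>Y W. (\<forall>p\<in>U. Y p = X p \<and> W p = Z p) \<longrightarrow> (\<forall>p\<in>U. N Y W p = N X Z p)) \<and>
      (\<forall>Y. vector_field \<A> U Y \<longrightarrow> (\<forall>p\<in>U. N (X + Y) Z p = N X Z p + N Y Z p)) \<and>
      (\<forall>f. smooth_fun \<A> U f \<longrightarrow>
         (\<forall>p\<in>U. N (\<lambda>q. tscale (f q) (X q)) Z p = tscale (f p) (N X Z p))) \<and>
      (\<forall>W. vector_field \<A> U W \<longrightarrow> (\<forall>p\<in>U. N X (Z + W) p = N X Z p + N X W p)) \<and>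
      (\<forall>f. smooth_fun \<A> U f \<longrightarrow> (\<forall>p\<in>U. N X (\<lambda>q. tscale (f q) (Z q)) p =
         tscale (dirderiv \<A> (X p) f p) (Z p) + tscale (f p) (N X Z p))))"

definition torsion_free ::
    "('m::topological_space, 'n::finite) chart set \<Rightarrow>
      (('m \<Rightarrow> ('m, 'n) tvec) \<Rightarrow> ('m \<Rightarrow> ('m, 'n) tvec) \<Rightarrow> 'm \<Rightarrow> ('m, 'n) tvec) \<Rightarrow> bool"
  where "torsion_free \<A> N \<longleftrightarrow>
    (\<forall>U X Y. open U \<longrightarrow> vector_field \<A> U X \<longrightarrow> vector_field \<A> U Y \<longrightarrow>
      (\<forall>p\<in>U. N X Y p - N Y X p = lie_bracket \<A> X Y p))"

definition curvature ::
    "('m, 'n::finite) chart set \<Rightarrow> (('m \<Rightarrow> ('m, 'n) tvec) \<Rightarrow> ('m \<Rightarrow> 'v) \<Rightarrow> 'm \<Rightarrow> 'v::ab_group_add) \<Rightarrow>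
      ('m \<Rightarrow> ('m, 'n) tvec) \<Rightarrow> ('m \<Rightarrow> ('m, 'n) tvec) \<Rightarrow> ('m \<Rightarrow> 'v) \<Rightarrow> 'm \<Rightarrow> 'v"
  where "curvature \<A> N X Y s = N X (N Y s) - N Y (N X s) - N (lie_bracket \<A> X Y) s"


section \<open>Tensors\<close>

text \<open>A tensor at a point, with values in \<open>'v\<close>, of all symmetric and antisymmetric degrees at once:
  an element of \<open>\<Prod>s. Sym^s T*M \<otimes> Alt T*M \<otimes> V\<close>. Its component of degree \<open>(s, k)\<close> is the
  restriction to \<open>s\<close> symmetric arguments (first list) and \<open>k\<close> antisymmetric arguments (second
  list), regarded as a multilinear map. The value is \<open>0\<close> if some argument is not a tangent
  vector at the point, so that equality of tensors is equality of functions.\<close>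

type_synonym ('m, 'n, 'v) tensor = "('m, 'n) tvec list \<Rightarrow> ('m, 'n) tvec list \<Rightarrow> 'v"

definition tensor_at ::
    "('m, 'n::finite) chart set \<Rightarrow> 'v::complex_space set \<Rightarrow> 'm \<Rightarrow> ('m, 'n, 'v) tensor \<Rightarrow> bool"
  where "tensor_at \<A> V p t \<longleftrightarrow> (let T = tangent_space \<A> p in
    (\<forall>vs ws. t vs ws \<in> V) \<and>
    (\<forall>vs ws. \<not> set vs \<union> set ws \<subseteq> T \<longrightarrow> t vs ws = 0) \<and>
    (\<forall>us us' ws. \<forall>x\<in>T. \<forall>y\<in>T. t (us @ (x + y) # us') ws = t (us @ x # us') ws + t (us @ y # us') ws) \<and>
    (\<forall>us us' ws a. \<forall>x\<in>T. t (us @ tscale a x # us') ws = of_real a *\<^sub>C t (us @ x # us') ws) \<and>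
    (\<forall>vs us us'. \<forall>x\<in>T. \<forall>y\<in>T. t vs (us @ (x + y) # us') = t vs (us @ x # us') + t vs (us @ y # us')) \<and>
    (\<forall>vs us us' a. \<forall>x\<in>T. t vs (us @ tscale a x # us') = of_real a *\<^sub>C t vs (us @ x # us')) \<and>
    (\<forall>vs vs' ws. mset vs = mset vs' \<longrightarrow> t vs ws = t vs' ws) \<and>
    (\<forall>vs ws. \<not> distinct ws \<longrightarrow> t vs ws = 0))"

text \<open>Here \<open>V\<close> is the bundle of values and \<open>S U\<close> tells which of its sections are smooth on \<open>U\<close>.\<close>

definition tensor_field ::
    "('m, 'n::finite) chart set \<Rightarrow> ('m \<Rightarrow> 'v::complex_space set) \<Rightarrow> ('m set \<Rightarrow> ('m \<Rightarrow> 'v) \<Rightarrow> bool) \<Rightarrow>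
      ('m \<Rightarrow> ('m, 'n, 'v) tensor) \<Rightarrow> bool"
  where "tensor_field \<A> V S t \<longleftrightarrow> (\<forall>p. tensor_at \<A> (V p) p (t p)) \<and>
    (\<forall>c\<in>\<A>. \<forall>is js. S (fst c)
       (\<lambda>p. t p (map (\<lambda>i. coord \<A> c i p) is) (map (\<lambda>j. coord \<A> c j p) js)))"

definition two_form :: "('m, 'n::finite) chart set \<Rightarrow> ('m \<Rightarrow> ('m, 'n, complex) tensor) \<Rightarrow> bool"
  where "two_form \<A> \<alpha> \<longleftrightarrow> tensor_field \<A> (\<lambda>_. UNIV) (smooth_fun \<A>) \<alpha> \<and>
    (\<forall>p vs ws. \<not> (vs = [] \<and> length ws = 2) \<longrightarrow> \<alpha> p vs ws = 0)"

definition ext_deriv_comp ::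
    "('m, 'n::finite) chart set \<Rightarrow> ('m, 'n) chart \<Rightarrow> ('m \<Rightarrow> ('m, 'n, complex) tensor) \<Rightarrow> 'n list \<Rightarrow> 'm \<Rightarrow> complex"
  where "ext_deriv_comp \<A> c \<alpha> js p = (\<Sum>k<length js. (- 1) ^ k * dirderiv \<A> (coord \<A> c (js ! k) p)
    (\<lambda>q. \<alpha> q [] (map (\<lambda>j. coord \<A> c j q) (take k js @ drop (Suc k) js))) p)"

definition closed_two_form :: "('m, 'n::finite) chart set \<Rightarrow> ('m \<Rightarrow> ('m, 'n, complex) tensor) \<Rightarrow> bool"
  where "closed_two_form \<A> \<alpha> \<longleftrightarrow> two_form \<A> \<alpha> \<and>
    (\<forall>c\<in>\<A>. \<forall>p\<in>fst c. \<forall>js. length js = 3 \<longrightarrow> ext_deriv_comp \<A> c \<alpha> js p = 0)"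

definition symplectic_form :: "('m, 'n::finite) chart set \<Rightarrow> ('m \<Rightarrow> ('m, 'n, complex) tensor) \<Rightarrow> bool"
  where "symplectic_form \<A> \<omega> \<longleftrightarrow> closed_two_form \<A> \<omega> \<and> (\<forall>p vs ws. \<omega> p vs ws \<in> \<real>) \<and>
    (\<forall>p. \<forall>v\<in>tangent_space \<A> p. (\<forall>w\<in>tangent_space \<A> p. \<omega> p [] [v, w] = 0) \<longrightarrow> v = 0)"

definition symplectic_connection ::
    "('m::topological_space, 'n::finite) chart set \<Rightarrow> ('m \<Rightarrow> ('m, 'n, complex) tensor) \<Rightarrow>
      (('m \<Rightarrow> ('m, 'n) tvec) \<Rightarrow> ('m \<Rightarrow> ('m, 'n) tvec) \<Rightarrow> 'm \<Rightarrow> ('m, 'n) tvec) \<Rightarrow> bool"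
  where "symplectic_connection \<A> \<omega> N \<longleftrightarrow> affine_connection \<A> N \<and>
    (\<forall>U X Y Z. open U \<longrightarrow> vector_field \<A> U X \<longrightarrow> vector_field \<A> U Y \<longrightarrow> vector_field \<A> U Z \<longrightarrow>
      (\<forall>p\<in>U. dirderiv \<A> (X p) (\<lambda>q. \<omega> q [] [Y q, Z q]) p =
        \<omega> p [] [N X Y p, Z p] + \<omega> p [] [Y p, N X Z p]))"

definition dx_sym :: "('m, 'n::finite) chart set \<Rightarrow> ('m, 'n) chart \<Rightarrow> 'n \<Rightarrow> 'm \<Rightarrow> ('m, 'n, complex) tensor"
  where "dx_sym \<A> c i p vs ws =
    (if length vs = 1 \<and> ws = [] \<and> set vs \<subseteq> tangent_space \<A> p then of_real (hd vs c $ i) else 0)"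

definition dx_alt :: "('m, 'n::finite) chart set \<Rightarrow> ('m, 'n) chart \<Rightarrow> 'n \<Rightarrow> 'm \<Rightarrow> ('m, 'n, complex) tensor"
  where "dx_alt \<A> c i p vs ws =
    (if vs = [] \<and> length ws = 1 \<and> set ws \<subseteq> tangent_space \<A> p then of_real (hd ws c $ i) else 0)"

text \<open>The product of \<open>Sym \<otimes> Alt \<otimes> V\<close> induced by a bilinear map \<open>B\<close> on the values, as a sum over
  shuffles; so \<open>\<alpha> \<and> \<beta> = \<alpha> \<otimes> \<beta> - \<beta> \<otimes> \<alpha>\<close> and \<open>\<alpha> \<or> \<beta> = \<alpha> \<otimes> \<beta> + \<beta> \<otimes> \<alpha>\<close> for covectors. Insertion of
  \<open>X\<close> in the symmetric (antisymmetric) part is \<open>\<lambda>vs ws. t (X # vs) ws\<close>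
  (\<open>\<lambda>vs ws. t vs (X # ws)\<close>), a derivation (antiderivation) of this product.\<close>

definition shuffle_sign :: "nat \<Rightarrow> nat set \<Rightarrow> complex"
  where "shuffle_sign k J = (- 1) ^ card {(i, j). i \<in> J \<and> j \<in> {..<k} - J \<and> j < i}"

definition tmul ::
    "('u \<Rightarrow> 'v \<Rightarrow> 'w::complex_space) \<Rightarrow> ('m, 'n, 'u) tensor \<Rightarrow> ('m, 'n, 'v) tensor \<Rightarrow> ('m, 'n, 'w) tensor"
  where "tmul B x y vs ws = (\<Sum>I\<in>Pow {..<length vs}. \<Sum>J\<in>Pow {..<length ws}.
    shuffle_sign (length ws) J *\<^sub>C B (x (nths vs I) (nths ws J)) (y (nths vs (- I)) (nths ws (- J))))"


section \<open>The spaces of the Fedosov construction\<close>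

text \<open>Formal Laurent series in \<open>\<lambda>\<close> are written as functions \<open>a\<close> on the integers, \<open>a m\<close> being
  the coefficient of \<open>\<lambda>^m\<close>; they are formal power series if \<open>a m = 0\<close> for all \<open>m < 0\<close>.\<close>

type_synonym ('m, 'n, 'v) wform = "int \<Rightarrow> 'm \<Rightarrow> ('m, 'n, 'v) tensor"

definition i_over_lambda :: "(int \<Rightarrow> 'v::complex_space) \<Rightarrow> int \<Rightarrow> 'v"
  where "i_over_lambda a m = \<i> *\<^sub>C a (m + 1)"

definition lambda_scale :: "complex fps \<Rightarrow> (int \<Rightarrow> 'v::complex_space) \<Rightarrow> int \<Rightarrow> 'v"
  where "lambda_scale z a m =
    (if m < 0 then 0 else \<Sum>i\<le>nat m. fps_nth z i *\<^sub>C a (m - int i))"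

definition const_series :: "'v::zero \<Rightarrow> int \<Rightarrow> 'v"
  where "const_series x m = (if m = 0 then x else 0)"

definition series :: "('m set \<Rightarrow> ('m \<Rightarrow> 'v::zero) \<Rightarrow> bool) \<Rightarrow> (int \<Rightarrow> 'm \<Rightarrow> 'v) set"
  where "series S = {s. (\<forall>m. S UNIV (s m)) \<and> (\<forall>m<0. s m = 0)}"

definition W_space ::
    "('m, 'n::finite) chart set \<Rightarrow> ('m \<Rightarrow> 'v::complex_space set) \<Rightarrow> ('m set \<Rightarrow> ('m \<Rightarrow> 'v) \<Rightarrow> bool) \<Rightarrow>
      ('m, 'n, 'v) wform set"
  where "W_space \<A> V S = {a. (\<forall>m. tensor_field \<A> V S (a m)) \<and> (\<forall>m<0. a m = 0)}"

definition has_deg_a :: "nat \<Rightarrow> ('m, 'n, 'v::zero) wform \<Rightarrow> bool"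
  where "has_deg_a k a \<longleftrightarrow> (\<forall>m p vs ws. length ws \<noteq> k \<longrightarrow> a m p vs ws = 0)"

definition part_deg_a :: "nat \<Rightarrow> ('m, 'n, 'v::zero) wform \<Rightarrow> ('m, 'n, 'v) wform"
  where "part_deg_a k a m p vs ws = (if length ws = k then a m p vs ws else 0)"

definition total_degree_ge :: "int \<Rightarrow> ('m, 'n, 'v::zero) wform \<Rightarrow> bool"
  where "total_degree_ge d a \<longleftrightarrow>
    (\<forall>m p vs ws. 2 * m + int (length vs) < d \<longrightarrow> a m p vs ws = 0)"

definition sigma :: "('m, 'n, 'v) wform \<Rightarrow> int \<Rightarrow> 'm \<Rightarrow> 'v"
  where "sigma a m p = a m p [] []"

definition delta :: "('m, 'n::finite) chart set \<Rightarrow> ('m, 'n, 'v::complex_space) wform \<Rightarrow> ('m, 'n, 'v) wform"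
  where "delta \<A> a m p = (let c = chart_at \<A> p in
    \<Sum>i\<in>UNIV. tmul scaleC (dx_alt \<A> c i p) (\<lambda>vs ws. a m p (coord \<A> c i p # vs) ws))"

definition delta_star :: "('m, 'n::finite) chart set \<Rightarrow> ('m, 'n, 'v::complex_space) wform \<Rightarrow> ('m, 'n, 'v) wform"
  where "delta_star \<A> a m p = (let c = chart_at \<A> p in
    \<Sum>i\<in>UNIV. tmul scaleC (dx_sym \<A> c i p) (\<lambda>vs ws. a m p vs (coord \<A> c i p # ws)))"

text \<open>\<open>delta_star\<close> preserves \<open>k + l\<close>, and it vanishes in degree \<open>k = l = 0\<close>.\<close>

definition delta_inv :: "('m, 'n::finite) chart set \<Rightarrow> ('m, 'n, 'v::complex_space) wform \<Rightarrow> ('m, 'n, 'v) wform"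
  where "delta_inv \<A> a m p vs ws =
    (1 / of_nat (length vs + length ws)) *\<^sub>C delta_star \<A> a m p vs ws"

text \<open>\<open>\<nabla>\<^sub>X t\<close> for \<open>t\<close> with values in a bundle with connection \<open>N\<close>, \<open>\<nabla>\<close> being the connection on \<open>TM\<close>.
  The arguments are extended to vector fields with constant components in the chart \<open>c\<close>; the
  result is tensorial in them.\<close>

definition cov_tensor ::
    "('m, 'n::finite) chart set \<Rightarrow> (('m \<Rightarrow> ('m, 'n) tvec) \<Rightarrow> ('m \<Rightarrow> ('m, 'n) tvec) \<Rightarrow> 'm \<Rightarrow> ('m, 'n) tvec) \<Rightarrow>
      (('m \<Rightarrow> ('m, 'n) tvec) \<Rightarrow> ('m \<Rightarrow> 'v) \<Rightarrow> 'm \<Rightarrow> 'v) \<Rightarrow> ('m, 'n) chart \<Rightarrow> ('m \<Rightarrow> ('m, 'n) tvec) \<Rightarrow>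
      ('m \<Rightarrow> ('m, 'n, 'v::complex_space) tensor) \<Rightarrow> 'm \<Rightarrow> ('m, 'n, 'v) tensor"
  where "cov_tensor \<A> nab N c X t p vs ws =
    (if set vs \<union> set ws \<subseteq> tangent_space \<A> p then
       N X (\<lambda>q. t q (map (\<lambda>v. const_field \<A> c (v c) q) vs) (map (\<lambda>w. const_field \<A> c (w c) q) ws)) p
       - (\<Sum>k<length vs. t p (vs[k := nab X (const_field \<A> c ((vs ! k) c)) p]) ws)
       - (\<Sum>k<length ws. t p vs (ws[k := nab X (const_field \<A> c ((ws ! k) c)) p]))
     else 0)"

definition cov_deriv ::
    "('m, 'n::finite) chart set \<Rightarrow> (('m \<Rightarrow> ('m, 'n) tvec) \<Rightarrow> ('m \<Rightarrow> ('m, 'n) tvec) \<Rightarrow> 'm \<Rightarrow> ('m, 'n) tvec) \<Rightarrow>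
      (('m \<Rightarrow> ('m, 'n) tvec) \<Rightarrow> ('m \<Rightarrow> 'v) \<Rightarrow> 'm \<Rightarrow> 'v) \<Rightarrow>
      ('m, 'n, 'v::complex_space) wform \<Rightarrow> ('m, 'n, 'v) wform"
  where "cov_deriv \<A> nab N a m p = (let c = chart_at \<A> p in
    \<Sum>i\<in>UNIV. tmul scaleC (dx_alt \<A> c i p) (cov_tensor \<A> nab N c (coord \<A> c i) (a m) p))"

definition omega_matrix ::
    "('m, 'n::finite) chart set \<Rightarrow> ('m \<Rightarrow> ('m, 'n, complex) tensor) \<Rightarrow> ('m, 'n) chart \<Rightarrow> 'm \<Rightarrow> complex ^ 'n ^ 'n"
  where "omega_matrix \<A> \<omega> c p = (\<chi> k l. \<omega> p [] [coord \<A> c k p, coord \<A> c l p])"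

definition poisson ::
    "('m, 'n::finite) chart set \<Rightarrow> ('m \<Rightarrow> ('m, 'n, complex) tensor) \<Rightarrow> ('m, 'n) chart \<Rightarrow> 'm \<Rightarrow> 'n \<Rightarrow> 'n \<Rightarrow> complex"
  where "poisson \<A> \<omega> c p k l = - (matrix_inv (omega_matrix \<A> \<omega> c p) $ k $ l)"

text \<open>The \<open>n\<close>-th power of the bidifferential operator in the exponent of the Weyl product,
  followed by the undeformed product. A list \<open>ks\<close> of \<open>n\<close> indices stands for the insertion of
  all the corresponding coordinate vectors.\<close>

definition weyl_term ::
    "('m, 'n::finite) chart set \<Rightarrow> ('m \<Rightarrow> ('m, 'n, complex) tensor) \<Rightarrow> ('u \<Rightarrow> 'v \<Rightarrow> 'w::complex_space) \<Rightarrow>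
      nat \<Rightarrow> 'm \<Rightarrow> ('m, 'n, 'u) tensor \<Rightarrow> ('m, 'n, 'v) tensor \<Rightarrow> ('m, 'n, 'w) tensor"
  where "weyl_term \<A> \<omega> B n p x y = (let c = chart_at \<A> p in
    \<Sum>ks | length ks = n. \<Sum>ls | length ls = n.
      (\<Prod>q<n. poisson \<A> \<omega> c p (ks ! q) (ls ! q)) *\<^sub>C
      tmul B (\<lambda>vs ws. x (map (\<lambda>k. coord \<A> c k p) ks @ vs) ws)
             (\<lambda>vs ws. y (map (\<lambda>l. coord \<A> c l p) ls @ vs) ws))"

text \<open>The index set of the sum is finite for Laurent series \<open>f\<close>, \<open>g\<close>.\<close>

definition wprod ::
    "('m, 'n::finite) chart set \<Rightarrow> ('m \<Rightarrow> ('m, 'n, complex) tensor) \<Rightarrow>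
      ('u::zero \<Rightarrow> 'v::zero \<Rightarrow> 'w::complex_space) \<Rightarrow>
      ('m, 'n, 'u) wform \<Rightarrow> ('m, 'n, 'v) wform \<Rightarrow> ('m, 'n, 'w) wform"
  where "wprod \<A> \<omega> B f g m p =
    (\<Sum>(i, j, n) | f i \<noteq> 0 \<and> g j \<noteq> 0 \<and> i + j + int n = m.
      ((\<i> / 2) ^ n / fact n) *\<^sub>C weyl_term \<A> \<omega> B n p (f i p) (g j p))"

text \<open>\<open>pl\<close> and \<open>pr\<close> are the two actions; the sum runs over the homogeneous components of \<open>a\<close>,
  and evaluation selects the complementary component of \<open>b\<close>.\<close>

definition super_commutator ::
    "(('m, 'n, 'u) wform \<Rightarrow> ('m, 'n, 'v) wform \<Rightarrow> ('m, 'n, 'v) wform) \<Rightarrow>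
      (('m, 'n, 'v) wform \<Rightarrow> ('m, 'n, 'u) wform \<Rightarrow> ('m, 'n, 'v) wform) \<Rightarrow>
      ('m, 'n, 'u::zero) wform \<Rightarrow> ('m, 'n, 'v::complex_space) wform \<Rightarrow> ('m, 'n, 'v) wform"
  where "super_commutator pl pr a b m p vs ws = (\<Sum>k\<le>length ws.
    pl (part_deg_a k a) b m p vs ws
    - (- 1) ^ (k * (length ws - k)) *\<^sub>C pr b (part_deg_a k a) m p vs ws)"


section \<open>Fedosov elements, Fedosov derivatives and deformed products\<close>

record ('m, 'n, 'e) fedosov_data =
  Atlas :: "('m, 'n) chart set"
  Symp :: "'m \<Rightarrow> ('m, 'n, complex) tensor"
  Conn :: "('m \<Rightarrow> ('m, 'n) tvec) \<Rightarrow> ('m \<Rightarrow> ('m, 'n) tvec) \<Rightarrow> 'm \<Rightarrow> ('m, 'n) tvec"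
  Fibre :: "'m \<Rightarrow> 'e set"
  Frames :: "('m, 'e) frame set"
  EConn :: "('m \<Rightarrow> ('m, 'n) tvec) \<Rightarrow> ('m \<Rightarrow> 'e) \<Rightarrow> 'm \<Rightarrow> 'e"
  Omega :: "int \<Rightarrow> 'm \<Rightarrow> ('m, 'n, complex) tensor"

abbreviation smooth_C :: "('m, 'n::finite, 'e::complex_space) fedosov_data \<Rightarrow> 'm set \<Rightarrow> ('m \<Rightarrow> complex) \<Rightarrow> bool"
  where "smooth_C G \<equiv> smooth_fun (Atlas G)"

abbreviation smooth_E :: "('m, 'n::finite, 'e::complex_space) fedosov_data \<Rightarrow> 'm set \<Rightarrow> ('m \<Rightarrow> 'e) \<Rightarrow> bool"
  where "smooth_E G \<equiv> smooth_section (Atlas G) (Fibre G) (Frames G)"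

abbreviation smooth_EndE ::
    "('m, 'n::finite, 'e::complex_space) fedosov_data \<Rightarrow> 'm set \<Rightarrow> ('m \<Rightarrow> 'e \<Rightarrow> 'e) \<Rightarrow> bool"
  where "smooth_EndE G \<equiv> smooth_End (Atlas G) (Fibre G) (Frames G)"

definition W_C :: "('m, 'n::finite, 'e::complex_space) fedosov_data \<Rightarrow> ('m, 'n, complex) wform set"
  where "W_C G = W_space (Atlas G) (\<lambda>_. UNIV) (smooth_C G)"

definition W_E :: "('m, 'n::finite, 'e::complex_space) fedosov_data \<Rightarrow> ('m, 'n, 'e) wform set"
  where "W_E G = W_space (Atlas G) (Fibre G) (smooth_E G)"

definition W_End :: "('m, 'n::finite, 'e::complex_space) fedosov_data \<Rightarrow> ('m, 'n, 'e \<Rightarrow> 'e) wform set"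
  where "W_End G = W_space (Atlas G) (End_fibre (Fibre G)) (smooth_EndE G)"

text \<open>The inclusion \<open>f \<mapsto> f \<otimes> id\<close> of the scalar forms into the \<open>End(E)\<close>-valued ones.\<close>

definition emb :: "('m, 'n::finite, 'e::complex_space) fedosov_data \<Rightarrow> ('m, 'n, complex) wform \<Rightarrow> ('m, 'n, 'e \<Rightarrow> 'e) wform"
  where "emb G a m p vs ws = a m p vs ws *\<^sub>C id_End (Fibre G) p"

definition local_section :: "('m::topological_space, 'n::finite, 'e::complex_space) fedosov_data \<Rightarrow> 'm \<Rightarrow> 'e \<Rightarrow> 'm \<Rightarrow> 'e"
  where "local_section G p x = (SOME s. (\<exists>U. open U \<and> p \<in> U \<and> smooth_E G U s) \<and> s p = x)"

definition CConn :: "('m, 'n::finite, 'e::complex_space) fedosov_data \<Rightarrow>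
    ('m \<Rightarrow> ('m, 'n) tvec) \<Rightarrow> ('m \<Rightarrow> complex) \<Rightarrow> 'm \<Rightarrow> complex"
  where "CConn G X f p = dirderiv (Atlas G) (X p) f p"

definition EndConn :: "('m::topological_space, 'n::finite, 'e::complex_space) fedosov_data \<Rightarrow>
    ('m \<Rightarrow> ('m, 'n) tvec) \<Rightarrow> ('m \<Rightarrow> 'e \<Rightarrow> 'e) \<Rightarrow> 'm \<Rightarrow> 'e \<Rightarrow> 'e"
  where "EndConn G X A p x = (if x \<in> Fibre G p then
    (let s = local_section G p x in EConn G X (\<lambda>q. A q (s q)) p - A p (EConn G X s p)) else 0)"

definition R_M :: "('m, 'n::finite, 'e::complex_space) fedosov_data \<Rightarrow> ('m, 'n, complex) wform"
  where "R_M G = const_series (\<lambda>p. let \<A> = Atlas G; c = chart_at \<A> p in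
    (1 / 4) *\<^sub>C (\<Sum>l\<in>UNIV. \<Sum>m\<in>UNIV. \<Sum>k\<in>UNIV. \<Sum>i\<in>UNIV. \<Sum>j\<in>UNIV.
      (omega_matrix \<A> (Symp G) c p $ l $ m *
       of_real (curvature \<A> (Conn G) (coord \<A> c i) (coord \<A> c j) (coord \<A> c k) p c $ m)) *\<^sub>C
      tmul (*) (tmul (*) (dx_sym \<A> c l p) (dx_sym \<A> c k p))
               (tmul (*) (dx_alt \<A> c i p) (dx_alt \<A> c j p))))"

definition R_E_comp :: "('m::topological_space, 'n::finite, 'e::complex_space) fedosov_data \<Rightarrow>
    ('m, 'n) chart \<Rightarrow> 'n \<Rightarrow> 'n \<Rightarrow> 'm \<Rightarrow> 'e \<Rightarrow> 'e"
  where "R_E_comp G c i j p x = (if x \<in> Fibre G p then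
    curvature (Atlas G) (EConn G) (coord (Atlas G) c i) (coord (Atlas G) c j) (local_section G p x) p
    else 0)"

definition R_E_form :: "('m::topological_space, 'n::finite, 'e::complex_space) fedosov_data \<Rightarrow> 'm \<Rightarrow> ('m, 'n, 'e \<Rightarrow> 'e) tensor"
  where "R_E_form G p vs ws = (let \<A> = Atlas G; c = chart_at \<A> p in
    (1 / 2) *\<^sub>C (\<Sum>i\<in>UNIV. \<Sum>j\<in>UNIV.
      tmul (*) (dx_alt \<A> c i p) (dx_alt \<A> c j p) vs ws *\<^sub>C R_E_comp G c i j p))"

definition lambda_R_E :: "('m::topological_space, 'n::finite, 'e::complex_space) fedosov_data \<Rightarrow> ('m, 'n, 'e \<Rightarrow> 'e) wform"
  where "lambda_R_E G m = (if m = 1 then R_E_form G else 0)"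

definition DC :: "('m, 'n::finite, 'e::complex_space) fedosov_data \<Rightarrow> ('m, 'n, complex) wform \<Rightarrow> ('m, 'n, complex) wform"
  where "DC G = cov_deriv (Atlas G) (Conn G) (CConn G)"

definition DE :: "('m, 'n::finite, 'e::complex_space) fedosov_data \<Rightarrow> ('m, 'n, 'e) wform \<Rightarrow> ('m, 'n, 'e) wform"
  where "DE G = cov_deriv (Atlas G) (Conn G) (EConn G)"

definition DEnd :: "('m::topological_space, 'n::finite, 'e::complex_space) fedosov_data \<Rightarrow>
    ('m, 'n, 'e \<Rightarrow> 'e) wform \<Rightarrow> ('m, 'n, 'e \<Rightarrow> 'e) wform"
  where "DEnd G = cov_deriv (Atlas G) (Conn G) (EndConn G)"

text \<open>The products between the scalar (\<open>C\<close>), \<open>E\<close>-valued (\<open>E\<close>) and \<open>End(E)\<close>-valued (\<open>A\<close>) forms.\<close>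

definition mul_CC :: "('m, 'n::finite, 'e::complex_space) fedosov_data \<Rightarrow>
    ('m, 'n, complex) wform \<Rightarrow> ('m, 'n, complex) wform \<Rightarrow> ('m, 'n, complex) wform"
  where "mul_CC G = wprod (Atlas G) (Symp G) (*)"

definition mul_AA :: "('m, 'n::finite, 'e::complex_space) fedosov_data \<Rightarrow>
    ('m, 'n, 'e \<Rightarrow> 'e) wform \<Rightarrow> ('m, 'n, 'e \<Rightarrow> 'e) wform \<Rightarrow> ('m, 'n, 'e \<Rightarrow> 'e) wform"
  where "mul_AA G = wprod (Atlas G) (Symp G) (\<circ>)"

definition mul_AE :: "('m, 'n::finite, 'e::complex_space) fedosov_data \<Rightarrow>
    ('m, 'n, 'e \<Rightarrow> 'e) wform \<Rightarrow> ('m, 'n, 'e) wform \<Rightarrow> ('m, 'n, 'e) wform"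
  where "mul_AE G = wprod (Atlas G) (Symp G) (\<lambda>A x. A x)"

definition mul_CE :: "('m, 'n::finite, 'e::complex_space) fedosov_data \<Rightarrow>
    ('m, 'n, complex) wform \<Rightarrow> ('m, 'n, 'e) wform \<Rightarrow> ('m, 'n, 'e) wform"
  where "mul_CE G = wprod (Atlas G) (Symp G) scaleC"

definition mul_EC :: "('m, 'n::finite, 'e::complex_space) fedosov_data \<Rightarrow>
    ('m, 'n, 'e) wform \<Rightarrow> ('m, 'n, complex) wform \<Rightarrow> ('m, 'n, 'e) wform"
  where "mul_EC G = wprod (Atlas G) (Symp G) (\<lambda>x z. z *\<^sub>C x)"

definition fedosov_element :: "('m, 'n::finite, 'e::complex_space) fedosov_data \<Rightarrow> ('m, 'n, complex) wform \<Rightarrow> bool"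
  where "fedosov_element G r \<longleftrightarrow> r \<in> W_C G \<and> has_deg_a 1 r \<and> total_degree_ge 3 r \<and>
    delta (Atlas G) r = R_M G + DC G r + i_over_lambda (mul_CC G r r) + Omega G \<and>
    delta_inv (Atlas G) r = 0"

definition fedosov_element_End ::
    "('m::topological_space, 'n::finite, 'e::complex_space) fedosov_data \<Rightarrow> ('m, 'n, 'e \<Rightarrow> 'e) wform \<Rightarrow> bool"
  where "fedosov_element_End G r' \<longleftrightarrow> r' \<in> W_End G \<and> has_deg_a 1 r' \<and> total_degree_ge 3 r' \<and>
    delta (Atlas G) r' = emb G (R_M G) - \<i> *\<^sub>C lambda_R_E G + DEnd G r'
      + i_over_lambda (mul_AA G r' r') + emb G (Omega G) \<and>
    delta_inv (Atlas G) r' = 0"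

definition r_E :: "('m, 'n::finite, 'e::complex_space) fedosov_data \<Rightarrow>
    ('m, 'n, complex) wform \<Rightarrow> ('m, 'n, 'e \<Rightarrow> 'e) wform \<Rightarrow> ('m, 'n, 'e \<Rightarrow> 'e) wform"
  where "r_E G r r' = i_over_lambda (r' - emb G r)"

definition fedosov_C :: "('m, 'n::finite, 'e::complex_space) fedosov_data \<Rightarrow>
    ('m, 'n, complex) wform \<Rightarrow> ('m, 'n, complex) wform \<Rightarrow> ('m, 'n, complex) wform"
  where "fedosov_C G r a = - delta (Atlas G) a + DC G a
    + i_over_lambda (super_commutator (mul_CC G) (mul_CC G) r a)"

definition fedosov_End :: "('m::topological_space, 'n::finite, 'e::complex_space) fedosov_data \<Rightarrow>
    ('m, 'n, 'e \<Rightarrow> 'e) wform \<Rightarrow> ('m, 'n, 'e \<Rightarrow> 'e) wform \<Rightarrow> ('m, 'n, 'e \<Rightarrow> 'e) wform"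
  where "fedosov_End G r' a = - delta (Atlas G) a + DEnd G a
    + i_over_lambda (super_commutator (mul_AA G) (mul_AA G) r' a)"

definition fedosov_E :: "('m, 'n::finite, 'e::complex_space) fedosov_data \<Rightarrow>
    ('m, 'n, complex) wform \<Rightarrow> ('m, 'n, 'e \<Rightarrow> 'e) wform \<Rightarrow> ('m, 'n, 'e) wform \<Rightarrow> ('m, 'n, 'e) wform"
  where "fedosov_E G r r' a = - delta (Atlas G) a + DE G a
    + i_over_lambda (super_commutator (mul_CE G) (mul_EC G) r a) + mul_AE G (r_E G r r') a"

definition ker_C :: "('m, 'n::finite, 'e::complex_space) fedosov_data \<Rightarrow> ('m, 'n, complex) wform \<Rightarrow>
    ('m, 'n, complex) wform set"
  where "ker_C G r = {a \<in> W_C G. fedosov_C G r a = 0 \<and> has_deg_a 0 a}"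

definition ker_End :: "('m::topological_space, 'n::finite, 'e::complex_space) fedosov_data \<Rightarrow>
    ('m, 'n, 'e \<Rightarrow> 'e) wform \<Rightarrow> ('m, 'n, 'e \<Rightarrow> 'e) wform set"
  where "ker_End G r' = {a \<in> W_End G. fedosov_End G r' a = 0 \<and> has_deg_a 0 a}"

definition ker_E :: "('m, 'n::finite, 'e::complex_space) fedosov_data \<Rightarrow> ('m, 'n, complex) wform \<Rightarrow>
    ('m, 'n, 'e \<Rightarrow> 'e) wform \<Rightarrow> ('m, 'n, 'e) wform set"
  where "ker_E G r r' = {a \<in> W_E G. fedosov_E G r r' a = 0 \<and> has_deg_a 0 a}"

definition tau_C :: "('m, 'n::finite, 'e::complex_space) fedosov_data \<Rightarrow> ('m, 'n, complex) wform \<Rightarrow>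
    (int \<Rightarrow> 'm \<Rightarrow> complex) \<Rightarrow> ('m, 'n, complex) wform"
  where "tau_C G r = inv_into (ker_C G r) sigma"

definition tau_End :: "('m::topological_space, 'n::finite, 'e::complex_space) fedosov_data \<Rightarrow>
    ('m, 'n, 'e \<Rightarrow> 'e) wform \<Rightarrow> (int \<Rightarrow> 'm \<Rightarrow> 'e \<Rightarrow> 'e) \<Rightarrow> ('m, 'n, 'e \<Rightarrow> 'e) wform"
  where "tau_End G r' = inv_into (ker_End G r') sigma"

definition tau_E :: "('m, 'n::finite, 'e::complex_space) fedosov_data \<Rightarrow> ('m, 'n, complex) wform \<Rightarrow>
    ('m, 'n, 'e \<Rightarrow> 'e) wform \<Rightarrow> (int \<Rightarrow> 'm \<Rightarrow> 'e) \<Rightarrow> ('m, 'n, 'e) wform"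
  where "tau_E G r r' = inv_into (ker_E G r r') sigma"

definition star :: "('m, 'n::finite, 'e::complex_space) fedosov_data \<Rightarrow> ('m, 'n, complex) wform \<Rightarrow>
    (int \<Rightarrow> 'm \<Rightarrow> complex) \<Rightarrow> (int \<Rightarrow> 'm \<Rightarrow> complex) \<Rightarrow> int \<Rightarrow> 'm \<Rightarrow> complex"
  where "star G r f g = sigma (mul_CC G (tau_C G r f) (tau_C G r g))"

definition star_End :: "('m::topological_space, 'n::finite, 'e::complex_space) fedosov_data \<Rightarrow>
    ('m, 'n, 'e \<Rightarrow> 'e) wform \<Rightarrow>
    (int \<Rightarrow> 'm \<Rightarrow> 'e \<Rightarrow> 'e) \<Rightarrow> (int \<Rightarrow> 'm \<Rightarrow> 'e \<Rightarrow> 'e) \<Rightarrow> int \<Rightarrow> 'm \<Rightarrow> 'e \<Rightarrow> 'e"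
  where "star_End G r' A B = sigma (mul_AA G (tau_End G r' A) (tau_End G r' B))"

definition left_act :: "('m::topological_space, 'n::finite, 'e::complex_space) fedosov_data \<Rightarrow>
    ('m, 'n, complex) wform \<Rightarrow> ('m, 'n, 'e \<Rightarrow> 'e) wform \<Rightarrow>
    (int \<Rightarrow> 'm \<Rightarrow> 'e \<Rightarrow> 'e) \<Rightarrow> (int \<Rightarrow> 'm \<Rightarrow> 'e) \<Rightarrow> int \<Rightarrow> 'm \<Rightarrow> 'e"
  where "left_act G r r' A s = sigma (mul_AE G (tau_End G r' A) (tau_E G r r' s))"

definition right_act :: "('m, 'n::finite, 'e::complex_space) fedosov_data \<Rightarrow>
    ('m, 'n, complex) wform \<Rightarrow> ('m, 'n, 'e \<Rightarrow> 'e) wform \<Rightarrow>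
    (int \<Rightarrow> 'm \<Rightarrow> 'e) \<Rightarrow> (int \<Rightarrow> 'm \<Rightarrow> complex) \<Rightarrow> int \<Rightarrow> 'm \<Rightarrow> 'e"
  where "right_act G r r' s f = sigma (mul_EC G (tau_E G r r' s) (tau_C G r f))"


section \<open>Modules\<close>

text \<open>Unital modules over an algebra \<open>(R, mul, e)\<close> over the ring of formal power series in \<open>\<lambda>\<close>,
  the actions being bilinear over that ring.\<close>

definition left_module ::
    "(int \<Rightarrow> 'a::complex_space) set \<Rightarrow> ((int \<Rightarrow> 'a) \<Rightarrow> (int \<Rightarrow> 'a) \<Rightarrow> int \<Rightarrow> 'a) \<Rightarrow> (int \<Rightarrow> 'a) \<Rightarrow>
      (int \<Rightarrow> 'b::complex_space) set \<Rightarrow> ((int \<Rightarrow> 'a) \<Rightarrow> (int \<Rightarrow> 'b) \<Rightarrow> int \<Rightarrow> 'b) \<Rightarrow> bool"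
  where "left_module R mul e M act \<longleftrightarrow>
    (\<forall>a\<in>R. \<forall>x\<in>M. act a x \<in> M) \<and>
    (\<forall>a\<in>R. \<forall>b\<in>R. \<forall>x\<in>M. act (a + b) x = act a x + act b x) \<and>
    (\<forall>a\<in>R. \<forall>x\<in>M. \<forall>y\<in>M. act a (x + y) = act a x + act a y) \<and>
    (\<forall>z. \<forall>a\<in>R. \<forall>x\<in>M. act (lambda_scale z a) x = lambda_scale z (act a x)) \<and>
    (\<forall>z. \<forall>a\<in>R. \<forall>x\<in>M. act a (lambda_scale z x) = lambda_scale z (act a x)) \<and>
    (\<forall>a\<in>R. \<forall>b\<in>R. \<forall>x\<in>M. act (mul a b) x = act a (act b x)) \<and>
    (\<forall>x\<in>M. act e x = x)"

definition right_module ::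
    "(int \<Rightarrow> 'a::complex_space) set \<Rightarrow> ((int \<Rightarrow> 'a) \<Rightarrow> (int \<Rightarrow> 'a) \<Rightarrow> int \<Rightarrow> 'a) \<Rightarrow> (int \<Rightarrow> 'a) \<Rightarrow>
      (int \<Rightarrow> 'b::complex_space) set \<Rightarrow> ((int \<Rightarrow> 'b) \<Rightarrow> (int \<Rightarrow> 'a) \<Rightarrow> int \<Rightarrow> 'b) \<Rightarrow> bool"
  where "right_module R mul e M act \<longleftrightarrow>
    left_module R (\<lambda>a b. mul b a) e M (\<lambda>a x. act x a)"

definition bimodule ::
    "(int \<Rightarrow> 'a::complex_space) set \<Rightarrow> ((int \<Rightarrow> 'a) \<Rightarrow> (int \<Rightarrow> 'a) \<Rightarrow> int \<Rightarrow> 'a) \<Rightarrow> (int \<Rightarrow> 'a) \<Rightarrow>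
      (int \<Rightarrow> 'c::complex_space) set \<Rightarrow> ((int \<Rightarrow> 'c) \<Rightarrow> (int \<Rightarrow> 'c) \<Rightarrow> int \<Rightarrow> 'c) \<Rightarrow> (int \<Rightarrow> 'c) \<Rightarrow>
      (int \<Rightarrow> 'b::complex_space) set \<Rightarrow> ((int \<Rightarrow> 'a) \<Rightarrow> (int \<Rightarrow> 'b) \<Rightarrow> int \<Rightarrow> 'b) \<Rightarrow>
      ((int \<Rightarrow> 'b) \<Rightarrow> (int \<Rightarrow> 'c) \<Rightarrow> int \<Rightarrow> 'b) \<Rightarrow> bool"
  where "bimodule R mulR eR S mulS eS M lact ract \<longleftrightarrow>
    left_module R mulR eR M lact \<and> right_module S mulS eS M ract \<and>
    (\<forall>a\<in>R. \<forall>x\<in>M. \<forall>b\<in>S. ract (lact a x) b = lact a (ract x b))"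

end

theory Submission
  imports Defs
begin

text \<open>Endomorphism-valued, \<open>E\<close>-valued and scalar forms are assembled into forms with values in the
  algebra of triangular matrices \<open>((A, s), (0, f))\<close>, where \<open>A\<close> is an endomorphism, \<open>s\<close> a vector and
  \<open>f\<close> a number. The pair \<open>r\<close>, \<open>r'\<close> is a Fedosov element of this algebra bundle, and its Fedosov
  derivation has the components \<open>\<D>'\<close>, \<open>\<D>\<^sup>E\<close>, \<open>\<D>\<close>. So the bimodule laws are components of the
  associativity, bilinearity and unit laws of the deformed product of one algebra bundle. For the latter
  one shows in local coordinates that the Fedosov derivation squares to zero, that it therefore has exactly
  one flat section with given symbol (by induction on the total degree, with the homotopy \<open>\<delta>\<^sup>*\<close>), and that
  flat sections form an algebra, as the derivation satisfies the Leibniz rule.\<close>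

text \<open>The obstacle is the factor \<open>1/\<lambda>\<close> in front of \<open>ad(r)\<close>.
  In a bundle of noncommutative algebras a commutator is divisible by \<open>\<lambda>\<close> only
  if the values commute at order zero. This is rescued by \<open>r_scalar\<close>: the equation and
  the normalisation of the Fedosov element force its \<open>\<lambda>\<close>-free part to be a
  multiple of the unit. For the triangular bundle the unit is \<open>(id, 0, 1)\<close>, so the same
  lemma says that \<open>r'\<close> and \<open>r\<close> agree at order zero, that is,
  \<open>r^E\<close> has no negative powers. The square of the derivation can only vanish if the
  curvature of the bundle connection is an inner derivation. Here it is the commutator with
  \<open>(RE, 0, 0)\<close>, and the term \<open>-i \<lambda> R^E\<close> in the equation for
  \<open>r'\<close> cancels exactly this. Since \<open>tau_C\<close>, \<open>tau_End\<close> and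
  \<open>tau_E\<close> are defined through \<open>inv_into\<close>, they are known to invert
  \<open>sigma\<close> only after bijectivity on flat sections has been proved. This, too, is done
  once, for the triangular bundle, and is then read off from the components.\<close>

notation scaleC (infixr "*C" 75)

abbreviation (input) USum :: "('a => 'b::comm_monoid_add) => 'b" (binder "SU " 10)
 where "USum f == sum f UNIV"

abbreviation (input) "FD == frechet_derivative"

text \<open>Sums over infinite sets are 0 and products are 1, so induction with this rule yields
  closure and linearity of sums without a finiteness hypothesis.\<close>

lemmas ifi = infinite_finite_induct

section \<open>Smooth functions\<close>

lemma frechet_derivative_cong_open:
 assumes "open S" "x : S" "!!y. y : S ==> f y = g y"
 shows "FD f (at x) = FD g (at x)"
  and "f differentiable (at x) \<longleftrightarrow> g differentiable (at x)"
proof -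
 have "(f has_derivative f') (at x) \<longleftrightarrow> (g has_derivative f') (at x)" for f'
  using has_derivative_transform_within_open[of f f' x UNIV S g]
   has_derivative_transform_within_open[of g f' x UNIV S f] assms by auto
 thus "FD f (at x) = FD g (at x)"
  and "f differentiable (at x) \<longleftrightarrow> g differentiable (at x)"
  by (simp_all add: frechet_derivative_def differentiable_def)
qed

text \<open>Openness of \<open>S\<close> makes the derivatives \<open>at x\<close> depend on the
  values in \<open>S\<close> only. In the closure lemmas below this permits replacing a derivative
  by the formula from the sum, product or chain rule before the induction hypothesis is
  used.\<close>

lemma Ck_on_cong:
 assumes "open S" "!!y. y : S ==> f y = g y"
 shows "Ck_on k S f \<longleftrightarrow> Ck_on k S g"
 using assms(2)
proof (induction k arbitrary: f g)
 case 0
 thus ?case by (simp cong: continuous_on_cong)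
next
 case (Suc k)
 have "FD f (at x) = FD g (at x)"
  "f differentiable (at x) \<longleftrightarrow> g differentiable (at x)" if "x : S" for x
  using frechet_derivative_cong_open[OF assms(1) that] Suc.prems by blast+
 thus ?case
  using Suc.IH[of "%x. FD f (at x) v" "%x. FD g (at x) v" for v]
  by auto
qed

lemma Ck_on_Suc_D: "Ck_on (Suc k) S f ==> Ck_on k S f"
proof (induction k arbitrary: f)
 case 0
 thus ?case
  by (auto intro!: continuous_at_imp_continuous_on differentiable_imp_continuous_within)
next
 case (Suc k)
 thus ?case by (metis Ck_on.simps(2))
qed

lemma Ck_on_subset: "Ck_on k S f ==> T <= S ==> Ck_on k T f"
 by (induction k arbitrary: f) (auto intro: continuous_on_subset)

lemma Ck_on_const: "Ck_on k S (%x. a)"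
 by (induction k arbitrary: a) auto

lemma Ck_on_add:
 assumes "open S" "Ck_on k S f" "Ck_on k S g"
 shows "Ck_on k S (%x. f x + g x)"
 using assms(2,3)
proof (induction k arbitrary: f g)
 case 0
 thus ?case by (auto intro: continuous_on_add)
next
 case (Suc k)
 have D: "((%x. f x + g x) has_derivative
   (%v. FD f (at x) v + FD g (at x) v)) (at x)" if "x : S" for x
  using Suc.prems that by (intro has_derivative_add) (simp_all add: frechet_derivative_works)
 have "Ck_on k S (%x. FD (%x. f x + g x) (at x) v)" for v
  using Suc.IH[of "%x. FD f (at x) v" "%x. FD g (at x) v"] Suc.prems
  by (subst Ck_on_cong[OF assms(1), of _ "%x. FD f (at x) v + FD g (at x) v"])
   (simp_all add: frechet_derivative_at[OF D, symmetric])
 thus ?case using Suc.prems by auto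
qed

lemma Ck_on_linear:
 assumes "open S" "Ck_on k S f" "bounded_linear h"
 shows "Ck_on k S (%x. h (f x))"
 using assms(2)
proof (induction k arbitrary: f)
 case 0
 thus ?case using assms(3) by (auto intro: linear_continuous_on_compose bounded_linear.continuous_on)
next
 case (Suc k)
 have D: "((%x. h (f x)) has_derivative (%v. h (FD f (at x) v))) (at x)" if "x : S" for x
  using Suc.prems that
  by (intro bounded_linear.has_derivative[OF assms(3)]) (simp add: frechet_derivative_works)
 have "Ck_on k S (%x. FD (%x. h (f x)) (at x) v)" for v
  using Suc.IH[of "%x. FD f (at x) v"] Suc.prems
  by (subst Ck_on_cong[OF assms(1), of _ "%x. h (FD f (at x) v)"])
   (simp_all add: frechet_derivative_at[OF D, symmetric])
 thus ?case using D by (auto simp: differentiable_def)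
qed

lemma Ck_on_bilinear:
 assumes "open S" "Ck_on k S f" "Ck_on k S g" "bounded_bilinear h"
 shows "Ck_on k S (%x. h (f x) (g x))"
 using assms(2,3)
proof (induction k arbitrary: f g)
 case 0
 thus ?case using bounded_bilinear.continuous_on[OF assms(4)] by auto
next
 case (Suc k)
 have D: "((%x. h (f x) (g x)) has_derivative
   (%v. h (f x) (FD g (at x) v) + h (FD f (at x) v) (g x))) (at x)"
  if "x : S" for x
  using Suc.prems that
  by (intro bounded_bilinear.FDERIV[OF assms(4)]) (simp_all add: frechet_derivative_works)
 have "Ck_on k S (%x. FD (%x. h (f x) (g x)) (at x) v)" for v
  using Suc.IH[of f "%x. FD g (at x) v"] Suc.IH[of "%x. FD f (at x) v" g]
   Suc.prems Ck_on_Suc_D[OF Suc.prems(1)] Ck_on_Suc_D[OF Suc.prems(2)]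
  by (subst Ck_on_cong[OF assms(1), of _ "%x. h (f x) (FD g (at x) v) + h (FD f (at x) v) (g x)"])
   (simp_all add: frechet_derivative_at[OF D, symmetric] Ck_on_add[OF assms(1)])
 thus ?case using D by (auto simp: differentiable_def)
qed

lemma Ck_on_sum:
 assumes "open S" "!!i. i : I ==> Ck_on k S (f i)"
 shows "Ck_on k S (%x. SUM i:I. f i x)"
 using assms(2) by (induction I rule: ifi) (auto intro: Ck_on_const Ck_on_add assms(1))

lemma Ck_on_compose:
 fixes f :: "'a::euclidean_space => 'b::euclidean_space" and g :: "'b => 'c::real_normed_vector"
 assumes "open S" "open T" "f ` S <= T" "Ck_on k S f" "Ck_on k T g"
 shows "Ck_on k S (%x. g (f x))"
 using assms(4,5)
proof (induction k arbitrary: g)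
 case 0
 thus ?case using assms(3) by (auto intro: continuous_on_compose2)
next
 case (Suc k)
 have D: "((%x. g (f x)) has_derivative (%v. FD g (at (f x)) (FD f (at x) v))) (at x)"
  if "x : S" for x
  using Suc.prems that assms(3)
  by (intro has_derivative_compose[of f _ x UNIV g, simplified]) (auto simp: frechet_derivative_works)
 have lin: "linear (FD g (at (f x)))" if "x : S" for x
  using Suc.prems that assms(3) by (auto intro!: linear_frechet_derivative)
 \<comment> \<open>The direction \<open>FD f (at x) v\<close> moves with \<open>x\<close>, whereas
   \<open>Ck_on\<close> controls derivatives of \<open>g\<close> in fixed directions only. Expansion
   in \<open>Basis\<close> leaves products of scalar functions with derivatives of \<open>g\<close>
   in fixed directions.\<close>
 have "FD (%x. g (f x)) (at x) v =
   (SUM b:Basis. (FD f (at x) v \<bullet> b) *\<^sub>R FD g (at (f x)) b)" if "x : S" for x v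
  using fun_cong[OF frechet_derivative_at[OF D[OF that]], of v] linear_sum[OF lin[OF that]] linear_scale[OF lin[OF that]]
   euclidean_representation[of "FD f (at x) v"]
  by (metis (no_types, lifting) sum.cong)
 moreover have "Ck_on k S (%x. SUM b:Basis. (FD f (at x) v \<bullet> b) *\<^sub>R FD g (at (f x)) b)" for v
  using Suc.prems Ck_on_Suc_D[OF Suc.prems(1)]
  by (intro Ck_on_sum Ck_on_bilinear[OF assms(1) _ _ bounded_bilinear_scaleR] assms(1)
    Ck_on_linear[OF assms(1) _ bounded_linear_inner_left] Suc.IH) auto
 ultimately have "Ck_on k S (%x. FD (%x. g (f x)) (at x) v)" for v
  by (subst Ck_on_cong[OF assms(1)]) auto
 thus ?case using D by (auto simp: differentiable_def)
qed

text \<open>The derivative of \<open>1/f\<close> is a product of \<open>f'\<close> with two factors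
  \<open>1/f\<close>, so the induction hypothesis for \<open>1/f\<close> itself, one order lower,
  suffices.\<close>

lemma Ck_on_inverse:
 fixes f :: "'a::euclidean_space => 'b::real_normed_field"
 assumes "open S" "Ck_on k S f" "!!x. x : S ==> f x ~= 0"
 shows "Ck_on k S (%x. inverse (f x))"
 using assms(2)
proof (induction k)
 case 0
 thus ?case using assms(3) by (auto intro: continuous_on_inverse)
next
 case (Suc k)
 have D: "((%x. inverse (f x)) has_derivative
   (%v. - (inverse (f x) * FD f (at x) v * inverse (f x)))) (at x)" if "x : S" for x
  using Suc.prems that assms(3) by (intro Deriv.has_derivative_inverse) (auto simp: frechet_derivative_works)
 have IH: "Ck_on k S (%x. inverse (f x))" using Suc.IH Ck_on_Suc_D[OF Suc.prems] by blast
 have "Ck_on k S (%x. - (inverse (f x) * FD f (at x) v * inverse (f x)))" for v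
  using Suc.prems IH
  by (intro Ck_on_linear[OF assms(1) _ bounded_linear_minus[OF bounded_linear_ident]]
    Ck_on_bilinear[OF assms(1) _ _ bounded_bilinear_mult]) auto
 hence "Ck_on k S (%x. FD (%x. inverse (f x)) (at x) v)" for v
  by (subst Ck_on_cong[OF assms(1)]) (simp_all add: frechet_derivative_at[OF D, symmetric])
 thus ?case using D by (auto simp: differentiable_def)
qed

lemma smooth_on_cong: "open S ==> (!!y. y : S ==> f y = g y) ==> smooth_on S f \<longleftrightarrow> smooth_on S g"
 unfolding smooth_on_def using Ck_on_cong by metis

lemma smooth_on_subset: "smooth_on S f ==> T <= S ==> smooth_on T f"
 unfolding smooth_on_def using Ck_on_subset by blast

lemma smooth_on_differentiable: "smooth_on S f ==> x : S ==> f differentiable (at x)"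
 unfolding smooth_on_def using Ck_on.simps(2) by blast

lemma smooth_on_frechet: "smooth_on S f ==> smooth_on S (%x. FD f (at x) v)"
 unfolding smooth_on_def using Ck_on.simps(2) by blast

lemma smooth_on_continuous: "smooth_on S f ==> continuous_on S f"
 unfolding smooth_on_def by (metis Ck_on.simps(1))

lemma smooth_on_const: "smooth_on S (%x. a)"
 unfolding smooth_on_def using Ck_on_const by blast

lemma smooth_on_add: "open S ==> smooth_on S f ==> smooth_on S g ==> smooth_on S (%x. f x + g x)"
 unfolding smooth_on_def using Ck_on_add by blast

lemma smooth_on_linear: "open S ==> smooth_on S f ==> bounded_linear h ==> smooth_on S (%x. h (f x))"
 unfolding smooth_on_def using Ck_on_linear by blast

lemma smooth_on_bilinear:
 "open S ==> smooth_on S f ==> smooth_on S g ==> bounded_bilinear h ==> smooth_on S (%x. h (f x) (g x))"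
 unfolding smooth_on_def using Ck_on_bilinear by blast

lemma smooth_on_inverse:
 fixes f :: "'a::euclidean_space => 'b::real_normed_field"
 shows "open S ==> smooth_on S f ==> (!!x. x : S ==> f x ~= 0) ==> smooth_on S (%x. inverse (f x))"
 unfolding smooth_on_def using Ck_on_inverse by blast

lemma smooth_on_compose:
 fixes f :: "'a::euclidean_space => 'b::euclidean_space" and g :: "'b => 'c::real_normed_vector"
 shows "open S ==> open T ==> f ` S <= T ==> smooth_on S f ==> smooth_on T g ==> smooth_on S (%x. g (f x))"
 unfolding smooth_on_def using Ck_on_compose by blast

text \<open>Two applications of the mean value theorem to the second difference quotient.\<close>

lemma second_difference:
 fixes f :: "'a::euclidean_space => real"
 assumes S: "open S" "smooth_on S f" and h: "h > 0"
  and sub: "!!s t. 0 <= s ==> s <= h ==> 0 <= t ==> t <= h ==> x + s *\<^sub>R u + t *\<^sub>R v : S"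
 shows "EX s t. 0 < s & s < h & 0 < t & t < h &
  f (x + h *\<^sub>R u + h *\<^sub>R v) - f (x + h *\<^sub>R u) - f (x + h *\<^sub>R v) + f x =
  h * h * FD (%y. FD f (at y) u) (at (x + s *\<^sub>R u + t *\<^sub>R v)) v"
proof -
 define g where "g = (%y. FD f (at y) u)"
 have g: "smooth_on S g" unfolding g_def using S smooth_on_frechet by blast
 have line: "((%s. F (a + s *\<^sub>R w)) has_real_derivative FD F (at (a + s *\<^sub>R w)) w) (at s)"
  if "smooth_on S F" "a + s *\<^sub>R w : S" for F :: "'a => real" and a w s
 proof -
  have 1: "(F has_derivative FD F (at (a + s *\<^sub>R w))) (at (a + s *\<^sub>R w))"
   using smooth_on_differentiable[OF that] by (simp add: frechet_derivative_works)
  have 2: "((%s. a + s *\<^sub>R w) has_derivative (%t. t *\<^sub>R w)) (at s)"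
   by (auto intro!: derivative_eq_intros)
  have "((%s. F (a + s *\<^sub>R w)) has_derivative (%t. FD F (at (a + s *\<^sub>R w)) (t *\<^sub>R w))) (at s)"
   by (rule has_derivative_compose[OF 2 1])
  moreover have "FD F (at (a + s *\<^sub>R w)) (t *\<^sub>R w) = FD F (at (a + s *\<^sub>R w)) w * t" for t
   using linear_scale[OF linear_frechet_derivative[OF smooth_on_differentiable[OF that]]] by simp
  ultimately show ?thesis by (simp add: has_field_derivative_def)
 qed
 \<comment> \<open>The first mean value is taken along \<open>u\<close>, for the difference of
   \<open>f\<close> between the two sides of the parallelogram; the second, along \<open>v\<close>,
   for the derivative \<open>g\<close>.\<close>
 have "EX s. 0 < s & s < h & (f (x + h *\<^sub>R v + h *\<^sub>R u) - f (x + h *\<^sub>R u)) - (f (x + h *\<^sub>R v + 0 *\<^sub>R u) - f (x + 0 *\<^sub>R u))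
   = (h - 0) * (g (x + h *\<^sub>R v + s *\<^sub>R u) - g (x + s *\<^sub>R u))"
  using sub[where t=0] sub[where t=h] h unfolding g_def
  by (intro MVT2[where f="%s. f (x + h *\<^sub>R v + s *\<^sub>R u) - f (x + s *\<^sub>R u)"] DERIV_diff line S)
   (auto simp: algebra_simps)
 then obtain s where s: "0 < s" "s < h" "f (x + h *\<^sub>R u + h *\<^sub>R v) - f (x + h *\<^sub>R u) - f (x + h *\<^sub>R v) + f x
   = h * (g (x + s *\<^sub>R u + h *\<^sub>R v) - g (x + s *\<^sub>R u))"
  by (auto simp: algebra_simps)
 have "EX t. 0 < t & t < h & g (x + s *\<^sub>R u + h *\<^sub>R v) - g (x + s *\<^sub>R u + 0 *\<^sub>R v)
   = (h - 0) * FD g (at (x + s *\<^sub>R u + t *\<^sub>R v)) v"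
  using sub[where s=s] s h by (intro MVT2 line g) auto
 then obtain t where "0 < t" "t < h" "g (x + s *\<^sub>R u + h *\<^sub>R v) - g (x + s *\<^sub>R u)
   = h * FD g (at (x + s *\<^sub>R u + t *\<^sub>R v)) v" by auto
 with s show ?thesis unfolding g_def by (intro exI[of _ s] exI[of _ t]) simp
qed

text \<open>The second difference is symmetric in \<open>u\<close> and \<open>v\<close>, so the two
  mixed derivatives take a common value at two points near \<open>x\<close>. Their continuity then
  bounds the difference at \<open>x\<close> by any \<open>e\<close>.\<close>

lemma second_derivative_symmetric_real:
 fixes f :: "'a::euclidean_space => real"
 assumes S: "open S" "smooth_on S f" and x: "x : S"
 shows "FD (%y. FD f (at y) u) (at x) v =
  FD (%y. FD f (at y) v) (at x) u"
proof -
 define F where "F u v y = FD (%y. FD f (at y) u) (at y) v" for u v y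
 have cont: "continuous_on S (F u v)" for u v
  unfolding F_def using S by (intro smooth_on_continuous smooth_on_frechet)
 have "\<bar>F u v x - F v u x\<bar> < e" if e: "e > 0" for e
 proof -
  obtain d1 where d1: "d1 > 0" "!!y. y : S ==> dist y x < d1 ==> dist (F u v y) (F u v x) < e / 2"
   using cont[of u v, unfolded continuous_on_iff] x e half_gt_zero by metis
  obtain d2 where d2: "d2 > 0" "!!y. y : S ==> dist y x < d2 ==> dist (F v u y) (F v u x) < e / 2"
   using cont[of v u, unfolded continuous_on_iff] x e half_gt_zero by metis
  obtain d3 where d3: "d3 > 0" "ball x d3 <= S" using S x open_contains_ball by blast
  define d where "d = min d1 (min d2 d3)"
  \<comment> \<open>With this step the parallelogram spanned by \<open>h u\<close> and
    \<open>h v\<close> lies within distance \<open>d\<close> of \<open>x\<close>; the summand 1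
    keeps the denominator positive for \<open>u = v = 0\<close>.\<close>
  define h where "h = d / (2 * (norm u + norm v + 1))"
  have d: "d > 0" using d1 d2 d3 by (simp add: d_def)
  have pos: "norm u + norm v + 1 > 0" by (smt (verit) norm_ge_zero)
  have h: "h > 0" using d pos by (simp add: h_def)
  have near: "dist (x + s *\<^sub>R u + t *\<^sub>R v) x < d" if "0 <= s" "s <= h" "0 <= t" "t <= h" for s t
  proof -
   have "norm (s *\<^sub>R u + t *\<^sub>R v) <= s * norm u + t * norm v"
    using that norm_triangle_ineq[of "s *\<^sub>R u" "t *\<^sub>R v"] by simp
   also have "... <= h * norm u + h * norm v" using that by (intro add_mono mult_right_mono) auto
   also have "... <= h * (norm u + norm v + 1)" using h by (simp add: algebra_simps)
   also have "... = d / 2" unfolding h_def using pos by (simp add: divide_simps)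
   also have "... < d" using d by simp
   finally show ?thesis by (simp add: dist_norm add.assoc)
  qed
  have inS: "y : S" if "dist y x < d" for y
   using that d3 by (auto simp: d_def dist_commute)
  obtain s t where st: "0 < s" "s < h" "0 < t" "t < h" "f (x + h *\<^sub>R u + h *\<^sub>R v) - f (x + h *\<^sub>R u) - f (x + h *\<^sub>R v) + f x =
    h * h * F u v (x + s *\<^sub>R u + t *\<^sub>R v)"
   using second_difference[OF S h, of x u v] near inS unfolding F_def by meson
  obtain s' t' where st': "0 < s'" "s' < h" "0 < t'" "t' < h" "f (x + h *\<^sub>R v + h *\<^sub>R u) - f (x + h *\<^sub>R v) - f (x + h *\<^sub>R u) + f x =
    h * h * F v u (x + s' *\<^sub>R v + t' *\<^sub>R u)"
  proof -
   have "x + s *\<^sub>R v + t *\<^sub>R u : S" if "0 <= s" "s <= h" "0 <= t" "t <= h" for s t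
    using near[of t s] inS[of "x + s *\<^sub>R v + t *\<^sub>R u"] that
    by (simp add: add.assoc add.commute add.left_commute)
   thus ?thesis using that second_difference[OF S h, of x v u] unfolding F_def by blast
  qed
  have "h * h * F u v (x + s *\<^sub>R u + t *\<^sub>R v) = h * h * F v u (x + s' *\<^sub>R v + t' *\<^sub>R u)"
   using st(5) st'(5) by (simp add: algebra_simps)
  hence eq: "F u v (x + s *\<^sub>R u + t *\<^sub>R v) = F v u (x + s' *\<^sub>R v + t' *\<^sub>R u)" using h by simp
  have n1: "dist (x + s *\<^sub>R u + t *\<^sub>R v) x < d" using near[of s t] st by simp
  have n2: "dist (x + s' *\<^sub>R v + t' *\<^sub>R u) x < d" using near[of t' s'] st' by (simp add: add.assoc add.commute add.left_commute)
  have "dist (F u v (x + s *\<^sub>R u + t *\<^sub>R v)) (F u v x) < e / 2" using d1(2) n1 inS[OF n1] by (simp add: d_def)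
  moreover have "dist (F v u (x + s' *\<^sub>R v + t' *\<^sub>R u)) (F v u x) < e / 2" using d2(2) n2 inS[OF n2] by (simp add: d_def)
  ultimately show ?thesis using eq unfolding dist_real_def by linarith
 qed
 hence "F u v x = F v u x" by (metis less_irrefl zero_less_abs_iff right_minus_eq)
 thus ?thesis by (simp add: F_def)
qed

lemma second_derivative_symmetric:
 fixes f :: "'a::euclidean_space => 'b::euclidean_space"
 assumes S: "open S" "smooth_on S f" and x: "x : S"
 shows "FD (%y. FD f (at y) u) (at x) v =
  FD (%y. FD f (at y) v) (at x) u"
proof (rule euclidean_eqI)
 fix b :: 'b assume "b : Basis"
 have comp: "FD (%y. F y \<bullet> b) (at y) w = FD F (at y) w \<bullet> b"
  if "smooth_on S F" "y : S" for F :: "'a => 'b" and y w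
 proof -
  have "((%y. F y \<bullet> b) has_derivative (%w. FD F (at y) w \<bullet> b)) (at y)"
   using smooth_on_differentiable[OF that]
   by (intro has_derivative_inner_left) (simp add: frechet_derivative_works)
  thus ?thesis using fun_cong[OF frechet_derivative_at] by metis
 qed
 have "FD (%y. FD f (at y) u) (at x) v \<bullet> b =
   FD (%y. FD (%y. f y \<bullet> b) (at y) u) (at x) v" for u v
  using comp[OF smooth_on_frechet[OF S(2)] x] comp[OF S(2)]
   frechet_derivative_cong_open(1)[OF S(1) x, of "%y. FD (%y. f y \<bullet> b) (at y) u" "%y. FD f (at y) u \<bullet> b"]
  by metis
 thus "FD (%y. FD f (at y) u) (at x) v \<bullet> b =
   FD (%y. FD f (at y) v) (at x) u \<bullet> b"
  using second_derivative_symmetric_real[OF S(1) smooth_on_linear[OF S bounded_linear_inner_left] x] by metis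
qed

section \<open>Complex vector spaces\<close>

lemma scaleC_zero_left [simp]: "0 *C x = (0::'a::complex_space)"
 using scaleC_add_left[of 0 0 x] by simp

lemma scaleC_zero_right [simp]: "a *C 0 = (0::'a::complex_space)"
 using scaleC_add_right[of a 0 0] by simp

lemma scaleC_minus_left [simp]: "(- a) *C x = - (a *C (x::'a::complex_space))"
 using scaleC_add_left[of "- a" a x] by (simp add: eq_neg_iff_add_eq_0)

lemma scaleC_minus_right [simp]: "a *C (- x) = - (a *C (x::'a::complex_space))"
 using scaleC_add_right[of a "- x" x] by (simp add: eq_neg_iff_add_eq_0)

lemma scaleC_diff_left: "(a - b) *C x = a *C x - b *C (x::'a::complex_space)"
 using scaleC_add_left[of a "- b" x] by simp

lemma scaleC_diff_right: "a *C (x - y) = a *C x - a *C (y::'a::complex_space)"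
 using scaleC_add_right[of a x "- y"] by simp

lemma scaleC_sum_left: "(SUM i:I. f i) *C x = (SUM i:I. f i *C (x::'a::complex_space))"
 by (induction I rule: ifi) (auto simp: scaleC_add_left)

lemma scaleC_sum_right: "a *C (SUM i:I. f i) = (SUM i:I. a *C (f i::'a::complex_space))"
 by (induction I rule: ifi) (auto simp: scaleC_add_right)

lemmas scaleC_simps = scaleC_add_right scaleC_add_left scaleC_diff_left scaleC_diff_right scaleC_scaleC

declare scaleC_one [simp]

lemma sum_apply: "(SUM i:I. f i) x = (SUM i:I. f i (x::'a)::'b::ab_group_add)"
 by (induction I rule: ifi) auto

text \<open>Triangular matrices are triples, that is, nested pairs. This instance makes tensors and
  Weyl products with values in them instances of the generic ones.\<close>

instantiation prod :: (complex_space, complex_space) complex_space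
begin
definition scaleC_prod :: "complex => 'a \<times> 'b => 'a \<times> 'b"
 where "scaleC_prod a x = (a *C fst x, a *C snd x)"
instance
 by standard (simp_all add: scaleC_prod_def prod_eq_iff scaleC_simps)
end

lemma fst_scaleC [simp]: "fst (a *C x) = a *C fst x"
 and snd_scaleC [simp]: "snd (a *C x) = a *C snd x"
 by (simp_all add: scaleC_prod_def)

lemma scaleC_fun_apply [simp]: "(a *C f) x = a *C f x"
 by (simp add: scaleC_fun_def)

section \<open>Manifolds\<close>

lemma vec_expand: "(SU i. (x $ i) *\<^sub>R axis i 1) = (x :: real ^ 'n::finite)"
 by (simp add: vec_eq_iff axis_def if_distrib cong: if_cong)

locale manifold =
 fixes \<A> :: "('m::topological_space, 'n::finite) chart set"
 assumes atlas: "smooth_atlas \<A>"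
begin

abbreviation (input) "cx == coord \<A>"
abbreviation (input) "vfd == vector_field \<A>"
abbreviation (input) "sfu == smooth_fun \<A>"
abbreviation (input) "chx == chart_at \<A>"
abbreviation (input) "tsp == tangent_space \<A>"
abbreviation (input) "dd == dirderiv \<A>"

lemma chart:
 assumes "c : \<A>"
 shows "open (fst c)" "open (snd c ` fst c)" "homeomorphism (fst c) (snd c ` fst c) (snd c) (chart_inv c)"
 using assms atlas by (auto simp: smooth_atlas_def is_chart_def)

lemma chart_inv_snd [simp]: "c : \<A> ==> p : fst c ==> chart_inv c (snd c p) = p"
 using chart(3) by (auto simp: homeomorphism_def)

lemma open_chart_image:
 assumes "c : \<A>" "open U" shows "open (snd c ` (U Int fst c))"
proof -
 have "openin (top_of_set (snd c ` fst c)) (snd c ` (U Int fst c))"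
  using assms(2)
  by (intro homeomorphism_imp_open_map[OF chart(3)[OF assms(1)]]) (metis Int_commute openin_open_Int)
 thus ?thesis using chart(2)[OF assms(1)] by (meson openin_open_trans)
qed

lemma chart_at: "chx p : \<A>" "p : fst (chx p)"
proof -
 have "p : (\<Union>c\<in>\<A>. fst c)" using atlas by (simp add: smooth_atlas_def)
 hence "EX c. c : \<A> & p : fst c" by blast
 hence "chx p : \<A> & p : fst (chx p)" unfolding chart_at_def by (rule someI_ex)
 thus "chx p : \<A>" "p : fst (chx p)" by auto
qed

lemma transition_smooth:
 "c : \<A> ==> d : \<A> ==> smooth_on (snd c ` (fst c Int fst d)) (snd d \<circ> chart_inv c)"
 using atlas by (auto simp: smooth_atlas_def)

lemma smooth_fun_cong: "open U ==> (!!p. p : U ==> f p = g p) ==> sfu U f \<longleftrightarrow> sfu U g"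
 unfolding smooth_fun_def o_def
proof (intro ball_cong refl smooth_on_cong open_chart_image)
 fix c y assume *: "c : \<A>" "y : snd c ` (U Int fst c)" "!!p. p : U ==> f p = g p"
 then obtain p where "p : U" "p : fst c" "y = snd c p" by blast
 thus "f (chart_inv c y) = g (chart_inv c y)" using * by simp
qed

lemma smooth_fun_subset: "sfu U f ==> V <= U ==> sfu V f"
 unfolding smooth_fun_def by (auto intro: smooth_on_subset[OF _ image_mono])

lemma smooth_fun_const: "sfu U (%p. a)"
 by (simp add: smooth_fun_def o_def smooth_on_const)

lemma smooth_fun_add:
 "open U ==> sfu U f ==> sfu U g ==> sfu U (%p. f p + g p)"
 by (simp add: smooth_fun_def o_def smooth_on_add open_chart_image)

lemma smooth_fun_linear:
 "open U ==> sfu U f ==> bounded_linear h ==> sfu U (%p. h (f p))"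
 unfolding smooth_fun_def o_def by (intro ballI smooth_on_linear[where h=h] open_chart_image) simp_all

lemma smooth_fun_bilinear:
 "open U ==> sfu U f ==> sfu U g ==> bounded_bilinear h ==> sfu U (%p. h (f p) (g p))"
 unfolding smooth_fun_def o_def by (intro ballI smooth_on_bilinear[where h=h] open_chart_image) simp_all

lemma smooth_fun_mult:
 fixes f :: "'m => 'b::real_normed_algebra"
 shows "open U ==> sfu U f ==> sfu U g ==> sfu U (%p. f p * g p)"
 by (rule smooth_fun_bilinear[OF _ _ _ bounded_bilinear_mult])

lemma smooth_fun_minus: "open U ==> sfu U f ==> sfu U (%p. - f p)"
 by (rule smooth_fun_linear[OF _ _ bounded_linear_minus[OF bounded_linear_ident]])

lemma smooth_fun_inverse:
 fixes f :: "'m => 'b::real_normed_field"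
 assumes "open U" "sfu U f" "!!p. p : U ==> f p ~= 0"
 shows "sfu U (%p. inverse (f p))"
 unfolding smooth_fun_def o_def
proof (intro ballI smooth_on_inverse open_chart_image assms(1))
 fix c assume c: "c : \<A>"
 thus "smooth_on (snd c ` (U Int fst c)) (%x. f (chart_inv c x))"
  using assms(2) by (simp add: smooth_fun_def o_def)
 fix y assume "y : snd c ` (U Int fst c)"
 then obtain p where "p : U" "p : fst c" "y = snd c p" by blast
 thus "f (chart_inv c y) ~= 0" using c assms(3) by simp
qed

lemma smooth_fun_sum:
 "open U ==> (!!i. i : I ==> sfu U (f i)) ==> sfu U (%p. SUM i:I. f i p)"
 by (induction I rule: ifi) (auto intro: smooth_fun_const smooth_fun_add)

lemma smooth_fun_prod:
 fixes f :: "'i => 'm => 'b::real_normed_field"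
 shows "open U ==> (!!i. i : I ==> sfu U (f i)) ==> sfu U (%p. \<Prod>i\<in>I. f i p)"
 by (induction I rule: ifi) (auto intro: smooth_fun_const smooth_fun_mult)

lemma smooth_fun_of_real: "open U ==> sfu U f ==> sfu U (%p. complex_of_real (f p))"
 by (rule smooth_fun_linear[OF _ _ bounded_linear_of_real])

lemma smooth_fun_component:
 "open U ==> sfu U f ==> sfu U (%p. (f p :: real ^ 'k::finite) $ i)"
 by (rule smooth_fun_linear[OF _ _ bounded_linear_vec_nth])

text \<open>Coordinate changes are smooth, so smoothness in one chart whose domain contains
  \<open>U\<close> is inherited by all other charts.\<close>

lemma smooth_fun_on_chart:
 assumes "open U" "c : \<A>" "U <= fst c" "smooth_on (snd c ` U) g"
 shows "sfu U (%p. g (snd c p))"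
 unfolding smooth_fun_def o_def
proof
 fix d assume d: "d : \<A>"
 have "smooth_on (snd d ` (U Int fst d)) (snd c \<circ> chart_inv d)"
  using transition_smooth[OF d assms(2)] by (rule smooth_on_subset) (use assms(3) in auto)
 moreover have "open (snd c ` U)" using open_chart_image[OF assms(2,1)] assms(3) by (simp add: Int_absorb2)
 ultimately show "smooth_on (snd d ` (U Int fst d)) (%y. g (snd c (chart_inv d y)))"
  using assms d
  by (intro smooth_on_compose[of "snd d ` (U Int fst d)" "snd c ` U" "%y. snd c (chart_inv d y)" g]
    open_chart_image[OF d assms(1)]) (force simp: o_def)+
qed

lemma smooth_fun_differentiable:
 "sfu U f ==> c : \<A> ==> p : U ==> p : fst c ==> (f \<circ> chart_inv c) differentiable (at (snd c p))"
 unfolding smooth_fun_def by (auto intro: smooth_on_differentiable)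

lemma transition_differentiable:
 "c : \<A> ==> d : \<A> ==> p : fst c ==> p : fst d ==> (snd d \<circ> chart_inv c) differentiable (at (snd c p))"
 using smooth_on_differentiable[OF transition_smooth] by blast

text \<open>Chain rule for the coordinate change. It makes \<open>dirderiv\<close>, which is
  evaluated in the arbitrary chart \<open>chart_at\<close>, computable in any chart
  (\<open>dirderiv_chart\<close>), and with a coordinate map for \<open>f\<close> it gives the
  cocycle rule of the Jacobians.\<close>

lemma frechet_chart_change:
 assumes "open U" "sfu U f" "c : \<A>" "d : \<A>" "p : U" "p : fst c" "p : fst d"
 shows "FD (f \<circ> chart_inv c) (at (snd c p)) u =
  FD (f \<circ> chart_inv d) (at (snd d p)) (jacobian c d p u)"
proof -
 have "((snd d \<circ> chart_inv c) has_derivative jacobian c d p) (at (snd c p))"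
  using transition_differentiable[OF assms(3,4,6,7)] by (simp add: jacobian_def frechet_derivative_works)
 moreover have "((f \<circ> chart_inv d) has_derivative FD (f \<circ> chart_inv d) (at (snd d p)))
   (at ((snd d \<circ> chart_inv c) (snd c p)))"
  using smooth_fun_differentiable[OF assms(2,4,5,7)] assms by (simp add: frechet_derivative_works)
 ultimately have D: "((%y. (f \<circ> chart_inv d) ((snd d \<circ> chart_inv c) y)) has_derivative
   (%u. FD (f \<circ> chart_inv d) (at (snd d p)) (jacobian c d p u))) (at (snd c p))"
  by (rule has_derivative_compose)
 have "FD (f \<circ> chart_inv c) (at (snd c p)) =
   FD (%y. (f \<circ> chart_inv d) ((snd d \<circ> chart_inv c) y)) (at (snd c p))"
  by (rule frechet_derivative_cong_open(1)[of "snd c ` ((U Int fst d) Int fst c)"])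
   (use assms chart open_chart_image[of c "U Int fst d"] in \<open>auto simp: open_Int\<close>)
 thus ?thesis using frechet_derivative_at[OF D] by metis
qed

lemma smooth_fun_snd:
 assumes "d : \<A>" shows "sfu (fst d) (snd d)"
 unfolding smooth_fun_def using transition_smooth assms by (auto simp: Int_commute)

lemma jacobian_cocycle:
 assumes "c : \<A>" "d : \<A>" "e : \<A>" "p : fst c" "p : fst d" "p : fst e"
 shows "jacobian c e p u = jacobian d e p (jacobian c d p u)"
 using frechet_chart_change[OF chart(1)[OF assms(3)] smooth_fun_snd[OF assms(3)] assms(1,2,6,4,5)]
 by (simp add: jacobian_def)

lemma jacobian_id [simp]:
 assumes "c : \<A>" "p : fst c" shows "jacobian c c p u = u"
proof -
 have "FD (snd c \<circ> chart_inv c) (at (snd c p)) = FD (%x. x) (at (snd c p))"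
  using assms chart[OF assms(1)] by (intro frechet_derivative_cong_open(1)[of "snd c ` fst c"]) auto
 thus ?thesis by (simp add: jacobian_def)
qed

lemma linear_jacobian: "c : \<A> ==> d : \<A> ==> p : fst c ==> p : fst d ==> linear (jacobian c d p)"
 unfolding jacobian_def by (intro linear_frechet_derivative transition_differentiable)

lemma tangentI:
 assumes "!!c d. c : \<A> ==> d : \<A> ==> p : fst c ==> p : fst d ==> v d = jacobian c d p (v c)"
  and "!!c. ~ (c : \<A> & p : fst c) ==> v c = 0"
 shows "v : tsp p"
 unfolding tangent_space_def using assms by blast

lemma tangentD:
 assumes "v : tsp p"
 shows "c : \<A> ==> d : \<A> ==> p : fst c ==> p : fst d ==> v d = jacobian c d p (v c)"
  and "~ (c : \<A> & p : fst c) ==> v c = 0"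
 using assms unfolding tangent_space_def by blast+

lemma tangent_add:
 assumes "v : tsp p" "w : tsp p"
 shows "v + w : tsp p"
proof (rule tangentI)
 fix c d assume cd: "c : \<A>" "d : \<A>" "p : fst c" "p : fst d"
 show "(v + w) d = jacobian c d p ((v + w) c)"
  unfolding plus_fun_apply linear_add[OF linear_jacobian[OF cd]]
  by (intro arg_cong2[where f="(+)"] tangentD(1)[OF _ cd] assms)
qed (use tangentD(2)[OF assms(1)] tangentD(2)[OF assms(2)] in simp)

lemma tangent_scale:
 assumes "v : tsp p" shows "tscale a v : tsp p"
proof (rule tangentI)
 fix c d assume cd: "c : \<A>" "d : \<A>" "p : fst c" "p : fst d"
 show "tscale a v d = jacobian c d p (tscale a v c)"
  unfolding tscale_def linear_scale[OF linear_jacobian[OF cd]]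
  by (intro arg_cong2[where f="(*\<^sub>R)"] tangentD(1)[OF _ cd] assms refl)
qed (use tangentD(2)[OF assms] in \<open>simp add: tscale_def\<close>)

lemma tangent_zero: "0 : tsp p"
 unfolding tangent_space_def by (auto simp: linear_0[OF linear_jacobian])

lemma tangent_sum: "(!!i. i : I ==> v i : tsp p) ==> (SUM i:I. v i) : tsp p"
 by (induction I rule: ifi) (auto intro: tangent_add tangent_zero)

lemma tangent_eqI:
 assumes "v : tsp p" "w : tsp p" "c : \<A>" "p : fst c" "v c = w c"
 shows "v = w"
proof
 fix d show "v d = w d"
  using tangentD[OF assms(1)] tangentD[OF assms(2)] assms(3-) by metis
qed

lemma const_field_tangent: "const_field \<A> c u p : tsp p"
 unfolding const_field_def tangent_space_def
 by (auto simp: linear_0[OF linear_jacobian] intro: jacobian_cocycle)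

lemma const_field_self [simp]: "c : \<A> ==> p : fst c ==> const_field \<A> c u p c = u"
 by (simp add: const_field_def)

lemma coord_tangent [simp]: "cx c i p : tsp p"
 by (simp add: coord_def const_field_tangent)

lemma coord_self [simp]: "c : \<A> ==> p : fst c ==> cx c i p c = axis i 1"
 by (simp add: coord_def)

lemma tangent_expand:
 assumes "v : tsp p" "c : \<A>" "p : fst c"
 shows "v = (SU i. tscale (v c $ i) (cx c i p))"
proof (rule tangent_eqI[OF assms(1) _ assms(2,3)])
 show "v c = (SU i. tscale (v c $ i) (cx c i p)) c"
  by (simp only: sum_apply) (simp only: tscale_def coord_self[OF assms(2,3)] vec_expand)
qed (simp add: tangent_sum tangent_scale)

lemma const_field_eq:
 assumes "v : tsp p" "c : \<A>" "p : fst c"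
 shows "const_field \<A> c (v c) p = v"
 by (rule tangent_eqI[OF const_field_tangent assms]) (simp add: assms)

lemma smooth_jacobian:
 assumes "c : \<A>" "d : \<A>"
 shows "sfu (fst c Int fst d) (%p. jacobian c d p u)"
 unfolding jacobian_def
 by (rule smooth_fun_on_chart[of _ c "%y. FD (snd d \<circ> chart_inv c) (at y) u"])
  (use assms chart(1)[OF assms(1)] chart(1)[OF assms(2)] in \<open>auto intro!: smooth_on_frechet transition_smooth\<close>)

lemma vector_field_const_field: "vfd (fst c) (const_field \<A> c u)" if "c : \<A>"
 unfolding vector_field_def
proof (intro conjI ballI const_field_tangent)
 fix d assume d: "d : \<A>"
 show "sfu (fst c Int fst d) (%p. const_field \<A> c u p d)"
  by (subst smooth_fun_cong[OF _ ,of _ _ "%p. jacobian c d p u"])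
   (use d that smooth_jacobian[OF that d] chart(1)[OF d] chart(1)[OF that] in \<open>auto simp: const_field_def\<close>)
qed

lemma vector_field_coord: "c : \<A> ==> vfd (fst c) (cx c i)"
 unfolding coord_def by (rule vector_field_const_field)

lemma vector_field_subset: "vfd U X ==> V <= U ==> vfd V X"
 unfolding vector_field_def by (blast intro: smooth_fun_subset)

lemma vector_field_tangent: "vfd U X ==> p : U ==> X p : tsp p"
 by (simp add: vector_field_def)

lemma vector_field_smooth: "vfd U X ==> c : \<A> ==> sfu (U Int fst c) (%p. X p c)"
 by (simp add: vector_field_def)

lemma vector_field_add:
 "open U ==> vfd U X ==> vfd U Y ==> vfd U (X + Y)"
 using tangent_add unfolding vector_field_def plus_fun_def by (simp add: smooth_fun_add chart(1) open_Int)

lemma vector_field_scale: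
 "open U ==> vfd U X ==> sfu U f ==> vfd U (%p. tscale (f p) (X p))"
 unfolding vector_field_def tscale_def[of _ "X p" for p]
 by (intro conjI ballI tangent_scale[unfolded tscale_def] smooth_fun_bilinear[OF _ _ _ bounded_bilinear_scaleR])
  (auto simp: chart(1) open_Int intro: smooth_fun_subset simp del: split_paired_All)

lemma vector_field_zero: "vfd U 0"
 unfolding vector_field_def by (auto intro: tangent_zero smooth_fun_const)

lemma vector_field_sum:
 "open U ==> (!!i. i : I ==> vfd U (X i)) ==> vfd U (SUM i:I. X i)"
 by (induction I rule: ifi) (auto intro: vector_field_add vector_field_zero)

lemma vector_field_component:
 assumes "open U" "vfd U X" "c : \<A>" "U <= fst c"
 shows "sfu U (%p. X p c $ i)"
 using vector_field_smooth[OF assms(2,3)] assms by (intro smooth_fun_component) (auto simp: Int_absorb2)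

lemma dirderiv_chart:
 assumes "open U" "sfu U f" "c : \<A>" "p : U" "p : fst c" "v : tsp p"
 shows "dd v f p = FD (f \<circ> chart_inv c) (at (snd c p)) (v c)"
proof -
 have "v c = jacobian (chx p) c p (v (chx p))"
  using assms chart_at unfolding tangent_space_def by blast
 thus ?thesis
  using frechet_chart_change[OF assms(1,2) chart_at(1) assms(3,4) chart_at(2) assms(5)]
  by (simp add: dirderiv_def Let_def)
qed

lemma dirderiv_differentiable:
 "sfu U f ==> p : U ==> ((f \<circ> chart_inv (chx p)) has_derivative
  FD (f \<circ> chart_inv (chx p)) (at (snd (chx p) p))) (at (snd (chx p) p))"
 using smooth_fun_differentiable[OF _ chart_at(1) _ chart_at(2)] by (simp add: frechet_derivative_works)

lemma dirderiv_const [simp]: "dd v (%q. a) p = 0"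
 by (simp add: dirderiv_def o_def)

lemma dirderiv_add:
 assumes "sfu U f" "sfu U g" "p : U"
 shows "dd v (%q. f q + g q) p = dd v f p + dd v g p"
 using frechet_derivative_at[OF has_derivative_add[OF dirderiv_differentiable[OF assms(1,3)] dirderiv_differentiable[OF assms(2,3)]]]
 by (simp add: dirderiv_def Let_def o_def fun_eq_iff)

lemma dirderiv_bilinear:
 assumes "sfu U f" "sfu U g" "p : U" "bounded_bilinear h"
 shows "dd v (%q. h (f q) (g q)) p = h (f p) (dd v g p) + h (dd v f p) (g p)"
 using frechet_derivative_at[OF bounded_bilinear.FDERIV[OF assms(4) dirderiv_differentiable[OF assms(1,3)] dirderiv_differentiable[OF assms(2,3)]]]
 by (simp add: dirderiv_def Let_def o_def fun_eq_iff chart_at)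

lemma dirderiv_linear:
 assumes "sfu U f" "p : U" "bounded_linear h"
 shows "dd v (%q. h (f q)) p = h (dd v f p)"
 using frechet_derivative_at[OF bounded_linear.has_derivative[OF assms(3) dirderiv_differentiable[OF assms(1,2)]]]
 by (simp add: dirderiv_def Let_def o_def fun_eq_iff)

lemma dirderiv_cong:
 assumes "open U" "!!q. q : U ==> f q = g q" "p : U"
 shows "dd v f p = dd v g p"
proof -
 let ?c = "chx p"
 have "FD (f \<circ> chart_inv ?c) (at (snd ?c p)) = FD (g \<circ> chart_inv ?c) (at (snd ?c p))"
  by (rule frechet_derivative_cong_open(1)[OF open_chart_image[OF chart_at(1) assms(1)]])
   (use assms chart_at in auto)
 thus ?thesis by (simp add: dirderiv_def Let_def)
qed

lemma dirderiv_vec_add: "sfu U f ==> p : U ==> dd (v + w) f p = dd v f p + dd w f p"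
 using linear_add[OF has_derivative_linear[OF dirderiv_differentiable]] by (simp add: dirderiv_def Let_def)

lemma dirderiv_vec_scale: "sfu U f ==> p : U ==> dd (tscale a v) f p = a *\<^sub>R dd v f p"
 using linear_scale[OF has_derivative_linear[OF dirderiv_differentiable]] by (simp add: dirderiv_def Let_def tscale_def)

lemma smooth_dirderiv:
 assumes U: "open U" and X: "vfd U X" and f: "sfu U f"
 shows "sfu U (%p. dd (X p) f p)"
 unfolding smooth_fun_def
proof
 fix c assume c: "c : \<A>"
 let ?D = "%y u. FD (f \<circ> chart_inv c) (at y) u" and ?S = "snd c ` (U Int fst c)"
 have S: "open ?S" using open_chart_image[OF c U] .
 have f': "smooth_on ?S (f \<circ> chart_inv c)" using f c by (auto simp: smooth_fun_def)
 have X': "smooth_on ?S ((%p. X p c) \<circ> chart_inv c)"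
  using vector_field_smooth[OF X c] c unfolding smooth_fun_def by (metis Int_absorb inf_assoc)
 have "dd (X (chart_inv c y)) f (chart_inv c y) =
   (SU i. (X (chart_inv c y) c $ i) *\<^sub>R ?D y (axis i 1))" if y: "y : ?S" for y
 proof -
  obtain p where p: "p : U" "p : fst c" "y = snd c p" using y by auto
  have lin: "linear (?D y)" using smooth_on_differentiable[OF f' y] by (rule linear_frechet_derivative)
  have "dd (X p) f p = ?D y (X p c)"
   using dirderiv_chart[OF U f c p(1,2) vector_field_tangent[OF X p(1)]] p by simp
  also have "X p c = (SU i. (X p c $ i) *\<^sub>R axis i 1)"
   by (simp only: vec_expand)
  also have "?D y ... = (SU i. (X p c $ i) *\<^sub>R ?D y (axis i 1))"
   by (simp add: linear_sum[OF lin] linear_scale[OF lin])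
  finally show ?thesis using p c by simp
 qed
 moreover have "smooth_on ?S (%y. SU i. (X (chart_inv c y) c $ i) *\<^sub>R ?D y (axis i 1))"
  unfolding smooth_on_def
 proof (intro allI Ck_on_sum S Ck_on_bilinear[OF S _ _ bounded_bilinear_scaleR])
  show "Ck_on k ?S (%y. X (chart_inv c y) c $ i)" for k i
   using Ck_on_linear[OF S _ bounded_linear_vec_nth] X' unfolding smooth_on_def o_def by blast
  show "Ck_on k ?S (%y. ?D y (axis i 1))" for k i
   using smooth_on_frechet[OF f'] unfolding smooth_on_def by blast
 qed
 ultimately show "smooth_on ?S ((%p. dd (X p) f p) \<circ> chart_inv c)"
  by (subst smooth_on_cong[OF S, of _ "%y. SU i. (X (chart_inv c y) c $ i) *\<^sub>R ?D y (axis i 1)"]) auto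
qed

text \<open>In the chart \<open>c\<close> both sides are iterated partial derivatives, so this is
  the symmetry of second derivatives.\<close>

lemma dirderiv_coord_commute:
 fixes f :: "'m => 'b::euclidean_space"
 assumes "open U" "sfu U f" "c : \<A>" "p : U" "U <= fst c"
 shows "dd (cx c i p) (%q. dd (cx c j q) f q) p =
  dd (cx c j p) (%q. dd (cx c i q) f q) p"
proof -
 let ?S = "snd c ` U"
 let ?F = "%j y. FD (f \<circ> chart_inv c) (at y) (axis j 1)"
 have U: "U Int fst c = U" using assms by auto
 have S: "open ?S" using open_chart_image[OF assms(3,1)] U by simp
 have f: "smooth_on ?S (f \<circ> chart_inv c)" using assms U unfolding smooth_fun_def by metis
 have p: "snd c p : ?S" using assms by simp
 have *: "dd (cx c i p) (%q. dd (cx c j q) f q) p =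
   FD (?F j) (at (snd c p)) (axis i 1)" for i j
 proof -
  have 1: "dd (cx c j q) f q = ?F j (snd c q)" if "q : U" for q
   using dirderiv_chart[OF assms(1,2,3) that] that assms(3,5) by auto
  have "dd (cx c i p) (%q. dd (cx c j q) f q) p =
    FD ((%q. dd (cx c j q) f q) \<circ> chart_inv c) (at (snd c p)) (cx c i p c)"
   using assms vector_field_subset[OF vector_field_coord[OF assms(3)] assms(5)]
   by (intro dirderiv_chart[OF assms(1) smooth_dirderiv]) auto
  also have "... = FD (?F j) (at (snd c p)) (cx c i p c)"
   using assms 1 by (subst frechet_derivative_cong_open(1)[OF S p, of _ "?F j"]) auto
  also have "cx c i p c = axis i 1" using assms by auto
  finally show ?thesis .
 qed
 show ?thesis unfolding * by (rule second_derivative_symmetric[OF S f p])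
qed

text \<open>The components of a coordinate field in another chart \<open>d\<close> are the
  derivatives of the coordinate map of \<open>d\<close> along it. The bracket is therefore a
  difference of mixed second derivatives of \<open>snd d\<close>.\<close>

lemma lie_bracket_coord:
 assumes "c : \<A>" "p : fst c" shows "lie_bracket \<A> (cx c i) (cx c j) p = 0"
proof
 fix d
 show "lie_bracket \<A> (cx c i) (cx c j) p d = 0 d"
 proof (cases "d : \<A> & p : fst d")
  case True
  let ?U = "fst c Int fst d"
  have U: "open ?U" "p : ?U" using assms True by (simp_all add: chart(1) open_Int)
  have sd: "sfu ?U (snd d)" using smooth_fun_subset[OF smooth_fun_snd] True by blast
  have "cx c j q d = dd (cx c j q) (snd d) q" if "q : ?U" for q j
  proof -
   have "cx c j q d = jacobian c d q (axis j 1)"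
    using that assms(1) True by (simp add: coord_def const_field_def)
   moreover have "dd (cx c j q) (snd d) q = jacobian c d q (cx c j q c)"
    using dirderiv_chart[OF U(1) sd assms(1) that _ coord_tangent] that by (simp add: jacobian_def)
   ultimately show ?thesis using that assms(1) by simp
  qed
  hence "dd v (%q. cx c j q d) p = dd v (%q. dd (cx c j q) (snd d) q) p" for v j
   by (intro dirderiv_cong[OF U(1)]) (use U in auto)
  thus ?thesis
   using dirderiv_coord_commute[OF U(1) sd assms(1) U(2)] True by (simp add: lie_bracket_def)
 qed (auto simp: lie_bracket_def)
qed

end

section \<open>The fibrewise Weyl product\<close>

text \<open>Tensors with the antisymmetric arguments fixed are functions on lists; \<open>ins v\<close> is the
  symmetric insertion of \<open>v\<close>. The symmetric product is determined by its value on the empty list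
  and the Leibniz rule for \<open>ins\<close>, so identities for it follow by induction on the list.\<close>

definition ins :: "'d => ('d list => 'v) => 'd list => 'v"
 where "ins v x = (%vs. x (v # vs))"

lemma ins_apply [simp]: "ins v x vs = x (v # vs)"
 by (simp add: ins_def)

lemma ins_add [simp]: "ins v (x + y) = ins v x + ins v y"
 and ins_zero [simp]: "ins v 0 = 0"
 and ins_scaleC [simp]: "ins v (a *C z) = a *C ins v z"
 and ins_diff [simp]: "ins v (x' - y') = ins v x' - ins v y'"
 by (auto simp: ins_def)

lemma ins_sum: "ins v (SUM i:I. x i) = (SUM i:I. ins v (x i :: _ => 'v::ab_group_add))"
 by (auto simp: ins_def sum_apply)

fun shuf :: "('u => 'v => 'w::complex_space) => ('d list => 'u) => ('d list => 'v) => 'd list => 'w" where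
 "shuf B x y [] = B (x []) (y [])"
| "shuf B x y (v # vs) = shuf B (ins v x) y vs + shuf B x (ins v y) vs"

lemma ins_shuf: "ins v (shuf B x y) = shuf B (ins v x) y + shuf B x (ins v y)"
 by (auto simp: ins_def)

text \<open>The sets of positions without 0 and those with 0 correspond to the two terms of the
  recursion, in which the first argument goes to \<open>y\<close> or to \<open>x\<close>.\<close>

lemma shuf_nths: "shuf B x y vs = (SUM I:Pow {..<length vs}. B (x (nths vs I)) (y (nths vs (- I))))"
proof (induction vs arbitrary: x y)
 case Nil
 thus ?case by simp
next
 case (Cons v vs)
 let ?f = "%I. B (x (nths (v # vs) I)) (y (nths (v # vs) (- I)))"
 let ?N = "{..<length vs}"
 have "{..<Suc (length vs)} = insert 0 (Suc ` ?N)" by (auto simp: image_iff less_Suc_eq_0_disj)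
 hence P: "Pow {..<length (v # vs)} = Pow (Suc ` ?N) \<union> insert 0 ` Pow (Suc ` ?N)"
  by (simp add: Pow_insert)
 have inj: "inj_on (insert 0) (Pow (Suc ` ?N))"
  by (rule inj_onI) (metis Pow_iff imageE in_mono insert_eq_iff old.nat.distinct(1))
 have "(SUM I:Pow {..<length (v # vs)}. ?f I) =
   (SUM I:Pow (Suc ` ?N). ?f I) + (SUM I:insert 0 ` Pow (Suc ` ?N). ?f I)"
  unfolding P by (rule sum.union_disjoint) auto
 also have "(SUM I:insert 0 ` Pow (Suc ` ?N). ?f I) = (SUM I:Pow (Suc ` ?N). ?f (insert 0 I))"
  using inj by (simp add: sum.reindex)
 also have "Pow (Suc ` ?N) = (`) Suc ` Pow ?N" by (rule image_Pow_surj[symmetric, OF refl])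
 also have "(SUM I:(`) Suc ` Pow ?N. ?f I) + (SUM I:(`) Suc ` Pow ?N. ?f (insert 0 I)) =
   (SUM I:Pow ?N. ?f (Suc ` I)) + (SUM I:Pow ?N. ?f (insert 0 (Suc ` I)))"
  by (simp add: sum.reindex inj_on_image)
 also have "(SUM I:Pow ?N. ?f (Suc ` I)) = (SUM I:Pow ?N. B (x (nths vs I)) (ins v y (nths vs (- I))))"
  by (intro sum.cong refl) (auto simp: nths_Cons Compl_eq intro!: arg_cong2[where f=B] arg_cong[where f=x] arg_cong[where f=y] arg_cong[where f="nths vs"])
 also have "(SUM I:Pow ?N. ?f (insert 0 (Suc ` I))) = (SUM I:Pow ?N. B (ins v x (nths vs I)) (y (nths vs (- I))))"
  by (intro sum.cong refl) (auto simp: nths_Cons Compl_eq intro!: arg_cong2[where f=B] arg_cong[where f=x] arg_cong[where f=y] arg_cong[where f="nths vs"])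
 finally show ?case by (simp add: Cons.IH)
qed

text \<open>Separates the signed sum over form arguments from the symmetric product. With the form
  arguments fixed, everything reduces to \<open>shuf\<close>.\<close>

lemma tmul_slices:
 "tmul B x y vs ws = (SUM J:Pow {..<length ws}. shuffle_sign (length ws) J *C
  shuf B (%vs. x vs (nths ws J)) (%vs. y vs (nths ws (- J))) vs)"
 unfolding tmul_def shuf_nths by (subst sum.swap) (simp add: scaleC_sum_right)

lemma shuf_map: "shuf B x y (map f vs) = shuf B (%l. x (map f l)) (%l. y (map f l)) vs"
 by (induction vs arbitrary: x y) (simp_all add: ins_def)

text \<open>The \<open>n\<close>-th term of the exponential series of the contraction with
  \<open>P\<close>. The factors \<open>1 / Suc n\<close> of the recursion multiply to
  \<open>1 / n!\<close>; the constant \<open>i/2\<close> will be part of \<open>P\<close>. The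
  vectors \<open>e k\<close> are left abstract, so that tangent vectors and mere indices can both be
  inserted.\<close>

primrec weyl :: "('u => 'v => 'w::complex_space) => ('k::finite => 'k => complex) => ('k => 'd) =>
  nat => ('d list => 'u) => ('d list => 'v) => 'd list => 'w" where
 "weyl B P e 0 x y = shuf B x y"
| "weyl B P e (Suc n) x y = (1 / of_nat (Suc n)) *C
  (SU k. SU l. P k l *C weyl B P e n (ins (e k) x) (ins (e l) y))"

lemma weyl_Suc_apply: "weyl B P e (Suc n) x y vs = (1 / of_nat (Suc n)) *C
  (SU k. SU l. P k l *C weyl B P e n (ins (e k) x) (ins (e l) y) vs)"
 by (simp add: sum_apply del: of_nat_Suc)

lemma weyl_Suc_mult: "of_nat (Suc n) *C weyl B P e (Suc n) x y =
  (SU k. SU l. P k l *C weyl B P e n (ins (e k) x) (ins (e l) y))"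
 by (simp add: scaleC_scaleC del: of_nat_Suc)

text \<open>Evaluation on coordinate vectors commutes with the product. This leads from tensors to
  their component functions on index lists.\<close>

lemma weyl_map: "weyl B P (%k. f (e k)) n x y (map f vs) =
  weyl B P e n (%l. x (map f l)) (%l. y (map f l)) vs"
 by (induction n arbitrary: x y) (simp_all add: shuf_map weyl_Suc_apply ins_def del: weyl.simps(2))

lemma weyl_scale_tensor:
 "weyl B (%k l. c * P k l) e n x y = c ^ n *C weyl B P e n x y"
 by (induction n arbitrary: x y) (simp_all add: scaleC_sum_right scaleC_scaleC ac_simps del: of_nat_Suc)

lemma lists_Suc: "{ks :: 'k list. length ks = Suc n} = (%(k, ks). k # ks) ` (UNIV \<times> {ks. length ks = n})"
 by (auto simp: length_Suc_conv image_iff)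

lemma sum_lists_Suc: "(\<Sum>ks | length ks = Suc n. f ks) = (SU k. \<Sum>ks | length ks = n. f ((k::'k::finite) # ks))"
 unfolding lists_Suc by (subst sum.reindex) (auto simp: inj_on_def sum.cartesian_product split_def)

text \<open>The factor \<open>fact n\<close> undoes the \<open>1 / n!\<close> contained in
  \<open>weyl\<close>.\<close>

lemma weyl_lists:
 "(\<Sum>ks | length ks = n. \<Sum>ls | length ls = n. (\<Prod>q<n. P (ks ! q) (ls ! q)) *C
   shuf B (%vs. x (map e ks @ vs)) (%vs. y (map e ls @ vs)) vs) =
  fact n *C weyl B P e n x y vs"
proof (induction n arbitrary: x y)
 case 0
 thus ?case by simp
next
 case (Suc n)
 let ?s = "%x y ks ls. shuf B (%vs. x (map e ks @ vs)) (%vs. y (map e ls @ vs)) vs"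
 have "(\<Sum>ks | length ks = Suc n. \<Sum>ls | length ls = Suc n. (\<Prod>q<Suc n. P (ks ! q) (ls ! q)) *C ?s x y ks ls) =
   (SU k. \<Sum>ks | length ks = n. SU l. \<Sum>ls | length ls = n.
    P k l *C ((\<Prod>q<n. P (ks ! q) (ls ! q)) *C ?s (ins (e k) x) (ins (e l) y) ks ls))"
  unfolding sum_lists_Suc by (simp only: prod.lessThan_Suc_shift) (simp add: scaleC_scaleC ins_def)
 also have "... = (SU k. SU l. P k l *C (fact n *C weyl B P e n (ins (e k) x) (ins (e l) y) vs))"
  by (intro sum.cong refl, subst sum.swap) (simp only: scaleC_sum_right[symmetric] Suc.IH)
 also have "... = fact (Suc n) *C weyl B P e (Suc n) x y vs"
  by (simp only: weyl_Suc_apply) (simp add: scaleC_sum_right scaleC_scaleC ac_simps del: of_nat_Suc)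
 finally show ?case .
qed

lemma weyl_term_slices:
 "weyl_term \<A> \<omega> B n p x y vs ws = fact n *C (SUM J:Pow {..<length ws}. shuffle_sign (length ws) J *C
  weyl B (poisson \<A> \<omega> (chart_at \<A> p) p) (%k. coord \<A> (chart_at \<A> p) k p) n
   (%vs. x vs (nths ws J)) (%vs. y vs (nths ws (- J))) vs)"
proof -
 let ?c = "chart_at \<A> p"
 let ?e = "%k. coord \<A> ?c k p"
 let ?P = "%ks ls. (\<Prod>q<n. poisson \<A> \<omega> ?c p (ks ! q) (ls ! q))"
 let ?s = "%J ks ls. shuf B (%vs. x (map ?e ks @ vs) (nths ws J)) (%vs. y (map ?e ls @ vs) (nths ws (- J))) vs"
 have "weyl_term \<A> \<omega> B n p x y vs ws = (\<Sum>ks | length ks = n. \<Sum>ls | length ls = n.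
   SUM J:Pow {..<length ws}. shuffle_sign (length ws) J *C (?P ks ls *C ?s J ks ls))"
  by (simp add: weyl_term_def Let_def sum_apply tmul_slices scaleC_sum_right scaleC_scaleC mult.commute)
 also have "... = (\<Sum>ks | length ks = n. SUM J:Pow {..<length ws}. \<Sum>ls | length ls = n.
   shuffle_sign (length ws) J *C (?P ks ls *C ?s J ks ls))"
  by (intro sum.cong refl sum.swap)
 also have "... = (SUM J:Pow {..<length ws}. \<Sum>ks | length ks = n. \<Sum>ls | length ls = n.
   shuffle_sign (length ws) J *C (?P ks ls *C ?s J ks ls))"
  by (rule sum.swap)
 also have "... = (SUM J:Pow {..<length ws}. shuffle_sign (length ws) J *C (fact n *C
   weyl B (poisson \<A> \<omega> ?c p) ?e n (%vs. x vs (nths ws J)) (%vs. y vs (nths ws (- J))) vs))"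
 proof (intro sum.cong refl)
  fix J
  show "(\<Sum>ks | length ks = n. \<Sum>ls | length ls = n. shuffle_sign (length ws) J *C (?P ks ls *C ?s J ks ls)) =
    shuffle_sign (length ws) J *C (fact n *C
     weyl B (poisson \<A> \<omega> ?c p) ?e n (%vs. x vs (nths ws J)) (%vs. y vs (nths ws (- J))) vs)"
   using weyl_lists[where n=n and P="poisson \<A> \<omega> ?c p" and B=B and e="?e" and vs=vs
     and x="%vs. x vs (nths ws J)" and y="%vs. y vs (nths ws (- J))"]
   by (simp only: scaleC_sum_right[symmetric])
 qed
 finally show ?thesis by (simp add: scaleC_sum_right scaleC_scaleC mult.commute)
qed

text \<open>Exchanging neighbours is enough for full symmetry (\<open>symm_mset\<close>) and is
  easier to carry through inductions over lists.\<close>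

definition symm :: "('d list => 'v) => bool"
 where "symm x \<longleftrightarrow> (ALL us u v vs. x (us @ u # v # vs) = x (us @ v # u # vs))"

lemma symm_ins: "symm x ==> symm (ins v x)"
 unfolding symm_def by (metis append_Cons ins_apply)

lemma ins_commute: "symm x ==> ins u (ins v x) = ins v (ins u x)"
 unfolding symm_def by (metis append_Nil ins_apply ext)

lemma symm_zero: "symm 0"
 and symm_add: "symm x ==> symm y ==> symm (x + y)"
 and symm_scaleC: "symm z ==> symm (a *C z)"
 by (auto simp: symm_def)

lemma symm_shuf: assumes "symm x" "symm y" shows "symm (shuf B x y)"
 unfolding symm_def
proof (intro allI)
 fix us u v vs
 show "shuf B x y (us @ u # v # vs) = shuf B x y (us @ v # u # vs)"
  using assms
 proof (induction us arbitrary: x y)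
  case Nil
  thus ?case by (simp add: ins_commute[of _ u v] ac_simps)
 next
  case (Cons w us)
  thus ?case using Cons.IH[of "ins w x" y] Cons.IH[of x "ins w y"] by (simp add: symm_ins del: ins_apply)
 qed
qed

lemma symm_cons_append: "symm x ==> x (us @ v # vs) = x (v # us @ vs)"
proof (induction us arbitrary: x)
 case (Cons u us)
 thus ?case using Cons.IH[OF symm_ins[of x u]] ins_commute[of x u v] by (metis append_Cons ins_apply)
qed simp

lemma symm_mset: "symm x ==> mset vs = mset vs' ==> x vs = x vs'"
proof (induction vs arbitrary: x vs')
 case (Cons v vs)
 then obtain us us' where vs': "vs' = us @ v # us'"
  by (metis list.set_intros(1) set_mset_mset split_list)
 hence "mset vs = mset (us @ us')" using Cons.prems(2) by simp
 hence "ins v x vs = ins v x (us @ us')" by (rule Cons.IH[OF symm_ins[OF Cons.prems(1)]])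
 thus ?case using symm_cons_append[OF Cons.prems(1)] vs' by simp
qed simp

lemma symmI_mset: "(!!vs vs'. mset vs = mset vs' ==> x vs = x vs') ==> symm x"
 unfolding symm_def by simp

text \<open>The laws are required on the carrier only: composition of functions, for instance, is
  additive in its right factor only for additive left factors. Hence the membership hypotheses of
  the lemmas on the Weyl product.\<close>

locale fibre_algebra =
 fixes V :: "'v::complex_space set" and B :: "'v => 'v => 'v" and u :: 'v
 assumes V_zero: "0 : V" and V_add: "x : V ==> y : V ==> x + y : V" and V_scale: "x : V ==> a *C x : V"
  and B_closed: "x : V ==> y : V ==> B x y : V"
  and B_add_left: "x : V ==> x' : V ==> y : V ==> B (x + x') y = B x y + B x' y"
  and B_add_right: "x : V ==> y : V ==> y' : V ==> B x (y + y') = B x y + B x y'"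
  and B_scale_left: "x : V ==> y : V ==> B (a *C x) y = a *C B x y"
  and B_scale_right: "x : V ==> y : V ==> B x (a *C y) = a *C B x y"
  and B_assoc: "x : V ==> y : V ==> z : V ==> B (B x y) z = B x (B y z)"
  and u_closed: "u : V" and B_u_left: "x : V ==> B u x = x" and B_u_right: "x : V ==> B x u = x"
begin

lemma B_zero_left: "y : V ==> B 0 y = 0" and B_zero_right: "y : V ==> B y 0 = 0"
 using B_scale_left[of 0 y 0] B_scale_right[of y 0 0] V_zero by auto

lemma V_minus: "x : V ==> - x : V"
 using V_scale[of x "-1"] by simp

lemma V_diff: "x : V ==> y : V ==> x - y : V"
 using V_add[OF _ V_minus, of x y] by simp

text \<open>Multilinearity is not included, so that functions on index lists, whose arguments have
  no linear structure, are covered together with tensors.\<close>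

definition W :: "('d list => 'v) set"
 where "W = {x. symm x & range x <= V}"

lemma W_V: "x : W ==> x vs : V"
 by (auto simp: W_def)

lemma W_symm: "x : W ==> symm x"
 by (auto simp: W_def)

lemma W_ins: "x : W ==> ins v x : W"
 by (auto simp: W_def symm_ins)

lemma W_zero: "0 : W"
 using V_zero by (auto simp: W_def symm_zero)

lemma W_add: "x : W ==> y : W ==> x + y : W"
 by (auto simp: W_def intro!: symm_add V_add)

lemma W_scale: "x : W ==> a *C x : W"
 by (auto simp: W_def intro!: symm_scaleC V_scale)

lemma W_minus: "x : W ==> - x : W"
 using W_scale[of x "-1"] by simp

lemma W_diff: "x : W ==> y : W ==> x - y : W"
 using W_add[OF _ W_minus, of x y] by simp

lemma W_sum: "(!!i. i : I ==> f i : W) ==> (SUM i:I. f i) : W"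
 by (induction I rule: ifi) (auto intro: W_zero W_add)

lemma V_shuf: "range x <= V ==> range y <= V ==> shuf B x y vs : V"
proof (induction vs arbitrary: x y)
 case Nil thus ?case by (simp add: range_subsetD B_closed)
next
 case (Cons v vs)
 have "range (ins v x) <= V" "range (ins v y) <= V" using Cons.prems by auto
 thus ?case using Cons by (simp add: V_add)
qed

lemma W_shuf: "x : W ==> y : W ==> shuf B x y : W"
 by (auto simp: W_def symm_shuf V_shuf)

lemma W_weyl: "x : W ==> y : W ==> weyl B P e n x y : W"
 by (induction n arbitrary: x y) (auto intro!: W_shuf W_scale W_sum W_ins)

lemma shuf_add_left: "x : W ==> x' : W ==> y : W ==> shuf B (x + x') y = shuf B x y + shuf B x' y"
proof (rule ext)
 fix vs show "x : W ==> x' : W ==> y : W ==> shuf B (x + x') y vs = (shuf B x y + shuf B x' y) vs"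
  by (induction vs arbitrary: x x' y) (simp_all add: B_add_left W_V W_ins ac_simps)
qed

lemma shuf_add_right: "x : W ==> y : W ==> y' : W ==> shuf B x (y + y') = shuf B x y + shuf B x y'"
proof (rule ext)
 fix vs show "x : W ==> y : W ==> y' : W ==> shuf B x (y + y') vs = (shuf B x y + shuf B x y') vs"
  by (induction vs arbitrary: x y y') (simp_all add: B_add_right W_V W_ins ac_simps)
qed

lemma shuf_scale_left: "x : W ==> y : W ==> shuf B (a *C x) y = a *C shuf B x y"
proof (rule ext)
 fix vs show "x : W ==> y : W ==> shuf B (a *C x) y vs = (a *C shuf B x y) vs"
  by (induction vs arbitrary: x y) (simp_all add: B_scale_left W_V W_ins scaleC_add_right)
qed

lemma shuf_scale_right: "x : W ==> y : W ==> shuf B x (a *C y) = a *C shuf B x y"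
proof (rule ext)
 fix vs show "x : W ==> y : W ==> shuf B x (a *C y) vs = (a *C shuf B x y) vs"
  by (induction vs arbitrary: x y) (simp_all add: B_scale_right W_V W_ins scaleC_add_right)
qed

lemma shuf_assoc: "x : W ==> y : W ==> z : W ==> shuf B (shuf B x y) z = shuf B x (shuf B y z)"
proof (rule ext)
 fix vs show "x : W ==> y : W ==> z : W ==> shuf B (shuf B x y) z vs = shuf B x (shuf B y z) vs"
  by (induction vs arbitrary: x y z)
   (simp_all add: B_assoc W_V W_ins W_shuf ins_shuf shuf_add_left shuf_add_right)
qed

lemma weyl_add_left: "x : W ==> x' : W ==> y : W ==>
  weyl B P e n (x + x') y = weyl B P e n x y + weyl B P e n x' y"
 by (induction n arbitrary: x x' y)
  (simp_all add: shuf_add_left W_ins scaleC_add_right sum.distrib)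

lemma weyl_add_right: "x : W ==> y : W ==> y' : W ==>
  weyl B P e n x (y + y') = weyl B P e n x y + weyl B P e n x y'"
 by (induction n arbitrary: x y y')
  (simp_all add: shuf_add_right W_ins scaleC_add_right sum.distrib)

lemma weyl_scale_left: "x : W ==> y : W ==> weyl B P e n (a *C x) y = a *C weyl B P e n x y"
 by (induction n arbitrary: x y)
  (simp_all add: shuf_scale_left W_ins scaleC_sum_right scaleC_scaleC mult.commute mult.left_commute)

lemma weyl_scale_right: "x : W ==> y : W ==> weyl B P e n x (a *C y) = a *C weyl B P e n x y"
 by (induction n arbitrary: x y)
  (simp_all add: shuf_scale_right W_ins scaleC_sum_right scaleC_scaleC mult.commute mult.left_commute)

lemma weyl_zero_left [simp]: "y : W ==> weyl B P e n 0 y = 0"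
 using weyl_scale_left[OF W_zero, of y P e n 0] by simp

lemma weyl_zero_right [simp]: "x : W ==> weyl B P e n x 0 = 0"
 using weyl_scale_right[OF _ W_zero, of x P e n 0] by simp

lemma weyl_minus_left: "x : W ==> y : W ==> weyl B P e n (- x) y = - weyl B P e n x y"
 using weyl_scale_left[of x y P e n "-1"] by simp

lemma weyl_minus_right: "x : W ==> y : W ==> weyl B P e n x (- y) = - weyl B P e n x y"
 using weyl_scale_right[of x y P e n "-1"] by simp

lemma weyl_diff_left: "x : W ==> x' : W ==> y : W ==>
  weyl B P e n (x - x') y = weyl B P e n x y - weyl B P e n x' y"
 using weyl_add_left[of x "- x'" y] by (simp add: W_minus weyl_minus_left)

lemma weyl_diff_right: "x : W ==> y : W ==> y' : W ==>
  weyl B P e n x (y - y') = weyl B P e n x y - weyl B P e n x y'"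
 using weyl_add_right[of x y "- y'"] by (simp add: W_minus weyl_minus_right)

lemma weyl_sum_left: "(!!i. i : I ==> f i : W) ==> y : W ==>
  weyl B P e n (SUM i:I. f i) y = (SUM i:I. weyl B P e n (f i) y)"
 by (induction I rule: ifi) (simp_all add: weyl_add_left W_sum)

lemma weyl_sum_right: "x : W ==> (!!i. i : I ==> f i : W) ==>
  weyl B P e n x (SUM i:I. f i) = (SUM i:I. weyl B P e n x (f i))"
 by (induction I rule: ifi) (simp_all add: weyl_add_right W_sum)

text \<open>By symmetry the insertion of \<open>v\<close> commutes with the insertions
  \<open>ins (e k)\<close> of the contraction, so it remains a derivation.\<close>

lemma ins_weyl: "x : W ==> y : W ==>
  ins v (weyl B P e n x y) = weyl B P e n (ins v x) y + weyl B P e n x (ins v y)"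
proof (induction n arbitrary: x y)
 case 0 show ?case by (simp only: weyl.simps ins_shuf)
next
 case (Suc n)
 have "ins (e k) (ins v x) = ins v (ins (e k) x)" "ins (e k) (ins v y) = ins v (ins (e k) y)" for k
  using Suc.prems by (auto intro: ins_commute W_symm)
 with Suc show ?case
  by (simp add: ins_sum W_ins scaleC_add_right sum.distrib
    del: of_nat_Suc ins_apply plus_fun_apply scaleC_fun_apply)
qed

text \<open>Multiplied by \<open>Suc N\<close>, either side at order \<open>Suc N\<close> is a sum of three contractions of the
  same side at order \<open>N\<close>, one for each pair of factors.\<close>

lemma weyl_assoc:
 fixes x y z :: "'d list => 'v" and e :: "'k::finite => 'd"
 assumes "x : W" "y : W" "z : W"
 shows "(\<Sum>q\<le>N. weyl B P e (N - q) (weyl B P e q x y) z) = (\<Sum>q\<le>N. weyl B P e (N - q) x (weyl B P e q y z))"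
 using assms
proof (induction N arbitrary: x y z)
 case 0 thus ?case by (simp add: shuf_assoc)
next
 case (Suc N)
 define M where "M = weyl B P e"
 define i :: "'k => ('d list => 'v) => 'd list => 'v" where "i k = ins (e k)" for k
 define S where "S f = (SU k. SU l. P k l *C f k l)" for f :: "'k => 'k => 'd list => 'v"
 define L where "L x y z = (\<Sum>q\<le>N. M (N - q) (M q x y) z)" for x y z
 define R where "R x y z = (\<Sum>q\<le>N. M (N - q) x (M q y z))" for x y z
 have W [simp]: "i k x : W" "M n x y : W" if "x : W" "y : W" for x y k n
  using that by (auto simp: i_def M_def W_ins W_weyl)
 have S_sum: "(SUM q:I. S (f q)) = S (%k l. SUM q:I. f q k l)" for f and I :: "nat set"
  unfolding S_def by (subst sum.swap, intro sum.cong refl, subst sum.swap) (simp add: scaleC_sum_right)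
 have S_add: "S f + S g = S (%k l. f k l + g k l)" for f g
  unfolding S_def by (simp add: scaleC_add_right sum.distrib)
 have MS: "of_nat (Suc n) *C M (Suc n) x y = S (%k l. M n (i k x) (i l y))" for n x y
  unfolding M_def S_def i_def by (rule weyl_Suc_mult)
 have iM: "i k (M n x y) = M n (i k x) y + M n x (i k y)" if "x : W" "y : W" for k n x y
  unfolding M_def i_def using that by (rule ins_weyl)
 have Madd: "M n (x + x') y = M n x y + M n x' y" "M n y (x + x') = M n y x + M n y x'"
  if "x : W" "x' : W" "y : W" for n x x' y
  unfolding M_def using that by (simp_all add: weyl_add_left weyl_add_right)
 have Mscale: "M n (a *C x) y = a *C M n x y" "M n x (a *C y) = a *C M n x y" if "x : W" "y : W" for n x y a
  unfolding M_def using that by (simp_all add: weyl_scale_left weyl_scale_right)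
 have MSl: "M n (S f) z = S (%k l. M n (f k l) z)" "M n z (S f) = S (%k l. M n z (f k l))"
  if "!!k l. f k l : W" "z : W" for n f z
  unfolding S_def M_def using that
  by (simp_all add: weyl_sum_left weyl_sum_right W_sum W_scale weyl_scale_left weyl_scale_right)
 have IH: "L x y z = R x y z" if "x : W" "y : W" "z : W" for x y z
  unfolding L_def R_def M_def using Suc.IH[OF that] .
 note xyz = Suc.prems
 \<comment> \<open>The factor is written as \<open>(Suc N - q) + q\<close>. The first part peels one
   contraction off the outer product; the second, after an index shift, off the inner one.\<close>
 have split: "of_nat (Suc N) *C (\<Sum>q\<le>Suc N. f q) =
   (\<Sum>q\<le>N. of_nat (Suc (N - q)) *C f q) + (\<Sum>q\<le>N. of_nat (Suc q) *C f (Suc q))"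
  for f :: "nat => 'd list => 'v"
 proof -
  have "of_nat (Suc N) *C (\<Sum>q\<le>Suc N. f q) = (\<Sum>q\<le>Suc N. of_nat (Suc N - q) *C f q + of_nat q *C f q)"
   by (simp only: scaleC_sum_right scaleC_add_left[symmetric] of_nat_add[symmetric])
    (intro sum.cong refl, simp)
  also have "... = (\<Sum>q\<le>Suc N. of_nat (Suc N - q) *C f q) + (\<Sum>q\<le>Suc N. of_nat q *C f q)"
   by (rule sum.distrib)
  also have "(\<Sum>q\<le>Suc N. of_nat (Suc N - q) *C f q) = (\<Sum>q\<le>N. of_nat (Suc (N - q)) *C f q)"
   by (auto simp: of_nat_diff algebra_simps intro!: sum.cong)
  also have "(\<Sum>q\<le>Suc N. of_nat q *C f q) = (\<Sum>q\<le>N. of_nat (Suc q) *C f (Suc q))"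
   by (subst sum.atMost_Suc_shift) simp
  finally show ?thesis .
 qed
 have "of_nat (Suc N) *C (\<Sum>q\<le>Suc N. M (Suc N - q) (M q x y) z) =
   (\<Sum>q\<le>N. S (%k l. M (N - q) (i k (M q x y)) (i l z))) + (\<Sum>q\<le>N. M (N - q) (S (%k l. M q (i k x) (i l y))) z)"
  unfolding split using xyz by (simp add: Suc_diff_le MS Mscale(1)[symmetric] del: of_nat_Suc)
 also have "... = S (%k l. L (i k x) y (i l z) + L x (i k y) (i l z) + L (i k x) (i l y) z)"
  using xyz by (simp add: S_sum S_add iM Madd MSl L_def sum.distrib ac_simps)
 also have "... = S (%k l. R (i k x) y (i l z) + R x (i k y) (i l z) + R (i k x) (i l y) z)"
  using xyz by (simp add: IH)
 also have "... = (\<Sum>q\<le>N. S (%k l. M (N - q) (i k x) (i l (M q y z)))) + (\<Sum>q\<le>N. M (N - q) x (S (%k l. M q (i k y) (i l z))))"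
  using xyz by (simp add: S_sum S_add iM Madd MSl R_def sum.distrib ac_simps)
 also have "... = of_nat (Suc N) *C (\<Sum>q\<le>Suc N. M (Suc N - q) x (M q y z))"
  unfolding split using xyz by (simp add: Suc_diff_le MS Mscale(2)[symmetric] del: of_nat_Suc)
 finally have "(1 / of_nat (Suc N)) *C of_nat (Suc N) *C (\<Sum>q\<le>Suc N. M (Suc N - q) (M q x y) z) =
   (1 / of_nat (Suc N)) *C of_nat (Suc N) *C (\<Sum>q\<le>Suc N. M (Suc N - q) x (M q y z))"
  by (simp only:)
 thus ?case unfolding M_def[symmetric] by (simp add: scaleC_scaleC del: of_nat_Suc sum.atMost_Suc)
qed

definition const :: "'v => 'd list => 'v"
 where "const a = (%vs. if vs = [] then a else 0)"

lemma ins_const [simp]: "ins v (const a) = 0"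
 by (auto simp: const_def)

lemma W_const: "a : V ==> const a : W"
 using V_zero by (auto simp: W_def const_def symm_def)

lemma weyl_const_Suc: "x : W ==> weyl B P e (Suc n) x (const a) = 0" "x : W ==> weyl B P e (Suc n) (const a) x = 0"
 by (simp_all add: W_ins)

text \<open>Each contraction removes one argument from either factor, so the symmetric degree of the
  \<open>n\<close>-th term is the sum of the degrees minus \<open>2 * n\<close>.\<close>

lemma weyl_degree:
 assumes "x : W" "y : W" "!!vs. length vs < a ==> x vs = 0" "!!vs. length vs < b ==> y vs = 0"
  "length vs + 2 * n < a + b"
 shows "weyl B P e n x y vs = 0"
 using assms
proof (induction n arbitrary: x y a b)
 case 0
 thus ?case
 proof (induction vs arbitrary: x y a b)
  case Nil
  thus ?case by (cases "a > 0") (auto simp: B_zero_left B_zero_right W_V)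
 next
  case (Cons v vs)
  have "weyl B P e 0 (ins v x) y vs = 0"
   using Cons.prems by (intro Cons.IH[of _ _ "a - 1" b] W_ins) auto
  moreover have "weyl B P e 0 x (ins v y) vs = 0"
   using Cons.prems by (intro Cons.IH[of _ _ a "b - 1"] W_ins) auto
  ultimately show ?case by simp
 qed
next
 case (Suc n)
 have "weyl B P e n (ins (e k) x) (ins (e l) y) vs = 0" for k l
  using Suc.prems by (intro Suc.IH[of _ _ "a - 1" "b - 1"] W_ins) auto
 thus ?case by (simp add: weyl_Suc_apply del: weyl.simps)
qed

text \<open>Exchanging the factors transposes \<open>P\<close> in each of the \<open>n\<close>
  contractions, and each transposition costs a sign. Only odd orders can therefore survive in a
  commutator with a centrally valued factor.\<close>

lemma weyl_central:
 assumes "x : W" "y : W" "!!vs b. b : V ==> B (x vs) b = B b (x vs)" "!!k l. P k l = - P l k"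
 shows "weyl B P e n x y = (- 1) ^ n *C weyl B P e n y x"
 using assms(1-3)
proof (induction n arbitrary: x y)
 case 0
 have "shuf B x y vs = shuf B y x vs" for vs
  using 0
 proof (induction vs arbitrary: x y)
  case (Cons v vs)
  have "shuf B (ins v x) y vs = shuf B y (ins v x) vs" "shuf B x (ins v y) vs = shuf B (ins v y) x vs"
   using Cons.prems by (intro Cons.IH W_ins; simp)+
  thus ?case by (simp add: add.commute)
 qed (simp add: W_V)
 thus ?case by (simp add: fun_eq_iff)
next
 case (Suc n)
 have "weyl B P e n (ins (e k) x) (ins (e l) y) = (- 1) ^ n *C weyl B P e n (ins (e l) y) (ins (e k) x)" for k l
  using Suc.prems by (intro Suc.IH W_ins) auto
 moreover have "(SU k. SU l. P k l *C (- 1) ^ n *C weyl B P e n (ins (e l) y) (ins (e k) x)) =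
   (SU k. SU l. (- 1) ^ Suc n *C P k l *C weyl B P e n (ins (e k) y) (ins (e l) x))"
  by (subst sum.swap) (subst assms(4), simp add: scaleC_scaleC mult.commute)
 ultimately show ?case by (simp add: scaleC_sum_right scaleC_scaleC ac_simps del: of_nat_Suc)
qed

text \<open>For two presentations \<open>(P, e)\<close> and \<open>(P', e')\<close> of the same
  bivector. The hypothesis is quantified over all bilinear \<open>F\<close>, because in the
  induction \<open>F\<close> is the Weyl term of lower order.\<close>

lemma weyl_contraction_cong:
 assumes T: "!!x. x : X ==> x : W"
  "!!x k. x : X ==> ins (e k) x : X" "!!x k. x : X ==> ins (e' k) x : X"
  and eq: "!!F :: ('d list => 'v) => ('d list => 'v) => 'd list => 'v. !!x y. x : X ==> y : X ==>
   (!!x x' y. x : W ==> x' : W ==> y : W ==> F (x + x') y = F x y + F x' y) ==>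
   (!!x y y'. x : W ==> y : W ==> y' : W ==> F x (y + y') = F x y + F x y') ==>
   (!!a x y. x : W ==> y : W ==> F (a *C x) y = a *C F x y) ==>
   (!!a x y. x : W ==> y : W ==> F x (a *C y) = a *C F x y) ==>
   (SU k. SU l. P k l *C F (ins (e k) x) (ins (e l) y)) =
   (SU k. SU l. P' k l *C F (ins (e' k) x) (ins (e' l) y))"
 shows "x : X ==> y : X ==> weyl B P e n x y = weyl B P' e' n x y"
proof (induction n arbitrary: x y)
 case 0 thus ?case by simp
next
 case (Suc n)
 have "weyl B P e (Suc n) x y = (1 / of_nat (Suc n)) *C
   (SU k. SU l. P k l *C weyl B P' e' n (ins (e k) x) (ins (e l) y))"
  unfolding weyl.simps by (simp only: Suc.IH T Suc.prems)
 also have "(SU k. SU l. P k l *C weyl B P' e' n (ins (e k) x) (ins (e l) y)) =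
   (SU k. SU l. P' k l *C weyl B P' e' n (ins (e' k) x) (ins (e' l) y))"
  using Suc.prems by (intro eq) (simp_all add: weyl_add_left weyl_add_right weyl_scale_left weyl_scale_right del: plus_fun_apply scaleC_fun_apply)
 finally show ?case by simp
qed

end

section \<open>Formal power series\<close>

definition triples :: "nat => (nat \<times> nat \<times> nat) set"
 where "triples m = {(i, j, n). i + j + n = m}"

lemma finite_triples [simp]: "finite (triples m)"
 by (rule finite_subset[of _ "{..m} \<times> {..m} \<times> {..m}"]) (auto simp: triples_def)

text \<open>The coefficient of \<open>\<lambda>^m\<close> in the product of two power series; the
  \<open>n\<close>-th contraction carries \<open>\<lambda>^n\<close>.\<close>

definition wstar :: "('u => 'v => 'w::complex_space) => ('k::finite => 'k => complex) => ('k => 'd) =>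
  (nat => 'd list => 'u) => (nat => 'd list => 'v) => nat => 'd list => 'w"
 where "wstar B P e X Y m = (\<Sum>(i, j, n)\<in>triples m. weyl B P e n (X i) (Y j))"

lemma wstar_apply: "wstar B P e X Y m vs = (\<Sum>(i, j, n)\<in>triples m. weyl B P e n (X i) (Y j) vs)"
 by (simp add: wstar_def sum_apply split_def)

lemma wstar_map: "wstar B P (%k. f (e k)) X Y m (map f vs) =
  wstar B P e (%i l. X i (map f l)) (%i l. Y i (map f l)) m vs"
 by (simp add: wstar_apply weyl_map)

text \<open>Both bracketings become a sum over the exponents of the three factors and over all
  distributions of the remaining order on the inner and the outer contraction. This is the inner sum
  of \<open>weyl_assoc\<close>.\<close>

lemma triples_assoc:
 fixes f :: "nat => nat => nat => nat => nat => 'a::comm_monoid_add"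
 shows "(\<Sum>(s, k, n)\<in>triples m. \<Sum>(i, j, q)\<in>triples s. f i j q k n) =
   (\<Sum>(i, j, k)\<in>{(i, j, k). i + j + k <= m}. \<Sum>q\<le>m - i - j - k. f i j q k (m - i - j - k - q))"
  and "(\<Sum>(i, s, n)\<in>triples m. \<Sum>(j, k, q)\<in>triples s. f i j q k n) =
   (\<Sum>(i, j, k)\<in>{(i, j, k). i + j + k <= m}. \<Sum>q\<le>m - i - j - k. f i j q k (m - i - j - k - q))"
proof -
 let ?T = "{(i, j, k). i + j + k <= m}"
 have fin: "finite ?T" by (rule finite_subset[of _ "{..m} \<times> {..m} \<times> {..m}"]) auto
 have R: "(\<Sum>(i, j, k)\<in>?T. \<Sum>q\<le>m - i - j - k. f i j q k (m - i - j - k - q)) =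
   (\<Sum>(t, q)\<in>Sigma ?T (%(i, j, k). {..m - i - j - k}).
    f (fst t) (fst (snd t)) q (snd (snd t)) (m - fst t - fst (snd t) - snd (snd t) - q))"
  by (subst sum.Sigma[symmetric]) (auto simp: fin fin[unfolded split_def] split_def)
 have "(\<Sum>(s, k, n)\<in>triples m. \<Sum>(i, j, q)\<in>triples s. f i j q k n) =
   (\<Sum>(t, t')\<in>Sigma (triples m) (%t. triples (fst t)). f (fst t') (fst (snd t')) (snd (snd t')) (fst (snd t)) (snd (snd t)))"
  by (subst sum.Sigma[symmetric]) (auto simp: split_def)
 also have "... = (\<Sum>(t, q)\<in>Sigma ?T (%(i, j, k). {..m - i - j - k}).
    f (fst t) (fst (snd t)) q (snd (snd t)) (m - fst t - fst (snd t) - snd (snd t) - q))"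
  by (rule sum.reindex_bij_witness[where
   i = "%((i, j, k), q). ((i + j + q, k, m - i - j - k - q), (i, j, q))" and
   j = "%((s, k, n), (i, j, q)). ((i, j, k), q)"]) (auto simp: triples_def)
 finally show "(\<Sum>(s, k, n)\<in>triples m. \<Sum>(i, j, q)\<in>triples s. f i j q k n) =
   (\<Sum>(i, j, k)\<in>?T. \<Sum>q\<le>m - i - j - k. f i j q k (m - i - j - k - q))" by (simp only: R)
 have "(\<Sum>(i, s, n)\<in>triples m. \<Sum>(j, k, q)\<in>triples s. f i j q k n) =
   (\<Sum>(t, t')\<in>Sigma (triples m) (%t. triples (fst (snd t))). f (fst t) (fst t') (snd (snd t')) (fst (snd t')) (snd (snd t)))"
  by (subst sum.Sigma[symmetric]) (auto simp: split_def)
 also have "... = (\<Sum>(t, q)\<in>Sigma ?T (%(i, j, k). {..m - i - j - k}).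
    f (fst t) (fst (snd t)) q (snd (snd t)) (m - fst t - fst (snd t) - snd (snd t) - q))"
  by (rule sum.reindex_bij_witness[where
   i = "%((i, j, k), q). ((i, j + k + q, m - i - j - k - q), (j, k, q))" and
   j = "%((i, s, n), (j, k, q)). ((i, j, k), q)"]) (auto simp: triples_def)
 finally show "(\<Sum>(i, s, n)\<in>triples m. \<Sum>(j, k, q)\<in>triples s. f i j q k n) =
   (\<Sum>(i, j, k)\<in>?T. \<Sum>q\<le>m - i - j - k. f i j q k (m - i - j - k - q))" by (simp only: R)
qed

context fibre_algebra
begin

definition WS :: "(nat => 'd list => 'v) set"
 where "WS = {X. ALL m. X m : W}"

lemma WS_W: "X : WS ==> X m : W"
 by (simp add: WS_def)

lemma WS_add: "X : WS ==> Y : WS ==> X + Y : WS"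
 and WS_diff: "X : WS ==> Y : WS ==> X - Y : WS"
 and WS_scale: "X : WS ==> a *C X : WS"
 and WS_ins: "X : WS ==> (%m. ins v (X m)) : WS"
 and WS_shift: "X : WS ==> (%m. X (Suc m)) : WS"
 by (simp_all add: WS_def W_add W_diff W_minus W_scale W_ins)

lemma WS_wstar: "X : WS ==> Y : WS ==> wstar B P e X Y : WS"
 by (auto simp: WS_def wstar_def intro!: W_sum W_weyl)

lemma wstar_add_left: "X : WS ==> X' : WS ==> Y : WS ==> wstar B P e (X + X') Y = wstar B P e X Y + wstar B P e X' Y"
 and wstar_add_right: "X : WS ==> Y : WS ==> Y' : WS ==> wstar B P e X (Y + Y') = wstar B P e X Y + wstar B P e X Y'"
 by (rule ext, simp add: wstar_def WS_def weyl_add_left weyl_add_right sum.distrib split_def)+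

lemma wstar_scale_left: "X : WS ==> Y : WS ==> wstar B P e (a *C X) Y = a *C wstar B P e X Y"
 and wstar_scale_right: "X : WS ==> Y : WS ==> wstar B P e X (a *C Y) = a *C wstar B P e X Y"
 by (rule ext, simp add: wstar_def WS_def weyl_scale_left weyl_scale_right scaleC_sum_right split_def)+

lemma wstar_diff_left: "X : WS ==> X' : WS ==> Y : WS ==> wstar B P e (X - X') Y = wstar B P e X Y - wstar B P e X' Y"
 and wstar_diff_right: "X : WS ==> Y : WS ==> Y' : WS ==> wstar B P e X (Y - Y') = wstar B P e X Y - wstar B P e X Y'"
 by (rule ext, simp add: wstar_def WS_def weyl_diff_left weyl_diff_right sum_subtractf split_def)+

lemma wstar_assoc:
 assumes "X : WS" "Y : WS" "Z : WS"
 shows "wstar B P e (wstar B P e X Y) Z = wstar B P e X (wstar B P e Y Z)"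
proof
 fix m
 note W = assms[THEN WS_W]
 have "wstar B P e (wstar B P e X Y) Z m =
   (\<Sum>(s, k, n)\<in>triples m. \<Sum>(i, j, q)\<in>triples s. weyl B P e n (weyl B P e q (X i) (Y j)) (Z k))"
  unfolding wstar_def split_def by (intro sum.cong refl weyl_sum_left W W_weyl)
 also have "... = (\<Sum>(i, s, n)\<in>triples m. \<Sum>(j, k, q)\<in>triples s. weyl B P e n (X i) (weyl B P e q (Y j) (Z k)))"
  unfolding triples_assoc by (intro sum.cong refl, clarify, rule weyl_assoc[OF W])
 also have "... = wstar B P e X (wstar B P e Y Z) m"
  unfolding wstar_def split_def by (intro sum.cong refl weyl_sum_right[symmetric] W W_weyl)
 finally show "wstar B P e (wstar B P e X Y) Z m = wstar B P e X (wstar B P e Y Z) m" .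
qed

lemma ins_wstar:
 assumes "X : WS" "Y : WS"
 shows "ins v (wstar B P e X Y m) = wstar B P e (%m. ins v (X m)) Y m + wstar B P e X (%m. ins v (Y m)) m"
 unfolding wstar_def using assms by (simp only: ins_sum split_def ins_weyl WS_W sum.distrib)

lemma triples_shift:
 assumes "!!i n. f i 0 n = 0"
 shows "(\<Sum>(i, j, n)\<in>triples (Suc m). f i j n) = (\<Sum>(i, j, n)\<in>triples m. f i (Suc j) n :: 'a::comm_monoid_add)"
proof -
 have "(\<Sum>(i, j, n)\<in>triples (Suc m). f i j n) = (\<Sum>(i, j, n)\<in>triples (Suc m) Int {t. fst (snd t) ~= 0}. f i j n)"
  by (rule sum.mono_neutral_right) (auto, metis assms gr0I)
 also have "... = (\<Sum>(i, j, n)\<in>triples m. f i (Suc j) n)"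
  by (rule sum.reindex_bij_witness[where i = "%(i, j, n). (i, Suc j, n)" and j = "%(i, j, n). (i, j - 1, n)"])
   (auto simp: triples_def)
 finally show ?thesis .
qed

lemma triples_swap: "(\<Sum>(i, j, n)\<in>triples m. f i j n) = (\<Sum>(i, j, n)\<in>triples m. f j i n)"
 by (rule sum.reindex_bij_witness[where i = "%(i, j, n). (j, i, n)" and j = "%(i, j, n). (j, i, n)"])
  (auto simp: triples_def)

text \<open>Shifting the coefficients is division by \<open>\<lambda>\<close>; it may be moved out
  of a product when no term of order zero is lost.\<close>

lemma wstar_shift_right:
 assumes "X : WS" "Y : WS" "Y 0 = 0"
 shows "wstar B P e X (%j. Y (Suc j)) m = wstar B P e X Y (Suc m)"
 unfolding wstar_def using assms by (subst triples_shift) (simp_all add: WS_W)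

lemma wstar_shift_left:
 assumes "X : WS" "Y : WS" "X 0 = 0"
 shows "wstar B P e (%j. X (Suc j)) Y m = wstar B P e X Y (Suc m)"
 unfolding wstar_def using assms
 by (subst (1 2) triples_swap, subst triples_shift) (simp_all add: WS_W)

text \<open>There is no sign, since it is applied to functions of the symmetric arguments, after the
  form arguments have been fixed.\<close>

definition comm :: "('k::finite => 'k => complex) => ('k => 'd) => (nat => 'd list => 'v) => (nat => 'd list => 'v) => nat => 'd list => 'v"
 where "comm P e X Y = wstar B P e X Y - wstar B P e Y X"

lemma WS_comm: "X : WS ==> Y : WS ==> comm P e X Y : WS"
 by (simp add: comm_def WS_wstar WS_diff)

lemma comm_add_left: "X : WS ==> X' : WS ==> Y : WS ==> comm P e (X + X') Y = comm P e X Y + comm P e X' Y"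
 and comm_add_right: "X : WS ==> Y : WS ==> Y' : WS ==> comm P e X (Y + Y') = comm P e X Y + comm P e X Y'"
 and comm_diff_left: "X : WS ==> X' : WS ==> Y : WS ==> comm P e (X - X') Y = comm P e X Y - comm P e X' Y"
 and comm_diff_right: "X : WS ==> Y : WS ==> Y' : WS ==> comm P e X (Y - Y') = comm P e X Y - comm P e X Y'"
 and comm_scale_left: "X : WS ==> Y : WS ==> comm P e (a *C X) Y = a *C comm P e X Y"
 and comm_scale_right: "X : WS ==> Y : WS ==> comm P e X (a *C Y) = a *C comm P e X Y"
 by (simp_all add: comm_def wstar_add_left wstar_add_right wstar_diff_left wstar_diff_right
   wstar_scale_left wstar_scale_right scaleC_diff_right)

lemma comm_shift_right:
 "X : WS ==> Y : WS ==> Y 0 = 0 ==> comm P e X (%j. Y (Suc j)) m = comm P e X Y (Suc m)"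
 by (simp add: comm_def wstar_shift_left wstar_shift_right)

lemma comm_shift_left:
 "X : WS ==> Y : WS ==> X 0 = 0 ==> comm P e (%j. X (Suc j)) Y m = comm P e X Y (Suc m)"
 by (simp add: comm_def wstar_shift_left wstar_shift_right)

lemma comm_jacobi:
 assumes "X : WS" "Y : WS" "Z : WS"
 shows "comm P e X (comm P e Y Z) - comm P e Y (comm P e X Z) = comm P e (comm P e X Y) Z"
 using assms by (simp add: comm_def wstar_diff_left wstar_diff_right WS_wstar wstar_assoc)

lemma comm_wstar:
 assumes "X : WS" "Y : WS" "Z : WS"
 shows "comm P e X (wstar B P e Y Z) = wstar B P e (comm P e X Y) Z + wstar B P e Y (comm P e X Z)"
 using assms by (simp add: comm_def wstar_diff_left wstar_diff_right WS_wstar wstar_assoc)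

lemma ins_comm:
 assumes "X : WS" "Y : WS"
 shows "ins v (comm P e X Y m) = comm P e (%m. ins v (X m)) Y m + comm P e X (%m. ins v (Y m)) m"
 using assms by (simp add: comm_def ins_wstar)

lemma triples_0: "triples 0 = {(0, 0, 0)}"
 by (auto simp: triples_def)

text \<open>At order zero only the undeformed product is left. Thus central values of
  \<open>X 0\<close> make the commutator divisible by \<open>\<lambda>\<close>.\<close>

lemma comm_0:
 assumes "X : WS" "Y : WS" "!!vs b. b : V ==> B (X 0 vs) b = B b (X 0 vs)"
 shows "comm P e X Y 0 = 0"
 using weyl_central[OF WS_W[OF assms(1)] WS_W[OF assms(2)] assms(3), where P="%_ _. 0" and n=0]
 by (simp add: comm_def wstar_def triples_0)

end

section \<open>Low antisymmetric degrees\<close>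

text \<open>Only three form degrees are ever expanded: sections have degree 0, the Fedosov element
  degree 1 and its defining equation degree 2.\<close>

lemma shuffle_sign_low [simp]:
 "shuffle_sign k {} = 1" "shuffle_sign 1 {0} = 1" "shuffle_sign (Suc 0) {0} = 1" "shuffle_sign (Suc (Suc 0)) {0} = 1"
 "shuffle_sign (Suc (Suc 0)) {Suc 0} = - 1" "shuffle_sign (Suc (Suc 0)) {0, Suc 0} = 1"
proof -
 have "{(i, j). i : {Suc 0} & j : {..<Suc (Suc 0)} - {Suc 0} & j < i} = {(Suc 0, 0)}" by auto
 thus "shuffle_sign (Suc (Suc 0)) {Suc 0} = - 1" by (simp add: shuffle_sign_def)
 have *: "{(i, j). i : {0, Suc 0} & j : {..<Suc (Suc 0)} - {0, Suc 0} & j < i} = {}" by auto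
 thus "shuffle_sign (Suc (Suc 0)) {0, Suc 0} = 1" unfolding shuffle_sign_def * by simp
 have "{(i, j). i : {0} & j : {..<k} - {0} & j < i} = {}" for k :: nat by auto
 thus "shuffle_sign 1 {0} = 1" "shuffle_sign (Suc 0) {0} = 1" "shuffle_sign (Suc (Suc 0)) {0} = 1"
  by (simp_all only: shuffle_sign_def card.empty power_0)
qed (simp add: shuffle_sign_def)

lemma sum_Pow_low:
 "(SUM J:Pow {..<0::nat}. f J) = f {}"
 "(SUM J:Pow {..<Suc 0}. f J) = f {} + f {0}"
 "(SUM J:Pow {..<Suc (Suc 0)}. f J) = f {} + f {0} + f {Suc 0} + (f {0, Suc 0} :: 'a::comm_monoid_add)"
proof -
 have 1: "Pow {..<Suc 0} = {{}, {0}}" by (auto simp: lessThan_Suc Pow_insert)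
 have 2: "Pow {..<Suc (Suc 0)} = {{}, {0}, {Suc 0}, {0, Suc 0}}" by (auto simp: lessThan_Suc Pow_insert)
 show "(SUM J:Pow {..<Suc 0}. f J) = f {} + f {0}" by (simp add: 1)
 have "{0, Suc 0} ~= {}" "{0, Suc 0} ~= {0}" "{0, Suc 0} ~= {Suc 0}" by auto
 thus "(SUM J:Pow {..<Suc (Suc 0)}. f J) = f {} + f {0} + f {Suc 0} + f {0, Suc 0}" by (simp add: 2 add.assoc)
qed simp

lemma shuf_scaleC_zero: "shuf scaleC (%_. 0) y vs = 0"
 by (induction vs arbitrary: y) (simp_all add: ins_def)

lemma shuf_scaleC_const: "shuf scaleC (%vs. if vs = [] then a else 0) y vs = a *C y vs"
 by (induction vs arbitrary: y) (simp_all add: ins_def shuf_scaleC_zero)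

lemma dx_alt_slice: "(%vs. dx_alt \<A> c i p vs ws) = (%vs. if vs = [] then
  (if length ws = 1 & set ws <= tangent_space \<A> p then of_real (hd ws c $ i) else 0) else 0)"
 by (rule ext) (simp add: dx_alt_def)

lemma tmul_dx_alt:
 "tmul scaleC (dx_alt \<A> c i p) t vs [] = 0"
 "tmul scaleC (dx_alt \<A> c i p) t vs [w] = (if w : tangent_space \<A> p then of_real (w c $ i) *C t vs [] else 0)"
 "tmul scaleC (dx_alt \<A> c i p) t vs [w, w'] =
  (if w : tangent_space \<A> p then of_real (w c $ i) *C t vs [w'] else 0) -
  (if w' : tangent_space \<A> p then of_real (w' c $ i) *C t vs [w] else 0)"
 unfolding tmul_slices dx_alt_slice shuf_scaleC_const
 by (simp_all add: sum_Pow_low nths_Cons)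

lemma tmul_dx_alt_degree:
 assumes "!!vs ws. length ws ~= k ==> t vs ws = 0" "length ws ~= Suc k"
 shows "tmul scaleC (dx_alt \<A> c i p) t vs ws = 0"
 unfolding tmul_slices dx_alt_slice shuf_scaleC_const
proof (intro sum.neutral ballI)
 fix J assume J: "J : Pow {..<length ws}"
 have "length (nths ws J) + length (nths ws (- J)) = length ws"
 proof -
  have "{i. i < length ws & i : J} \<union> {i. i < length ws & i : - J} = {..<length ws}" by auto
  thus ?thesis
   unfolding length_nths by (subst card_Un_disjoint[symmetric]) auto
 qed
 thus "shuffle_sign (length ws) J *C
   (if length (nths ws J) = 1 & set (nths ws J) <= tangent_space \<A> p then of_real (hd (nths ws J) c $ i) else 0) *C
   t vs (nths ws (- J)) = 0"
  using assms by (cases "length (nths ws J) = 1") (auto simp: assms(1))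
qed

section \<open>Bundles of algebras with connection\<close>

text \<open>A bundle of unital algebras whose connection \<open>N\<close> is a derivation;
  \<open>S U\<close> singles out the smooth sections over \<open>U\<close>. Keeping \<open>S\<close>
  and \<open>N\<close> abstract spares the local computations from handling triples.\<close>

locale algebra_bundle = manifold \<A> for \<A> :: "('m::topological_space, 'n::finite) chart set" +
 fixes V :: "'m => 'v::complex_space set"
  and S :: "'m set => ('m => 'v) => bool"
  and N :: "('m => ('m, 'n) tvec) => ('m => 'v) => 'm => 'v"
  and B :: "'v => 'v => 'v"
  and u :: "'m => 'v"
  and \<omega> :: "'m => ('m, 'n, complex) tensor"
  and nab :: "('m => ('m, 'n) tvec) => ('m => ('m, 'n) tvec) => 'm => ('m, 'n) tvec"
 assumes fibre_algebra: "!!p. fibre_algebra (V p) B (u p)"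
  and S_V: "!!U s p. S U s ==> p : U ==> s p : V p"
  and S_cong: "!!U s t. open U ==> S U s ==> (!!p. p : U ==> s p = t p) ==> S U t"
  and S_subset: "!!U U' s. S U s ==> open U' ==> U' <= U ==> S U' s"
  and S_add: "!!U s t. open U ==> S U s ==> S U t ==> S U (%p. s p + t p)"
  and S_scale: "!!U f s. open U ==> smooth_fun \<A> U f ==> S U s ==> S U (%p. f p *C s p)"
  and S_B: "!!U s t. open U ==> S U s ==> S U t ==> S U (%p. B (s p) (t p))"
  and S_u: "!!U. open U ==> S U u"
  and N_S: "!!U X s. open U ==> vector_field \<A> U X ==> S U s ==> S U (N X s)"
  and N_cong: "!!U X s Y t p. open U ==> vector_field \<A> U X ==> S U s ==>
   (!!p. p : U ==> Y p = X p) ==> (!!p. p : U ==> t p = s p) ==> p : U ==> N Y t p = N X s p"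
  and N_addX: "!!U X Y s p. open U ==> vector_field \<A> U X ==> vector_field \<A> U Y ==> S U s ==> p : U ==>
   N (X + Y) s p = N X s p + N Y s p"
  and N_scaleX: "!!U X f s p. open U ==> vector_field \<A> U X ==> S U s ==> smooth_fun \<A> U f ==> p : U ==>
   N (%q. tscale (f q) (X q)) s p = of_real (f p) *C N X s p"
  and N_add: "!!U X s t p. open U ==> vector_field \<A> U X ==> S U s ==> S U t ==> p : U ==>
   N X (%q. s q + t q) p = N X s p + N X t p"
  and N_scale: "!!U X f s p. open U ==> vector_field \<A> U X ==> S U s ==> smooth_fun \<A> U f ==> p : U ==>
   N X (%q. f q *C s q) p = dirderiv \<A> (X p) f p *C s p + f p *C N X s p"
  and N_B: "!!U X s t p. open U ==> vector_field \<A> U X ==> S U s ==> S U t ==> p : U ==>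
   N X (%q. B (s q) (t q)) p = B (N X s p) (t p) + B (s p) (N X t p)"
  and affine: "affine_connection \<A> nab"
begin

sublocale F: fibre_algebra "V p" B "u p" for p
 by (rule fibre_algebra)

lemma nab:
 assumes "open U" "vfd U X" "vfd U Z"
 shows nab_vector_field: "vfd U (nab X Z)"
  and nab_cong: "!!Y W p. (!!p. p : U ==> Y p = X p) ==> (!!p. p : U ==> W p = Z p) ==> p : U ==> nab Y W p = nab X Z p"
  and nab_addX: "!!Y p. vfd U Y ==> p : U ==> nab (X + Y) Z p = nab X Z p + nab Y Z p"
  and nab_scaleX: "!!f p. sfu U f ==> p : U ==> nab (%q. tscale (f q) (X q)) Z p = tscale (f p) (nab X Z p)"
  and nab_add: "!!W p. vfd U W ==> p : U ==> nab X (Z + W) p = nab X Z p + nab X W p"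
  and nab_scale: "!!f p. sfu U f ==> p : U ==>
   nab X (%q. tscale (f q) (Z q)) p = tscale (dd (X p) f p) (Z p) + tscale (f p) (nab X Z p)"
 using affine[unfolded affine_connection_def, rule_format, OF assms] by blast+

lemma S_zero: "open U ==> S U (%p. 0)"
 using S_scale[OF _ smooth_fun_const S_u, of U 0] by simp

lemma S_sum: "open U ==> (!!i. i : I ==> S U (s i)) ==> S U (%p. SUM i:I. s i p)"
 by (induction I rule: ifi) (auto intro: S_zero S_add)

lemma S_scale_const: "open U ==> S U s ==> S U (%p. a *C s p)"
 by (rule S_scale[OF _ smooth_fun_const])

lemma S_diff: "open U ==> S U s ==> S U t ==> S U (%p. s p - t p)"
 using S_add[OF _ _ S_scale_const[of U t "-1"], of s] by simp

lemma N_zero: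
 assumes "open U" "vfd U X" "p : U" shows "N X (%q. 0) p = 0"
 using N_scale[OF assms(1,2) S_u[OF assms(1)] smooth_fun_const[of U 0] assms(3)] by simp

lemma N_sum: "open U ==> vfd U X ==> p : U ==> (!!i. i : I ==> S U (s i)) ==>
  N X (%q. SUM i:I. s i q) p = (SUM i:I. N X (s i) p)"
 by (induction I rule: ifi) (simp_all add: N_zero N_add S_sum)

lemma N_scale_const: "open U ==> vfd U X ==> S U s ==> p : U ==>
  N X (%q. a *C s q) p = a *C N X s p"
 using N_scale[of U X s "%q. a" p] smooth_fun_const[of U a] by simp

lemma N_u: "open U ==> vfd U X ==> p : U ==> N X u p = 0"
proof -
 assume a: "open U" "vfd U X" "p : U"
 have "N X u p = N X (%q. B (u q) (u q)) p"
  using N_cong[OF a(1,2) S_u[OF a(1)] _ _ a(3), of X "%q. B (u q) (u q)"] F.B_u_left F.u_closed by simp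
 also have "... = N X u p + N X u p"
  using a S_V[OF N_S[OF a(1,2) S_u[OF a(1)]] a(3)] by (subst N_B) (auto simp: S_u F.B_u_left F.B_u_right)
 finally show ?thesis by simp
qed

lemma N_zeroX: "open U ==> S U s ==> p : U ==> N 0 s p = 0"
 using N_addX[of U 0 0 s p] vector_field_zero by simp

lemma N_sumX: "open U ==> S U s ==> p : U ==> (!!i. i : I ==> vfd U (X i)) ==>
  N (SUM i:I. X i) s p = (SUM i:I. N (X i) s p)"
 by (induction I rule: ifi) (simp_all add: N_zeroX N_addX vector_field_sum)

lemma nab_zeroX: "open U ==> vfd U Z ==> p : U ==> nab 0 Z p = 0"
 using nab_addX[of U 0 Z 0 p] vector_field_zero by simp

lemma nab_sumX: "open U ==> vfd U Z ==> p : U ==> (!!i. i : I ==> vfd U (X i)) ==>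
  nab (SUM i:I. X i) Z p = (SUM i:I. nab (X i) Z p)"
 by (induction I rule: ifi) (simp_all add: nab_zeroX nab_addX vector_field_sum)

lemma nab_zero: "open U ==> vfd U X ==> p : U ==> nab X 0 p = 0"
 using nab_add[of U X 0 0 p] vector_field_zero by simp

lemma nab_sum: "open U ==> vfd U X ==> p : U ==> (!!i. i : I ==> vfd U (Z i)) ==>
  nab X (SUM i:I. Z i) p = (SUM i:I. nab X (Z i) p)"
 by (induction I rule: ifi) (simp_all add: nab_zero nab_add vector_field_sum)

section \<open>Expansion in coordinate fields and tensoriality of the covariant derivative\<close>

lemma vector_field_coord_on: "c : \<A> ==> U <= fst c ==> vfd U (cx c i)"
 by (rule vector_field_subset[OF vector_field_coord])

lemma vector_field_expand:
 assumes "vfd U X" "c : \<A>" "U <= fst c" "q : U"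
 shows "X q = (SU i. (%q. tscale (X q c $ i) (cx c i q))) q"
 using tangent_expand[OF vector_field_tangent[OF assms(1,4)] assms(2)] assms(3,4)
  sum_apply[of "%i q. tscale (X q c $ i) (cx c i q)" UNIV q] by auto

lemma N_expandX:
 assumes "open U" "vfd U X" "c : \<A>" "U <= fst c" "S U s" "p : U"
 shows "N X s p = (SU i. of_real (X p c $ i) *C N (cx c i) s p)"
proof -
 have vf: "vfd U (%q. tscale (X q c $ i) (cx c i q))" for i
  using assms by (intro vector_field_scale vector_field_coord_on vector_field_component)
 have "N X s p = N (SU i. (%q. tscale (X q c $ i) (cx c i q))) s p"
  by (rule N_cong[OF assms(1) vector_field_sum[OF assms(1) vf] assms(5) _ _ assms(6)])
   (auto intro: vector_field_expand[OF assms(2-4)])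
 also have "... = (SU i. of_real (X p c $ i) *C N (cx c i) s p)"
  using assms vf by (subst N_sumX[of U])
   (simp_all add: N_scaleX[OF assms(1) vector_field_coord_on assms(5) vector_field_component] assms)
 finally show ?thesis .
qed

lemma nab_expandX:
 assumes "open U" "vfd U X" "c : \<A>" "U <= fst c" "vfd U Z" "p : U"
 shows "nab X Z p = (SU i. tscale (X p c $ i) (nab (cx c i) Z p))"
proof -
 have vf: "vfd U (%q. tscale (X q c $ i) (cx c i q))" for i
  using assms by (intro vector_field_scale vector_field_coord_on vector_field_component)
 have "nab X Z p = nab (SU i. (%q. tscale (X q c $ i) (cx c i q))) Z p"
  by (rule nab_cong[OF assms(1) vector_field_sum[OF assms(1) vf] assms(5) _ _ assms(6)])
   (auto intro: vector_field_expand[OF assms(2-4)])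
 also have "... = (SU i. tscale (X p c $ i) (nab (cx c i) Z p))"
  using assms vf by (subst nab_sumX[of U])
   (simp_all add: nab_scaleX[OF assms(1) vector_field_coord_on assms(5) vector_field_component] assms)
 finally show ?thesis .
qed

text \<open>Symmetric and antisymmetric arguments are merged into one list, so that tensoriality of
  the covariant derivative has to be proved for one kind of argument only.\<close>

definition mfield :: "nat => ('m => ('m, 'n) tvec list => 'v) => bool"
 where "mfield L t \<longleftrightarrow>
  (ALL q us us'. length us + length us' + 1 = L -->
   (ALL x:tsp q. ALL y:tsp q. t q (us @ (x + y) # us') = t q (us @ x # us') + t q (us @ y # us')) &
   (ALL a. ALL x:tsp q. t q (us @ tscale a x # us') = of_real a *C t q (us @ x # us'))) &
  (ALL c:\<A>. ALL is. length is = L --> S (fst c) (%q. t q (map (%i. cx c i q) is)))"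

lemma mfield_add: "mfield L t ==> length us + length us' + 1 = L ==> x : tsp q ==> y : tsp q ==>
  t q (us @ (x + y) # us') = t q (us @ x # us') + t q (us @ y # us')"
 and mfield_scale: "mfield L t ==> length us + length us' + 1 = L ==> x : tsp q ==>
  t q (us @ tscale a x # us') = of_real a *C t q (us @ x # us')"
 and mfield_S: "mfield L t ==> c : \<A> ==> length is = L ==> S (fst c) (%q. t q (map (%i. cx c i q) is))"
 unfolding mfield_def by blast+

lemma mfield_sum:
 assumes "mfield L t" "length us + length us' + 1 = L" "!!i. x i : tsp q"
 shows "t q (us @ (SUM i:I. x i) # us') = (SUM i:I. t q (us @ x i # us'))"
proof -
 have "t q (us @ 0 # us') = 0"
  using mfield_scale[OF assms(1,2) tangent_zero, of q 0] by (simp add: tscale_def zero_fun_def)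
 thus ?thesis
  by (induction I rule: ifi) (simp_all add: mfield_add[OF assms(1,2)] assms(3) tangent_sum)
qed

lemma mfield_expand:
 assumes "mfield L t" "length us + length us' + 1 = L" "x : tsp q" "c : \<A>" "q : fst c"
 shows "t q (us @ x # us') = (SU i. of_real (x c $ i) *C t q (us @ cx c i q # us'))"
 by (subst tangent_expand[OF assms(3-5)], subst mfield_sum[OF assms(1,2)])
  (simp_all add: tangent_scale mfield_scale[OF assms(1,2)])

text \<open>The fields are expanded one after the other; the prefix \<open>is\<close> records the
  coordinate fields that have already replaced them.\<close>

lemma mfield_S_fields:
 assumes "mfield L t" "open U" "c : \<A>" "U <= fst c" "!!Z. Z : set Zs ==> vfd U Z"
  "length is + length Zs = L"
 shows "S U (%q. t q (map (%i. cx c i q) is @ map (%Z. Z q) Zs))"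
 using assms(5,6)
proof (induction Zs arbitrary: "is")
 case Nil
 thus ?case using S_subset[OF mfield_S[OF assms(1,3)] assms(2,4), of "is"] by simp
next
 case (Cons Z Zs)
 have Z: "vfd U Z" using Cons.prems by simp
 have "S U (%q. SU i. of_real (Z q c $ i) *C t q (map (%i. cx c i q) (is @ [i]) @ map (%Z. Z q) Zs))"
  using Cons.prems vector_field_component[OF assms(2) Z assms(3,4)]
  by (intro S_sum S_scale assms(2) smooth_fun_of_real Cons.IH) auto
 thus ?case
 proof (rule S_cong[OF assms(2)])
  fix q assume q: "q : U"
  show "(SU i. of_real (Z q c $ i) *C t q (map (%i. cx c i q) (is @ [i]) @ map (%Z. Z q) Zs)) =
    t q (map (%i. cx c i q) is @ map (%Z. Z q) (Z # Zs))"
   using mfield_expand[OF assms(1) _ vector_field_tangent[OF Z q] assms(3), of "map (%i. cx c i q) is" "map (%Z. Z q) Zs"]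
    Cons.prems q assms(4) by auto
 qed
qed

text \<open>The arguments are vector fields rather than vectors: each summand depends on their
  derivatives, and only the whole is tensorial (\<open>covf_cong\<close>).\<close>

definition covf :: "('m => ('m, 'n) tvec) => ('m => ('m, 'n) tvec list => 'v) => ('m => ('m, 'n) tvec) list => 'm => 'v"
 where "covf X t Zs p = N X (%q. t q (map (%Z. Z q) Zs)) p
  - (\<Sum>k<length Zs. t p ((map (%Z. Z p) Zs)[k := nab X (Zs ! k) p]))"

context
 fixes L t U c X p
 assumes t: "mfield L t" and U: "open U" "c : \<A>" "U <= fst c" and X: "vfd U X" and p: "p : U"
begin

text \<open>The derivatives of the component functions of \<open>Z\<close> appear once in the
  Leibniz rule for \<open>N\<close> and once in that for \<open>nab\<close>, and cancel in the
  difference.\<close>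

lemma covf_slot_expand:
 assumes "!!Z. Z : set Ys \<union> set Ys' ==> vfd U Z" "vfd U Z" "length Ys + length Ys' + 1 = L"
 defines "h == %Z. N X (%q. t q (map (%Z. Z q) (Ys @ Z # Ys'))) p
   - t p (map (%Z. Z p) Ys @ nab X Z p # map (%Z. Z p) Ys')"
 shows "h Z = (SU i. of_real (Z p c $ i) *C h (cx c i))"
proof -
 let ?Y = "%q. map (%Z. Z q) Ys" and ?Y' = "%q. map (%Z. Z q) Ys'"
 let ?t = "%i q. t q (?Y q @ cx c i q # ?Y' q)"
 let ?g = "%i q. Z q c $ i"
 have len: "length (?Y q) + length (?Y' q) + 1 = L" for q using assms(3) by simp
 have g: "sfu U (?g i)" for i by (rule vector_field_component[OF U(1) assms(2) U(2,3)])
 have vc: "vfd U (cx c i)" for i by (rule vector_field_coord_on[OF U(2,3)])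
 have St: "S U (?t i)" for i
  using mfield_S_fields[OF t U, of "Ys @ cx c i # Ys'" "[]"] assms(1,3) vc by auto
 have vt: "vfd U (%q. tscale (?g i q) (cx c i q))" for i
  by (rule vector_field_scale[OF U(1) vc g])
 have tan: "nab X (cx c i) p : tsp p" for i
  by (rule vector_field_tangent[OF nab_vector_field[OF U(1) X vc] p])
 have "N X (%q. t q (map (%Z. Z q) (Ys @ Z # Ys'))) p = N X (%q. SU i. of_real (?g i q) *C ?t i q) p"
  by (rule N_cong[OF U(1) X _ _ _ p])
   (use vector_field_tangent[OF assms(2)] mfield_expand[OF t len _ U(2)] U(3) in
    \<open>auto intro!: S_sum S_scale U(1) St smooth_fun_of_real g\<close>)
 also have "... = (SU i. of_real (dd (X p) (?g i) p) *C ?t i p + of_real (?g i p) *C N X (?t i) p)"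
  using g by (simp add: N_sum[OF U(1) X p] S_scale[OF U(1)] smooth_fun_of_real[OF U(1)] St
   N_scale[OF U(1) X St _ p] dirderiv_linear[OF g p bounded_linear_of_real])
 finally have 1: "N X (%q. t q (map (%Z. Z q) (Ys @ Z # Ys'))) p = ..." .
 have "nab X Z p = nab X (SU i. (%q. tscale (?g i q) (cx c i q))) p"
  by (rule nab_cong[OF U(1) X vector_field_sum[OF U(1) vt] _ _ p])
   (auto intro: vector_field_expand[OF assms(2) U(2,3)])
 also have "... = (SU i. tscale (dd (X p) (?g i) p) (cx c i p) + tscale (?g i p) (nab X (cx c i) p))"
  by (simp add: nab_sum[OF U(1) X p vt] nab_scale[OF U(1) X vc g p])
 finally have "t p (?Y p @ nab X Z p # ?Y' p) =
   (SU i. of_real (dd (X p) (?g i) p) *C ?t i p + of_real (?g i p) *C t p (?Y p @ nab X (cx c i) p # ?Y' p))"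
  by (simp add: mfield_sum[OF t len] tangent_add tangent_scale tan mfield_add[OF t len] mfield_scale[OF t len])
 with 1 show ?thesis unfolding h_def by (simp add: scaleC_diff_right sum_subtractf[symmetric])
qed

lemma covf_slot:
 assumes "!!Z. Z : set Ys \<union> set Ys' ==> vfd U Z" "vfd U Z" "vfd U Z'"
  "length Ys + length Ys' + 1 = L" "Z p = Z' p"
 shows "covf X t (Ys @ Z # Ys') p = covf X t (Ys @ Z' # Ys') p"
proof -
 have split: "(\<Sum>k<length (Ys @ Z # Ys'). f k) = f (length Ys) + (SUM k:{..<length (Ys @ Z # Ys')} - {length Ys}. f k)"
  for f :: "nat => 'v" and Z
  by (rule sum.remove) auto
 have "(SUM k:{..<length (Ys @ Z # Ys')} - {length Ys}. t p ((map (%Z. Z p) (Ys @ Z # Ys'))[k := nab X ((Ys @ Z # Ys') ! k) p])) =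
   (SUM k:{..<length (Ys @ Z' # Ys')} - {length Ys}. t p ((map (%Z. Z p) (Ys @ Z' # Ys'))[k := nab X ((Ys @ Z' # Ys') ! k) p]))"
  using assms(5) by (intro sum.cong) (auto simp: nth_append nth_Cons' intro!: arg_cong[where f="t p"] arg_cong2[where f="%l x. l[_ := x]"])
 with covf_slot_expand[OF assms(1,2,4)] covf_slot_expand[OF assms(1,3,4)] assms(5)
 show ?thesis unfolding covf_def split by (simp add: list_update_append diff_diff_eq[symmetric])
qed

text \<open>Fields with equal values at \<open>p\<close> are exchanged slot by slot. This allows the
  constant fields of one chart, used in \<open>cov_tensor\<close>, to be replaced by the coordinate
  fields of another.\<close>

lemma covf_cong:
 assumes "list_all2 (%Z Z'. vfd U Z & vfd U Z' & Z p = Z' p) Zs Zs'"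
  "!!Z. Z : set Ys ==> vfd U Z" "length Ys + length Zs = L"
 shows "covf X t (Ys @ Zs) p = covf X t (Ys @ Zs') p"
 using assms
proof (induction Zs Zs' arbitrary: Ys rule: list_all2_induct)
 case Nil thus ?case by simp
next
 case (Cons Z Zs Z' Zs')
 have "vfd U W" if "W : set Zs" for W
  using that Cons.hyps(2) by (auto simp: list_all2_conv_all_nth in_set_conv_nth)
 hence "covf X t (Ys @ Z # Zs) p = covf X t (Ys @ Z' # Zs) p"
  using Cons by (intro covf_slot) auto
 also have "... = covf X t ((Ys @ [Z']) @ Zs) p" by simp
 also have "... = covf X t ((Ys @ [Z']) @ Zs') p"
  using Cons by (intro Cons.IH) auto
 finally show ?case by simp
qed

lemma covf_expandX:
 assumes "!!Z. Z : set Zs ==> vfd U Z" "length Zs = L"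
 shows "covf X t Zs p = (SU i. of_real (X p c $ i) *C covf (cx c i) t Zs p)"
proof -
 have 1: "N X (%q. t q (map (%Z. Z q) Zs)) p = (SU i. of_real (X p c $ i) *C N (cx c i) (%q. t q (map (%Z. Z q) Zs)) p)"
  using mfield_S_fields[OF t U, of Zs "[]"] assms by (intro N_expandX[OF U(1) X U(2,3) _ p]) auto
 have 2: "t p ((map (%Z. Z p) Zs)[k := nab X (Zs ! k) p]) =
   (SU i. of_real (X p c $ i) *C t p ((map (%Z. Z p) Zs)[k := nab (cx c i) (Zs ! k) p]))"
  if k: "k < length Zs" for k
 proof -
  have vf: "vfd U (Zs ! k)" using assms(1) k by simp
  have upd: "(map (%Z. Z p) Zs)[k := x] = take k (map (%Z. Z p) Zs) @ x # drop (Suc k) (map (%Z. Z p) Zs)" for x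
   using k by (simp add: upd_conv_take_nth_drop)
  have len: "length (take k (map (%Z. Z p) Zs)) + length (drop (Suc k) (map (%Z. Z p) Zs)) + 1 = L"
   using k assms(2) by simp
  have tan: "nab (cx c i) (Zs ! k) p : tsp p" for i
   by (rule vector_field_tangent[OF nab_vector_field[OF U(1) vector_field_coord_on[OF U(2,3)] vf] p])
  show ?thesis
   unfolding upd nab_expandX[OF U(1) X U(2,3) vf p]
   by (simp only: mfield_sum[OF t len] tangent_scale tan mfield_scale[OF t len])
 qed
 show ?thesis
  unfolding covf_def 1 using 2 by (simp add: scaleC_diff_right scaleC_sum_right sum_subtractf sum.swap[of _ _ "{..<length Zs}"])
qed

end

end

section \<open>Symplectic geometry in coordinates\<close>

locale symplectic_bundle = algebra_bundle \<A> V S N B u \<omega> nab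
 for \<A> :: "('m::topological_space, 'n::finite) chart set" and V :: "'m => 'v::complex_space set"
  and S N B u \<omega> nab +
 assumes symplectic_form: "symplectic_form \<A> \<omega>"
  and symplectic: "symplectic_connection \<A> \<omega> nab"
  and torsion_free: "torsion_free \<A> nab"
begin

section \<open>The symplectic matrix, its inverse, and the Christoffel symbols\<close>

abbreviation om :: "('m, 'n) chart => 'm => complex ^ 'n ^ 'n"
 where "om == omega_matrix \<A> \<omega>"

abbreviation La :: "('m, 'n) chart => 'm => 'n => 'n => complex"
 where "La == poisson \<A> \<omega>"

lemma om_tensor: "tensor_field \<A> (%_. UNIV) (sfu) \<omega>"
 using symplectic_form by (auto simp: symplectic_form_def closed_two_form_def two_form_def)

lemma om_bilinear:
 assumes "v : tsp p" "v' : tsp p" "w : tsp p"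
 shows "\<omega> p [] [v + v', w] = \<omega> p [] [v, w] + \<omega> p [] [v', w]"
  and "\<omega> p [] [w, v + v'] = \<omega> p [] [w, v] + \<omega> p [] [w, v']"
  and "\<omega> p [] [tscale a v, w] = of_real a * \<omega> p [] [v, w]"
  and "\<omega> p [] [w, tscale a v] = of_real a * \<omega> p [] [w, v]"
  and "\<omega> p [] [v, v] = 0"
proof -
 have "tensor_at \<A> UNIV p (\<omega> p)" using om_tensor by (simp add: tensor_field_def)
 note t = this[unfolded tensor_at_def Let_def]
 have add: "\<omega> p [] (us @ (v + v') # us') = \<omega> p [] (us @ v # us') + \<omega> p [] (us @ v' # us')" for us us'
  using t assms by blast
 have scale: "\<omega> p [] (us @ tscale a v # us') = of_real a *C \<omega> p [] (us @ v # us')" for us us'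
  using t assms by blast
 show "\<omega> p [] [v + v', w] = \<omega> p [] [v, w] + \<omega> p [] [v', w]" using add[of "[]" "[w]"] by simp
 show "\<omega> p [] [w, v + v'] = \<omega> p [] [w, v] + \<omega> p [] [w, v']" using add[of "[w]" "[]"] by simp
 show "\<omega> p [] [tscale a v, w] = of_real a * \<omega> p [] [v, w]" using scale[of "[]" "[w]"] by (simp add: scaleC_complex_def)
 show "\<omega> p [] [w, tscale a v] = of_real a * \<omega> p [] [w, v]" using scale[of "[w]" "[]"] by (simp add: scaleC_complex_def)
 have "~ distinct [v, v]" by simp
 thus "\<omega> p [] [v, v] = 0" using t by blast
qed

lemma om_antisym:
 assumes "v : tsp p" "w : tsp p" shows "\<omega> p [] [v, w] = - \<omega> p [] [w, v]"
proof -
 have "\<omega> p [] [v + w, v + w] = 0" using assms by (intro om_bilinear(5)[OF _ _ assms(1)] tangent_add)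
 hence "\<omega> p [] [v, w] + \<omega> p [] [w, v] = 0"
  using om_bilinear(5)[OF assms(1,1,1)] om_bilinear(5)[OF assms(2,2,2)]
   om_bilinear(1)[OF assms tangent_add[OF assms]] om_bilinear(2)[OF assms assms(1)] om_bilinear(2)[OF assms assms(2)] by simp
 thus ?thesis by (simp add: eq_neg_iff_add_eq_0)
qed

lemma om_scale:
 assumes "v : tsp p" "w : tsp p"
 shows "\<omega> p [] [tscale a v, w] = of_real a * \<omega> p [] [v, w]" "\<omega> p [] [w, tscale a v] = of_real a * \<omega> p [] [w, v]"
 using om_bilinear(3,4)[OF assms(1,1,2)] .

lemma om_zero:
 assumes "w : tsp p" shows "\<omega> p [] [0, w] = 0" "\<omega> p [] [w, 0] = 0"
 using om_bilinear(3,4)[OF tangent_zero tangent_zero assms, of 0] by (simp_all add: tscale_def zero_fun_def)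

lemma om_sum:
 assumes "w : tsp p" "!!i. v i : tsp p"
 shows "\<omega> p [] [SUM i:I. v i, w] = (SUM i:I. \<omega> p [] [v i, w])"
  and "\<omega> p [] [w, SUM i:I. v i] = (SUM i:I. \<omega> p [] [w, v i])"
 by (induction I rule: ifi) (simp_all add: om_zero om_bilinear assms tangent_sum)

lemma om_expand_right:
 assumes "w : tsp p" "c : \<A>" "p : fst c"
 shows "\<omega> p [] [cx c k p, w] = (SU l. of_real (w c $ l) * om c p $ k $ l)"
 by (subst tangent_expand[OF assms]) (simp add: om_sum tangent_scale om_scale omega_matrix_def)

lemma om_expand_left:
 assumes "w : tsp p" "c : \<A>" "p : fst c"
 shows "\<omega> p [] [w, cx c l p] = (SU k. of_real (w c $ k) * om c p $ k $ l)"
 by (subst tangent_expand[OF assms]) (simp add: om_sum tangent_scale om_scale omega_matrix_def)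

lemma om_expand:
 assumes "v : tsp p" "w : tsp p" "c : \<A>" "p : fst c"
 shows "\<omega> p [] [v, w] = (SU k. SU l. of_real (v c $ k) * of_real (w c $ l) * om c p $ k $ l)"
proof -
 have "\<omega> p [] [v, w] = (SU k. of_real (v c $ k) * \<omega> p [] [cx c k p, w])"
  using assms(2) by (subst tangent_expand[OF assms(1,3,4)]) (simp add: om_sum tangent_scale om_scale)
 thus ?thesis by (simp add: om_expand_right[OF assms(2-4)] sum_distrib_left mult.assoc)
qed

lemma om_matrix_antisym: "om c p $ k $ l = - om c p $ l $ k"
 unfolding omega_matrix_def by (simp add: om_antisym[of "cx c k p" p "cx c l p"])

lemma om_real: "om c p $ k $ l : \<real>"
 using symplectic_form by (simp add: symplectic_form_def omega_matrix_def)

text \<open>Nondegeneracy concerns real tangent vectors, whereas the matrix is complex. As its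
  entries are real, real and imaginary part of a kernel vector lie in the kernel separately.\<close>

lemma om_invertible:
 assumes "c : \<A>" "p : fst c"
 shows "invertible (om c p)"
proof -
 have real0: "x = 0" if x: "!!k. (SU l. om c p $ k $ l * of_real (x $ l)) = 0" for x :: "real ^ 'n"
 proof -
  define v where "v = (SU i. tscale (x $ i) (cx c i p))"
  have v: "v : tsp p" unfolding v_def by (intro tangent_sum tangent_scale coord_tangent)
  have vc: "v c = x" unfolding v_def by (simp only: sum_apply) (simp only: tscale_def coord_self[OF assms] vec_expand)
  have "\<omega> p [] [v, w] = 0" if w: "w : tsp p" for w
  proof -
   have "\<omega> p [] [w, v] = (SU k. of_real (w c $ k) * (SU l. om c p $ k $ l * of_real (x $ l)))"
    by (simp add: om_expand[OF w v assms] vc sum_distrib_left ac_simps)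
   thus ?thesis using om_antisym[OF v w] x by simp
  qed
  hence "v = 0" using symplectic_form v unfolding symplectic_form_def by blast
  thus ?thesis using vc by (simp add: zero_fun_def)
 qed
 have "x = 0" if x: "om c p *v x = 0" for x
 proof -
  have row: "(SU l. om c p $ k $ l * x $ l) = 0" for k
   using x by (simp add: vec_eq_iff matrix_vector_mult_def)
  have om: "om c p $ k $ l = of_real (Re (om c p $ k $ l))" for k l using om_real by (simp add: complex_is_Real_iff complex_eq_iff)
  have "(SU l. om c p $ k $ l * of_real (Re (x $ l))) = of_real (Re (SU l. om c p $ k $ l * x $ l))" for k
   by (subst (1 2) om) (simp add: complex_eq_iff)
  hence Re0: "(\<chi> l. Re (x $ l)) = 0" using row by (intro real0) simp
  have "(SU l. om c p $ k $ l * of_real (Im (x $ l))) = of_real (Im (SU l. om c p $ k $ l * x $ l))" for k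
   by (subst (1 2) om) (simp add: complex_eq_iff)
  hence Im0: "(\<chi> l. Im (x $ l)) = 0" using row by (intro real0) simp
  show ?thesis using Re0 Im0 by (simp add: vec_eq_iff complex_eq_iff)
 qed
 thus ?thesis using matrix_left_invertible_ker[of "om c p"] unfolding invertible_left_inverse by blast
qed

lemma om_inverse:
 assumes "c : \<A>" "p : fst c"
 shows "om c p ** matrix_inv (om c p) = mat 1" "matrix_inv (om c p) ** om c p = mat 1"
 using om_invertible[OF assms] unfolding invertible_def matrix_inv_def by (metis (mono_tags, lifting) someI_ex)+

lemma om_La:
 assumes "c : \<A>" "p : fst c"
 shows "(SU m. om c p $ k $ m * La c p m l) = (if k = l then - 1 else 0)"
  and "(SU m. La c p k m * om c p $ m $ l) = (if k = l then - 1 else 0)"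
 using om_inverse[OF assms] by (auto simp: vec_eq_iff matrix_matrix_mult_def mat_def poisson_def sum_negf)

lemma La_unique:
 assumes "c : \<A>" "p : fst c" and Q: "!!k l. (SU m. om c p $ k $ m * Q m l) = (if k = l then - 1 else 0)"
 shows "Q k l = La c p k l"
proof -
 have "Q k l = - (SU j. (SU m. La c p k m * om c p $ m $ j) * Q j l)"
  by (simp add: om_La[OF assms(1,2)] if_distrib[of "%x. x * _"] cong: if_cong)
 also have "... = - (SU m. La c p k m * (SU j. om c p $ m $ j * Q j l))"
  by (simp add: sum_distrib_left sum_distrib_right mult.assoc) (rule sum.swap)
 also have "... = La c p k l" by (simp add: Q if_distrib cong: if_cong)
 finally show ?thesis .
qed

lemma La_antisym:
 assumes "c : \<A>" "p : fst c" shows "La c p k l = - La c p l k"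
proof -
 have "(SU m. om c p $ k $ m * - La c p l m) = (SU m. La c p l m * om c p $ m $ k)" for k l
  by (rule sum.cong[OF refl], subst om_matrix_antisym) simp
 thus ?thesis
  using La_unique[OF assms, of "%k l. - La c p l k"] om_La(2)[OF assms] by (simp add: eq_commute[of k])
qed

text \<open>The transformed matrix satisfies the equation that characterises \<open>La\<close> in
  the chart \<open>c\<close>, because the Jacobians of the two coordinate changes are inverse to
  each other (\<open>JK\<close>).\<close>

lemma La_chart_change:
 assumes c: "c : \<A>" "p : fst c" and d: "d : \<A>" "p : fst d"
 shows "(SU k. SU l. La d p k l * of_real (cx d k p c $ a) * of_real (cx d l p c $ b)) = La c p a b"
proof (rule La_unique[OF c])
 fix a b
 let ?J = "%a k. complex_of_real (cx d k p c $ a)" and ?K = "%k a. complex_of_real (cx c a p d $ k)"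
 have om_d: "(SU m. om c p $ a $ m * ?J m k) = (SU l. ?K l a * om d p $ l $ k)" for a k
 proof -
  have "\<omega> p [] [cx c a p, cx d k p] = (SU m. om c p $ a $ m * ?J m k)"
   by (subst om_expand_right[OF _ c]) (simp_all add: mult.commute)
  moreover have "\<omega> p [] [cx c a p, cx d k p] = (SU l. ?K l a * om d p $ l $ k)"
   by (rule om_expand_left[OF _ d]) simp
  ultimately show ?thesis by simp
 qed
 have JK: "(SU l. ?K l a * ?J b l) = (if a = b then 1 else 0)"
 proof -
  have "cx c a p c = (SU l. tscale (cx c a p d $ l) (cx d l p)) c"
   using tangent_expand[OF coord_tangent d] by metis
  hence "axis a 1 = (SU l. (cx c a p d $ l) *\<^sub>R cx d l p c)"
   using c by (simp only: sum_apply tscale_def coord_self)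
  hence "axis a 1 $ b = (SU l. (cx c a p d $ l) * cx d l p c $ b)" by simp
  hence "complex_of_real (axis a 1 $ b) = (SU l. ?K l a * ?J b l)" by simp
  thus ?thesis by (auto simp: axis_def)
 qed
 have "(SU m. om c p $ a $ m * (SU k. SU l. La d p k l * ?J m k * ?J b l)) =
   (SU k. SU m. SU l. om c p $ a $ m * ?J m k * La d p k l * ?J b l)"
  by (subst sum.swap) (simp add: sum_distrib_left ac_simps)
 also have "... = (SU k. SU l. (SU m. om c p $ a $ m * ?J m k) * La d p k l * ?J b l)"
  by (rule sum.cong[OF refl], subst sum.swap) (simp add: sum_distrib_right)
 also have "... = (SU k. SU l. SU j. ?K j a * (om d p $ j $ k * La d p k l) * ?J b l)"
  unfolding om_d by (simp add: sum_distrib_right mult.assoc)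
 also have "... = (SU l. SU k. SU j. ?K j a * (om d p $ j $ k * La d p k l) * ?J b l)"
  by (rule sum.swap)
 also have "... = (SU l. SU j. ?K j a * (SU k. om d p $ j $ k * La d p k l) * ?J b l)"
  by (rule sum.cong[OF refl], subst sum.swap) (simp add: sum_distrib_left sum_distrib_right)
 also have "... = - (SU l. ?K l a * ?J b l)"
  by (simp add: om_La[OF d] if_distrib[of "%x. _ * x"] if_distrib[of "%x. x * _"] sum_negf cong: if_cong)
 finally show "(SU m. om c p $ a $ m * (SU k. SU l. La d p k l * ?J m k * ?J b l)) = (if a = b then - 1 else 0)"
  by (simp add: JK)
qed

lemma om_smooth: "c : \<A> ==> sfu (fst c) (%p. om c p $ k $ l)"
 using om_tensor[unfolded tensor_field_def, THEN conjunct2, THEN bspec, THEN spec, THEN spec, of c "[]" "[k, l]"]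
 by (simp add: omega_matrix_def)

lemma smooth_det:
 assumes "open U" "!!i j. sfu U (%p. M p $ i $ j)"
 shows "sfu U (%p. det (M p :: complex ^ 'k::finite ^ 'k))"
 unfolding det_def
 by (intro smooth_fun_sum[OF assms(1)] smooth_fun_mult[OF assms(1) smooth_fun_const] smooth_fun_prod[OF assms(1)] assms(2))

text \<open>Cramer's rule writes each entry of the inverse matrix as a quotient of determinants in
  the smooth entries of \<open>om\<close>.\<close>

lemma La_smooth: assumes "c : \<A>" shows "sfu (fst c) (%p. La c p k l)"
proof -
 let ?M = "%p. (\<chi> i j. if j = k then axis l 1 $ i else om c p $ i $ j) :: complex ^ 'n ^ 'n"
 have U: "open (fst c)" using chart(1)[OF assms] .
 have det: "det (om c p) ~= 0" if "p : fst c" for p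
  using om_invertible[OF assms that] invertible_det_nz by blast
 have "La c p k l = - (det (?M p) * inverse (det (om c p)))" if "p : fst c" for p
 proof -
  have "om c p *v (matrix_inv (om c p) *v axis l 1) = axis l 1"
   using om_inverse[OF assms that] by (simp add: matrix_vector_mul_assoc)
  hence "matrix_inv (om c p) *v axis l 1 = (\<chi> k. det (\<chi> i j. if j = k then axis l 1 $ i else om c p $ i $ j) / det (om c p))"
   using cramer[OF det[OF that]] by blast
  hence "(matrix_inv (om c p) *v axis l 1) $ k = det (?M p) / det (om c p)" by simp
  thus ?thesis
   by (simp add: poisson_def matrix_vector_mult_def axis_def if_distrib divide_inverse cong: if_cong)
 qed
 moreover have "sfu (fst c) (%p. ?M p $ i $ j)" for i j
  using om_smooth[OF assms] smooth_fun_const by (cases "j = k") simp_all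
 hence "sfu (fst c) (%p. - (det (?M p) * inverse (det (om c p))))"
  using det om_smooth[OF assms]
  by (intro smooth_fun_minus[OF U] smooth_fun_mult[OF U] smooth_fun_inverse[OF U] smooth_det[OF U]) auto
 ultimately show ?thesis using smooth_fun_cong[OF U] by (metis (no_types, lifting))
qed

text \<open>The Christoffel symbols of the base connection, as complex numbers: \<open>l\<close> is
  the upper index, \<open>i\<close> the direction of differentiation.\<close>

definition Ga :: "('m, 'n) chart => 'n => 'n => 'n => 'm => complex"
 where "Ga c i j l p = of_real (nab (cx c i) (cx c j) p c $ l)"

lemma Ga_smooth: "c : \<A> ==> sfu (fst c) (Ga c i j l)"
 unfolding Ga_def[abs_def]
 by (intro smooth_fun_of_real chart(1) vector_field_component nab_vector_field vector_field_coord) auto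

lemma Ga_sym: assumes "c : \<A>" "p : fst c" shows "Ga c i j l p = Ga c j i l p"
proof -
 have "nab (cx c i) (cx c j) p - nab (cx c j) (cx c i) p = lie_bracket \<A> (cx c i) (cx c j) p"
  using torsion_free chart(1)[OF assms(1)] vector_field_coord[OF assms(1)] assms(2) unfolding torsion_free_def by blast
 thus ?thesis using lie_bracket_coord[OF assms] by (simp add: Ga_def)
qed

lemma om_nab:
 assumes "open U" "vfd U X" "vfd U Y" "vfd U Z" "p : U"
 shows "dd (X p) (%q. \<omega> q [] [Y q, Z q]) p = \<omega> p [] [nab X Y p, Z p] + \<omega> p [] [Y p, nab X Z p]"
 using symplectic assms unfolding symplectic_connection_def by blast

lemma om_coord_deriv:
 assumes c: "c : \<A>" "p : fst c"
 shows "dd (cx c i p) (%q. om c q $ k $ l) p =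
  (SU m. Ga c i k m p * om c p $ m $ l) + (SU m. Ga c i l m p * om c p $ k $ m)"
proof -
 note v = vector_field_coord[OF c(1)]
 have tan: "nab (cx c i) (cx c j) p : tsp p" for i j
  by (rule vector_field_tangent[OF nab_vector_field[OF chart(1)[OF c(1)] v v] c(2)])
 have "dd (cx c i p) (%q. om c q $ k $ l) p =
   \<omega> p [] [nab (cx c i) (cx c k) p, cx c l p] + \<omega> p [] [cx c k p, nab (cx c i) (cx c l) p]"
  using om_nab[OF chart(1)[OF c(1)] v v v c(2)] by (simp add: omega_matrix_def)
 thus ?thesis
  by (simp add: om_expand_left[OF tan c] om_expand_right[OF tan c] Ga_def)
qed

lemma dirderiv_mult:
 fixes f g :: "'m => complex"
 assumes "sfu U f" "sfu U g" "p : U"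
 shows "dd v (%q. f q * g q) p = f p * dd v g p + dd v f p * g p"
 by (rule dirderiv_bilinear[OF assms bounded_bilinear_mult])

lemma dirderiv_sum:
 assumes "open U" "!!i. sfu U (f i)" "p : U"
 shows "dd v (%q. SUM i:I. f i q) p = (SUM i:I. dd v (f i) p)"
 by (induction I rule: ifi)
  (simp_all add: dirderiv_add[OF assms(2) smooth_fun_sum[OF assms(1,2)] assms(3)])

text \<open>The Poisson tensor is parallel: this follows by differentiating
  \<open>La * om = -1\<close> and inserting the corresponding formula for \<open>om\<close>, which
  expresses that the connection is symplectic.\<close>

lemma La_deriv:
 assumes c: "c : \<A>" "p : fst c"
 shows "dd (cx c i p) (%q. La c q k l) p =
  - (SU m. Ga c i m k p * La c p m l) - (SU m. Ga c i m l p * La c p k m)"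
proof -
 let ?d = "%f. dd (cx c i p) f p"
 have U: "open (fst c)" using chart(1)[OF c(1)] .
 note sm = om_smooth[OF c(1)] La_smooth[OF c(1)]
 have 1: "(SU m. ?d (%q. La c q k m) * om c p $ m $ j) = - (SU m. La c p k m * ?d (%q. om c q $ m $ j))" for j
 proof -
  have "?d (%q. SU m. La c q k m * om c q $ m $ j) = ?d (%q. if k = j then - 1 else 0)"
   by (rule dirderiv_cong[OF U _ c(2)]) (simp add: om_La(2)[OF c(1)])
  hence "?d (%q. SU m. La c q k m * om c q $ m $ j) = 0" by simp
  hence "(SU m. La c p k m * ?d (%q. om c q $ m $ j) + ?d (%q. La c q k m) * om c p $ m $ j) = 0"
   using sm c(2) by (simp add: dirderiv_sum[OF U] smooth_fun_mult[OF U] dirderiv_mult[of "fst c"])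
  thus ?thesis by (simp add: sum.distrib eq_neg_iff_add_eq_0 add.commute)
 qed
 have "?d (%q. La c q k l) = - (SU m. ?d (%q. La c q k m) * (SU j. om c p $ m $ j * La c p j l))"
  by (simp add: om_La(1)[OF c] if_distrib[of "%x. _ * x"] cong: if_cong)
 also have "... = - (SU j. (SU m. ?d (%q. La c q k m) * om c p $ m $ j) * La c p j l)"
  by (simp add: sum_distrib_left sum_distrib_right mult.assoc) (rule sum.swap)
 also have "... = (SU j. (SU m. La c p k m * ?d (%q. om c q $ m $ j)) * La c p j l)"
  by (simp add: 1 sum_negf)
 also have "... = (SU j. SU m. SU a. La c p k m * Ga c i m a p * om c p $ a $ j * La c p j l)
   + (SU j. SU m. SU a. La c p k m * om c p $ m $ a * Ga c i j a p * La c p j l)"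
  by (simp add: om_coord_deriv[OF c] sum_distrib_left sum_distrib_right distrib_left distrib_right sum.distrib ac_simps)
 also have "(SU j. SU m. SU a. La c p k m * Ga c i m a p * om c p $ a $ j * La c p j l) =
   (SU m. SU a. La c p k m * Ga c i m a p * (SU j. om c p $ a $ j * La c p j l))"
  by (subst sum.swap, rule sum.cong[OF refl], subst sum.swap) (simp add: sum_distrib_left mult.assoc)
 also have "... = - (SU m. Ga c i m l p * La c p k m)"
  by (simp add: om_La(1)[OF c] if_distrib[of "%x. _ * x"] sum_negf cong: if_cong) (simp add: mult.commute)
 also have "(SU j. SU m. SU a. La c p k m * om c p $ m $ a * Ga c i j a p * La c p j l) =
   (SU j. SU a. (SU m. La c p k m * om c p $ m $ a) * Ga c i j a p * La c p j l)"
  by (rule sum.cong[OF refl], subst sum.swap) (simp add: sum_distrib_right mult.assoc)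
 also have "... = - (SU j. Ga c i j k p * La c p j l)"
  by (simp add: om_La(2)[OF c] if_distrib[of "%x. x * _"] sum_negf cong: if_cong)
 finally show ?thesis by simp
qed

text \<open>The curvature components \<open>R^m_kij\<close>, with the upper index \<open>m\<close>
  last.\<close>

definition Ri :: "('m, 'n) chart => 'n => 'n => 'n => 'n => 'm => complex"
 where "Ri c k i j m p = of_real (curvature \<A> nab (cx c i) (cx c j) (cx c k) p c $ m)"

lemma nab_coord_expand:
 assumes c: "c : \<A>" "p : fst c" and Z: "vfd (fst c) Z"
 shows "of_real (nab (cx c i) Z p c $ l) =
  dd (cx c i p) (%q. complex_of_real (Z q c $ l)) p + (SU m. of_real (Z p c $ m) * Ga c i m l p)"
proof -
 have U: "open (fst c)" using chart(1)[OF c(1)] .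
 note v = vector_field_coord[OF c(1)]
 have g: "sfu (fst c) (%q. Z q c $ m)" for m by (rule vector_field_component[OF U Z c(1) order_refl])
 have vt: "vfd (fst c) (%q. tscale (Z q c $ m) (cx c m q))" for m
  by (rule vector_field_scale[OF U v g])
 have "nab (cx c i) Z p = nab (cx c i) (SU m. (%q. tscale (Z q c $ m) (cx c m q))) p"
  by (rule nab_cong[OF U v vector_field_sum[OF U vt] _ _ c(2)]) (auto intro: vector_field_expand[OF Z c(1) order_refl])
 also have "... = (SU m. tscale (dd (cx c i p) (%q. Z q c $ m) p) (cx c m p)
   + tscale (Z p c $ m) (nab (cx c i) (cx c m) p))"
  by (simp add: nab_sum[OF U v c(2) vt] nab_scale[OF U v v g c(2)])
 finally have "nab (cx c i) Z p c $ l = (SU m. dd (cx c i p) (%q. Z q c $ m) p * axis m 1 $ l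
   + Z p c $ m * nab (cx c i) (cx c m) p c $ l)"
  using c by (simp add: sum_apply tscale_def)
 also have "... = dd (cx c i p) (%q. Z q c $ l) p + (SU m. Z p c $ m * nab (cx c i) (cx c m) p c $ l)"
  by (simp add: sum.distrib axis_def if_distrib[of "%x. _ * x"] cong: if_cong)
 finally show ?thesis
  by (simp add: Ga_def dirderiv_linear[OF g c(2) bounded_linear_of_real])
qed

lemma nab_zero_field:
 assumes "open U" "vfd U Z" "p : U" "!!q. q : U ==> X q = 0"
 shows "nab X Z p = 0"
 using nab_cong[OF assms(1) vector_field_zero assms(2), of X Z p] nab_zeroX[OF assms(1,2,3)] assms by simp

lemma curvature_coord:
 assumes c: "c : \<A>" "p : fst c" and Z: "vfd (fst c) Z"
 shows "curvature \<A> nab (cx c i) (cx c j) Z p =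
  nab (cx c i) (nab (cx c j) Z) p - nab (cx c j) (nab (cx c i) Z) p"
 using nab_zero_field[OF chart(1)[OF c(1)] Z c(2) lie_bracket_coord[OF c(1)]] by (simp add: curvature_def)

lemma Ri_eq:
 assumes c: "c : \<A>" "p : fst c"
 shows "Ri c k i j l p = dd (cx c i p) (Ga c j k l) p - dd (cx c j p) (Ga c i k l) p
  + (SU m. Ga c j k m p * Ga c i m l p) - (SU m. Ga c i k m p * Ga c j m l p)"
proof -
 have U: "open (fst c)" using chart(1)[OF c(1)] .
 note v = vector_field_coord[OF c(1)]
 have "Ri c k i j l p = of_real (nab (cx c i) (nab (cx c j) (cx c k)) p c $ l)
   - of_real (nab (cx c j) (nab (cx c i) (cx c k)) p c $ l)"
  by (simp add: Ri_def curvature_coord[OF c v])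
 thus ?thesis
  by (simp add: nab_coord_expand[OF c nab_vector_field[OF U v v]] Ga_def[abs_def])
qed

lemma smooth_om_fields:
 assumes c: "c : \<A>" and "vfd (fst c) Y" "vfd (fst c) Z"
 shows "sfu (fst c) (%q. \<omega> q [] [Y q, Z q])"
proof -
 have U: "open (fst c)" using chart(1)[OF c] .
 have "sfu (fst c) (%q. SU k. SU l. of_real (Y q c $ k) * of_real (Z q c $ l) * om c q $ k $ l)"
  using assms by (intro smooth_fun_sum[OF U] smooth_fun_mult[OF U] smooth_fun_of_real[OF U] om_smooth c vector_field_component[OF U]) auto
 thus ?thesis
  by (rule smooth_fun_cong[OF U, THEN iffD1, rotated]) (simp add: om_expand[OF _ _ c] vector_field_tangent[OF assms(2)] vector_field_tangent[OF assms(3)])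
qed

text \<open>Differentiate \<open>\<omega>(Z, W)\<close> twice along commuting coordinate fields. The
  mixed terms are symmetric in \<open>i\<close> and \<open>j\<close> and drop out, so the curvature
  is skew for \<open>\<omega>\<close>; antisymmetry of \<open>\<omega>\<close> turns this into a
  symmetry.\<close>

lemma om_curvature:
 assumes c: "c : \<A>" "p : fst c"
 shows "\<omega> p [] [curvature \<A> nab (cx c i) (cx c j) (cx c k) p, cx c l p] =
  \<omega> p [] [curvature \<A> nab (cx c i) (cx c j) (cx c l) p, cx c k p]"
proof -
 let ?n = "%i. nab (cx c i)" and ?W = "cx c l" and ?Z = "cx c k"
 have U: "open (fst c)" using chart(1)[OF c(1)] .
 note v = vector_field_coord[OF c(1)]
 have nv: "vfd (fst c) (?n i Z)" if "vfd (fst c) Z" for i Z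
  by (rule nab_vector_field[OF U v that])
 have t: "Z p : tsp p" if "vfd (fst c) Z" for Z using vector_field_tangent[OF that c(2)] .
 have D: "dd (cx c i p) (%q. dd (cx c j q) (%q. \<omega> q [] [?Z q, ?W q]) q) p =
   (\<omega> p [] [?n i (?n j ?Z) p, ?W p] + \<omega> p [] [?n j ?Z p, ?n i ?W p]) +
   (\<omega> p [] [?n i ?Z p, ?n j ?W p] + \<omega> p [] [?Z p, ?n i (?n j ?W) p])" for i j
 proof -
  have "dd (cx c i p) (%q. dd (cx c j q) (%q. \<omega> q [] [?Z q, ?W q]) q) p =
    dd (cx c i p) (%q. \<omega> q [] [?n j ?Z q, ?W q] + \<omega> q [] [?Z q, ?n j ?W q]) p"
   by (rule dirderiv_cong[OF U _ c(2)]) (rule om_nab[OF U v v v])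
  thus ?thesis
   by (simp add: dirderiv_add[OF smooth_om_fields[OF c(1) nv v] smooth_om_fields[OF c(1) v nv] c(2)] v nv
     om_nab[OF U v nv v c(2)] om_nab[OF U v v nv c(2)])
 qed
 have diff: "\<omega> p [] [X - Y, Z] = \<omega> p [] [X, Z] - \<omega> p [] [Y, Z]"
  if "X : tsp p" "Y : tsp p" "Z : tsp p" for X Y Z
 proof -
  have "X - Y = X + tscale (-1) Y" by (auto simp: tscale_def)
  hence "\<omega> p [] [X - Y, Z] = \<omega> p [] [X + tscale (-1) Y, Z]" by (simp only:)
  thus ?thesis using om_bilinear(1)[OF that(1) tangent_scale[OF that(2)] that(3)] om_scale(1)[OF that(2,3)] by simp
 qed
 have diffr: "\<omega> p [] [Z, X - Y] = \<omega> p [] [Z, X] - \<omega> p [] [Z, Y]"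
  if "X : tsp p" "Y : tsp p" "Z : tsp p" for X Y Z
 proof -
  have "X - Y = X + tscale (-1) Y" by (auto simp: tscale_def)
  hence "\<omega> p [] [Z, X - Y] = \<omega> p [] [Z, X + tscale (-1) Y]" by (simp only:)
  thus ?thesis using om_bilinear(2)[OF that(1) tangent_scale[OF that(2)] that(3)] om_scale(2)[OF that(2,3)] by simp
 qed
 have "\<omega> p [] [curvature \<A> nab (cx c i) (cx c j) ?Z p, ?W p] + \<omega> p [] [?Z p, curvature \<A> nab (cx c i) (cx c j) ?W p] = 0"
  using dirderiv_coord_commute[OF U smooth_om_fields[OF c(1) v v] c order_refl, of i j k l] D[of i j] D[of j i]
  unfolding curvature_coord[OF c v] diff[OF t[OF nv[OF nv[OF v]]] t[OF nv[OF nv[OF v]]] t[OF v]]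
   diffr[OF t[OF nv[OF nv[OF v]]] t[OF nv[OF nv[OF v]]] t[OF v]]
  by (simp add: algebra_simps)
 moreover have "curvature \<A> nab (cx c i) (cx c j) ?W p : tsp p"
  unfolding curvature_coord[OF c v]
 proof -
  have "?n i (?n j ?W) p - ?n j (?n i ?W) p = ?n i (?n j ?W) p + tscale (-1) (?n j (?n i ?W) p)" by (auto simp: tscale_def)
  thus "?n i (?n j ?W) p - ?n j (?n i ?W) p : tsp p"
   by (simp only:) (intro tangent_add tangent_scale t nv v)
 qed
 ultimately show ?thesis by (subst (asm) om_antisym[of "?Z p"]) (simp_all add: eq_neg_iff_add_eq_0)
qed

text \<open>Because of this symmetry the curvature with lowered index can be read as a fibrewise
  quadratic function, as required for \<open>R_M\<close>.\<close>

lemma Ri_sym: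
 assumes c: "c : \<A>" "p : fst c"
 shows "(SU m. om c p $ l $ m * Ri c k i j m p) = (SU m. om c p $ k $ m * Ri c l i j m p)"
proof -
 have U: "open (fst c)" using chart(1)[OF c(1)] .
 note v = vector_field_coord[OF c(1)]
 have tan: "curvature \<A> nab (cx c i) (cx c j) (cx c k) p : tsp p" for k
 proof -
  let ?n = "%i. nab (cx c i)"
  have "?n i (?n j (cx c k)) p - ?n j (?n i (cx c k)) p =
    ?n i (?n j (cx c k)) p + tscale (-1) (?n j (?n i (cx c k)) p)" by (auto simp: tscale_def)
  thus ?thesis unfolding curvature_coord[OF c v]
   by (simp only:) (intro tangent_add tangent_scale vector_field_tangent[OF _ c(2)] nab_vector_field[OF U v] v)
 qed
 have "\<omega> p [] [curvature \<A> nab (cx c i) (cx c j) (cx c k) p, cx c l p] = - (SU m. om c p $ l $ m * Ri c k i j m p)" for k l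
  by (subst om_antisym[OF tan coord_tangent], subst om_expand_right[OF tan c]) (simp add: Ri_def mult.commute)
 thus ?thesis using om_curvature[OF c, of i j k l] by simp
qed

end

section \<open>Symmetric tensors at a point\<close>

text \<open>The sum over all slots of \<open>f\<close> applied in that slot, as it occurs in the
  covariant derivative of a tensor; the recursive form suits inductions with
  \<open>ins\<close>.\<close>

fun der :: "('d => 'd) => ('d list => 'v::ab_group_add) => 'd list => 'v" where
 "der f x [] = 0"
| "der f x (v # vs) = x (f v # vs) + der f (ins v x) vs"

lemma der_sum: "der f x vs = (\<Sum>k<length vs. x (vs[k := f (vs ! k)]))"
 by (induction vs arbitrary: x) (simp_all add: sum.lessThan_Suc_shift del: sum.lessThan_Suc)

lemma symm_der: assumes "symm x" shows "symm (der f x)"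
 unfolding symm_def
proof (intro allI)
 fix us u v vs
 show "der f x (us @ u # v # vs) = der f x (us @ v # u # vs)"
  using assms
 proof (induction us arbitrary: x)
  case Nil
  have "x (f u # v # vs) = x (v # f u # vs)" "x (u # f v # vs) = x (f v # u # vs)"
   using Nil unfolding symm_def by (metis append_Nil)+
  thus ?case using ins_commute[OF Nil, of u v] by simp
 next
  case (Cons w us)
  have "x (f w # us @ u # v # vs) = x (f w # us @ v # u # vs)"
   using Cons.prems unfolding symm_def by (metis append_Cons)
  thus ?case using Cons.IH[OF symm_ins[OF Cons.prems], of w] by (simp del: ins_apply)
 qed
qed

context symplectic_bundle
begin

abbreviation T :: "'m => ('m, 'n) tvec set"
 where "T == tsp"

text \<open>The slices of tensors at \<open>p\<close> with fixed form arguments. Linearity is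
  imposed for the first argument; by symmetry it holds for all.\<close>

definition SY :: "'m => (('m, 'n) tvec list => 'v) set"
 where "SY p = {x : F.W p. (ALL vs. ~ set vs <= T p --> x vs = 0) &
  (ALL v:T p. ALL w:T p. ins (v + w) x = ins v x + ins w x) & (ALL a. ALL v:T p. ins (tscale a v) x = of_real a *C ins v x)}"

lemma SY_W: "x : SY p ==> x : F.W p"
 and SY_off: "x : SY p ==> ~ set vs <= T p ==> x vs = 0"
 and SY_add_arg: "x : SY p ==> v : T p ==> w : T p ==> ins (v + w) x = ins v x + ins w x"
 and SY_scale_arg: "x : SY p ==> v : T p ==> ins (tscale a v) x = of_real a *C ins v x"
 by (auto simp: SY_def)

lemma SYI:
 assumes "x : F.W p" "!!v vs. v \<notin> T p ==> x (v # vs) = 0"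
  "!!v w. v : T p ==> w : T p ==> ins (v + w) x = ins v x + ins w x"
  "!!a v. v : T p ==> ins (tscale a v) x = of_real a *C ins v x"
 shows "x : SY p"
proof -
 have "x vs = 0" if off: "~ set vs <= T p" for vs
 proof -
  obtain us v us' where "vs = us @ v # us'" "v \<notin> T p" using off by (metis split_list subsetI)
  thus ?thesis using symm_cons_append[OF F.W_symm[OF assms(1)]] assms(2) by simp
 qed
 thus ?thesis using assms by (simp add: SY_def)
qed

lemma SY_zero: "0 : SY p"
 by (rule SYI) (simp_all add: F.W_zero)

lemma SY_add: "x : SY p ==> y : SY p ==> x + y : SY p"
 by (rule SYI)
  (simp_all add: SY_W F.W_add SY_off SY_add_arg SY_scale_arg scaleC_add_right del: plus_fun_apply scaleC_fun_apply,
   simp add: SY_off)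

lemma SY_scale: "x : SY p ==> a *C x : SY p"
 by (rule SYI)
  (simp_all add: SY_W F.W_scale SY_off SY_add_arg SY_scale_arg scaleC_add_right scaleC_scaleC mult.commute)

lemma SY_sum: "(!!i. i : I ==> x i : SY p) ==> (SUM i:I. x i) : SY p"
 by (induction I rule: ifi) (auto intro: SY_zero SY_add)

lemma SY_ins: assumes x: "x : SY p" shows "ins v x : SY p"
proof (rule SYI)
 show "ins v x : F.W p" using SY_W[OF x] by (rule F.W_ins)
 show "ins v x (w # vs) = 0" if "w \<notin> T p" for w vs using SY_off[OF x, of "v # w # vs"] that by simp
 note c = ins_commute[OF F.W_symm[OF SY_W[OF x]], of _ v]
 show "ins (w + w') (ins v x) = ins w (ins v x) + ins w' (ins v x)" if "w : T p" "w' : T p" for w w'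
  unfolding c SY_add_arg[OF x that] by (rule ins_add)
 show "ins (tscale a w) (ins v x) = of_real a *C ins w (ins v x)" if "w : T p" for a w
  unfolding c SY_scale_arg[OF x that] by (rule ins_scaleC)
qed

lemma SY_ins_off: "x : SY p ==> v \<notin> T p ==> ins v x = 0"
 using SY_off by (intro ext) simp

lemma SY_shuf: assumes x: "x : SY p" and y: "y : SY p" shows "shuf B x y : SY p"
proof (rule SYI)
 note W = SY_W[OF x] SY_W[OF y]
 show "shuf B x y : F.W p" using W by (rule F.W_shuf)
 show "shuf B x y (v # vs) = 0" if "v \<notin> T p" for v vs
  using F.weyl_zero_left[OF W(2), of _ _ 0] F.weyl_zero_right[OF W(1), of _ _ 0]
  by (simp add: SY_ins_off[OF x that] SY_ins_off[OF y that])
 show "ins (v + w) (shuf B x y) = ins v (shuf B x y) + ins w (shuf B x y)" if "v : T p" "w : T p" for v w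
  unfolding ins_shuf SY_add_arg[OF x that] SY_add_arg[OF y that]
  by (simp only: F.shuf_add_left[where p=p] F.shuf_add_right[where p=p] F.W_ins[where p=p] W ac_simps)
 show "ins (tscale a v) (shuf B x y) = of_real a *C ins v (shuf B x y)" if "v : T p" for a v
  unfolding ins_shuf SY_scale_arg[OF x that] SY_scale_arg[OF y that]
  by (simp only: F.shuf_scale_left[where p=p] F.shuf_scale_right[where p=p] F.W_ins[where p=p] W scaleC_add_right)
qed

lemma SY_weyl: "x : SY p ==> y : SY p ==> weyl B P e n x y : SY p"
 by (induction n arbitrary: x y) (auto intro!: SY_shuf SY_scale SY_sum SY_ins)

lemma SY_wstar: "(!!i. X i : SY p) ==> (!!i. Y i : SY p) ==> wstar B P e X Y m : SY p"
 unfolding wstar_def by (intro SY_sum) (auto intro: SY_weyl)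

lemma SY_sum_arg: "x : SY p ==> (!!i. v i : T p) ==> ins (SUM i:I. v i) x = (SUM i:I. ins (v i) x)"
proof (induction I rule: ifi)
 case empty
 have "ins 0 x = 0" using SY_scale_arg[OF empty(1) tangent_zero, of 0] by (simp add: tscale_def zero_fun_def)
 thus ?case by (simp only: sum.empty)
next
 case (infinite I)
 have "ins 0 x = 0" using SY_scale_arg[OF infinite(2) tangent_zero, of 0] by (simp add: tscale_def zero_fun_def)
 thus ?case by (simp only: sum.infinite[OF infinite(1)])
qed (simp add: SY_add_arg tangent_sum)

lemma SY_expand_arg:
 assumes "x : SY p" "v : T p" "c : \<A>" "p : fst c"
 shows "ins v x = (SU i. of_real (v c $ i) *C ins (cx c i p) x)"
 by (subst tangent_expand[OF assms(2-4)], subst SY_sum_arg[OF assms(1)])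
  (simp_all only: tangent_scale coord_tangent SY_scale_arg[OF assms(1)])

lemma tensor_atD:
 assumes "tensor_at \<A> (V p) p t"
 shows "t vs ws : V p"
  and "~ set vs \<union> set ws <= T p ==> t vs ws = 0"
  and "v : T p ==> w : T p ==> t (us @ (v + w) # us') ws = t (us @ v # us') ws + t (us @ w # us') ws"
  and "v : T p ==> t (us @ tscale a v # us') ws = of_real a *C t (us @ v # us') ws"
  and "v : T p ==> w : T p ==> t vs (us @ (v + w) # us') = t vs (us @ v # us') + t vs (us @ w # us')"
  and "v : T p ==> t vs (us @ tscale a v # us') = of_real a *C t vs (us @ v # us')"
  and "mset vs = mset vs' ==> t vs ws = t vs' ws"
proof -
 note t = assms[unfolded tensor_at_def Let_def]
 note t1 = t[THEN conjunct1, rule_format] and r1 = t[THEN conjunct2]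
 note t2 = r1[THEN conjunct1, rule_format] and r2 = r1[THEN conjunct2]
 note t3 = r2[THEN conjunct1, rule_format] and r3 = r2[THEN conjunct2]
 note t4 = r3[THEN conjunct1, rule_format] and r4 = r3[THEN conjunct2]
 note t5 = r4[THEN conjunct1, rule_format] and r5 = r4[THEN conjunct2]
 note t6 = r5[THEN conjunct1, rule_format] and r6 = r5[THEN conjunct2]
 note t7 = r6[THEN conjunct1, rule_format]
 show "t vs ws : V p" by (rule t1)
 show "~ set vs \<union> set ws <= T p ==> t vs ws = 0" by (rule t2)
 show "v : T p ==> w : T p ==> t (us @ (v + w) # us') ws = t (us @ v # us') ws + t (us @ w # us') ws" by (rule t3)
 show "v : T p ==> t (us @ tscale a v # us') ws = of_real a *C t (us @ v # us') ws" by (rule t4)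
 show "v : T p ==> w : T p ==> t vs (us @ (v + w) # us') = t vs (us @ v # us') + t vs (us @ w # us')" by (rule t5)
 show "v : T p ==> t vs (us @ tscale a v # us') = of_real a *C t vs (us @ v # us')" by (rule t6)
 show "mset vs = mset vs' ==> t vs ws = t vs' ws" by (rule t7)
qed

lemma tensor_at_slice: assumes t: "tensor_at \<A> (V p) p t" shows "(%vs. t vs ws) : SY p"
proof (rule SYI)
 note t = tensor_atD[OF t]
 have "symm (%vs. t vs ws)" by (rule symmI_mset) (rule t(7))
 thus "(%vs. t vs ws) : F.W p" using t(1) by (auto simp: F.W_def)
 show "t (v # vs) ws = 0" if "v \<notin> T p" for v vs
  by (rule t(2)) (use that in simp)
 show "ins (v + w) (%vs. t vs ws) = ins v (%vs. t vs ws) + ins w (%vs. t vs ws)" if "v : T p" "w : T p" for v w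
  using t(3)[OF that, of "[]" _ ws] by (simp add: ins_def fun_eq_iff)
 show "ins (tscale a v) (%vs. t vs ws) = of_real a *C ins v (%vs. t vs ws)" if "v : T p" for a v
  using t(4)[OF that, of "[]" a _ ws] by (simp add: ins_def fun_eq_iff)
qed

lemma tensor_atI:
 assumes "!!vs ws. t vs ws : V p"
  and "!!vs ws. ~ set vs \<union> set ws <= T p ==> t vs ws = 0"
  and "!!us us' ws v w. v : T p ==> w : T p ==> t (us @ (v + w) # us') ws = t (us @ v # us') ws + t (us @ w # us') ws"
  and "!!us us' ws a v. v : T p ==> t (us @ tscale a v # us') ws = of_real a *C t (us @ v # us') ws"
  and "!!vs us us' v w. v : T p ==> w : T p ==> t vs (us @ (v + w) # us') = t vs (us @ v # us') + t vs (us @ w # us')"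
  and "!!vs us us' a v. v : T p ==> t vs (us @ tscale a v # us') = of_real a *C t vs (us @ v # us')"
  and "!!vs vs' ws. mset vs = mset vs' ==> t vs ws = t vs' ws"
  and "!!vs ws. ~ distinct ws ==> t vs ws = 0"
 shows "tensor_at \<A> (V p) p t"
 unfolding tensor_at_def Let_def by (intro conjI allI ballI impI; rule assms; assumption)

lemma tensor_at_deg0:
 assumes x: "(%vs. t vs []) : SY p" and z: "!!vs ws. ws ~= [] ==> t vs ws = 0"
 shows "tensor_at \<A> (V p) p t"
proof -
 note W = SY_W[OF x]
 have move: "t (us @ v # vs) ws = t (v # us @ vs) ws" for us v vs ws
  using symm_cons_append[OF F.W_symm[OF W], of us v vs] z by (cases "ws = []") auto
 have add: "t ((v + w) # vs) ws = t (v # vs) ws + t (w # vs) ws" if "v : T p" "w : T p" for v w vs ws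
  using fun_cong[OF SY_add_arg[OF x that], of vs] z by (cases "ws = []") auto
 have scale: "t (tscale a v # vs) ws = of_real a *C t (v # vs) ws" if "v : T p" for a v vs ws
  using fun_cong[OF SY_scale_arg[OF x that, where a=a], of vs] z by (cases "ws = []") auto
 show ?thesis
 proof (rule tensor_atI)
 show "t vs ws : V p" for vs ws using F.W_V[OF W] z F.V_zero by (cases "ws = []") auto
 show "t vs ws = 0" if "~ set vs \<union> set ws <= T p" for vs ws
  using SY_off[OF x] z that by (cases "ws = []") auto
 show "t vs ws = t vs' ws" if "mset vs = mset vs'" for vs vs' ws
  using symm_mset[OF F.W_symm[OF W] that] z by (cases "ws = []") auto
 show "t vs ws = 0" if "~ distinct ws" for vs ws using z that by (cases "ws = []") auto
 show "t (us @ (v + w) # us') ws = t (us @ v # us') ws + t (us @ w # us') ws" if "v : T p" "w : T p" for us us' ws v w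
  unfolding move using that by (rule add)
 show "t (us @ tscale a v # us') ws = of_real a *C t (us @ v # us') ws" if "v : T p" for us us' ws a v
  unfolding move using that by (rule scale)
 qed (simp_all add: z)
qed

lemma tensor_at_deg1:
 assumes x: "!!w. (%vs. t vs [w]) : SY p" and z: "!!vs ws. length ws ~= 1 ==> t vs ws = 0"
  and off: "!!vs w. w \<notin> T p ==> t vs [w] = 0"
  and lin: "!!vs v w. v : T p ==> w : T p ==> t vs [v + w] = t vs [v] + t vs [w]"
   "!!vs a v. v : T p ==> t vs [tscale a v] = of_real a *C t vs [v]"
 shows "tensor_at \<A> (V p) p t"
proof -
 have len: "length ws = 1 \<longleftrightarrow> (EX w. ws = [w])" for ws :: "('m, 'n) tvec list" by (auto simp: length_Suc_conv)
 have sl: "(%vs. t vs ws) : SY p" for ws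
  using x z len[of ws] SY_zero by (cases "length ws = 1") (auto simp: zero_fun_def)
 have move: "t (us @ v # vs) ws = t (v # us @ vs) ws" for us v vs ws
  using symm_cons_append[OF F.W_symm[OF SY_W[OF sl[of ws]]], of us v vs] by simp
 have add: "t ((v + w) # vs) ws = t (v # vs) ws + t (w # vs) ws" if "v : T p" "w : T p" for v w vs ws
  using fun_cong[OF SY_add_arg[OF sl[of ws] that], of vs] by simp
 have scale: "t (tscale a v # vs) ws = of_real a *C t (v # vs) ws" if "v : T p" for a v vs ws
  using fun_cong[OF SY_scale_arg[OF sl[of ws] that, where a=a], of vs] by simp
 show ?thesis
 proof (rule tensor_atI)
 show "t vs ws : V p" for vs ws using F.W_V[OF SY_W[OF sl]] by blast
 show "t vs ws = 0" if "~ set vs \<union> set ws <= T p" for vs ws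
  using SY_off[OF sl[of ws], of vs] off[of _ vs] z[of ws vs] len[of ws] that by (cases "length ws = 1") force+
 show "t vs ws = t vs' ws" if "mset vs = mset vs'" for vs vs' ws
  using symm_mset[OF F.W_symm[OF SY_W[OF sl]] that] by blast
 show "t vs ws = 0" if "~ distinct ws" for vs ws
  using z[of ws] len[of ws] that by (cases "length ws = 1") auto
 show "t vs (us @ (v + w) # us') = t vs (us @ v # us') + t vs (us @ w # us')" if "v : T p" "w : T p" for vs us us' v w
  using lin(1)[OF that] z by (cases "us = [] & us' = []") auto
 show "t vs (us @ tscale a v # us') = of_real a *C t vs (us @ v # us')" if "v : T p" for a vs us us' v
  using lin(2)[OF that] z by (cases "us = [] & us' = []") auto
 show "t (us @ (v + w) # us') ws = t (us @ v # us') ws + t (us @ w # us') ws" if "v : T p" "w : T p" for us us' ws v w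
  unfolding move using that by (rule add)
 show "t (us @ tscale a v # us') ws = of_real a *C t (us @ v # us') ws" if "v : T p" for us us' ws a v
  unfolding move using that by (rule scale)
 qed
qed

section \<open>The Weyl product of tensor fields\<close>

text \<open>Contains the constant \<open>i/2\<close> of the exponent, so that \<open>wstar\<close>
  needs no prefactors.\<close>

definition Pc :: "('m, 'n) chart => 'm => 'n => 'n => complex"
 where "Pc c p k l = (\<i> / 2) * La c p k l"

text \<open>The product at \<open>p\<close> is defined in the chart \<open>chart_at p\<close>, which
  is chosen separately for each point. Smoothness and derivatives of products require one chart for
  a whole neighbourhood.\<close>

lemma weyl_chart_change:
 assumes c: "c : \<A>" "p : fst c" and d: "d : \<A>" "p : fst d" and xy: "x : SY p" "y : SY p"
 shows "weyl B (Pc d p) (%k. cx d k p) n x y = weyl B (Pc c p) (%k. cx c k p) n x y"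
proof (rule F.weyl_contraction_cong[where X="SY p", OF SY_W SY_ins SY_ins _ xy])
 fix Fn :: "(('m, 'n) tvec list => 'v) => (('m, 'n) tvec list => 'v) => ('m, 'n) tvec list => 'v" and x y
 assume xy: "x : SY p" "y : SY p"
  and add: "!!x x' y. x : F.W p ==> x' : F.W p ==> y : F.W p ==> Fn (x + x') y = Fn x y + Fn x' y"
   "!!x y y'. x : F.W p ==> y : F.W p ==> y' : F.W p ==> Fn x (y + y') = Fn x y + Fn x y'"
  and scale: "!!a x y. x : F.W p ==> y : F.W p ==> Fn (a *C x) y = a *C Fn x y"
   "!!a x y. x : F.W p ==> y : F.W p ==> Fn x (a *C y) = a *C Fn x y"
 have zero: "Fn 0 y = 0" "Fn y 0 = 0" if "y : F.W p" for y
  using scale(1)[OF F.W_zero that, of 0] scale(2)[OF that F.W_zero, of 0] by simp_all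
 have sum: "Fn (SUM i:I. f i) y = (SUM i:I. Fn (f i) y)" "Fn y (SUM i:I. f i) = (SUM i:I. Fn y (f i))"
  if "!!i. f i : F.W p" "y : F.W p" for f y and I :: "'n set"
  using that by (induction I rule: ifi) (simp_all add: zero add F.W_sum)
 let ?J = "%k a. complex_of_real (cx d k p c $ a)"
 let ?x = "%a. ins (cx c a p) x" and ?y = "%a. ins (cx c a p) y"
 have W: "?x a : F.W p" "?y a : F.W p" for a by (intro F.W_ins SY_W xy)+
 have "Fn (ins (cx d k p) x) (ins (cx d l p) y) = (SU a. SU b. (?J k a * ?J l b) *C Fn (?x a) (?y b))" for k l
  unfolding SY_expand_arg[OF xy(1) coord_tangent c, of d k] SY_expand_arg[OF xy(2) coord_tangent c, of d l]
  by (subst sum.swap) (simp add: sum F.W_scale F.W_sum W scale scaleC_sum_right scaleC_scaleC mult.commute)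
 hence "(SU k. SU l. Pc d p k l *C Fn (ins (cx d k p) x) (ins (cx d l p) y)) =
   (SU k. SU l. SU a. SU b. (Pc d p k l * ?J k a * ?J l b) *C Fn (?x a) (?y b))"
  by (simp add: scaleC_sum_right scaleC_scaleC mult.assoc)
 also have "... = (SU a. SU b. SU k. SU l. (Pc d p k l * ?J k a * ?J l b) *C Fn (?x a) (?y b))"
 proof -
  have sw: "(SU k. SU l. SU a. SU b. g k l a b) = (SU a. SU b. SU k. SU l. g k l a b)"
   for g :: "'n => 'n => 'n => 'n => ('m, 'n) tvec list => 'v"
  proof -
   have sw3: "(SU k. SU l. SU a. h k l a) = (SU a. SU k. SU l. h k l a)"
    for h :: "'n => 'n => 'n => ('m, 'n) tvec list => 'v"
    by (subst sum.swap[of _ _ UNIV], rule sum.swap)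
   show ?thesis by (subst sw3, rule sum.cong[OF refl], rule sw3)
  qed
  show ?thesis by (rule sw)
 qed
 also have "... = (SU a. SU b. Pc c p a b *C Fn (?x a) (?y b))"
  unfolding Pc_def La_chart_change[OF c d, symmetric] by (simp add: scaleC_sum_left sum_distrib_left mult.assoc)
 finally show "(SU k. SU l. Pc d p k l *C Fn (ins (cx d k p) x) (ins (cx d l p) y)) =
   (SU a. SU b. Pc c p a b *C Fn (?x a) (?y b))" .
qed

lemma wstar_chart_change:
 assumes "c : \<A>" "p : fst c" "d : \<A>" "p : fst d" "!!i. X i : SY p" "!!i. Y i : SY p"
 shows "wstar B (Pc d p) (%k. cx d k p) X Y m = wstar B (Pc c p) (%k. cx c k p) X Y m"
 unfolding wstar_def by (intro sum.cong refl) (auto intro!: weyl_chart_change assms)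

definition sl :: "('m, 'n, 'v) wform => 'm => ('m, 'n) tvec list => nat => ('m, 'n) tvec list => 'v"
 where "sl a p ws = (%m vs. a (int m) p vs ws)"

abbreviation \<W> :: "('m, 'n, 'v) wform set"
 where "\<W> == W_space \<A> V S"

lemma \<W>_neg: "a : \<W> ==> m < 0 ==> a m = 0"
 and \<W>_field: "a : \<W> ==> tensor_field \<A> V S (a m)"
 and \<W>_tensor: "a : \<W> ==> tensor_at \<A> (V p) p (a m p)"
 and \<W>_smooth: "a : \<W> ==> c : \<A> ==>
  S (fst c) (%p. a m p (map (%i. cx c i p) is) (map (%j. cx c j p) js))"
 by (auto simp: W_space_def tensor_field_def)

lemma sl_SY: "a : \<W> ==> sl a p ws m : SY p"
 unfolding sl_def using tensor_at_slice[OF \<W>_tensor] .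

lemma sl_WS: "a : \<W> ==> sl a p ws : F.WS p"
 using SY_W[OF sl_SY] by (simp add: F.WS_def)

lemma wprod_neg:
 assumes "a : \<W>" "b : \<W>" "m < 0" shows "wprod \<A> \<omega> B a b m = 0"
proof -
 have "{(i, j, n). a i ~= 0 & b j ~= 0 & i + j + int n = m} = {}"
 proof (rule ccontr)
  assume "~ ?thesis"
  then obtain i j n where "a i ~= 0" "b j ~= 0" "i + j + int n = m" by auto
  moreover hence "i \<ge> 0" "j \<ge> 0" using \<W>_neg[OF assms(1)] \<W>_neg[OF assms(2)] by (meson not_less)+
  ultimately show False using assms(3) by linarith
 qed
 thus ?thesis by (intro ext) (simp only: wprod_def sum.empty zero_fun_apply)
qed

lemma wprod_slices:
 assumes a: "a : \<W>" and b: "b : \<W>"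
 shows "wprod \<A> \<omega> B a b (int m) p vs ws = (SUM J:Pow {..<length ws}. shuffle_sign (length ws) J *C
  wstar B (Pc (chx p) p) (%k. cx (chx p) k p) (sl a p (nths ws J)) (sl b p (nths ws (- J))) m vs)"
proof -
 let ?c = "chx p"
 let ?e = "%k. cx ?c k p"
 define h where "h i j n = (SUM J:Pow {..<length ws}. shuffle_sign (length ws) J *C
   weyl B (Pc ?c p) ?e n (%vs. a i p vs (nths ws J)) (%vs. b j p vs (nths ws (- J))) vs)" for i j n
 have trm: "((\<i> / 2) ^ n / fact n) *C weyl_term \<A> \<omega> B n p (a i p) (b j p) vs ws = h i j n" for i j n
  unfolding h_def weyl_term_slices Pc_def[abs_def] weyl_scale_tensor scaleC_fun_apply
  by (simp add: scaleC_scaleC scaleC_sum_right mult.commute)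
 have h0: "h i j n = 0" if "a i = 0 \<or> b j = 0" for i j n
 proof -
  have "(%vs. a i p vs ws) : F.W p" "(%vs. b j p vs ws) : F.W p" for ws
   using SY_W[OF tensor_at_slice[OF \<W>_tensor]] a b by blast+
  moreover have "(%vs. 0) = (0 :: ('m, 'n) tvec list => 'v)" by auto
  ultimately show ?thesis using that unfolding h_def
   by (auto simp: F.weyl_zero_left[where p=p] F.weyl_zero_right[where p=p] intro!: sum.neutral)
 qed
 let ?f = "%(i, j, n). (int i, int j, n :: nat)"
 have "wprod \<A> \<omega> B a b (int m) p vs ws = (\<Sum>(i, j, n) | a i ~= 0 & b j ~= 0 & i + j + int n = int m. h i j n)"
  by (simp add: wprod_def sum_apply split_def trm)
 \<comment> \<open>The sum in \<open>wprod\<close> runs over nonzero coefficients only. The missing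
   index triples are put back; their terms vanish by \<open>h0\<close>.\<close>
 also have "... = (\<Sum>(i, j, n)\<in>?f ` triples m. h i j n)"
 proof (rule sum.mono_neutral_left)
  show "{(i, j, n). a i ~= 0 & b j ~= 0 & i + j + int n = int m} <= ?f ` triples m"
  proof
   fix t assume "t : {(i, j, n). a i ~= 0 & b j ~= 0 & i + j + int n = int m}"
   then obtain i j n where t: "t = (i, j, n)" "a i ~= 0" "b j ~= 0" "i + j + int n = int m" by auto
   hence "i \<ge> 0" "j \<ge> 0" using \<W>_neg[OF a] \<W>_neg[OF b] by (meson not_less)+
   hence "t = ?f (nat i, nat j, n)" "(nat i, nat j, n) : triples m" using t by (auto simp: triples_def)
   thus "t : ?f ` triples m" by blast
  qed
 qed (simp, auto simp: h0 triples_def)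
 also have "... = (\<Sum>(i, j, n)\<in>triples m. h (int i) (int j) n)"
  by (subst sum.reindex) (auto simp: inj_on_def split_def intro!: sum.cong)
 also have "... = (SUM J:Pow {..<length ws}. \<Sum>(i, j, n)\<in>triples m. shuffle_sign (length ws) J *C
   weyl B (Pc ?c p) ?e n (sl a p (nths ws J) i) (sl b p (nths ws (- J)) j) vs)"
  unfolding h_def sl_def split_def by (rule sum.swap)
 finally show ?thesis by (simp add: wstar_apply scaleC_sum_right split_def)
qed

lemma sl_deg: "has_deg_a k a ==> length ws ~= k ==> sl a p ws = 0"
 by (auto simp: sl_def has_deg_a_def fun_eq_iff)

lemma WS_zero: "0 : F.WS p"
 by (simp add: F.WS_def F.W_zero)

lemma wstar_zero:
 assumes "Y : F.WS p" shows "wstar B P e 0 Y = 0" "wstar B P e Y 0 = 0"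
 using F.wstar_scale_left[OF WS_zero assms, of P e 0] F.wstar_scale_right[OF assms WS_zero, of P e 0]
 by simp_all

text \<open>From here on forms are handled through their components in a chart, index lists taking
  the place of tangent vectors. The order of arguments makes \<open>comp c a js\<close> a series in
  \<open>\<lambda>\<close> of functions of the symmetric indices.\<close>

definition comp :: "('m, 'n) chart => ('m, 'n, 'v) wform => 'n list => nat => 'n list => 'm => 'v"
 where "comp c a js m is q = a (int m) q (map (%i. cx c i q) is) (map (%j. cx c j q) js)"

definition ev :: "'m => (nat => 'n list => 'm => 'v) => nat => 'n list => 'v"
 where "ev q X = (%m is. X m is q)"

definition st :: "('m, 'n) chart => (nat => 'n list => 'm => 'v) => (nat => 'n list => 'm => 'v) => nat => 'n list => 'm => 'v"
 where "st c X Y m is q = wstar B (Pc c q) (%k. k) (ev q X) (ev q Y) m is"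

lemma wstar_sl_comp:
 assumes "a : \<W>" "b : \<W>" "c : \<A>" "p : fst c"
 shows "wstar B (Pc (chx p) p) (%k. cx (chx p) k p)
   (sl a p (map (%j. cx c j p) js)) (sl b p (map (%j. cx c j p) js')) m (map (%i. cx c i p) is) =
  st c (comp c a js) (comp c b js') m is p"
proof -
 have "ev p (comp c a js) = (%i l. sl a p (map (%j. cx c j p) js) i (map (%i. cx c i p) l))" for a js
  by (simp add: ev_def comp_def sl_def)
 thus ?thesis
  using wstar_map[of B "Pc c p" "%i. cx c i p" "%k. k"]
  by (simp add: wstar_chart_change[OF assms(3,4) chart_at sl_SY[OF assms(1)] sl_SY[OF assms(2)]] st_def)
qed

lemma wprod_comp:
 assumes ab: "a : \<W>" "b : \<W>" and c: "c : \<A>" "p : fst c"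
 shows "has_deg_a 0 a ==> has_deg_a 0 b ==> comp c (wprod \<A> \<omega> B a b) [] m is p = st c (comp c a []) (comp c b []) m is p"
  and "has_deg_a 1 a ==> has_deg_a 0 b ==> comp c (wprod \<A> \<omega> B a b) [j] m is p = st c (comp c a [j]) (comp c b []) m is p"
  and "has_deg_a 0 a ==> has_deg_a 1 b ==> comp c (wprod \<A> \<omega> B a b) [j] m is p = st c (comp c a []) (comp c b [j]) m is p"
  and "has_deg_a 1 a ==> has_deg_a 1 b ==> comp c (wprod \<A> \<omega> B a b) [i, j] m is p =
   st c (comp c a [i]) (comp c b [j]) m is p - st c (comp c a [j]) (comp c b [i]) m is p"
 using wstar_sl_comp[OF ab c, of "[]" "[]" m "is"] wstar_sl_comp[OF ab c, of "[j]" "[]" m "is"]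
  wstar_sl_comp[OF ab c, of "[]" "[j]" m "is"] wstar_sl_comp[OF ab c, of "[i]" "[j]" m "is"] wstar_sl_comp[OF ab c, of "[j]" "[i]" m "is"]
 by (simp_all add: comp_def[of _ "wprod _ _ _ _ _"] wprod_slices[OF ab] sum_Pow_low nths_Cons sl_deg sl_WS[where p=p] ab wstar_zero[where p=p] WS_zero)

end

context symplectic_bundle
begin

section \<open>Smoothness and degrees of Weyl products\<close>

definition LS :: "('m, 'n) chart => (nat => 'n list => 'm => 'v) set"
 where "LS c = {X. (ALL m is. S (fst c) (X m is)) & (ALL q:fst c. ALL m. symm (ev q X m))}"

lemma LS_S: "X : LS c ==> S (fst c) (X m is)"
 by (simp add: LS_def)

lemma LS_WS: "X : LS c ==> q : fst c ==> ev q X : F.WS q"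
 using S_V[of "fst c" "X _ _" q] by (auto simp: LS_def F.WS_def F.W_def ev_def)

lemma S_weyl:
 assumes c: "c : \<A>" and "!!is. S (fst c) (x is)" "!!is. S (fst c) (y is)"
 shows "S (fst c) (%q. weyl B (Pc c q) (%k. k) n (%is. x is q) (%is. y is q) is)"
 using assms(2,3)
proof (induction n arbitrary: x y)
 case 0
 thus ?case
 proof (induction "is" arbitrary: x y)
  case Nil thus ?case by (simp add: S_B chart(1)[OF c])
 next
  case (Cons i "is")
  have "S (fst c) (%q. shuf B (%is. x (i # is) q) (%is. y is q) is)" "S (fst c) (%q. shuf B (%is. x is q) (%is. y (i # is) q) is)"
   using Cons.IH[of "%is. x (i # is)" y] Cons.IH[of x "%is. y (i # is)"] Cons.prems by auto
  thus ?case by (simp add: ins_def S_add chart(1)[OF c])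
 qed
next
 case (Suc n)
 have P: "sfu (fst c) (%q. Pc c q k l)" for k l
  unfolding Pc_def by (intro smooth_fun_mult chart(1)[OF c] smooth_fun_const La_smooth c)
 have "S (fst c) (%q. weyl B (Pc c q) (%k. k) n (%is. x (k # is) q) (%is. y (l # is) q) is)" for k l
  using Suc.IH[of "%is. x (k # is)" "%is. y (l # is)"] Suc.prems by blast
 thus ?case
  unfolding weyl_Suc_apply ins_def
  by (intro S_scale_const S_sum S_scale P chart(1)[OF c])
qed

lemma LS_st: assumes c: "c : \<A>" and X: "X : LS c" and Y: "Y : LS c" shows "st c X Y : LS c"
proof -
 have "S (fst c) (st c X Y m is)" for m "is"
  unfolding st_def[abs_def] wstar_apply ev_def split_def
  by (intro S_sum S_weyl c chart(1)[OF c] LS_S X Y)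
 moreover have "symm (ev q (st c X Y) m)" if "q : fst c" for q m
  using F.W_symm[OF F.WS_W[OF F.WS_wstar[OF LS_WS[OF X that] LS_WS[OF Y that]]]] by (simp add: ev_def st_def)
 ultimately show ?thesis by (simp add: LS_def)
qed

lemma ev_st: "ev q (st c X Y) = wstar B (Pc c q) (%k. k) (ev q X) (ev q Y)"
 by (auto simp: ev_def st_def)

lemma comp_LS: assumes a: "a : \<W>" and c: "c : \<A>" shows "comp c a js : LS c"
proof -
 have "symm (ev q (comp c a js) m)" for q m
  using F.W_symm[OF SY_W[OF sl_SY[OF a]], of q "map (%j. cx c j q) js" m]
  unfolding symm_def ev_def comp_def sl_def by simp
 thus ?thesis using \<W>_smooth[OF a c] by (simp add: LS_def comp_def[abs_def])
qed

lemma wprod_deg: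
 assumes a: "a : \<W>" "has_deg_a k a" and b: "b : \<W>" "has_deg_a l b"
 shows "has_deg_a (k + l) (wprod \<A> \<omega> B a b)"
 unfolding has_deg_a_def
proof (intro allI impI)
 fix m p vs and ws :: "('m, 'n) tvec list" assume len: "length ws ~= k + l"
 show "wprod \<A> \<omega> B a b m p vs ws = 0"
 proof (cases "m < 0")
  case True thus ?thesis using wprod_neg[OF a(1) b(1)] by simp
 next
  case False
  then obtain m' where m: "m = int m'" by (metis nat_0_le not_less)
  have "wstar B (Pc (chx p) p) (%k. cx (chx p) k p) (sl a p (nths ws J)) (sl b p (nths ws (- J))) m' vs = 0" for J
  proof -
   have "{i. i < length ws & i : J} \<union> {i. i < length ws & i : - J} = {..<length ws}" by auto
   hence "length (nths ws J) + length (nths ws (- J)) = length ws"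
    unfolding length_nths by (subst card_Un_disjoint[symmetric]) auto
   hence "length (nths ws J) ~= k \<or> length (nths ws (- J)) ~= l" using len by auto
   thus ?thesis
    by (auto simp: sl_deg[OF a(2)] sl_deg[OF b(2)] wstar_zero[OF sl_WS[OF a(1)]] wstar_zero[OF sl_WS[OF b(1)]])
  qed
  thus ?thesis unfolding m wprod_slices[OF a(1) b(1)] by simp
 qed
qed

lemma wprod_\<W>:
 assumes a: "a : \<W>" "has_deg_a 0 a" and b: "b : \<W>" "has_deg_a 0 b"
 shows "wprod \<A> \<omega> B a b : \<W>"
proof -
 have deg: "wprod \<A> \<omega> B a b m p vs ws = 0" if "ws ~= []" for m p vs ws
  using wprod_deg[OF a b] that by (simp add: has_deg_a_def)
 have "tensor_at \<A> (V p) p (wprod \<A> \<omega> B a b (int m) p)" for m p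
 proof (rule tensor_at_deg0[OF _ deg])
  show "(%vs. wprod \<A> \<omega> B a b (int m) p vs []) : SY p"
   unfolding wprod_slices[OF a(1) b(1)] by (simp add: sum_Pow_low SY_wstar sl_SY a(1) b(1))
 qed
 moreover have "S (fst c) (%p. wprod \<A> \<omega> B a b (int m) p (map (%i. cx c i p) is) (map (%j. cx c j p) js))"
  if c: "c : \<A>" for m c "is" js
 proof (cases "js = []")
  case True
  show ?thesis
   unfolding True
   by (rule S_cong[OF chart(1)[OF c] LS_S[OF LS_st[OF c comp_LS[OF a(1) c, of "[]"] comp_LS[OF b(1) c, of "[]"]], of m "is"]])
    (use wprod_comp(1)[OF a(1) b(1) c _ a(2) b(2)] in \<open>simp add: comp_def[of _ "wprod _ _ _ _ _"]\<close>)
 qed (simp add: deg S_zero chart(1)[OF c])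
 ultimately have "tensor_field \<A> V S (wprod \<A> \<omega> B a b (int m))" for m by (simp add: tensor_field_def)
 moreover have "tensor_field \<A> V S 0"
 proof -
  have "(%vs. 0) = (0 :: ('m, 'n) tvec list => 'v)" by auto
  hence "tensor_at \<A> (V p) p 0" for p using SY_zero by (intro tensor_at_deg0) simp_all
  thus ?thesis using S_zero chart(1) by (simp add: tensor_field_def)
 qed
 ultimately have "tensor_field \<A> V S (wprod \<A> \<omega> B a b m)" for m
  using wprod_neg[OF a(1) b(1), of m] by (cases "m < 0") (auto, metis nat_0_le not_less)
 thus ?thesis using wprod_neg[OF a(1) b(1)] by (simp add: W_space_def)
qed

section \<open>Covariant derivatives of tensor fields\<close>

lemma sum_lessThan_add: "(\<Sum>k<(a::nat) + b. f k) = (\<Sum>k<a. f k) + (\<Sum>k<b. f (a + k) :: 'z::comm_monoid_add)"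
 by (induction b) (simp_all add: add.assoc)

lemma tensor_mfield:
 assumes a: "tensor_field \<A> V S t"
 shows "mfield (s + k) (%q L. t q (take s L) (drop s L))"
proof -
 have t: "tensor_at \<A> (V q) q (t q)" for q using a by (simp add: tensor_field_def)
 have "t q (take s (us @ (x + y) # us')) (drop s (us @ (x + y) # us')) =
   t q (take s (us @ x # us')) (drop s (us @ x # us')) + t q (take s (us @ y # us')) (drop s (us @ y # us'))"
  if "x : T q" "y : T q" for q us us' x y
  using tensor_atD(3)[OF t that, where us=us] tensor_atD(5)[OF t that, where us'=us']
  by (cases "length us < s") (simp_all add: Suc_diff_Suc[symmetric] take_Cons' drop_Cons')
 moreover have "t q (take s (us @ tscale a x # us')) (drop s (us @ tscale a x # us')) =
   of_real a *C t q (take s (us @ x # us')) (drop s (us @ x # us'))" if "x : T q" for q us us' x a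
  using tensor_atD(4)[OF t that, where us=us] tensor_atD(6)[OF t that, where us'=us']
  by (cases "length us < s") (simp_all add: take_Cons' drop_Cons')
 moreover have "S (fst c) (%q. t q (take s (map (%i. cx c i q) is)) (drop s (map (%i. cx c i q) is)))"
  if "c : \<A>" for c "is"
  using a that by (simp add: tensor_field_def take_map drop_map)
 ultimately show ?thesis unfolding mfield_def by blast
qed

lemma cov_tensor_covf:
 assumes "set vs \<union> set ws <= T p" "c : \<A>" "p : fst c"
 shows "cov_tensor \<A> nab N c X t p vs ws = covf X (%q L. t q (take (length vs) L) (drop (length vs) L))
  (map (%v. const_field \<A> c (v c)) (vs @ ws)) p"
proof -
 have id: "map (%v. const_field \<A> c (v c) p) vs = vs" "map (%v. const_field \<A> c (v c) p) ws = ws"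
  using assms(1) by (auto intro!: map_idI const_field_eq[OF _ assms(2,3)])
 show ?thesis
  unfolding cov_tensor_def covf_def using assms(1)
  by (simp add: sum_lessThan_add o_def id nth_append list_update_append diff_diff_eq)
qed

lemma cov_deriv_deg:
 assumes "has_deg_a k a" "a : \<W>" shows "has_deg_a (Suc k) (cov_deriv \<A> nab N a)"
proof -
 let ?c = "chx"
 have z: "cov_tensor \<A> nab N (?c p) (cx (?c p) i) (a m) p vs ws = 0" if "length ws ~= k" for m p i vs ws
 proof -
  have "N (cx (?c p) i) (%q. 0) p = 0"
   by (rule N_zero[OF chart(1)[OF chart_at(1)] vector_field_coord[OF chart_at(1)] chart_at(2)])
  thus ?thesis using assms(1) that by (simp add: cov_tensor_def has_deg_a_def)
 qed
 thus ?thesis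
  unfolding has_deg_a_def cov_deriv_def Let_def
  by (auto simp: sum_apply intro!: sum.neutral tmul_dx_alt_degree[of k])
qed

lemma cov_deriv_neg: "a : \<W> ==> m < 0 ==> cov_deriv \<A> nab N a m = 0"
proof (intro ext)
 fix p vs ws assume a: "a : \<W>" "m < 0"
 let ?c = "chx p"
 have "N (cx ?c i) (%q. 0) p = 0" for i
  by (rule N_zero[OF chart(1)[OF chart_at(1)] vector_field_coord[OF chart_at(1)] chart_at(2)])
 hence z: "cov_tensor \<A> nab N ?c (cx ?c i) (a m) p = (%_ _. 0)" for i
  using \<W>_neg[OF a] by (intro ext) (simp add: cov_tensor_def)
 have "tmul scaleC (dx_alt \<A> ?c i p) (%_ _. 0 :: 'v) vs ws = 0" for i
  unfolding tmul_slices dx_alt_slice shuf_scaleC_const by simp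
 thus "cov_deriv \<A> nab N a m p vs ws = (0 :: 'm => ('m, 'n, 'v) tensor) p vs ws"
  unfolding cov_deriv_def Let_def z by (simp add: sum_apply)
qed

text \<open>The Christoffel terms of the covariant derivative, one for each symmetric index.\<close>

fun gam :: "('n => 'n => complex) => ('n list => 'v) => 'n list => 'v" where
 "gam G x [] = 0"
| "gam G x (i # is) = (SU l. G i l *C x (l # is)) + gam G (ins i x) is"

text \<open>The covariant derivative in direction \<open>j\<close>, where form indices are treated
  as mere labels. Their Christoffel terms cancel after antisymmetrisation, since the torsion
  vanishes (\<open>cov_deriv_comp\<close>).\<close>

definition nb :: "('m, 'n) chart => 'n => (nat => 'n list => 'm => 'v) => nat => 'n list => 'm => 'v"
 where "nb c j X m is q = N (cx c j) (X m is) q - gam (%i l. Ga c j i l q) (ev q X m) is"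

lemma S_gam:
 assumes c: "c : \<A>" and "!!is. S (fst c) (x is)"
 shows "S (fst c) (%q. gam (%i l. Ga c j i l q) (%is. x is q) is)"
 using assms(2)
proof (induction "is" arbitrary: x)
 case Nil thus ?case by (simp add: S_zero chart(1)[OF c])
next
 case (Cons i "is")
 have "S (fst c) (%q. gam (%i l. Ga c j i l q) (%is. x (i # is) q) is)"
  using Cons.IH[of "%is. x (i # is)"] Cons.prems by blast
 thus ?case
  using Cons.prems Ga_smooth[OF c] by (simp add: ins_def S_add S_sum S_scale chart(1)[OF c])
qed

lemma S_nb: assumes c: "c : \<A>" and X: "X : LS c" shows "S (fst c) (nb c j X m is)"
 unfolding nb_def[abs_def] ev_def
 by (intro S_diff chart(1)[OF c] N_S vector_field_coord[OF c] LS_S[OF X] S_gam c)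

lemma gam_tensor:
 assumes c: "c : \<A>" "p : fst c" and x: "x : SY p" and f: "!!i. f i : T p"
 shows "(\<Sum>k<length is. x ((map (%i. cx c i p) is)[k := f (is ! k)])) =
  gam (%i l. of_real (f i c $ l)) (%is. x (map (%i. cx c i p) is)) is"
 using x
proof (induction "is" arbitrary: x)
 case Nil thus ?case by simp
next
 case (Cons i "is")
 have "x (f i # map (%i. cx c i p) is) = (SU l. of_real (f i c $ l) *C x (cx c l p # map (%i. cx c i p) is))"
  using fun_cong[OF SY_expand_arg[OF Cons.prems f c]] by (simp add: sum_apply)
 thus ?case
  using Cons.IH[OF SY_ins[OF Cons.prems, of "cx c i p"]]
  by (simp add: sum.lessThan_Suc_shift ins_def del: sum.lessThan_Suc)
qed

lemma nab_tangent: "c : \<A> ==> p : fst c ==> nab (cx c j) (cx c i) p : T p"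
 by (rule vector_field_tangent[OF nab_vector_field[OF chart(1)]]) (auto intro: vector_field_coord)

lemma covf_coord:
 assumes a: "a : \<W>" and c: "c : \<A>" "p : fst c"
 shows "covf (cx c j) (%q L. a (int m) q (take (length is) L) (drop (length is) L)) (map (cx c) (is @ js)) p =
  nb c j (comp c a js) m is p - (\<Sum>k<length js. a (int m) p (map (%i. cx c i p) is)
   ((map (%i. cx c i p) js)[k := nab (cx c j) (cx c (js ! k)) p]))"
proof -
 have "(\<Sum>k<length is. a (int m) p ((map (%i. cx c i p) is)[k := nab (cx c j) (cx c (is ! k)) p]) (map (%i. cx c i p) js)) =
   gam (%i l. Ga c j i l p) (ev p (comp c a js) m) is"
  using gam_tensor[OF c sl_SY[OF a, of p "map (%i. cx c i p) js" m],
    of "%i. nab (cx c j) (cx c i) p" "is"] nab_tangent[OF c]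
  by (simp add: sl_def Ga_def ev_def comp_def)
 thus ?thesis
  unfolding covf_def nb_def
  by (simp add: sum_lessThan_add o_def nth_append list_update_append diff_diff_eq comp_def[abs_def])
qed

text \<open>Linearity in the direction assembles the derivatives along the coordinate fields of
  \<open>d\<close> into one along a coordinate field of \<open>c\<close>; then tensoriality
  exchanges the constant fields of \<open>d\<close> for coordinate fields of
  \<open>c\<close>.\<close>

lemma cov_tensor_chart:
 assumes a: "a : \<W>" and c: "c : \<A>" "p : fst c"
 defines "d == chx p"
 shows "(SU i. of_real (cx c j p d $ i) *C cov_tensor \<A> nab N d (cx d i) (a (int m)) p
   (map (%i. cx c i p) is) (map (%i. cx c i p) js)) =
  nb c j (comp c a js) m is p - (\<Sum>k<length js. a (int m) p (map (%i. cx c i p) is)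
   ((map (%i. cx c i p) js)[k := nab (cx c j) (cx c (js ! k)) p]))"
proof -
 let ?t = "%q L. a (int m) q (take (length is) L) (drop (length is) L)"
 let ?U = "fst c Int fst d"
 have d: "d : \<A>" "p : fst d" using chart_at by (auto simp: d_def)
 have U: "open ?U" "p : ?U" using chart(1)[OF c(1)] chart(1)[OF d(1)] c d by auto
 have t: "mfield (length is + length js) ?t" using tensor_mfield[OF \<W>_field[OF a]] .
 have vc: "vfd ?U (cx c i)" "vfd ?U (const_field \<A> d u)" for i u
  using vector_field_subset[OF vector_field_coord[OF c(1)]] vector_field_subset[OF vector_field_const_field[OF d(1)]] by auto
 let ?Zs = "map (%v. const_field \<A> d (v d)) (map (%i. cx c i p) is @ map (%i. cx c i p) js)"
 have "(SU i. of_real (cx c j p d $ i) *C cov_tensor \<A> nab N d (cx d i) (a (int m)) p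
   (map (%i. cx c i p) is) (map (%i. cx c i p) js)) =
   (SU i. of_real (cx c j p d $ i) *C covf (cx d i) ?t ?Zs p)"
  by (subst cov_tensor_covf[OF _ d]) auto
 also have "... = covf (cx c j) ?t ?Zs p"
  by (rule covf_expandX[OF t U(1) d(1) _ vc(1) U(2), symmetric]) (use vc in auto)
 also have "... = covf (cx c j) ?t ([] @ map (cx c) (is @ js)) p"
  by (subst append_Nil[symmetric, of ?Zs], rule covf_cong[OF t U(1) c(1) _ vc(1) U(2)])
   (use vc in \<open>auto simp: list_all2_map1 list_all2_map2 list_all2_append const_field_eq[OF coord_tangent d] intro!: list_all2_refl list_all2_appendI\<close>)
 finally show ?thesis by (simp only: append_Nil covf_coord[OF a c])
qed

lemma cov_deriv_comp:
 assumes a: "a : \<W>" and c: "c : \<A>" "p : fst c"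
 shows "comp c (cov_deriv \<A> nab N a) [j] m is p = nb c j (comp c a []) m is p"
  and "comp c (cov_deriv \<A> nab N a) [i, j] m is p = nb c i (comp c a [j]) m is p - nb c j (comp c a [i]) m is p"
proof -
 let ?d = "chx p"
 have "comp c (cov_deriv \<A> nab N a) [j] m is p =
   (SU i. of_real (cx c j p ?d $ i) *C cov_tensor \<A> nab N ?d (cx ?d i) (a (int m)) p
    (map (%i. cx c i p) is) (map (%i. cx c i p) []))"
  by (simp add: comp_def cov_deriv_def Let_def sum_apply tmul_dx_alt)
 thus "comp c (cov_deriv \<A> nab N a) [j] m is p = nb c j (comp c a []) m is p"
  unfolding cov_tensor_chart[OF a c] by simp
 have "comp c (cov_deriv \<A> nab N a) [i, j] m is p =
   (SU k. of_real (cx c i p ?d $ k) *C cov_tensor \<A> nab N ?d (cx ?d k) (a (int m)) p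
    (map (%i. cx c i p) is) (map (%i. cx c i p) [j])) -
   (SU k. of_real (cx c j p ?d $ k) *C cov_tensor \<A> nab N ?d (cx ?d k) (a (int m)) p
    (map (%i. cx c i p) is) (map (%i. cx c i p) [i]))"
  by (simp add: comp_def cov_deriv_def Let_def sum_apply tmul_dx_alt sum_subtractf)
 \<comment> \<open>Vanishing torsion: the Christoffel terms of the form index drop out of the
   antisymmetrised derivative.\<close>
 moreover have "nab (cx c i) (cx c j) p = nab (cx c j) (cx c i) p"
  using tangent_eqI[OF nab_tangent nab_tangent, OF c c c] Ga_sym[OF c, of i j] by (simp add: Ga_def vec_eq_iff)
 ultimately show "comp c (cov_deriv \<A> nab N a) [i, j] m is p = nb c i (comp c a [j]) m is p - nb c j (comp c a [i]) m is p"
  unfolding cov_tensor_chart[OF a c] by simp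
qed

lemma der_add: "der f (x + y) vs = der f x vs + der f y vs"
 by (induction vs arbitrary: x y) (simp_all add: algebra_simps)

lemma der_scale: "der f (a *C x) vs = a *C der f (x :: _ => 'z::complex_space) vs"
 by (induction vs arbitrary: x) (simp_all add: scaleC_add_right)

lemma der_V: "x : F.W p ==> der f x vs : V p"
 by (induction vs arbitrary: x) (simp_all add: F.V_zero F.V_add F.W_V F.W_ins del: ins_apply)

lemma const_field_linear:
 assumes "c : \<A>" "q : fst c"
 shows "const_field \<A> c (v + w) q = const_field \<A> c v q + const_field \<A> c w q"
  and "const_field \<A> c (r *\<^sub>R v) q = tscale r (const_field \<A> c v q)"
 using assms linear_add[OF linear_jacobian] linear_scale[OF linear_jacobian]
 by (auto simp: const_field_def tscale_def fun_eq_iff)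

text \<open>A tangent vector is extended with constant components in \<open>c\<close>, and this
  extension is linear in the vector; so each summand of \<open>cov_tensor\<close> is linear in its
  arguments.\<close>

lemma cov_tensor_SY:
 assumes a: "a : \<W>" and c: "c : \<A>" "p : fst c"
 shows "(%vs. cov_tensor \<A> nab N c (cx c i) (a m) p vs []) : SY p"
proof -
 let ?X = "cx c i"
 let ?cf = "%v :: ('m, 'n) tvec. const_field \<A> c (v c)"
 let ?t = "%q vs. a m q vs []"
 let ?g = "%vs q. ?t q (map (%v. ?cf v q) vs)"
 let ?f = "%v. nab ?X (?cf v) p"
 let ?C = "%vs. cov_tensor \<A> nab N c ?X (a m) p vs []"
 have U: "open (fst c)" using chart(1)[OF c(1)] .
 note X = vector_field_coord[OF c(1), of i]
 have vf: "vfd (fst c) (?cf v)" for v by (rule vector_field_const_field[OF c(1)])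
 have t: "?t q : SY q" for q by (rule tensor_at_slice[OF \<W>_tensor[OF a]])
 have g: "S (fst c) (?g vs)" for vs
  using mfield_S_fields[OF tensor_mfield[OF \<W>_field[OF a], of "length vs" 0] U c(1) order_refl, of "map ?cf vs" "[]"] vf
  by (auto simp: o_def)
 have C: "?C vs = N ?X (?g vs) p - der ?f (?t p) vs" if "set vs <= T p" for vs
  using that by (simp add: cov_tensor_def der_sum)
 have C0: "?C vs = 0" if "~ set vs <= T p" for vs using that by (simp add: cov_tensor_def)
 have ft: "?f v : T p" for v by (rule vector_field_tangent[OF nab_vector_field[OF U X vf] c(2)])
 have f_add: "?f (v + w) = ?f v + ?f w" for v w
  using nab_cong[OF U X vector_field_add[OF U vf vf], of ?X "?cf (v + w)" v w p] nab_add[OF U X vf vf c(2), of v w] c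
  by (simp add: const_field_linear[OF c(1)])
 have f_scale: "?f (tscale r v) = tscale r (?f v)" for r v
  using nab_cong[OF U X vector_field_scale[OF U vf smooth_fun_const[of _ r]], of ?X "?cf (tscale r v)" v p]
   nab_scale[OF U X vf smooth_fun_const[of "fst c" r] c(2), of v] c
  by (simp add: const_field_linear[OF c(1)] tscale_def[of r v] dirderiv_const tscale_def[of 0] zero_fun_def[symmetric])
 show ?thesis
 proof (rule SYI)
  have "symm ?C"
   unfolding symm_def
  proof (intro allI)
   fix us vs and u v :: "('m, 'n) tvec"
   have set: "set (us @ u # v # vs) = set (us @ v # u # vs)" by auto
   have "?g (us @ u # v # vs) = ?g (us @ v # u # vs)"
    using F.W_symm[OF SY_W[OF t]] by (intro ext) (simp add: symm_def)
   moreover have "der ?f (?t p) (us @ u # v # vs) = der ?f (?t p) (us @ v # u # vs)"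
    using symm_der[OF F.W_symm[OF SY_W[OF t]]] unfolding symm_def by blast
   ultimately show "?C (us @ u # v # vs) = ?C (us @ v # u # vs)"
    using C[of "us @ u # v # vs"] C[of "us @ v # u # vs"] C0[of "us @ u # v # vs"] C0[of "us @ v # u # vs"]
    by (cases "set (us @ u # v # vs) <= T p") (simp_all only: set simp_thms)
  qed
  moreover have "?C vs : V p" for vs
   using C[of vs] C0[of vs] F.V_diff[OF S_V[OF N_S[OF U X g[of vs]] c(2)] der_V[OF SY_W[OF t[of p]], of ?f vs]] F.V_zero[of p]
   by (cases "set vs <= T p") simp_all
  ultimately show "?C : F.W p" by (auto simp: F.W_def)
  show "?C (v # vs) = 0" if "v \<notin> T p" for v vs by (rule C0) (use that in simp)
  show "ins (v + w) ?C = ins v ?C + ins w ?C" if vw: "v : T p" "w : T p" for v w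
  proof
   fix vs
   show "ins (v + w) ?C vs = (ins v ?C + ins w ?C) vs"
   proof (cases "set vs <= T p")
    case True
    have "N ?X (?g ((v + w) # vs)) p = N ?X (%q. ?g (v # vs) q + ?g (w # vs) q) p"
    proof (rule N_cong[OF U X S_add[OF U g g] _ _ c(2)])
     fix q assume q: "q : fst c"
     show "?g ((v + w) # vs) q = ?g (v # vs) q + ?g (w # vs) q"
      using fun_cong[OF SY_add_arg[OF t[of q] const_field_tangent[of c "v c" q] const_field_tangent[of c "w c" q]]] q
      by (simp add: const_field_linear[OF c(1)])
    qed simp
    also have "... = N ?X (?g (v # vs)) p + N ?X (?g (w # vs)) p" by (rule N_add[OF U X g g c(2)])
    finally have 1: "N ?X (?g ((v + w) # vs)) p = ..." .
    have "der ?f (?t p) ((v + w) # vs) = der ?f (?t p) (v # vs) + der ?f (?t p) (w # vs)"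
     using fun_cong[OF SY_add_arg[OF t[of p] ft[of v] ft[of w]], of vs] SY_add_arg[OF t[of p] vw]
     by (simp add: f_add der_add del: plus_fun_apply) (simp add: der_add)
    with 1 show ?thesis using True vw C[of "(v + w) # vs"] C[of "v # vs"] C[of "w # vs"] by (simp add: tangent_add)
   next
    case False
    thus ?thesis using C0[of "_ # vs"] by simp
   qed
  qed
  show "ins (tscale r v) ?C = of_real r *C ins v ?C" if v: "v : T p" for r v
  proof
   fix vs
   show "ins (tscale r v) ?C vs = (of_real r *C ins v ?C) vs"
   proof (cases "set vs <= T p")
    case True
    have "N ?X (?g (tscale r v # vs)) p = N ?X (%q. of_real r *C ?g (v # vs) q) p"
    proof (rule N_cong[OF U X S_scale_const[OF U g] _ _ c(2)])
     fix q assume q: "q : fst c"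
     show "?g (tscale r v # vs) q = of_real r *C ?g (v # vs) q"
      using fun_cong[OF SY_scale_arg[OF t[of q] const_field_tangent[of c "v c" q], of r]] q
      by (simp add: const_field_linear[OF c(1)] tscale_def[of r v])
    qed simp
    also have "... = of_real r *C N ?X (?g (v # vs)) p" by (rule N_scale_const[OF U X g c(2)])
    finally have 1: "N ?X (?g (tscale r v # vs)) p = ..." .
    have "der ?f (?t p) (tscale r v # vs) = of_real r *C der ?f (?t p) (v # vs)"
     using fun_cong[OF SY_scale_arg[OF t[of p] ft[of v], of r], of vs] SY_scale_arg[OF t[of p] v, of r]
     by (simp add: f_scale der_scale scaleC_add_right)
    with 1 show ?thesis using True v C[of "tscale r v # vs"] C[of "v # vs"] by (simp add: tangent_scale scaleC_diff_right)
   next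
    case False
    thus ?thesis using C0[of "_ # vs"] by simp
   qed
  qed
 qed
qed

lemma cov_deriv_\<W>:
 assumes a: "a : \<W>" "has_deg_a 0 a"
 shows "cov_deriv \<A> nab N a : \<W>"
proof -
 let ?D = "cov_deriv \<A> nab N a"
 have deg: "has_deg_a 1 ?D" using cov_deriv_deg[OF a(2,1)] by simp
 hence z: "?D m p vs ws = 0" if "length ws ~= 1" for m p vs ws using that by (simp add: has_deg_a_def)
 have D1: "?D m p vs [w] = (SU i. (if w : T p then of_real (w (chx p) $ i) *C
   cov_tensor \<A> nab N (chx p) (cx (chx p) i) (a m) p vs [] else 0))" for m p vs w
  by (simp add: cov_deriv_def Let_def sum_apply tmul_dx_alt)
 have "tensor_at \<A> (V p) p (?D m p)" for m p
 proof (rule tensor_at_deg1[OF _ z])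
  fix w
  have "(%vs. ?D m p vs [w]) = (if w : T p then (SU i. of_real (w (chx p) $ i) *C
   (%vs. cov_tensor \<A> nab N (chx p) (cx (chx p) i) (a m) p vs [])) else 0)"
   by (simp add: D1 fun_eq_iff sum_apply)
  thus "(%vs. ?D m p vs [w]) : SY p"
   using SY_zero by (simp add: SY_sum SY_scale cov_tensor_SY[OF a(1) chart_at])
 qed (simp_all add: D1 tangent_add tangent_scale scaleC_add_left sum.distrib scaleC_sum_right scaleC_scaleC,
    simp_all add: tscale_def)
 moreover have "S (fst c) (%p. ?D m p (map (%i. cx c i p) is) (map (%j. cx c j p) js))"
  if c: "c : \<A>" for m c "is" js
 proof (cases "length js = 1 & m \<ge> 0")
  case True
  obtain j where js: "js = [j]" using True by (auto simp: length_Suc_conv)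
  obtain m' where m: "m = int m'" using True nonneg_int_cases by blast
  show ?thesis
   unfolding js m
   by (rule S_cong[OF chart(1)[OF c] S_nb[OF c comp_LS[OF a(1) c, of "[]"], of j m' "is"]])
    (use cov_deriv_comp(1)[OF a(1) c] in \<open>simp add: comp_def[of _ ?D]\<close>)
 next
  case False
  thus ?thesis using z cov_deriv_neg[OF a(1), of m] S_zero[OF chart(1)[OF c]] by (cases "m < 0") auto
 qed
 ultimately show ?thesis using cov_deriv_neg[OF a(1)] by (simp add: W_space_def tensor_field_def)
qed

end

context symplectic_bundle
begin

section \<open>The Fedosov derivation in a chart\<close>

lemma symm_gam: assumes "symm x" shows "symm (gam G x)"
 unfolding symm_def
proof (intro allI)
 fix us u v vs
 show "gam G x (us @ u # v # vs) = gam G x (us @ v # u # vs)"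
  using assms
 proof (induction us arbitrary: x)
  case Nil
  have "x (l # u # vs) = x (u # l # vs)" for l u vs using Nil unfolding symm_def by (metis append_Nil)
  thus ?case using ins_commute[OF Nil, of u v] by simp
 next
  case (Cons w us)
  have "x (l # us @ u # v # vs) = x (l # us @ v # u # vs)" for l
   using Cons.prems unfolding symm_def by (metis append_Cons)
  thus ?case using Cons.IH[OF symm_ins[OF Cons.prems], of w] by (simp del: ins_apply)
 qed
qed

lemma gam_add: "gam G (x + y) is = gam G x is + gam G y is"
 by (induction "is" arbitrary: x y) (simp_all add: scaleC_add_right sum.distrib algebra_simps)

lemma gam_scale: "gam G (a *C x) is = a *C gam G x is"
 by (induction "is" arbitrary: x) (simp_all add: scaleC_add_right scaleC_sum_right scaleC_scaleC mult.commute)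

text \<open>\<open>L1\<close>, \<open>n1\<close> and \<open>m1\<close> are the counterparts of
  \<open>LS\<close>, \<open>nb\<close> and of a single contraction order of \<open>st\<close> for
  one coefficient in \<open>\<lambda>\<close>; the inductions over index lists and contraction
  orders run on these.\<close>

definition L1 :: "('m, 'n) chart => ('n list => 'm => 'v) set"
 where "L1 c = {x. (ALL is. S (fst c) (x is)) & (ALL q:fst c. symm (%is. x is q))}"

definition n1 :: "('m, 'n) chart => 'n => ('n list => 'm => 'v) => 'n list => 'm => 'v"
 where "n1 c j x is q = N (cx c j) (x is) q - gam (%i l. Ga c j i l q) (%is. x is q) is"

definition m1 :: "('m, 'n) chart => nat => ('n list => 'm => 'v) => ('n list => 'm => 'v) => 'n list => 'm => 'v"
 where "m1 c n x y is q = weyl B (Pc c q) (%k. k) n (%is. x is q) (%is. y is q) is"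

lemma L1_S: "x : L1 c ==> S (fst c) (x is)"
 and L1_ins: "x : L1 c ==> ins i x : L1 c"
 by (auto simp: L1_def symm_def) (metis append_Cons)

lemma L1_W: "x : L1 c ==> q : fst c ==> (%is. x is q) : F.W q"
 using S_V[of "fst c" "x _" q] by (auto simp: L1_def F.W_def)

lemma LS_L1: "X : LS c ==> X m : L1 c"
 by (simp add: LS_def L1_def ev_def)

lemma LS_I: "(!!m. X m : L1 c) ==> X : LS c"
 by (simp add: LS_def L1_def ev_def)

context
 fixes c
 assumes c: "c : \<A>"
begin

lemma U: "open (fst c)" by (rule chart(1)[OF c])

lemma X: "vfd (fst c) (cx c j)" by (rule vector_field_coord[OF c])

lemma n1_cong:
 assumes "y : L1 c" "!!is q. q : fst c ==> x is q = y is q" "q : fst c"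
 shows "n1 c j x is q = n1 c j y is q"
proof -
 have "N (cx c j) (x is) q = N (cx c j) (y is) q"
  by (rule N_cong[OF U X L1_S[OF assms(1)] _ _ assms(3)]) (simp_all add: assms(2))
 thus ?thesis by (simp add: n1_def assms(2)[OF assms(3)])
qed

lemma n1_add: "x : L1 c ==> y : L1 c ==> q : fst c ==> n1 c j (%is q. x is q + y is q) is q = n1 c j x is q + n1 c j y is q"
 using gam_add[of _ "%is. x is q" "%is. y is q"] by (simp add: n1_def N_add[OF U X] L1_S plus_fun_def)

lemma n1_scale: "x : L1 c ==> sfu (fst c) f ==> q : fst c ==>
  n1 c j (%is q. f q *C x is q) is q = dd (cx c j q) f q *C x is q + f q *C n1 c j x is q"
 using gam_scale[of _ "f q" "%is. x is q"] by (simp add: n1_def N_scale[OF U X] L1_S scaleC_fun_def scaleC_diff_right)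

lemma L1_zero: "(%is q. 0) : L1 c"
 and L1_add: "x : L1 c ==> y : L1 c ==> (%is q. x is q + y is q) : L1 c"
 and L1_diff: "x : L1 c ==> y : L1 c ==> (%is q. x is q - y is q) : L1 c"
 and L1_scale: "x : L1 c ==> sfu (fst c) f ==> (%is q. f q *C x is q) : L1 c"
 using S_zero[OF U] S_add[OF U] S_diff[OF U] S_scale[OF U] by (simp_all add: L1_def symm_def)

lemma L1_sum: "(!!i. i : I ==> x i : L1 c) ==> (%is q. SUM i:I. x i is q) : L1 c"
 by (induction I rule: ifi) (auto intro: L1_zero L1_add)

lemma n1_sum: "(!!i. i : I ==> x i : L1 c) ==> q : fst c ==>
  n1 c j (%is q. SUM i:I. x i is q) is q = (SUM i:I. n1 c j (x i) is q)"
proof (induction I rule: ifi)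
 case (insert i I)
 thus ?case using n1_add[of "x i" "%is q. SUM i:I. x i is q"] L1_sum[of I x] by simp
qed (use n1_scale[OF L1_zero smooth_fun_const[of _ 0]] in simp_all)

text \<open>Splits off the Christoffel term of the first index and thereby reduces claims about
  \<open>n1\<close> to shorter index lists.\<close>

lemma n1_Cons: "n1 c j x (i # is) q = n1 c j (ins i x) is q - (SU l. Ga c j i l q *C x (l # is) q)"
 by (simp add: n1_def ins_def)

lemma L1_n1: assumes x: "x : L1 c" shows "n1 c j x : L1 c"
proof -
 have "S (fst c) (n1 c j x is)" for "is"
  unfolding n1_def[abs_def] by (intro S_diff U N_S X L1_S[OF x] S_gam c)
 moreover have "symm (%is. n1 c j x is q)" if q: "q : fst c" for q
  unfolding symm_def
 proof (intro allI)
  fix us u v vs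
  have "N (cx c j) (x (us @ u # v # vs)) q = N (cx c j) (x (us @ v # u # vs)) q"
   using x by (intro N_cong[OF U X L1_S[OF x] _ _ q]) (auto simp: L1_def symm_def)
  moreover have "symm (gam (%i l. Ga c j i l q) (%is. x is q))" using x q by (intro symm_gam) (auto simp: L1_def)
  ultimately show "n1 c j x (us @ u # v # vs) q = n1 c j x (us @ v # u # vs) q"
   unfolding n1_def by (simp add: symm_def)
 qed
 ultimately show ?thesis by (simp add: L1_def)
qed

lemma L1_m1:
 assumes "x : L1 c" "y : L1 c" shows "m1 c n x y : L1 c"
proof -
 have "symm (%is. m1 c n x y is q)" if "q : fst c" for q
  using F.W_symm[OF F.W_weyl[OF L1_W[OF assms(1) that] L1_W[OF assms(2) that]]] by (simp add: m1_def)
 thus ?thesis using S_weyl[OF c L1_S[OF assms(1)] L1_S[OF assms(2)]] by (simp add: L1_def m1_def[abs_def])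
qed

lemma m1_Cons:
 assumes "x : L1 c" "y : L1 c" "q : fst c"
 shows "m1 c n x y (i # is) q = m1 c n (ins i x) y is q + m1 c n x (ins i y) is q"
 using fun_cong[OF F.ins_weyl[OF L1_W[OF assms(1,3)] L1_W[OF assms(2,3)], where v=i and P="Pc c q" and e="%k. k" and n=n], of "is"]
 by (simp add: m1_def) (simp add: ins_def)

lemma m1_add:
 assumes "x : L1 c" "x' : L1 c" "y : L1 c" "q : fst c"
 shows "m1 c n (%is q. x is q + x' is q) y is q = m1 c n x y is q + m1 c n x' y is q"
  and "m1 c n y (%is q. x is q + x' is q) is q = m1 c n y x is q + m1 c n y x' is q"
 using fun_cong[OF F.weyl_add_left[OF assms(1-3)[THEN L1_W[OF _ assms(4)]], of "Pc c q" "%k. k" n], of "is"]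
  fun_cong[OF F.weyl_add_right[OF assms(3,1,2)[THEN L1_W[OF _ assms(4)]], of "Pc c q" "%k. k" n], of "is"]
 by (simp_all add: m1_def plus_fun_def)

lemma m1_sum_scale:
 assumes "!!i. x i : L1 c" "y : L1 c" "q : fst c"
 shows "m1 c n (%is q. SUM i:I. f i q *C x i is q) y is q = (SUM i:I. f i q *C m1 c n (x i) y is q)"
  and "m1 c n y (%is q. SUM i:I. f i q *C x i is q) is q = (SUM i:I. f i q *C m1 c n y (x i) is q)"
proof -
 note W = L1_W[OF assms(1) assms(3)] L1_W[OF assms(2,3)]
 have e: "(%is. SUM i:I. f i q *C x i is q) = (SUM i:I. f i q *C (%is. x i is q))" by (simp add: fun_eq_iff sum_apply)
 show "m1 c n (%is q. SUM i:I. f i q *C x i is q) y is q = (SUM i:I. f i q *C m1 c n (x i) y is q)"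
  and "m1 c n y (%is q. SUM i:I. f i q *C x i is q) is q = (SUM i:I. f i q *C m1 c n y (x i) is q)"
  unfolding m1_def e
  by (subst F.weyl_sum_left[OF F.W_scale[OF W(1)] W(2)] F.weyl_sum_right[OF W(2) F.W_scale[OF W(1)]],
    simp add: F.weyl_scale_left[OF W] F.weyl_scale_right[OF W(2,1)] sum_apply)+
qed

lemma m1_Suc: "m1 c (Suc n) x y is q = (1 / of_nat (Suc n)) *C
  (SU k. SU l. Pc c q k l *C m1 c n (ins k x) (ins l y) is q)"
 unfolding m1_def weyl_Suc_apply by (simp add: ins_def del: of_nat_Suc)

lemma Pc_smooth: "sfu (fst c) (%q. Pc c q k l)"
 unfolding Pc_def by (intro smooth_fun_mult U smooth_fun_const La_smooth c)

lemma Pc_deriv: "q : fst c ==> dd (cx c j q) (%q. Pc c q k l) q =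
  - (SU m. Ga c j m k q * Pc c q m l) - (SU m. Ga c j m l q * Pc c q k m)"
 unfolding Pc_def
 by (subst dirderiv_mult[OF smooth_fun_const La_smooth[OF c]])
  (simp_all add: La_deriv[OF c] sum_distrib_left right_diff_distrib ac_simps)

lemma n1_ins: "q : fst c ==> n1 c j (ins k x) is q = ins k (n1 c j x) is q + (SU a. Ga c j k a q *C ins a x is q)"
 by (simp add: n1_Cons)

text \<open>The covariant derivative is a derivation of the Weyl product because the Poisson tensor is
  parallel.\<close>

lemma n1_m1:
 "x : L1 c ==> y : L1 c ==> q : fst c ==> n1 c j (m1 c n x y) is q = m1 c n (n1 c j x) y is q + m1 c n x (n1 c j y) is q"
proof (induction n arbitrary: x y "is" q)
 case 0
 thus ?case
 proof (induction "is" arbitrary: x y)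
  case Nil
  have "m1 c 0 x y [] = (%q. B (x [] q) (y [] q))" by (simp add: m1_def fun_eq_iff)
  thus ?case using N_B[OF U X L1_S[OF Nil(1), of "[]"] L1_S[OF Nil(2), of "[]"] Nil(3)] by (simp add: n1_def m1_def)
 next
  case (Cons i "is")
  let ?i = "%x. ins i x"
  note xy = Cons.prems(1,2) and q = Cons.prems(3)
  note ixy = xy[THEN L1_ins]
  \<comment> \<open>Insertion and covariant differentiation commute up to Christoffel terms, which
    occur with equal total on both sides of the Leibniz rule.\<close>
  have split: "m1 c 0 (?i (n1 c j x)) y is q = m1 c 0 (n1 c j (?i x)) y is q - (SU a. Ga c j i a q *C m1 c 0 (ins a x) y is q)"
   "m1 c 0 y (?i (n1 c j x)) is q = m1 c 0 y (n1 c j (?i x)) is q - (SU a. Ga c j i a q *C m1 c 0 y (ins a x) is q)"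
   if "x : L1 c" "y : L1 c" for x y
  proof -
   have e: "m1 c 0 (n1 c j (?i x)) y is q = m1 c 0 (%is q. ?i (n1 c j x) is q + (SU a. Ga c j i a q *C ins a x is q)) y is q"
    "m1 c 0 y (n1 c j (?i x)) is q = m1 c 0 y (%is q. ?i (n1 c j x) is q + (SU a. Ga c j i a q *C ins a x is q)) is q"
    unfolding m1_def by (simp_all only: n1_ins[OF q])
   have s: "(%is q. SU a. Ga c j i a q *C ins a x is q) : L1 c"
    by (intro L1_sum L1_scale L1_ins that(1) Ga_smooth c)
   note add = m1_add[OF L1_ins[OF L1_n1[OF that(1)]] s that(2) q]
   show "m1 c 0 (?i (n1 c j x)) y is q = m1 c 0 (n1 c j (?i x)) y is q - (SU a. Ga c j i a q *C m1 c 0 (ins a x) y is q)"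
    "m1 c 0 y (?i (n1 c j x)) is q = m1 c 0 y (n1 c j (?i x)) is q - (SU a. Ga c j i a q *C m1 c 0 y (ins a x) is q)"
    unfolding e add m1_sum_scale[OF L1_ins[OF that(1)] that(2) q] by simp_all
  qed
  have "n1 c j (m1 c 0 x y) (i # is) q = n1 c j (%is q. m1 c 0 (?i x) y is q + m1 c 0 x (?i y) is q) is q
    - (SU l. Ga c j i l q *C (m1 c 0 (ins l x) y is q + m1 c 0 x (ins l y) is q))"
  proof -
   have "n1 c j (ins i (m1 c 0 x y)) is q = n1 c j (%is q. m1 c 0 (?i x) y is q + m1 c 0 x (?i y) is q) is q"
    by (rule n1_cong[OF L1_add[OF L1_m1[OF ixy(1) xy(2)] L1_m1[OF xy(1) ixy(2)]] _ q]) (simp add: m1_Cons xy)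
   thus ?thesis by (simp add: n1_Cons m1_Cons xy q)
  qed
  thus ?case
   using split(1)[OF xy] split(2)[OF xy(2,1)] Cons.IH[OF ixy(1) xy(2) q] Cons.IH[OF xy(1) ixy(2) q]
   by (simp add: n1_add[OF L1_m1[OF ixy(1) xy(2)] L1_m1[OF xy(1) ixy(2)] q] m1_Cons L1_n1 xy q scaleC_add_right sum.distrib del: ins_apply)
 qed
next
 case (Suc n)
 note xy = Suc.prems(1,2) and q = Suc.prems(3)
 let ?M = "%k l. m1 c n (ins k x) (ins l y)" and ?P = "%k l. Pc c q k l" and ?G = "%k a. Ga c j k a q"
 have M: "?M k l : L1 c" for k l by (intro L1_m1 L1_ins xy)
 have split: "m1 c n (n1 c j (ins k x)) y is q = m1 c n (ins k (n1 c j x)) y is q + (SU a. ?G k a *C m1 c n (ins a x) y is q)"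
  "m1 c n y (n1 c j (ins k x)) is q = m1 c n y (ins k (n1 c j x)) is q + (SU a. ?G k a *C m1 c n y (ins a x) is q)"
  if "x : L1 c" "y : L1 c" for x y k
 proof -
  have e: "m1 c n (n1 c j (ins k x)) y is q = m1 c n (%is q. ins k (n1 c j x) is q + (SU a. Ga c j k a q *C ins a x is q)) y is q"
   "m1 c n y (n1 c j (ins k x)) is q = m1 c n y (%is q. ins k (n1 c j x) is q + (SU a. Ga c j k a q *C ins a x is q)) is q"
   unfolding m1_def by (simp_all only: n1_ins[OF q])
  have s: "(%is q. SU a. Ga c j k a q *C ins a x is q) : L1 c"
   by (intro L1_sum L1_scale L1_ins that(1) Ga_smooth c)
  show "m1 c n (n1 c j (ins k x)) y is q = m1 c n (ins k (n1 c j x)) y is q + (SU a. ?G k a *C m1 c n (ins a x) y is q)"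
   "m1 c n y (n1 c j (ins k x)) is q = m1 c n y (ins k (n1 c j x)) is q + (SU a. ?G k a *C m1 c n y (ins a x) is q)"
   unfolding e m1_add[OF L1_ins[OF L1_n1[OF that(1)]] s that(2) q] m1_sum_scale[OF L1_ins[OF that(1)] that(2) q] by simp_all
 qed
 have PM: "(%is q. Pc c q k l *C ?M k l is q) : L1 c" for k l by (intro L1_scale M Pc_smooth)
 have "n1 c j (m1 c (Suc n) x y) is q =
   (1 / of_nat (Suc n)) *C (SU k. SU l. n1 c j (%is q. Pc c q k l *C ?M k l is q) is q)"
 proof -
  have s: "(%is q. SU k. SU l. Pc c q k l *C ?M k l is q) : L1 c" by (intro L1_sum PM)
  have "m1 c (Suc n) x y = (%is q. (1 / of_nat (Suc n)) *C (SU k. SU l. Pc c q k l *C ?M k l is q))"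
   by (intro ext) (rule m1_Suc)
  thus ?thesis
   by (simp add: n1_scale[OF s smooth_fun_const q] n1_sum[OF L1_sum[OF PM] q] n1_sum[OF PM q] del: of_nat_Suc ins_apply)
 qed
 also have "(SU k. SU l. n1 c j (%is q. Pc c q k l *C ?M k l is q) is q) =
   (SU k. SU l. dd (cx c j q) (%q. Pc c q k l) q *C ?M k l is q) +
   (SU k. SU l. ?P k l *C (m1 c n (n1 c j (ins k x)) (ins l y) is q + m1 c n (ins k x) (n1 c j (ins l y)) is q))"
  by (simp add: n1_scale[OF M Pc_smooth q] Suc.IH[OF L1_ins[OF xy(1)] L1_ins[OF xy(2)] q] sum.distrib del: ins_apply)
 \<comment> \<open>Moving the derivative past the two insertions produces Christoffel terms in the
   contracted indices. After renaming of indices they are the negative of the derivative of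
   \<open>Pc\<close> and cancel it.\<close>
 also have "(SU k. SU l. ?P k l *C (m1 c n (n1 c j (ins k x)) (ins l y) is q + m1 c n (ins k x) (n1 c j (ins l y)) is q)) =
   (SU k. SU l. ?P k l *C (m1 c n (ins k (n1 c j x)) (ins l y) is q + m1 c n (ins k x) (ins l (n1 c j y)) is q)) +
   ((SU k. SU l. SU a. (?P k l * ?G k a) *C ?M a l is q) + (SU k. SU l. SU a. (?P k l * ?G l a) *C ?M k a is q))"
  by (simp add: split(1)[OF xy(1) L1_ins[OF xy(2)]] split(2)[OF xy(2) L1_ins[OF xy(1)]] scaleC_add_right scaleC_sum_right
    scaleC_scaleC sum.distrib del: ins_apply)
 also have "(SU k. SU l. SU a. (?P k l * ?G k a) *C ?M a l is q) = (SU k. SU l. (SU m. ?G m k * ?P m l) *C ?M k l is q)"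
 proof -
  have "(SU k. SU l. SU a. (?P k l * ?G k a) *C ?M a l is q) = (SU k. SU a. SU l. (?P k l * ?G k a) *C ?M a l is q)"
   by (rule sum.cong[OF refl], rule sum.swap)
  also have "... = (SU a. SU k. SU l. (?P k l * ?G k a) *C ?M a l is q)" by (rule sum.swap)
  also have "... = (SU a. SU l. SU k. (?P k l * ?G k a) *C ?M a l is q)"
   by (rule sum.cong[OF refl], rule sum.swap)
  finally show ?thesis by (simp add: scaleC_sum_left mult.commute)
 qed
 also have "(SU k. SU l. SU a. (?P k l * ?G l a) *C ?M k a is q) = (SU k. SU l. (SU m. ?G m l * ?P k m) *C ?M k l is q)"
  by (rule sum.cong[OF refl], subst sum.swap) (simp add: scaleC_sum_left mult.commute)
 finally show ?case
  unfolding m1_Suc by (simp add: Pc_deriv[OF q] scaleC_add_left scaleC_add_right scaleC_diff_left sum.distrib sum_subtractf sum_negf del: of_nat_Suc ins_apply)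
qed

text \<open>One index contributes one curvature term: the products of Christoffel symbols with first
  derivatives of \<open>x\<close> are symmetric in \<open>i\<close> and \<open>j\<close>, and what
  remains is the coordinate formula \<open>Ri_eq\<close>.\<close>

lemma n1_commutator_Cons:
 assumes x: "x : L1 c" and q: "q : fst c"
 shows "n1 c i (n1 c j x) (k # is) q - n1 c j (n1 c i x) (k # is) q =
  n1 c i (n1 c j (ins k x)) is q - n1 c j (n1 c i (ins k x)) is q - (SU a. Ri c k i j a q *C x (a # is) q)"
proof -
 have D: "n1 c i (n1 c j x) (k # is) q = n1 c i (n1 c j (ins k x)) is q
   - (SU a. dd (cx c i q) (Ga c j k a) q *C x (a # is) q)
   - (SU a. Ga c j k a q *C n1 c i (ins a x) is q)
   - (SU a. Ga c i k a q *C n1 c j (ins a x) is q)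
   + (SU a. (SU m. Ga c i k m q * Ga c j m a q) *C x (a # is) q)" for i j
 proof -
  have s: "(%is q. Ga c j k a q *C ins a x is q) : L1 c" for a
   by (intro L1_scale L1_ins x Ga_smooth c)
  have "n1 c i (ins k (n1 c j x)) is q = n1 c i (%is q. n1 c j (ins k x) is q - (SU a. Ga c j k a q *C ins a x is q)) is q"
   by (rule n1_cong[OF L1_diff[OF L1_n1[OF L1_ins[OF x]] L1_sum[OF s]] _ q]) (simp add: n1_Cons)
  also have "... = n1 c i (n1 c j (ins k x)) is q - (SU a. n1 c i (%is q. Ga c j k a q *C ins a x is q) is q)"
  proof -
   let ?y = "n1 c j (ins k x)" and ?s = "%is q. SU a. Ga c j k a q *C ins a x is q"
   have y: "?y : L1 c" and ss: "?s : L1 c" by (intro L1_n1 L1_ins x L1_sum s)+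
   have "n1 c i ?y is q = n1 c i (%is q. (?y is q - ?s is q) + ?s is q) is q" by simp
   also have "... = n1 c i (%is q. ?y is q - ?s is q) is q + n1 c i ?s is q" by (rule n1_add[OF L1_diff[OF y ss] ss q])
   finally show ?thesis by (simp add: n1_sum[OF s q] del: ins_apply)
  qed
  also have "... = n1 c i (n1 c j (ins k x)) is q - (SU a. dd (cx c i q) (Ga c j k a) q *C x (a # is) q)
    - (SU a. Ga c j k a q *C n1 c i (ins a x) is q)"
   by (simp only: n1_scale[OF L1_ins[OF x] Ga_smooth[OF c] q] sum.distrib) simp
  finally have 1: "n1 c i (ins k (n1 c j x)) is q = ..." .
  have "(SU m. Ga c i k m q *C n1 c j x (m # is) q) = (SU m. Ga c i k m q *C n1 c j (ins m x) is q)
    - (SU m. SU a. (Ga c i k m q * Ga c j m a q) *C x (a # is) q)"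
   by (simp add: n1_Cons scaleC_diff_right sum_subtractf scaleC_sum_right scaleC_scaleC)
  also have "(SU m. SU a. (Ga c i k m q * Ga c j m a q) *C x (a # is) q) =
    (SU a. (SU m. Ga c i k m q * Ga c j m a q) *C x (a # is) q)"
   by (subst sum.swap) (simp add: scaleC_sum_left)
  finally show ?thesis unfolding n1_Cons[of i "n1 c j x"] 1 by (simp del: ins_apply)
 qed
 show ?thesis
  unfolding D[of i j] D[of j i] Ri_eq[OF c q]
  by (simp add: scaleC_add_left scaleC_diff_left sum.distrib sum_subtractf algebra_simps)
qed

end

end

section \<open>The Fedosov derivation in components and its square\<close>

context symplectic_bundle
begin

abbreviation (input) K :: "('m, 'n) chart => 'm => (nat => 'n list => 'v) => (nat => 'n list => 'v) => nat => 'n list => 'v"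
 where "K c q == F.comm (Pc c q) (%k. k)"

text \<open>This is \<open>(i/\<lambda>) ad\<close>: the shift to \<open>Suc m\<close> divides by
  \<open>\<lambda>\<close>. A coefficient of order zero would be discarded silently; it vanishes
  where this is applied, by \<open>R_central\<close>.\<close>

definition lad :: "('m, 'n) chart => (nat => 'n list => 'm => 'v) => (nat => 'n list => 'm => 'v) => nat => 'n list => 'm => 'v"
 where "lad c R X m is q = \<i> *C (st c R X (Suc m) is q - st c X R (Suc m) is q)"

text \<open>The \<open>j\<close>-th form component of
  \<open>-\<delta> + D + (i/\<lambda>) ad(r)\<close> on sections of form degree 0, where
  \<open>\<delta>\<close> turns the first symmetric index into the form index.\<close>

definition fed :: "('m, 'n) chart => ('n => nat => 'n list => 'm => 'v) => 'n => (nat => 'n list => 'm => 'v) => nat => 'n list => 'm => 'v"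
 where "fed c R j X m is q = nb c j X m is q - X m (j # is) q + lad c (R j) X m is q"

lemma nb_n1: "nb c j X m = n1 c j (X m)"
 by (simp add: nb_def n1_def ev_def fun_eq_iff)

lemma ev_lad: "ev q (lad c R X) = (%m. \<i> *C K c q (ev q R) (ev q X) (Suc m))"
 by (simp add: fun_eq_iff ev_def lad_def F.comm_def st_def)

context
 fixes c
 assumes c: "c : \<A>"
begin

lemma LS_nb: "X : LS c ==> nb c j X : LS c"
 by (rule LS_I, unfold nb_n1, rule L1_n1[OF c], rule LS_L1)

lemma LS_ins: "X : LS c ==> (%m. ins j (X m)) : LS c"
 by (rule LS_I, rule L1_ins, rule LS_L1)

lemma LS_lad: assumes "R : LS c" "X : LS c" shows "lad c R X : LS c"
proof (rule LS_I)
 fix m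
 have "(%is q. \<i> *C (st c R X (Suc m) is q - st c X R (Suc m) is q)) : L1 c"
  using LS_st[OF c] assms by (intro L1_scale[OF c] L1_diff[OF c] smooth_fun_const) (simp_all add: LS_L1)
 thus "lad c R X m : L1 c" by (simp add: lad_def[abs_def])
qed

lemma LS_fed: assumes "R j : LS c" "X : LS c" shows "fed c R j X : LS c"
proof (rule LS_I)
 fix m
 have "(%is q. (nb c j X m is q - ins j (X m) is q) + lad c (R j) X m is q) : L1 c"
  by (intro L1_add[OF c] L1_diff[OF c] L1_ins LS_L1[OF LS_nb] LS_L1[OF LS_lad] LS_L1[OF assms(2)] assms)
 thus "fed c R j X m : L1 c" by (simp add: fed_def[abs_def])
qed

lemma nb_st:
 assumes X: "X : LS c" and Y: "Y : LS c" and q: "q : fst c"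
 shows "nb c j (st c X Y) m is q = st c (nb c j X) Y m is q + st c X (nb c j Y) m is q"
proof -
 have st: "st c X Y m is q = (SUM t:triples m. m1 c (snd (snd t)) (X (fst t)) (Y (fst (snd t))) is q)" for X Y q "is" m
  by (simp add: st_def wstar_apply m1_def ev_def split_def)
 have L: "m1 c (snd (snd t)) (X (fst t)) (Y (fst (snd t))) : L1 c" for t :: "nat \<times> nat \<times> nat"
  by (intro L1_m1[OF c] LS_L1[OF X] LS_L1[OF Y])
 have "nb c j (st c X Y) m is q = n1 c j (%is q. SUM t:triples m. m1 c (snd (snd t)) (X (fst t)) (Y (fst (snd t))) is q) is q"
  by (simp only: nb_n1 st[abs_def])
 also have "... = (SUM t:triples m. n1 c j (m1 c (snd (snd t)) (X (fst t)) (Y (fst (snd t)))) is q)"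
  by (rule n1_sum[OF c L q])
 also have "... = st c (nb c j X) Y m is q + st c X (nb c j Y) m is q"
  by (simp add: st n1_m1[OF c LS_L1[OF X] LS_L1[OF Y] q] sum.distrib nb_n1)
 finally show ?thesis .
qed

lemma nb_lad:
 assumes R: "R : LS c" and X: "X : LS c" and q: "q : fst c"
 shows "nb c i (lad c R X) m is q = lad c (nb c i R) X m is q + lad c R (nb c i X) m is q"
proof -
 have L: "st c R X (Suc m) : L1 c" "st c X R (Suc m) : L1 c" by (intro LS_L1[OF LS_st] c R X)+
 let ?a = "st c R X (Suc m)" and ?b = "st c X R (Suc m)"
 have L': "(%is q. (- 1) *C ?b is q) : L1 c" by (rule L1_scale[OF c L(2) smooth_fun_const])
 have "nb c i (lad c R X) m is q = n1 c i (%is q. \<i> *C (?a is q + (- 1) *C ?b is q)) is q"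
  by (simp add: nb_n1 lad_def[abs_def])
 also have "... = \<i> *C (n1 c i ?a is q - n1 c i ?b is q)"
  by (simp only: n1_scale[OF c L1_add[OF c L(1) L'] smooth_fun_const q] n1_add[OF c L(1) L' q]
   n1_scale[OF c L(2) smooth_fun_const q]) simp
 also have "... = lad c (nb c i R) X m is q + lad c R (nb c i X) m is q"
  using nb_st[OF R X q, of i "Suc m" "is"] nb_st[OF X R q, of i "Suc m" "is"]
  by (simp add: nb_n1 lad_def scaleC_simps)
 finally show ?thesis .
qed

lemma nb_fed:
 assumes R: "R j : LS c" and X: "X : LS c" and q: "q : fst c"
 shows "nb c i (fed c R j X) m is q =
  n1 c i (n1 c j (X m)) is q - n1 c i (ins j (X m)) is q + lad c (nb c i (R j)) X m is q + lad c (R j) (nb c i X) m is q"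
proof -
 have L: "n1 c j (X m) : L1 c" "ins j (X m) : L1 c" "lad c (R j) X m : L1 c"
  by (intro L1_n1[OF c] L1_ins LS_L1[OF X] LS_L1[OF LS_lad] R X)+
 have L': "(%is q. (- 1) *C ins j (X m) is q) : L1 c" by (rule L1_scale[OF c L(2) smooth_fun_const])
 have "nb c i (fed c R j X) m is q = n1 c i (%is q. (n1 c j (X m) is q + (- 1) *C ins j (X m) is q) + lad c (R j) X m is q) is q"
  by (simp add: nb_n1 fed_def[abs_def])
 also have "... = n1 c i (n1 c j (X m)) is q - n1 c i (ins j (X m)) is q + nb c i (lad c (R j) X) m is q"
  by (simp only: n1_add[OF c L1_add[OF c L(1) L'] L(3) q] n1_add[OF c L(1) L' q] n1_scale[OF c L(2) smooth_fun_const q] nb_n1) simp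
 finally show ?thesis by (simp add: nb_lad[OF R X q] del: ins_apply)
qed

text \<open>The curvature of the Fedosov connection is the commutator with its Weyl curvature; the
  hypothesis on \<open>H\<close> is the equation for the Fedosov element.\<close>

lemma fed_commute:
 assumes R: "!!j. R j : LS c" and X: "X : LS c" and p: "p : fst c" and H: "H : F.WS p"
  and central: "!!j is q b. b : V p ==> B (R j 0 is p) b = B b (R j 0 is p)"
  and R_eq: "!!m is. R j m (i # is) p - R i m (j # is) p = H m is + nb c i (R j) m is p - nb c j (R i) m is p
   + \<i> *C K c p (ev p (R i)) (ev p (R j)) (Suc m) is"
  and curv: "!!m is. n1 c i (n1 c j (X m)) is p - n1 c j (n1 c i (X m)) is p = \<i> *C K c p H (ev p X) (Suc m) is"
 shows "fed c R i (fed c R j X) m is p = fed c R j (fed c R i X) m is p"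
proof -
 let ?K = "K c p"
 define y where "y = ev p X"
 define \<rho> where "\<rho> j = ev p (R j)" for j
 define yi where "yi i = (%m. ins i (y m))" for i
 define \<rho>i where "\<rho>i j i = (%m. ins i (\<rho> j m))" for j i
 define yn where "yn i = ev p (nb c i X)" for i
 define \<rho>n where "\<rho>n j i = ev p (nb c i (R j))" for j i
 define sh where "sh z = (%m. z (Suc m))" for z :: "nat => 'n list => 'v"
 have WS: "y : F.WS p" "\<rho> j : F.WS p" "yi j : F.WS p" "\<rho>i j i : F.WS p" "yn i : F.WS p" "\<rho>n j i : F.WS p" for i j
  unfolding y_def \<rho>_def yi_def \<rho>i_def yn_def \<rho>n_def by (intro F.WS_ins LS_WS[OF _ p] X R LS_nb)+
 have WSK: "?K a b : F.WS p" "sh (?K a b) : F.WS p" if "a : F.WS p" "b : F.WS p" for a b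
  using F.WS_comm[OF that] unfolding sh_def by (auto intro: F.WS_shift)
 \<comment> \<open>This is where \<open>central\<close> enters: commutators with
   \<open>\<rho> j\<close> are divisible by \<open>\<lambda>\<close>, so both divisions in a double
   commutator can be carried out outside.\<close>
 have K0: "?K (\<rho> j) b 0 = 0" if "b : F.WS p" for j b
  by (rule F.comm_0[OF WS(2) that]) (simp add: \<rho>_def ev_def central)
 have evfed: "ev p (fed c R j X) = yn j - yi j + \<i> *C sh (?K (\<rho> j) y)" for j
  using ev_lad[of p c "R j" X] by (simp add: fun_eq_iff ev_def fed_def yn_def yi_def sh_def \<rho>_def y_def)
 have E: "fed c R i (fed c R j X) m is p =
   (n1 c i (n1 c j (X m)) is p - n1 c i (ins j (X m)) is p + \<i> *C ?K (\<rho>n j i) y (Suc m) is + \<i> *C ?K (\<rho> j) (yn i) (Suc m) is)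
   - (n1 c j (ins i (X m)) is p - (SU l. Ga c j i l p *C X m (l # is) p) - X m (j # i # is) p
     + \<i> *C ?K (\<rho>i j i) y (Suc m) is + \<i> *C ?K (\<rho> j) (yi i) (Suc m) is)
   + (\<i> *C ?K (\<rho> i) (yn j) (Suc m) is - \<i> *C ?K (\<rho> i) (yi j) (Suc m) is - ?K (\<rho> i) (?K (\<rho> j) y) (Suc (Suc m)) is)" for i j
 proof -
  have lad_eq: "lad c A Z m is p = \<i> *C ?K (ev p A) (ev p Z) (Suc m) is" for A Z m "is"
   by (simp add: lad_def F.comm_def st_def)
  have 1: "fed c R j X m (i # is) p = n1 c j (ins i (X m)) is p - (SU l. Ga c j i l p *C X m (l # is) p) - X m (j # i # is) p
     + \<i> *C ?K (\<rho>i j i) y (Suc m) is + \<i> *C ?K (\<rho> j) (yi i) (Suc m) is"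
   using fun_cong[OF F.ins_comm[OF WS(2)[of j] WS(1), of i "Pc c p" "%k. k" "Suc m"], of "is"]
   by (simp add: fed_def nb_n1 n1_Cons[OF c] lad_eq y_def[symmetric] \<rho>_def[symmetric] \<rho>i_def yi_def scaleC_add_right del: ins_apply)
    (simp add: scaleC_add_right[symmetric])
  have 2: "lad c (R i) (fed c R j X) m is p = \<i> *C ?K (\<rho> i) (yn j) (Suc m) is - \<i> *C ?K (\<rho> i) (yi j) (Suc m) is
    - ?K (\<rho> i) (?K (\<rho> j) y) (Suc (Suc m)) is"
  proof -
   have "?K (\<rho> i) (sh (?K (\<rho> j) y)) (Suc m) = ?K (\<rho> i) (?K (\<rho> j) y) (Suc (Suc m))"
    unfolding sh_def by (rule F.comm_shift_right[OF WS(2) WSK(1)[OF WS(2,1)] K0[OF WS(1)]])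
   thus ?thesis
    unfolding lad_eq evfed \<rho>_def[symmetric]
    by (simp add: F.comm_add_right[where p=p] F.comm_diff_right[where p=p] F.comm_scale_right[where p=p] WS WSK
      F.WS_diff[where p=p] F.WS_scale[where p=p] scaleC_simps)
  qed
  show ?thesis
   unfolding fed_def[of c R i "fed c R j X"] nb_fed[OF R X p] 1 2 unfolding lad_eq
   by (simp add: \<rho>n_def yn_def \<rho>_def y_def)
 qed
 have Req: "\<rho>i j i - \<rho>i i j = H + \<rho>n j i - \<rho>n i j + \<i> *C sh (?K (\<rho> i) (\<rho> j))"
  using R_eq by (simp add: fun_eq_iff \<rho>i_def \<rho>_def \<rho>n_def sh_def ev_def)
 have "?K (\<rho>i j i) y - ?K (\<rho>i i j) y = ?K (\<rho>i j i - \<rho>i i j) y"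
  by (rule F.comm_diff_left[symmetric, OF WS(4,4,1)])
 also have "... = ?K H y + ?K (\<rho>n j i) y - ?K (\<rho>n i j) y + \<i> *C ?K (sh (?K (\<rho> i) (\<rho> j))) y"
  unfolding Req
  by (simp add: F.comm_add_left[where p=p] F.comm_diff_left[where p=p] F.comm_scale_left[where p=p] WS WSK H
    F.WS_diff[where p=p] F.WS_add[where p=p] F.WS_scale[where p=p])
 finally have D: "?K (\<rho>i j i) y (Suc m) is - ?K (\<rho>i i j) y (Suc m) is = ?K H y (Suc m) is
   + ?K (\<rho>n j i) y (Suc m) is - ?K (\<rho>n i j) y (Suc m) is + \<i> *C ?K (sh (?K (\<rho> i) (\<rho> j))) y (Suc m) is"
  by (simp add: fun_eq_iff)
 \<comment> \<open>The double commutators carry \<open>i/\<lambda>\<close> twice. By the Jacobi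
   identity their difference is the commutator with the quadratic term of
   \<open>R_eq\<close>.\<close>
 have "?K (sh (?K (\<rho> i) (\<rho> j))) y (Suc m) = ?K (?K (\<rho> i) (\<rho> j)) y (Suc (Suc m))"
  unfolding sh_def by (rule F.comm_shift_left[OF WSK(1)[OF WS(2,2)] WS(1) K0[OF WS(2)]])
 also have "... = ?K (\<rho> i) (?K (\<rho> j) y) (Suc (Suc m)) - ?K (\<rho> j) (?K (\<rho> i) y) (Suc (Suc m))"
  by (simp add: F.comm_jacobi[OF WS(2,2,1), symmetric])
 finally have J: "?K (sh (?K (\<rho> i) (\<rho> j))) y (Suc m) is =
   ?K (\<rho> i) (?K (\<rho> j) y) (Suc (Suc m)) is - ?K (\<rho> j) (?K (\<rho> i) y) (Suc (Suc m)) is" by simp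
 have sym: "X m (j # i # is) p = X m (i # j # is) p"
 proof -
  have "symm (ev p X m)" using X p by (simp add: LS_def)
  from this[unfolded symm_def, THEN spec[of _ "[]"], THEN spec[of _ j], THEN spec[of _ i], THEN spec[of _ "is"]]
  show ?thesis by (simp add: ev_def)
 qed
 have C: "n1 c i (n1 c j (X m)) is p - n1 c j (n1 c i (X m)) is p = \<i> *C ?K H y (Suc m) is"
  using curv by (simp add: y_def)
 have D': "\<i> *C ?K (\<rho>i j i) y (Suc m) is - \<i> *C ?K (\<rho>i i j) y (Suc m) is = \<i> *C ?K H y (Suc m) is
   + \<i> *C ?K (\<rho>n j i) y (Suc m) is - \<i> *C ?K (\<rho>n i j) y (Suc m) is
   - (?K (\<rho> i) (?K (\<rho> j) y) (Suc (Suc m)) is - ?K (\<rho> j) (?K (\<rho> i) y) (Suc (Suc m)) is)"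
  using arg_cong[OF D, of "scaleC \<i>"] J by (simp add: scaleC_simps)
 have Gs: "(SU l. Ga c j i l p *C X m (l # is) p) = (SU l. Ga c i j l p *C X m (l # is) p)"
  by (simp add: Ga_sym[OF c p])
 show ?thesis
  unfolding E[of i j] E[of j i] Gs sym
  using C D' by (simp add: algebra_simps del: ins_apply)
qed

end

section \<open>The curvature as a commutator\<close>

text \<open>The Weyl curvature at a point: the quadratic part is the curvature of the base connection, the
  other parts are constant in the fibre direction.\<close>

definition Hc :: "('m, 'n) chart => 'n => 'n => 'm => 'v => (nat => complex) => nat => 'n list => 'v"
 where "Hc c i j p \<rho> w m is =
  (if m = 0 & length is = 2 then (SU k. om c p $ (is ! 0) $ k * Ri c (is ! 1) i j k p) *C u p else 0)
  + (if m = 1 & is = [] then - (\<i> *C \<rho>) else 0) + (if is = [] then w m *C u p else 0)"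

lemma weyl_const_left:
 assumes "a : V p" "y : F.W p" shows "weyl B P e n (F.const a) y vs = (if n = 0 then B a (y vs) else 0)"
  and "weyl B P e n y (F.const a) vs = (if n = 0 then B (y vs) a else 0)"
proof -
 have z: "shuf B 0 y = 0" "shuf B y 0 = 0" if "y : F.W p" for y
  using F.weyl_zero_left[OF that, of _ _ 0] F.weyl_zero_right[OF that, of _ _ 0] by simp_all
 have "shuf B (F.const a) y vs = B a (y vs) & shuf B y (F.const a) vs = B (y vs) a"
  using assms(2)
 proof (induction vs arbitrary: y)
  case (Cons v vs)
  thus ?case using Cons.IH[OF F.W_ins[OF Cons.prems, of v]] z[OF Cons.prems] by (simp del: ins_apply) simp
 qed (simp add: F.const_def)
 moreover have "weyl B P e n (F.const a) y = 0" "weyl B P e n y (F.const a) = 0" if nz: "n ~= 0"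
 proof -
  obtain n' where n: "n = Suc n'" using nz not0_implies_Suc by blast
  show "weyl B P e n (F.const a) y = 0" "weyl B P e n y (F.const a) = 0"
   unfolding n by (rule F.weyl_const_Suc[OF assms(2)])+
 qed
 ultimately show "weyl B P e n (F.const a) y vs = (if n = 0 then B a (y vs) else 0)"
  "weyl B P e n y (F.const a) vs = (if n = 0 then B (y vs) a else 0)" by auto
qed

lemma Pc_antisym: "c : \<A> ==> p : fst c ==> Pc c p k l = - Pc c p l k"
 unfolding Pc_def by (subst La_antisym) auto

text \<open>The quadratic part acts through its first contraction only and yields the curvature term
  of an index. The constant part at order \<open>\<lambda>\<close> acts as the commutator with
  \<open>\<rho>\<close>, because \<open>(i/\<lambda>) (-i \<lambda>) = 1\<close>. The terms
  \<open>w m\<close> are multiples of the unit and commute with everything.\<close>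

lemma comm_Hc:
 assumes c: "c : \<A>" "p : fst c" and \<rho>: "\<rho> : V p" and y: "Y : F.WS p"
 shows "Hc c i j p \<rho> w : F.WS p"
  and "\<i> *C K c p (Hc c i j p \<rho> w) Y (Suc m) [] = B \<rho> (Y m []) - B (Y m []) \<rho>"
  and "\<i> *C K c p (Hc c i j p \<rho> w) Y (Suc m) (a # is) =
   \<i> *C K c p (Hc c i j p \<rho> w) (%m. ins a (Y m)) (Suc m) is - (SU l. Ri c a i j l p *C Y m (l # is))"
proof -
 let ?M = "weyl B (Pc c p) (%k. k)"
 define r where "r k l = (SU m. om c p $ k $ m * Ri c l i j m p)" for k l
 have r_sym: "r k l = r l k" for k l unfolding r_def by (rule Ri_sym[OF c])
 define Q where "Q is = (if length is = 2 then r (is ! 0) (is ! 1) *C u p else 0)" for "is"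
 have Q_eval: "Q [k, l] = r k l *C u p" for k l by (simp add: Q_def)
 have insQ: "ins a (ins k Q) = F.const (r a k *C u p)" for a k
  by (auto simp: Q_def F.const_def fun_eq_iff r_sym[of a k])
 have Q: "Q : F.W p"
 proof -
  have "Q (us @ k # l # vs) = Q (us @ l # k # vs)" for us k l vs
  proof (cases "us = [] & vs = []")
   case True thus ?thesis using Q_eval r_sym by simp
  qed (auto simp: Q_def)
  thus ?thesis using F.V_zero F.V_scale[OF F.u_closed] by (auto simp: F.W_def symm_def Q_def)
 qed
 define h where "h m = (if m = 0 then Q else 0) + F.const ((if m = 1 then - (\<i> *C \<rho>) else 0) + w m *C u p)" for m
 have Hc: "Hc c i j p \<rho> w = h"
  by (auto simp: fun_eq_iff Hc_def h_def Q_def r_def F.const_def)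
 have cV: "(if m = 1 then - (\<i> *C \<rho>) else 0) + w m *C u p : V p" for m
  by (simp add: F.V_add F.V_minus F.V_scale F.V_zero F.u_closed \<rho>)
 thus HWS: "Hc c i j p \<rho> w : F.WS p"
  unfolding Hc F.WS_def h_def mem_Collect_eq
  by (intro allI F.W_add F.W_const cV) (simp add: Q F.W_zero)
 have kK: "K c p h Y (Suc m) is = 2 *C ?M 1 Q (Y m) is + B (- (\<i> *C \<rho>)) (Y m is) - B (Y m is) (- (\<i> *C \<rho>))"
  if Y: "Y : F.WS p" for Y m "is"
 proof -
  have yW: "Y j : F.W p" for j by (rule F.WS_W[OF Y])
  \<comment> \<open>Even orders cancel by \<open>weyl_central\<close>, order one is doubled, and
    from order three on the contraction exhausts the quadratic function.\<close>
  have Qn: "?M n Q (Y j) - ?M n (Y j) Q = (if n = 1 then 2 *C ?M 1 Q (Y j) else 0)" for n j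
  proof -
   have "B (Q vs) b = B b (Q vs)" if "b : V p" for vs b
    by (simp add: Q_def F.B_scale_left[OF F.u_closed that] F.B_scale_right[OF that F.u_closed]
      F.B_u_left[OF that] F.B_u_right[OF that] F.B_zero_left[OF that] F.B_zero_right[OF that])
   hence *: "?M n Q (Y j) = (- 1) ^ n *C ?M n (Y j) Q"
    by (intro F.weyl_central[OF Q yW] Pc_antisym[OF c])
   show ?thesis
   proof (cases "n \<ge> 3")
    case True
    then obtain n' where n: "n = Suc (Suc (Suc n'))" by (metis Suc_le_D numeral_3_eq_3 Suc_le_mono)
    have "?M (Suc n') (ins k' (ins k Q)) z = 0" if "z : F.W p" for k k' z
     unfolding insQ by (rule F.weyl_const_Suc(2)[OF that])
    hence "?M n Q (Y j) = 0"
     unfolding n weyl.simps(2)[of _ _ _ "Suc (Suc n')"] weyl.simps(2)[of _ _ _ "Suc n'"]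
     by (simp add: F.W_ins yW del: weyl.simps of_nat_Suc)
    moreover hence "?M n (Y j) Q = 0" using * by (cases "even n") auto
    ultimately show ?thesis using True by simp
   next
    case False
    then consider "n = 0" | "n = 1" | "n = 2" by linarith
    thus ?thesis
    proof cases
     case 2
     have "2 *C ?M 1 Q (Y j) = ?M 1 Q (Y j) + ?M 1 Q (Y j)"
      using scaleC_add_left[of 1 1 "?M 1 Q (Y j)"] by simp
     thus ?thesis using * 2 by (simp del: weyl.simps)
    qed (use * in simp_all)
   qed
  qed
  have hn: "?M n (h s) (Y j) is - ?M n (Y j) (h s) is =
    (if n = 1 & s = 0 then 2 *C ?M 1 Q (Y j) is else 0) +
    (if n = 0 & s = 1 then B (- (\<i> *C \<rho>)) (Y j is) - B (Y j is) (- (\<i> *C \<rho>)) else 0)" for n s j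
  proof -
   let ?q = "if s = 0 then Q else 0" and ?k = "(if s = 1 then - (\<i> *C \<rho>) else 0) + w s *C u p"
   have q: "?q : F.W p" using Q by (simp add: F.W_zero)
   have k: "F.const ?k : F.W p" by (intro F.W_const cV)
   have "?M n (h s) (Y j) is - ?M n (Y j) (h s) is = (?M n ?q (Y j) - ?M n (Y j) ?q) is
     + (?M n (F.const ?k) (Y j) is - ?M n (Y j) (F.const ?k) is)"
    unfolding h_def by (simp only: F.weyl_add_left[OF q k yW] F.weyl_add_right[OF yW q k]) (simp del: weyl.simps)
   also have "(?M n ?q (Y j) - ?M n (Y j) ?q) is = (if n = 1 & s = 0 then 2 *C ?M 1 Q (Y j) is else 0)"
    using fun_cong[OF Qn[of n j], of "is"] by (cases "n = 1") (simp_all add: yW F.weyl_zero_left[where p=p] F.weyl_zero_right[where p=p] del: weyl.simps)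
   also have "?M n (F.const ?k) (Y j) is - ?M n (Y j) (F.const ?k) is =
     (if n = 0 & s = 1 then B (- (\<i> *C \<rho>)) (Y j is) - B (Y j is) (- (\<i> *C \<rho>)) else 0)"
   proof -
    have V: "(if s = 1 then - (\<i> *C \<rho>) else 0) : V p" "w s *C u p : V p" "Y j is : V p"
     using F.W_V[OF yW] by (auto intro: F.V_minus F.V_scale \<rho> F.V_zero F.u_closed)
    show ?thesis
     unfolding weyl_const_left[OF cV yW] F.B_add_left[OF V] F.B_add_right[OF V(3,1,2)]
      F.B_scale_left[OF F.u_closed V(3)] F.B_scale_right[OF V(3) F.u_closed] F.B_u_left[OF V(3)] F.B_u_right[OF V(3)]
     using F.B_zero_left[OF V(3)] F.B_zero_right[OF V(3)] by simp
   qed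
   finally show ?thesis .
  qed
  have "K c p h Y (Suc m) is = (\<Sum>(s, j, n)\<in>triples (Suc m). ?M n (h s) (Y j) is) - (\<Sum>(j, s, n)\<in>triples (Suc m). ?M n (Y j) (h s) is)"
   by (simp add: F.comm_def wstar_apply)
  also have "... = (\<Sum>(s, j, n)\<in>triples (Suc m). ?M n (h s) (Y j) is - ?M n (Y j) (h s) is)"
   by (subst (2) F.triples_swap) (simp add: split_def sum_subtractf)
  also have "... = (\<Sum>(s, j, n)\<in>triples (Suc m). if n = 1 & s = 0 then 2 *C ?M 1 Q (Y j) is else 0) +
    (\<Sum>(s, j, n)\<in>triples (Suc m). if n = 0 & s = 1 then B (- (\<i> *C \<rho>)) (Y j is) - B (Y j is) (- (\<i> *C \<rho>)) else 0)"
   unfolding hn by (simp add: split_def sum.distrib del: weyl.simps)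
  also have "(\<Sum>(s, j, n)\<in>triples (Suc m). if n = 1 & s = 0 then 2 *C ?M 1 Q (Y j) is else 0) = 2 *C ?M 1 Q (Y m) is"
  proof -
   have "(SUM t:triples (Suc m). case t of (s, j, n) => if n = 1 & s = 0 then 2 *C ?M 1 Q (Y j) is else 0) =
     (SUM t:{(0::nat, m, 1::nat)}. case t of (s, j, n) => if n = 1 & s = 0 then 2 *C ?M 1 Q (Y j) is else 0)"
    by (rule sum.mono_neutral_right, simp) (auto simp: triples_def split: if_splits)
   thus ?thesis by simp
  qed
  also have "(\<Sum>(s, j, n)\<in>triples (Suc m). if n = 0 & s = 1 then B (- (\<i> *C \<rho>)) (Y j is) - B (Y j is) (- (\<i> *C \<rho>)) else 0) =
    B (- (\<i> *C \<rho>)) (Y m is) - B (Y m is) (- (\<i> *C \<rho>))"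
  proof -
   have "(SUM t:triples (Suc m). case t of (s, j, n) => if n = 0 & s = 1 then B (- (\<i> *C \<rho>)) (Y j is) - B (Y j is) (- (\<i> *C \<rho>)) else 0) =
     (SUM t:{(1::nat, m, 0::nat)}. case t of (s, j, n) => if n = 0 & s = 1 then B (- (\<i> *C \<rho>)) (Y j is) - B (Y j is) (- (\<i> *C \<rho>)) else 0)"
    by (rule sum.mono_neutral_right, simp) (auto simp: triples_def split: if_splits)
   thus ?thesis by simp
  qed
  finally show ?thesis by simp
 qed
 \<comment> \<open>The sign is \<open>i * 2 * (i/2) = -1\<close>: the 2 stems from the two orders of
   the factors, the \<open>i/2\<close> from \<open>Pc\<close>.\<close>
 have iK: "\<i> *C K c p h Y (Suc m) is = - (SU k. SU l. La c p k l *C shuf B (ins k Q) (ins l (Y m)) is)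
   + (B \<rho> (Y m is) - B (Y m is) \<rho>)" if Y: "Y : F.WS p" for Y m "is"
 proof -
  have V: "Y m is : V p" by (rule F.W_V[OF F.WS_W[OF Y]])
  have m: "- (\<i> *C \<rho>) = (- \<i>) *C \<rho>" by simp
  have "?M 1 Q (Y m) is = (SU k. SU l. Pc c p k l *C shuf B (ins k Q) (ins l (Y m)) is)"
   using weyl_Suc_apply[of B "Pc c p" "%k. k" 0 Q "Y m" "is"] by simp
  moreover have "\<i> *C 2 *C (SU k. SU l. Pc c p k l *C shuf B (ins k Q) (ins l (Y m)) is) =
    - (SU k. SU l. La c p k l *C shuf B (ins k Q) (ins l (Y m)) is)"
   by (simp add: scaleC_sum_right scaleC_scaleC Pc_def sum_negf[symmetric])
  ultimately show ?thesis
   unfolding kK[OF Y] m F.B_scale_left[OF \<rho> V] F.B_scale_right[OF V \<rho>] by (simp add: scaleC_simps)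
 qed
 have z: "shuf B 0 y = 0" if "y : F.W p" for y using F.weyl_zero_left[OF that, of _ _ 0] by simp
 show "\<i> *C K c p (Hc c i j p \<rho> w) Y (Suc m) [] = B \<rho> (Y m []) - B (Y m []) \<rho>"
 proof -
  have "Y m [l] : V p" for l by (rule F.W_V[OF F.WS_W[OF y]])
  thus ?thesis unfolding Hc iK[OF y] by (simp add: Q_def F.B_zero_left[where p=p])
 qed
 have yW: "Y m : F.W p" by (rule F.WS_W[OF y])
 have "(SU k. SU l. La c p k l *C shuf B (ins a (ins k Q)) (ins l (Y m)) is) = (SU l. Ri c a i j l p *C Y m (l # is))"
 proof -
  have "shuf B (ins a (ins k Q)) (ins l (Y m)) is = r a k *C Y m (l # is)" for k l
   unfolding insQ
   using weyl_const_left(1)[OF F.V_scale[OF F.u_closed, where a="r a k"] F.W_ins[OF yW, of l], where n=0 and vs="is"]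
    F.W_V[OF yW, of "l # is"]
   by (simp add: F.B_scale_left[OF F.u_closed] F.B_u_left)
  hence "(SU k. SU l. La c p k l *C shuf B (ins a (ins k Q)) (ins l (Y m)) is) =
    (SU l. (SU k. La c p k l * r a k) *C Y m (l # is))"
   by (subst sum.swap) (simp add: scaleC_sum_left scaleC_scaleC)
  \<comment> \<open>Contraction with \<open>La\<close> raises the index that \<open>om\<close> has
    lowered; the symmetry of \<open>r\<close> is used to make it the contracted one.\<close>
  moreover have "(SU k. La c p k l * r a k) = Ri c a i j l p" for l
  proof -
   have "(SU k. La c p k l * r a k) = (SU k. SU m. La c p k l * (om c p $ k $ m * Ri c a i j m p))"
    unfolding r_sym[of a] by (simp add: r_def sum_distrib_left)
   also have "... = (SU m. - (SU k. La c p l k * om c p $ k $ m) * Ri c a i j m p)"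
    by (subst sum.swap, subst La_antisym[OF c]) (simp add: sum_distrib_right sum_negf mult.assoc)
   also have "... = Ri c a i j l p"
    by (simp add: om_La(2)[OF c] if_distrib[of "%x. x * _"] if_distrib[of uminus] cong: if_cong)
   finally show ?thesis .
  qed
  ultimately show ?thesis by simp
 qed
 thus "\<i> *C K c p (Hc c i j p \<rho> w) Y (Suc m) (a # is) =
   \<i> *C K c p (Hc c i j p \<rho> w) (%m. ins a (Y m)) (Suc m) is - (SU l. Ri c a i j l p *C Y m (l # is))"
  unfolding Hc iK[OF y] iK[OF F.WS_ins[OF y, of a]]
  using ins_commute[OF F.W_symm[OF yW], of a]
  by (simp add: scaleC_add_right sum.distrib)
qed

text \<open>Induction over the symmetric indices. Without indices this is the hypothesis on
  \<open>N\<close>; each further index adds the same curvature term on both sides.\<close>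

lemma curvature_comm:
 assumes c: "c : \<A>" "p : fst c" and X: "X : LS c" and \<rho>: "\<rho> : V p"
  and curv: "!!s. S (fst c) s ==> N (cx c i) (N (cx c j) s) p - N (cx c j) (N (cx c i) s) p
   = B \<rho> (s p) - B (s p) \<rho>"
 shows "n1 c i (n1 c j (X m)) is p - n1 c j (n1 c i (X m)) is p = \<i> *C K c p (Hc c i j p \<rho> w) (ev p X) (Suc m) is"
 using X
proof (induction "is" arbitrary: X)
 case Nil
 have n1_Nil: "n1 c j x [] = N (cx c j) (x [])" for j x by (simp add: n1_def fun_eq_iff)
 show ?case
  unfolding comm_Hc(2)[OF c \<rho> LS_WS[OF Nil c(2)]] n1_Nil using curv[OF LS_S[OF Nil]] by (simp add: ev_def)
next
 case (Cons a "is")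
 have "ev p (%m. ins a (X m)) = (%m. ins a (ev p X m))" by (simp add: ev_def fun_eq_iff)
 thus ?case
  using Cons.IH[OF LS_ins[OF c(1) Cons.prems, of a]]
  unfolding comm_Hc(3)[OF c \<rho> LS_WS[OF Cons.prems c(2)]] n1_commutator_Cons[OF c(1) LS_L1[OF Cons.prems] c(2)]
  by (simp add: ev_def[of p X] del: ins_apply)
qed

end

section \<open>The Koszul homotopy\<close>

text \<open>Allows the homotopy to be used modulo a subspace of the fibre: modulo \<open>{0}\<close>
  for vanishing statements, and modulo the multiples of the unit in \<open>r_scalar\<close>.\<close>

definition complex_subspace :: "'v::complex_space set => bool"
 where "complex_subspace Z \<longleftrightarrow> 0 : Z & (ALL x:Z. ALL y:Z. x + y : Z) & (ALL a. ALL x:Z. a *C x : Z)"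

lemma complex_subspace_zero: "complex_subspace Z ==> 0 : Z"
 and complex_subspace_add: "complex_subspace Z ==> x : Z ==> y : Z ==> x + y : Z"
 and complex_subspace_scale: "complex_subspace Z ==> x : Z ==> a *C x : Z"
 by (auto simp: complex_subspace_def)

lemma complex_subspace_diff: "complex_subspace Z ==> x : Z ==> y : Z ==> x - y : Z"
 using complex_subspace_add[of Z x "- y"] complex_subspace_scale[of Z y "-1"] by simp

lemma complex_subspace_sum: "complex_subspace Z ==> (!!i. i : I ==> f i : Z) ==> (SUM i:I. f i) : Z"
 by (induction I rule: ifi) (auto intro: complex_subspace_zero complex_subspace_add)

lemma complex_subspace_singleton: "complex_subspace {0}"
 by (simp add: complex_subspace_def)

text \<open>\<open>dst\<close> is \<open>\<delta>\<^sup>*\<close> on one-forms, the form argument coming first.\<close>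

fun dst :: "('d => 'd list => 'v::ab_group_add) => 'd list => 'v" where
 "dst x [] = 0"
| "dst x (v # vs) = x v vs + dst (%w. ins v (x w)) vs"

lemma dst_map: "dst x (map f vs) = dst (%i l. x (f i) (map f l)) vs"
 by (induction vs arbitrary: x) (simp_all add: ins_def)

lemma dst_add: "dst (%w. x w + y w) vs = dst x vs + dst y vs"
 by (induction vs arbitrary: x y) (simp_all add: ac_simps)

lemma dst_scale: "dst (%w. a *C x w) vs = a *C dst x vs" for x :: "'d => 'd list => 'v::complex_space"
 by (induction vs arbitrary: x) (simp_all add: scaleC_add_right)

lemma dst_zero: "dst (%w. 0) vs = 0"
 by (induction vs) (simp_all add: ins_def zero_fun_def)

lemma dst_cong: "(!!w rest. Suc (length rest) = length vs ==> x w rest = y w rest) ==> dst x vs = dst y vs"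
proof (induction vs arbitrary: x y)
 case (Cons v vs)
 have "x v vs = y v vs" by (rule Cons.prems) simp
 moreover have "dst (%w. ins v (x w)) vs = dst (%w. ins v (y w)) vs"
  by (rule Cons.IH) (simp add: Cons.prems)
 ultimately show ?case by (simp del: ins_apply)
qed simp

lemma symm_dst: assumes "!!w. symm (x w)" shows "symm (dst x)"
 unfolding symm_def
proof (intro allI)
 fix us u v vs
 show "dst x (us @ u # v # vs) = dst x (us @ v # u # vs)"
  using assms
 proof (induction us arbitrary: x)
  case Nil
  have "ins v (ins u (x w)) = ins u (ins v (x w))" for w by (rule ins_commute[OF Nil])
  thus ?case by (simp del: ins_apply add: ac_simps) (simp add: ac_simps)
 next
  case (Cons w us)
  have "x w (us @ u # v # vs) = x w (us @ v # u # vs)"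
   using Cons.prems[of w] unfolding symm_def by blast
  moreover have "dst (%z. ins w (x z)) (us @ u # v # vs) = dst (%z. ins w (x z)) (us @ v # u # vs)"
   by (rule Cons.IH, rule symm_ins, rule Cons.prems)
  ultimately show ?case by (simp del: ins_apply)
 qed
qed

text \<open>Euler's relation, modulo \<open>Z\<close>: on functions, \<open>\<delta>\<close>
  followed by \<open>\<delta>\<close>-star multiplies by the symmetric degree.\<close>

lemma dst_degree:
 fixes Z :: "'v::complex_space set"
 assumes Z: "complex_subspace Z" and "symm z"
  and "!!w rest. Suc (length rest) = length vs ==> y w rest - z (w # rest) : Z"
 shows "dst y vs - of_nat (length vs) *C z vs : Z"
 using assms(2,3)
proof (induction vs arbitrary: y z)
 case Nil thus ?case using complex_subspace_zero[OF Z] by simp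
next
 case (Cons v vs)
 have "y w (v # rest) - z (v # w # rest) : Z" if "Suc (length rest) = length vs" for w rest
  using Cons.prems(2)[of "v # rest" w] fun_cong[OF ins_commute[OF Cons.prems(1), where u=v and v=w], of rest] that by simp
 hence "dst (%w. ins v (y w)) vs - of_nat (length vs) *C ins v z vs : Z"
  by (intro Cons.IH symm_ins[OF Cons.prems(1)]) simp
 moreover have "y v vs - z (v # vs) : Z" using Cons.prems(2) by simp
 ultimately have "(y v vs - z (v # vs)) + (dst (%w. ins v (y w)) vs - of_nat (length vs) *C z (v # vs)) : Z"
  using complex_subspace_add[OF Z] by simp
 thus ?case by (simp add: scaleC_add_left scaleC_one algebra_simps)
qed

text \<open>The Koszul homotopy on one-forms, modulo \<open>Z\<close>. If both
  \<open>\<delta>\<close>-star and \<open>\<delta>\<close> annihilate \<open>x\<close>, then so does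
  their anticommutator, which multiplies by the total number of arguments
  \<open>1 + length vs\<close>, a nonzero number.\<close>

lemma dst_mem:
 fixes Z :: "'v::complex_space set"
 assumes Z: "complex_subspace Z" and x: "!!w. symm (x w)" and d: "dst x (j # vs) : Z"
  and "!!k rest. Suc (length rest) = length vs ==> x k (j # rest) - x j (k # rest) : Z"
 shows "x j vs : Z"
proof -
 let ?n = "of_nat (length vs) :: complex"
 have "dst (%w. ins j (x w)) vs - ?n *C x j vs : Z"
  by (rule dst_degree[OF Z x]) (simp add: assms(4))
 from complex_subspace_diff[OF Z d this] have "(1 + ?n) *C x j vs : Z"
  by (simp add: scaleC_add_left scaleC_one algebra_simps)
 from complex_subspace_scale[OF Z this, of "1 / (1 + ?n)"] show ?thesis
  using of_nat_neq_0[of "length vs", where 'a=complex] by (simp add: scaleC_scaleC scaleC_one add.commute)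
qed

context symplectic_bundle
begin

section \<open>Forms of low degree\<close>

lemma SY_mem:
 assumes Z: "complex_subspace Z" and x: "x : SY p" and c: "c : \<A>" "p : fst c"
  and "!!is. length is = length vs ==> x (map (%i. cx c i p) is) : Z"
 shows "x vs : Z"
 using x assms(5)
proof (induction vs arbitrary: x)
 case Nil from Nil(2)[of "[]"] show ?case by simp
next
 case (Cons v vs)
 show ?case
 proof (cases "v : T p")
  case True
  have "ins (cx c i p) x vs : Z" for i
   by (rule Cons.IH[OF SY_ins[OF Cons.prems(1)]])
    (use Cons.prems(2)[of "i # _"] in simp)
  hence "ins v x vs : Z"
   unfolding SY_expand_arg[OF Cons.prems(1) True c] sum_apply scaleC_fun_apply
   by (intro complex_subspace_sum[OF Z] complex_subspace_scale[OF Z])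
  thus ?thesis by simp
 qed (use SY_off[OF Cons.prems(1), of "v # vs"] complex_subspace_zero[OF Z] in simp)
qed

lemma form_arg_expand:
 assumes b: "b : \<W>" and w: "w : T p" and c: "c : \<A>" "p : fst c"
 shows "b m p vs [w] = (SU i. of_real (w c $ i) *C b m p vs [cx c i p])"
 using mfield_expand[OF tensor_mfield[OF \<W>_field[OF b], where s="length vs" and k=1] _ w c, where us=vs and us'="[]"]
 by simp

lemma form_mem:
 assumes Z: "complex_subspace Z" and b: "b : \<W>" and c: "c : \<A>" "p : fst c"
  and "!!is j. length is = length vs ==> b m p (map (%i. cx c i p) is) [cx c j p] : Z"
 shows "b m p vs [w] : Z"
proof (cases "w : T p")
 case True
 have "b m p vs [cx c j p] : Z" for j
  by (rule SY_mem[OF Z tensor_at_slice[OF \<W>_tensor[OF b]] c]) (rule assms(5))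
 thus ?thesis
  unfolding form_arg_expand[OF b True c] by (intro complex_subspace_sum[OF Z] complex_subspace_scale[OF Z])
next
 case False
 thus ?thesis using tensor_atD(2)[OF \<W>_tensor[OF b], of vs "[w]"] complex_subspace_zero[OF Z] by simp
qed

lemma tensor_at_distinct: "tensor_at \<A> (V p) p s ==> ALL vs ws. ~ distinct ws --> s vs ws = 0"
 unfolding tensor_at_def Let_def by (elim conjE)

lemma tensor_at_add:
 assumes "tensor_at \<A> (V p) p s" "tensor_at \<A> (V p) p t" shows "tensor_at \<A> (V p) p (s + t)"
proof -
 note s = tensor_atD[OF assms(1)] and t = tensor_atD[OF assms(2)]
 note z = tensor_at_distinct[OF assms(1), rule_format] tensor_at_distinct[OF assms(2), rule_format]
 show ?thesis
 proof (rule tensor_atI)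
  show "(s + t) vs ws = (s + t) vs' ws" if "mset vs = mset vs'" for vs vs' ws
   by (simp add: s(7)[OF that] t(7)[OF that])
  show "(s + t) vs ws = 0" if "~ set vs \<union> set ws <= T p" for vs ws
   by (simp add: s(2)[OF that] t(2)[OF that])
  show "(s + t) (us @ (v + w) # us') ws = (s + t) (us @ v # us') ws + (s + t) (us @ w # us') ws"
   if "v : T p" "w : T p" for us us' ws v w
   unfolding plus_fun_apply[of s] plus_fun_apply[of "s _"] s(3)[OF that] t(3)[OF that] by (simp only: ac_simps)
  show "(s + t) vs (us @ (v + w) # us') = (s + t) vs (us @ v # us') + (s + t) vs (us @ w # us')"
   if "v : T p" "w : T p" for vs us us' v w
   unfolding plus_fun_apply[of s] plus_fun_apply[of "s _"] s(5)[OF that] t(5)[OF that] by (simp only: ac_simps)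
 qed (simp_all add: z s(1,4,6) t(1,4,6) F.V_add scaleC_add_right)
qed

lemma tensor_at_scale:
 assumes "tensor_at \<A> (V p) p s" shows "tensor_at \<A> (V p) p (a *C s)"
proof -
 note s = tensor_atD[OF assms(1)]
 note z = tensor_at_distinct[OF assms, rule_format]
 show ?thesis
 proof (rule tensor_atI)
  show "(a *C s) vs ws = (a *C s) vs' ws" if "mset vs = mset vs'" for vs vs' ws
   by (simp add: s(7)[OF that])
  show "(a *C s) vs ws = 0" if "~ set vs \<union> set ws <= T p" for vs ws
   by (simp add: s(2)[OF that])
 qed (simp_all add: z s(1,3-6) F.V_scale scaleC_add_right scaleC_scaleC mult.commute del: plus_fun_apply)
qed

lemma \<W>_arg:
 assumes a: "a : \<W>"
 shows \<W>_expand_arg: "v : T p ==> c : \<A> ==> p : fst c ==>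
   a m p (v # vs) ws = (SU i. of_real (v c $ i) *C a m p (cx c i p # vs) ws)"
  and \<W>_off_arg: "v \<notin> T p ==> a m p (v # vs) ws = 0"
  and \<W>_add_arg: "v : T p ==> w : T p ==> a m p ((v + w) # vs) ws = a m p (v # vs) ws + a m p (w # vs) ws"
  and \<W>_scale_arg: "v : T p ==> a m p (tscale x v # vs) ws = of_real x *C a m p (v # vs) ws"
proof -
 have SY: "(%vs. a m p vs ws) : SY p" by (rule tensor_at_slice[OF \<W>_tensor[OF a]])
 show "v : T p ==> c : \<A> ==> p : fst c ==>
   a m p (v # vs) ws = (SU i. of_real (v c $ i) *C a m p (cx c i p # vs) ws)"
  using fun_cong[OF SY_expand_arg[OF SY], of v c vs] by (simp add: sum_apply)
 show "v \<notin> T p ==> a m p (v # vs) ws = 0" using SY_off[OF SY, of "v # vs"] by simp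
 show "v : T p ==> w : T p ==> a m p ((v + w) # vs) ws = a m p (v # vs) ws + a m p (w # vs) ws"
  using fun_cong[OF SY_add_arg[OF SY], of v w vs] by (simp add: ins_def)
 show "v : T p ==> a m p (tscale x v # vs) ws = of_real x *C a m p (v # vs) ws"
  using fun_cong[OF SY_scale_arg[OF SY], of v x vs] by (simp add: ins_def)
qed

lemma \<W>_add: assumes "a : \<W>" "b : \<W>" shows "a + b : \<W>"
 using \<W>_tensor[OF assms(1)] \<W>_tensor[OF assms(2)] \<W>_smooth[OF assms(1)] \<W>_smooth[OF assms(2)]
  \<W>_neg[OF assms(1)] \<W>_neg[OF assms(2)] chart(1)
 by (auto simp: W_space_def tensor_field_def intro!: tensor_at_add S_add)

lemma \<W>_scale: assumes "a : \<W>" shows "z *C a : \<W>"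
 using \<W>_tensor[OF assms(1)] \<W>_smooth[OF assms(1)] \<W>_neg[OF assms(1)] chart(1)
 by (auto simp: W_space_def tensor_field_def intro!: tensor_at_scale S_scale_const)

lemma \<W>_diff: "a : \<W> ==> b : \<W> ==> a - b : \<W>"
 using \<W>_add[OF _ \<W>_scale[of b "-1"], of a] by simp

lemma \<W>_zero: "0 : \<W>"
proof -
 have "(%vs. 0) = (0 :: ('m, 'n) tvec list => 'v)" by auto
 hence "tensor_at \<A> (V p) p 0" for p using SY_zero by (intro tensor_at_deg0) simp_all
 thus ?thesis using S_zero chart(1) by (simp add: W_space_def tensor_field_def)
qed

lemma form_zeroI:
 assumes b: "b : \<W>" "has_deg_a 1 b" and z: "!!p j m is. comp (chx p) b [j] m is p = 0"
 shows "b = 0"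
proof (intro ext)
 fix m p vs ws
 show "b m p vs ws = (0 :: ('m, 'n, 'v) wform) m p vs ws"
 proof (cases "length ws = 1 & m \<ge> 0")
  case True
  then obtain w m' where w: "ws = [w]" "m = int m'" by (metis length_Suc_conv length_0_conv One_nat_def nonneg_int_cases)
  have "b m p vs [w] : {0}"
   by (rule form_mem[OF complex_subspace_singleton b(1) chart_at]) (use z in \<open>simp add: w comp_def\<close>)
  thus ?thesis by (simp add: w)
 next
  case False
  thus ?thesis using b(2) \<W>_neg[OF b(1), of m] by (auto simp: has_deg_a_def)
 qed
qed

lemma function_zeroI:
 assumes b: "b : \<W>" "has_deg_a 0 b" and z: "!!p m is. comp (chx p) b [] m is p = 0"
 shows "b = 0"
proof (intro ext)
 fix m p vs ws
 show "b m p vs ws = (0 :: ('m, 'n, 'v) wform) m p vs ws"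
 proof (cases "ws = [] & m \<ge> 0")
  case True
  then obtain m' where m: "m = int m'" by (metis nonneg_int_cases)
  have "b m p vs [] : {0}"
   by (rule SY_mem[OF complex_subspace_singleton tensor_at_slice[OF \<W>_tensor[OF b(1)]] chart_at])
    (use z in \<open>simp add: m comp_def\<close>)
  thus ?thesis using True by simp
 next
  case False
  thus ?thesis using b(2) \<W>_neg[OF b(1), of m] by (auto simp: has_deg_a_def)
 qed
qed

lemma \<W>_deg1I:
 assumes SY: "!!m p w. (%vs. b m p vs [w]) : SY p" and z: "!!m p vs ws. length ws ~= 1 ==> b m p vs ws = 0"
  and off: "!!m p vs w. w \<notin> T p ==> b m p vs [w] = 0"
  and lin: "!!m p vs v w. v : T p ==> w : T p ==> b m p vs [v + w] = b m p vs [v] + b m p vs [w]"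
   "!!m p vs a v. v : T p ==> b m p vs [tscale a v] = of_real a *C b m p vs [v]"
  and neg: "!!m. m < 0 ==> b m = 0"
  and sm: "!!c m j is. c : \<A> ==> S (fst c) (comp c b [j] m is)"
 shows "b : \<W>"
proof -
 have "tensor_at \<A> (V p) p (b m p)" for m p by (rule tensor_at_deg1[OF SY z off lin])
 moreover have "S (fst c) (%p. b m p (map (%i. cx c i p) is) (map (%j. cx c j p) js))"
  if c: "c : \<A>" for m c "is" js
 proof (cases "length js = 1 & m \<ge> 0")
  case True
  then obtain j m' where j: "js = [j]" "m = int m'" by (metis length_Suc_conv length_0_conv One_nat_def nonneg_int_cases)
  show ?thesis using sm[OF c, of j m' "is"] unfolding j comp_def[abs_def] .
 next
  case False
  thus ?thesis using z neg[of m] S_zero[OF chart(1)[OF c]] by (cases "m < 0") auto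
 qed
 ultimately show ?thesis using neg by (simp add: W_space_def tensor_field_def)
qed

lemma \<W>_deg0I:
 assumes SY: "!!m p. (%vs. b m p vs []) : SY p" and z: "!!m p vs ws. ws ~= [] ==> b m p vs ws = 0"
  and neg: "!!m. m < 0 ==> b m = 0"
  and sm: "!!c m is. c : \<A> ==> S (fst c) (comp c b [] m is)"
 shows "b : \<W>"
proof -
 have "tensor_at \<A> (V p) p (b m p)" for m p by (rule tensor_at_deg0[where t="b m p"]) (rule SY, rule z)
 moreover have "S (fst c) (%p. b m p (map (%i. cx c i p) is) (map (%j. cx c j p) js))"
  if c: "c : \<A>" for m c "is" js
 proof (cases "js = [] & m \<ge> 0")
  case True
  then obtain m' where j: "js = []" "m = int m'" by (metis nonneg_int_cases)
  show ?thesis using sm[OF c, of m' "is"] unfolding j comp_def[abs_def] list.map .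
 next
  case False
  thus ?thesis using z neg[of m] S_zero[OF chart(1)[OF c]] by (cases "m < 0") auto
 qed
 ultimately show ?thesis using neg by (simp add: W_space_def tensor_field_def)
qed

lemma form_lin:
 assumes b: "b : \<W>"
 shows "w \<notin> T p ==> b m p vs [w] = 0"
  and "v : T p ==> w : T p ==> b m p vs [v + w] = b m p vs [v] + b m p vs [w]"
  and "v : T p ==> b m p vs [tscale a v] = of_real a *C b m p vs [v]"
proof -
 note t = \<W>_tensor[OF b, of p m]
 show "w \<notin> T p ==> b m p vs [w] = 0" using tensor_atD(2)[OF t, of vs "[w]"] by simp
 show "v : T p ==> w : T p ==> b m p vs [v + w] = b m p vs [v] + b m p vs [w]"
  using tensor_atD(5)[OF t, where us="[]" and us'="[]"] unfolding append_Nil .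
 show "v : T p ==> b m p vs [tscale a v] = of_real a *C b m p vs [v]"
  using tensor_atD(6)[OF t, where us="[]" and us'="[]"] unfolding append_Nil .
qed

lemma delta_deg0:
 assumes a: "a : \<W>" "has_deg_a 0 a"
 shows "delta \<A> a m p vs ws = (if length ws = 1 then a m p (hd ws # vs) [] else 0)"
proof (cases "length ws = 1")
 case True
 then obtain w where w: "ws = [w]" by (metis length_Suc_conv length_0_conv One_nat_def)
 show ?thesis
 proof (cases "w : T p")
  case wT: True
  show ?thesis
   using \<W>_expand_arg[OF a(1) wT chart_at, where m=m and vs=vs and ws="[]"] wT
   by (simp add: w delta_def Let_def sum_apply tmul_dx_alt)
 next
  case False
  thus ?thesis using \<W>_off_arg[OF a(1), where v=w and p=p and m=m and vs=vs and ws="[]"]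
   by (simp add: w delta_def Let_def sum_apply tmul_dx_alt)
 qed
next
 case False
 have "a m p (cx (chx p) i p # vs) ws = 0" if "length ws ~= 0" for vs ws i using a(2) that by (simp add: has_deg_a_def)
 thus ?thesis using False
  by (auto simp: delta_def Let_def sum_apply intro!: sum.neutral tmul_dx_alt_degree[of 0])
qed

lemma delta_\<W>:
 assumes a: "a : \<W>" "has_deg_a 0 a" shows "delta \<A> a : \<W>" "has_deg_a 1 (delta \<A> a)"
proof -
 note d = delta_deg0[OF a]
 have SYa: "(%vs. a m p vs []) : SY p" for m p by (rule tensor_at_slice[OF \<W>_tensor[OF a(1)]])
 show "has_deg_a 1 (delta \<A> a)" by (simp add: has_deg_a_def d)
 show "delta \<A> a : \<W>"
 proof (rule \<W>_deg1I)
  show "(%vs. delta \<A> a m p vs [w]) : SY p" for m p w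
  proof -
   have "ins w (%vs. a m p vs []) : SY p" by (rule SY_ins, rule SYa)
   thus ?thesis by (simp add: d ins_def)
  qed
  show "delta \<A> a m p vs [v + w] = delta \<A> a m p vs [v] + delta \<A> a m p vs [w]" if "v : T p" "w : T p" for m p vs v w
   using \<W>_add_arg[OF a(1) that] unfolding d by simp
  show "delta \<A> a m p vs [tscale x v] = of_real x *C delta \<A> a m p vs [v]" if "v : T p" for m p vs x v
   using \<W>_scale_arg[OF a(1) that] unfolding d by simp
  show "delta \<A> a m p vs [w] = 0" if "w \<notin> T p" for m p vs w
   using \<W>_off_arg[OF a(1) that] unfolding d by simp
  show "delta \<A> a m = 0" if "m < 0" for m using \<W>_neg[OF a(1) that] by (intro ext) (simp add: d)
  show "S (fst c) (comp c (delta \<A> a) [j] m is)" if "c : \<A>" for c m j "is"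
   using \<W>_smooth[OF a(1) that, of "int m" "j # is" "[]"] by (simp add: comp_def[abs_def] d)
 qed (simp add: d)
qed

lemma delta_comp:
 "a : \<W> ==> has_deg_a 0 a ==> comp c (delta \<A> a) [j] m is p = comp c a [] m (j # is) p"
 by (simp add: comp_def delta_deg0)

lemma delta_comp2:
 assumes a: "a : \<W>" and c: "c : \<A>" "p : fst c"
 shows "comp c (delta \<A> a) [i, j] m is p = comp c a [j] m (i # is) p - comp c a [i] m (j # is) p"
 using \<W>_expand_arg[OF a coord_tangent[where c=c and i=i and p=p] chart_at, where m="int m" and vs="map (%i. cx c i p) is" and ws="[cx c j p]"]
  \<W>_expand_arg[OF a coord_tangent[where c=c and i=j and p=p] chart_at, where m="int m" and vs="map (%i. cx c i p) is" and ws="[cx c i p]"]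
 by (simp add: comp_def delta_def Let_def sum_apply tmul_dx_alt coord_tangent sum_subtractf)

lemma wprod_\<W>_deg1:
 assumes a: "a : \<W>" "has_deg_a k a" and b: "b : \<W>" "has_deg_a l b" and kl: "k + l = 1"
 shows "wprod \<A> \<omega> B a b : \<W>" "has_deg_a 1 (wprod \<A> \<omega> B a b)"
proof -
 let ?w = "wprod \<A> \<omega> B a b"
 let ?st = "%p. wstar B (Pc (chx p) p) (%k. cx (chx p) k p)"
 show deg: "has_deg_a 1 ?w" using wprod_deg[OF a b] kl by simp
 note neg = wprod_neg[OF a(1) b(1)]
 have sl: "?w (int m) p vs [w] = ?st p (sl a p []) (sl b p [w]) m vs + ?st p (sl a p [w]) (sl b p []) m vs" for m p vs w
  by (simp add: wprod_slices[OF a(1) b(1)] sum_Pow_low nths_Cons)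
 note WSa = sl_WS[OF a(1)] and WSb = sl_WS[OF b(1)]
 have lin: "sl x p [w] = 0" if "x : \<W>" "w \<notin> T p" for x p w
  using form_lin(1)[OF that] by (simp add: sl_def fun_eq_iff)
 have lin2: "sl x p [v + w] = sl x p [v] + sl x p [w]" if "x : \<W>" "v : T p" "w : T p" for x p v w
  using form_lin(2)[OF that] by (simp add: sl_def fun_eq_iff)
 have lin3: "sl x p [tscale y v] = of_real y *C sl x p [v]" if "x : \<W>" "v : T p" for x p y v
  using form_lin(3)[OF that] by (simp add: sl_def fun_eq_iff)
 have neg': "P m" if "!!m'. P (int m')" "!!m. m < 0 ==> P m" for P and m :: int
  using that by (metis nonneg_int_cases not_less)
 show "?w : \<W>"
 proof (rule \<W>_deg1I)
  show "(%vs. ?w m p vs [w]) : SY p" for m p w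
  proof (rule neg'[of _ m])
   have "?st p (sl a p []) (sl b p [w]) m + ?st p (sl a p [w]) (sl b p []) m : SY p" for m
    by (intro SY_add SY_wstar sl_SY a b)
   thus "(%vs. ?w (int m') p vs [w]) : SY p" for m' by (simp add: sl plus_fun_def)
   show "(%vs. ?w m p vs [w]) : SY p" if "m < 0" for m using SY_zero by (simp add: neg[OF that] zero_fun_def)
  qed
  show "?w m p vs [w] = 0" if "w \<notin> T p" for m p vs w
   by (rule neg'[of _ m]) (simp_all add: neg sl lin[OF a(1) that] lin[OF b(1) that] wstar_zero[OF WSa] wstar_zero[OF WSb])
  show "?w m p vs [v + w] = ?w m p vs [v] + ?w m p vs [w]" if "v : T p" "w : T p" for m p vs v w
   by (rule neg'[of _ m], simp only: sl lin2[OF a(1) that] lin2[OF b(1) that] F.wstar_add_left[OF WSa WSa WSb] F.wstar_add_right[OF WSa WSb WSb],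
     simp only: plus_fun_apply ac_simps, simp add: neg)
  show "?w m p vs [tscale x v] = of_real x *C ?w m p vs [v]" if "v : T p" for m p vs x v
   by (rule neg'[of _ m])
    (simp_all add: neg sl lin3[OF a(1) that] lin3[OF b(1) that] F.wstar_scale_left[OF WSa WSb] F.wstar_scale_right[OF WSa WSb] scaleC_add_right)
  show "S (fst c) (comp c ?w [j] m is)" if c: "c : \<A>" for c m j "is"
  proof (cases "k = 1")
   case True
   hence "has_deg_a 1 a" "has_deg_a 0 b" using a b kl by simp_all
   from S_cong[OF chart(1)[OF c] LS_S[OF LS_st[OF c comp_LS[OF a(1) c] comp_LS[OF b(1) c]]] wprod_comp(2)[OF a(1) b(1) c _ this, symmetric]]
   show ?thesis .
  next
   case False
   hence "has_deg_a 0 a" "has_deg_a 1 b" using a b kl by (auto simp: le_Suc_eq add_is_1)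
   from S_cong[OF chart(1)[OF c] LS_S[OF LS_st[OF c comp_LS[OF a(1) c] comp_LS[OF b(1) c]]] wprod_comp(3)[OF a(1) b(1) c _ this, symmetric]]
   show ?thesis .
  qed
 qed (use deg neg in \<open>auto simp: has_deg_a_def\<close>)
qed

lemma SY_dst:
 assumes x: "!!w. x w : SY p" and off: "!!w. w \<notin> T p ==> x w = 0"
  and lin: "!!v w. v : T p ==> w : T p ==> x (v + w) = x v + x w"
   "!!a v. v : T p ==> x (tscale a v) = of_real a *C x v"
 shows "dst x : SY p"
proof (rule SYI)
 have "dst x vs : V p" for vs
  using x
 proof (induction vs arbitrary: x)
  case (Cons v vs)
  have "dst (%w. ins v (x w)) vs : V p" by (rule Cons.IH, rule SY_ins, rule Cons.prems)
  thus ?case using F.W_V[OF SY_W[OF Cons.prems], of v vs] by (simp add: F.V_add del: ins_apply)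
 qed (simp add: F.V_zero)
 thus "dst x : F.W p" using symm_dst[OF F.W_symm[OF SY_W[OF x]]] by (auto simp: F.W_def)
 show "dst x (v # vs) = 0" if "v \<notin> T p" for v vs
  using SY_ins_off[OF x that] off[OF that] by (simp add: dst_zero del: ins_apply)
 show "ins (v + w) (dst x) = ins v (dst x) + ins w (dst x)" if "v : T p" "w : T p" for v w
 proof
  fix vs
  have "dst (%z. ins (v + w) (x z)) vs = dst (%z. ins v (x z)) vs + dst (%z. ins w (x z)) vs"
   unfolding SY_add_arg[OF x that] by (rule dst_add)
  thus "ins (v + w) (dst x) vs = (ins v (dst x) + ins w (dst x)) vs" using lin(1)[OF that] by simp
 qed
 show "ins (tscale a v) (dst x) = of_real a *C ins v (dst x)" if "v : T p" for a v
 proof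
  fix vs
  have "dst (%z. ins (tscale a v) (x z)) vs = of_real a *C dst (%z. ins v (x z)) vs"
   unfolding SY_scale_arg[OF x that] by (rule dst_scale)
  thus "ins (tscale a v) (dst x) vs = (of_real a *C ins v (dst x)) vs"
   using lin(2)[OF that] by (simp add: scaleC_add_right)
 qed
qed

lemma SY_grade: assumes x: "x : SY p" shows "(%vs. g (length vs) *C x vs) : SY p"
proof (rule SYI)
 show "(%vs. g (length vs) *C x vs) : F.W p"
  using F.W_V[OF SY_W[OF x]] F.W_symm[OF SY_W[OF x]] by (auto simp: F.W_def symm_def F.V_scale)
 show "g (length (v # vs)) *C x (v # vs) = 0" if "v \<notin> T p" for v vs
  using SY_off[OF x, of "v # vs"] that by simp
 show "ins (v + w) (%vs. g (length vs) *C x vs) = ins v (%vs. g (length vs) *C x vs) + ins w (%vs. g (length vs) *C x vs)"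
  if "v : T p" "w : T p" for v w
  using SY_add_arg[OF x that] by (simp add: fun_eq_iff scaleC_add_right)
 show "ins (tscale a v) (%vs. g (length vs) *C x vs) = of_real a *C ins v (%vs. g (length vs) *C x vs)"
  if "v : T p" for a v
  using SY_scale_arg[OF x that] by (simp add: fun_eq_iff scaleC_scaleC mult.commute)
qed

text \<open>\<open>delta_inv\<close> on one-forms without reference to a chart. The result has as
  many symmetric arguments as the one-form has arguments altogether. For the empty list
  \<open>dst\<close> is 0, so the division by 0 there is harmless.\<close>

definition dinv :: "('m, 'n, 'v) wform => ('m, 'n, 'v) wform"
 where "dinv b m p vs ws = (if ws = [] then (1 / of_nat (length vs)) *C dst (%w vs. b m p vs [w]) vs else 0)"

lemma dinv_comp: "comp c (dinv b) [] m is p = (1 / of_nat (length is)) *C dst (%j is. comp c b [j] m is p) is"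
 by (simp add: comp_def dinv_def dst_map)

lemma S_dst:
 assumes "open U" "!!i l. S U (x i l)" shows "S U (%p. dst (%i l. x i l p) is)"
 using assms(2)
proof (induction "is" arbitrary: x)
 case (Cons i "is")
 have "S U (%p. dst (%j l. x j (i # l) p) is)" using Cons.IH[of "%j l. x j (i # l)"] Cons.prems by blast
 thus ?case using Cons.prems by (simp add: ins_def S_add[OF assms(1)])
qed (simp add: S_zero[OF assms(1)])

lemma dinv_\<W>:
 assumes b: "b : \<W>" shows "dinv b : \<W>" "has_deg_a 0 (dinv b)"
proof -
 show "has_deg_a 0 (dinv b)" by (simp add: has_deg_a_def dinv_def)
 show "dinv b : \<W>"
 proof (rule \<W>_deg0I)
  show "(%vs. dinv b m p vs []) : SY p" for m p
  proof -
   have "dst (%w vs. b m p vs [w]) : SY p"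
    by (rule SY_dst) (simp_all add: fun_eq_iff tensor_at_slice[OF \<W>_tensor[OF b]] form_lin[OF b])
   from SY_grade[OF this, of "%n. 1 / of_nat n"] show ?thesis by (simp add: dinv_def)
  qed
  show "S (fst c) (comp c (dinv b) [] m is)" if c: "c : \<A>" for c m "is"
   unfolding dinv_comp[abs_def]
   by (intro S_scale_const S_dst chart(1)[OF c] LS_S[OF comp_LS[OF b c]])
  show "dinv b m = 0" if "m < 0" for m
  proof (intro ext)
   fix p vs ws
   have "(%w vs. b m p vs [w]) = (%w. 0)" using \<W>_neg[OF b that] by (simp add: fun_eq_iff)
   thus "dinv b m p vs ws = (0 :: 'm => ('m, 'n, 'v) tensor) p vs ws" by (simp add: dinv_def dst_zero)
  qed
 qed (simp add: dinv_def)
qed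

text \<open>Translates the normalisation of the Fedosov element into a statement about
  \<open>dst\<close>, to which the homotopy applies.\<close>

lemma delta_inv_comp:
 assumes b: "b : \<W>" "has_deg_a 1 b"
 shows "comp (chx p) (delta_inv \<A> b) [] m is p = (1 / of_nat (length is)) *C dst (%j is. comp (chx p) b [j] m is p) is"
proof -
 let ?c = "chx p"
 let ?e = "%i. cx ?c i p"
 have e: "?e i ?c $ j = (if j = i then 1 else 0)" for i j
  using coord_self[OF chart_at[of p], of i] by (simp add: axis_def)
 define X where "X i = (%vs. dx_sym \<A> ?c i p vs [])" for i
 have insX: "ins (?e k) (X i) = (%vs. if vs = [] then (if i = k then 1 else 0) else 0)" for i k
  by (auto simp: X_def fun_eq_iff dx_sym_def e coord_tangent)
 have "(SU i. shuf scaleC (X i) (y i) (map ?e is)) = dst (%i l. y i (map ?e l)) is" for y :: "'n => _ => 'v"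
 proof (induction "is" arbitrary: y)
  case Nil thus ?case by (simp add: X_def dx_sym_def)
 next
  case (Cons k "is")
  have "(SU i. (if i = k then 1 else 0 :: complex) *C y i (map ?e is)) = y k (map ?e is)"
   by (simp add: if_distrib[of "%z. z *C _"] scaleC_one cong: if_cong)
  thus ?case
   using Cons.IH[of "%i. ins (?e k) (y i)"]
   by (simp add: sum.distrib insX shuf_scaleC_const del: ins_apply) (simp add: ins_def)
 qed
 note this[of "%i vs. b (int m) p vs [?e i]"]
 moreover have "delta_star \<A> b (int m) p vs [] = (SU i. shuf scaleC (X i) (%vs. b (int m) p vs [?e i]) vs)" for vs
  by (simp add: delta_star_def Let_def sum_apply tmul_slices sum_Pow_low X_def)
 ultimately show ?thesis by (simp add: comp_def delta_inv_def)
qed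

end

section \<open>The Fedosov derivation of a bundle of algebras\<close>

lemma scaleC_cancel:
 assumes "a *C x = 0" "a ~= 0" shows "x = (0 :: 'v::complex_space)"
proof -
 have "(1 / a) *C a *C x = 0" by (simp add: assms(1))
 thus ?thesis using assms(2) by (simp add: scaleC_scaleC scaleC_one)
qed

lemma shuf_mem:
 assumes Z: "complex_subspace Z" and "!!us vs. length us + length vs = length is ==> B (x us) (y vs) : Z"
 shows "shuf B x y is : Z"
 using assms(2)
proof (induction "is" arbitrary: x y)
 case Nil thus ?case by simp
next
 case (Cons i "is")
 have "shuf B (ins i x) y is : Z" "shuf B x (ins i y) is : Z"
  by (rule Cons.IH, simp add: Cons.prems)+
 thus ?case by (simp add: complex_subspace_add[OF Z] del: ins_apply)
qed

lemma shuf_comm: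
 assumes "!!us vs. length us + length vs = length is ==> B (x us) (y vs) = B (y vs) (x us)"
 shows "shuf B x y is = shuf B y x is"
 using assms
proof (induction "is" arbitrary: x y)
 case Nil thus ?case by simp
next
 case (Cons i "is")
 have "shuf B (ins i x) y is = shuf B y (ins i x) is" "shuf B x (ins i y) is = shuf B (ins i y) x is"
  by (rule Cons.IH, simp add: Cons.prems)+
 thus ?case by (simp add: add.commute del: ins_apply)
qed

lemma triples_1: "triples (Suc 0) = {(1, 0, 0), (0, 1, 0), (0, 0, 1)}"
 by (auto simp: triples_def add_is_1)

definition td :: "nat => (nat => 'd list => 'v::zero) => bool"
 where "td d Y \<longleftrightarrow> (ALL m is. 2 * m + length is < d --> Y m is = 0)"

text \<open>The total degree is additive: a contraction removes two symmetric arguments, and the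
  accompanying power of \<open>\<lambda>\<close> counts twice.\<close>

lemma (in fibre_algebra) td_wstar:
 fixes X Y :: "nat => 'd list => 'v"
 assumes X: "X : WS" "td a X" and Y: "Y : WS" "td b Y" shows "td (a + b) (wstar B P e X Y)"
 unfolding td_def
proof (intro allI impI)
 fix m and vs :: "'d list" assume d: "2 * m + length vs < a + b"
 have "weyl B P e n (X i) (Y j) vs = 0" if "i + j + n = m" for i j n
  by (rule weyl_degree[OF WS_W[OF X(1)] WS_W[OF Y(1)], where a="a - 2 * i" and b="b - 2 * j"])
   (use X(2) Y(2) d that in \<open>auto simp: td_def\<close>)
 thus "wstar B P e X Y m vs = 0" unfolding wstar_apply by (intro sum.neutral) (auto simp: triples_def)
qed

text \<open>Here \<open>\<rho>\<close> is the curvature of the bundle connection, which must be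
  inner, and \<open>w\<close> the contribution of central two-forms. \<open>N_scalar\<close> keeps
  multiples of the unit stable in the proof of \<open>r_scalar\<close>, and \<open>S_glue\<close>
  makes symbols of forms globally smooth.\<close>

locale fedosov_bundle = symplectic_bundle \<A> V S N B u \<omega> nab
 for \<A> :: "('m::topological_space, 'n::finite) chart set" and V :: "'m => 'v::complex_space set"
  and S N B u \<omega> nab +
 fixes r :: "('m, 'n, 'v) wform"
 assumes r_\<W>: "r : W_space \<A> V S" and r_deg: "has_deg_a 1 r" and r_total: "total_degree_ge 3 r"
  and r_dinv: "delta_inv \<A> r = 0"
  and N_scalar: "!!U X s p. open U ==> vector_field \<A> U X ==> S U s ==>
   (!!q. q : U ==> EX z. s q = z *C u q) ==> p : U ==> EX z. N X s p = z *C u p"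
  and S_glue: "!!s. (!!c. c : \<A> ==> S (fst c) s) ==> S UNIV s"
  and r_eq: "!!p i j. \<exists>\<rho>\<in>V p. EX w.
   (ALL s. S (fst (chart_at \<A> p)) s -->
    N (coord \<A> (chart_at \<A> p) i) (N (coord \<A> (chart_at \<A> p) j) s) p
    - N (coord \<A> (chart_at \<A> p) j) (N (coord \<A> (chart_at \<A> p) i) s) p = B \<rho> (s p) - B (s p) \<rho>) &
   (ALL m is. comp (chart_at \<A> p) (delta \<A> r) [i, j] m is p = Hc (chart_at \<A> p) i j p \<rho> w m is
    + comp (chart_at \<A> p) (cov_deriv \<A> nab N r) [i, j] m is p
    + comp (chart_at \<A> p) (i_over_lambda (wprod \<A> \<omega> B r r)) [i, j] m is p)"
begin

abbreviation (input) Rc :: "('m, 'n) chart => 'n => nat => 'n list => 'm => 'v"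
 where "Rc c j == comp c r [j]"

lemma R_LS: "c : \<A> ==> Rc c j : LS c"
 by (rule comp_LS[OF r_\<W>])

lemma R_eq:
 fixes p i j
 defines "c == chx p"
 shows "\<exists>\<rho>\<in>V p. EX w.
  (ALL s. S (fst c) s --> N (cx c i) (N (cx c j) s) p - N (cx c j) (N (cx c i) s) p
   = B \<rho> (s p) - B (s p) \<rho>) &
  (ALL m is. Rc c j m (i # is) p - Rc c i m (j # is) p = Hc c i j p \<rho> w m is + nb c i (Rc c j) m is p
   - nb c j (Rc c i) m is p + \<i> *C K c p (ev p (Rc c i)) (ev p (Rc c j)) (Suc m) is)"
proof -
 have c: "c : \<A>" "p : fst c" unfolding c_def by (rule chart_at)+
 have 1: "comp c (i_over_lambda (wprod \<A> \<omega> B r r)) [i, j] m is p = \<i> *C K c p (ev p (Rc c i)) (ev p (Rc c j)) (Suc m) is" for m "is"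
  using wprod_comp(4)[OF r_\<W> r_\<W> c r_deg r_deg, of i j "Suc m" "is"]
  by (simp add: comp_def i_over_lambda_def F.comm_def st_def add.commute)
 show ?thesis
  using r_eq[of p i j] unfolding c_def[symmetric]
  by (simp only: delta_comp2[OF r_\<W> c] cov_deriv_comp(2)[OF r_\<W> c] 1 add_diff_eq)
qed

section \<open>The Fedosov element is scalar at order zero\<close>

definition scalars :: "'m => 'v set"
 where "scalars p = range (%z. z *C u p)"

lemma scalars_subspace: "complex_subspace (scalars p)"
 unfolding complex_subspace_def scalars_def
proof (intro conjI ballI allI)
 show "0 : range (%z. z *C u p)" by (rule range_eqI[of _ _ 0]) simp
 fix x y a assume "x : range (%z. z *C u p)"
 then obtain z where x: "x = z *C u p" by blast
 show "a *C x : range (%z. z *C u p)" by (rule range_eqI[of _ _ "a * z"]) (simp add: x scaleC_scaleC)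
 assume "y : range (%z. z *C u p)"
 then obtain z' where y: "y = z' *C u p" by blast
 show "x + y : range (%z. z *C u p)" by (rule range_eqI[of _ _ "z + z'"]) (simp add: x y scaleC_add_left)
qed

lemma scalars_central: "a : scalars p ==> b : V p ==> B a b = B b a"
 using F.u_closed by (auto simp: scalars_def F.B_scale_left[where p=p] F.B_scale_right[where p=p] F.B_u_left[where p=p] F.B_u_right[where p=p])

lemma scalars_B: "a : scalars p ==> b : scalars p ==> B a b : scalars p"
 using F.u_closed[of p] F.V_scale[OF F.u_closed[of p]]
 by (auto simp: scalars_def F.B_scale_left[where p=p] F.B_u_left[where p=p] scaleC_scaleC)

lemma gam_mem:
 assumes Z: "complex_subspace Z" and "!!l. length l = length is ==> x l : Z" shows "gam G x is : Z"
 using assms(2)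
proof (induction "is" arbitrary: x)
 case Nil thus ?case by (simp add: complex_subspace_zero[OF Z])
next
 case (Cons i "is")
 have "gam G (ins i x) is : Z" by (rule Cons.IH) (simp add: Cons.prems)
 moreover have "(SU l. G i l *C x (l # is)) : Z"
  by (intro complex_subspace_sum[OF Z] complex_subspace_scale[OF Z] Cons.prems) simp
 ultimately show ?case by (simp add: complex_subspace_add[OF Z] del: ins_apply)
qed

text \<open>The \<open>\<lambda>\<close>-free part of the Fedosov element does not see the bundle; this is what makes
  \<open>ad(r) / \<lambda>\<close> free of negative powers of \<open>\<lambda>\<close>.\<close>

lemma r_scalar: "r 0 p vs [w] : scalars p"
proof (induction "length vs" arbitrary: p vs w rule: less_induct)
 case less
 show ?case
 proof (rule form_mem[OF scalars_subspace r_\<W> chart_at])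
  fix "is" :: "'n list" and j :: 'n assume len: "length is = length vs"
  let ?c = "chx p"
  note c = chart_at[of p]
  define x where "x i l = Rc ?c i 0 l p" for i l
  have xV: "x i l : V p" for i l using S_V[OF LS_S[OF R_LS[OF c(1)]] c(2)] by (simp add: x_def)
  have xZ: "x i l : scalars p" if "length l < length vs" for i l
   using less[of "map (%i. cx ?c i p) l" p] that by (simp add: x_def comp_def)
  \<comment> \<open>At order zero the total degree is the symmetric degree, and it is at least
    3.\<close>
  have x1: "x i [k] = 0" for i k
   using r_total by (simp add: x_def comp_def total_degree_ge_def)
  \<comment> \<open>The normalisation gives \<open>dst x = 0\<close>. By \<open>dst_mem\<close> it
    remains to see that the antisymmetrised components are scalar; these are the left side of the
    Fedosov equation, whose right side involves only values already known to be scalar.\<close>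
  have "x j is : scalars p"
  proof (rule dst_mem[where x=x and j=j and vs="is", OF scalars_subspace])
   show "symm (x w)" for w using R_LS[OF c(1)] c(2) unfolding x_def LS_def ev_def by auto
   have "(1 / of_nat (length (j # is))) *C dst x (j # is) = 0"
    using delta_inv_comp[OF r_\<W> r_deg, of p 0 "j # is"] r_dinv unfolding x_def
    by (simp add: comp_def zero_fun_def del: dst.simps)
   hence "dst x (j # is) = 0" by (rule scaleC_cancel) (simp del: of_nat_Suc)
   thus "dst x (j # is) : scalars p" using complex_subspace_zero[OF scalars_subspace] by simp
  next
   fix k :: 'n and rest :: "'n list" assume "Suc (length rest) = length is"
   hence lr: "length rest < length vs" using len by simp
   let ?x = "%i m l. Rc ?c i m l p"
   have sV: "?x i m l : V p" for i m l using S_V[OF LS_S[OF R_LS[OF c(1)]] c(2)] .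
   obtain \<rho> w where eq: "x k (j # rest) - x j (k # rest) = Hc ?c j k p \<rho> w 0 rest + nb ?c j (Rc ?c k) 0 rest p
     - nb ?c k (Rc ?c j) 0 rest p + \<i> *C K ?c p (ev p (Rc ?c j)) (ev p (Rc ?c k)) (Suc 0) rest"
    using R_eq[of p j k] unfolding x_def by blast
   \<comment> \<open>The non-scalar term with \<open>\<rho>\<close> occurs at order
     \<open>\<lambda>\<close> only.\<close>
   have H: "Hc ?c j k p \<rho> w 0 rest : scalars p"
   proof -
    have s: "z *C u p : scalars p" for z by (simp add: scalars_def)
    show ?thesis unfolding Hc_def
     by (intro complex_subspace_add[OF scalars_subspace]) (simp_all add: s complex_subspace_zero[OF scalars_subspace])
   qed
   \<comment> \<open>The derivative requires scalar values in a whole neighbourhood, hence the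
     induction is uniform in the point.\<close>
   have nb: "nb ?c i (Rc ?c k) 0 rest p : scalars p" for i k
   proof -
    have "N (cx ?c i) (Rc ?c k 0 rest) p : scalars p"
     using N_scalar[OF chart(1)[OF c(1)] vector_field_coord[OF c(1)] LS_S[OF R_LS[OF c(1)]] _ c(2), of k 0 rest i]
      less[of "map (%i. cx ?c i _) rest"] lr by (auto simp: scalars_def comp_def image_iff)
    thus ?thesis unfolding nb_def
     by (intro complex_subspace_diff[OF scalars_subspace] gam_mem[OF scalars_subspace])
      (use xZ lr in \<open>simp_all add: ev_def x_def\<close>)
   qed
   \<comment> \<open>At order \<open>\<lambda>\<close> there are uncontracted products with one
     coefficient of order one, which cancel because the other factor is scalar on such short lists,
     and first contractions of coefficients of order zero. In the latter both factors have fewer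
     arguments than \<open>vs\<close>, unless one factor is linear and hence 0 by
     \<open>x1\<close>.\<close>
   have Kz: "K ?c p (ev p (Rc ?c j)) (ev p (Rc ?c k)) (Suc 0) rest : scalars p"
   proof -
    let ?M = "weyl B (Pc ?c p) (%k. k) (Suc 0)"
    have sc: "shuf B (?x i 1) (x i') rest = shuf B (x i') (?x i 1) rest" for i i'
    proof (rule shuf_comm)
     fix us vs :: "'n list" assume "length us + length vs = length rest"
     hence "x i' vs : scalars p" using lr by (intro xZ) simp
     from scalars_central[OF this sV] show "B (?x i 1 us) (x i' vs) = B (x i' vs) (?x i 1 us)" by simp
    qed
    have M: "?M (x i) (x i') rest : scalars p" for i i'
     unfolding weyl_Suc_apply unfolding weyl.simps(1)
    proof (intro complex_subspace_scale[OF scalars_subspace] complex_subspace_sum[OF scalars_subspace] shuf_mem[OF scalars_subspace])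
     fix a b and us vs' :: "'n list" assume l: "length us + length vs' = length rest"
     show "B (ins a (x i) us) (ins b (x i') vs') : scalars p"
     proof (cases "us = [] \<or> vs' = []")
      case True
      hence "B (ins a (x i) us) (ins b (x i') vs') = 0"
       using x1 xV F.B_zero_left[where p=p] F.B_zero_right[where p=p] by auto
      thus ?thesis using complex_subspace_zero[OF scalars_subspace] by simp
     next
      case False
      hence "length us > 0" "length vs' > 0" by auto
      hence "Suc (length us) <= length rest" "Suc (length vs') <= length rest" using l by linarith+
      thus ?thesis using lr by (auto intro!: scalars_B xZ)
     qed
    qed
    have ev: "ev p (Rc ?c i) 0 = x i" "ev p (Rc ?c i) (Suc 0) = ?x i 1" for i by (simp_all add: ev_def x_def fun_eq_iff)
    have "K ?c p (ev p (Rc ?c j)) (ev p (Rc ?c k)) (Suc 0) rest = ?M (x j) (x k) rest - ?M (x k) (x j) rest"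
     using sc[of j k] sc[of k j] by (simp add: F.comm_def wstar_apply triples_1 ev del: weyl.simps(2))
    thus ?thesis using complex_subspace_diff[OF scalars_subspace M M] by simp
   qed
   show "x k (j # rest) - x j (k # rest) : scalars p"
    unfolding eq using H nb Kz
    by (intro complex_subspace_add[OF scalars_subspace] complex_subspace_diff[OF scalars_subspace]
      complex_subspace_scale[OF scalars_subspace])
  qed
  thus "r 0 p (map (%i. cx ?c i p) is) [cx ?c j p] : scalars p" by (simp add: x_def comp_def)
 qed
qed

lemma R_central: "b : V p ==> B (Rc c j 0 is p) b = B b (Rc c j 0 is p)"
 using scalars_central[OF r_scalar] by (simp add: comp_def)

lemma R_td: "td 3 (ev p (Rc c j))"
 using r_total by (simp add: td_def ev_def comp_def total_degree_ge_def)

lemma fed_commutes: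
 fixes p
 defines "c == chx p"
 assumes X: "X : LS c"
 shows "fed c (Rc c) i (fed c (Rc c) j X) m is p = fed c (Rc c) j (fed c (Rc c) i X) m is p"
proof -
 have c: "c : \<A>" "p : fst c" unfolding c_def by (rule chart_at)+
 obtain \<rho> w where \<rho>: "\<rho> : V p"
  and curv: "!!s. S (fst c) s ==> N (cx c i) (N (cx c j) s) p - N (cx c j) (N (cx c i) s) p
   = B \<rho> (s p) - B (s p) \<rho>"
  and eq: "!!m is. Rc c j m (i # is) p - Rc c i m (j # is) p = Hc c i j p \<rho> w m is + nb c i (Rc c j) m is p
   - nb c j (Rc c i) m is p + \<i> *C K c p (ev p (Rc c i)) (ev p (Rc c j)) (Suc m) is"
  using R_eq[of p i j] unfolding c_def by blast
 show ?thesis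
  by (rule fed_commute[OF c(1) R_LS[OF c(1)] X c(2) comm_Hc(1)[OF c \<rho> LS_WS[OF X c(2)], where w=w] R_central eq])
   (simp_all add: curvature_comm[OF c X \<rho> curv])
qed

section \<open>Local properties of the Fedosov derivation\<close>

text \<open>Neither term lowers the total degree: \<open>r\<close> has degree at least 3 and the
  division by \<open>\<lambda>\<close> costs 2. Only \<open>\<delta>\<close> lowers it, by one,
  which drives the inductions below.\<close>

lemma nb_lad_td:
 assumes c: "c : \<A>" "p : fst c" and X: "X : LS c" and d: "!!q. q : fst c ==> td d (ev q X)"
  and l: "2 * m + length is < d"
 shows "nb c j X m is p = 0" and "lad c (Rc c j) X m is p = 0"
proof -
 have X0: "X m l q = 0" if "q : fst c" "length l = length is" for q l
  using d[OF that(1)] l that(2) by (simp add: td_def ev_def)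
 have "N (cx c j) (X m is) p = N (cx c j) (%q. 0) p"
  by (rule N_cong[OF chart(1)[OF c(1)] vector_field_coord[OF c(1)] S_zero[OF chart(1)[OF c(1)]] _ _ c(2)]) (simp_all add: X0)
 moreover have "gam (%i l. Ga c j i l p) (ev p X m) is : {0}"
  by (rule gam_mem[OF complex_subspace_singleton]) (simp add: ev_def X0 c)
 ultimately show "nb c j X m is p = 0"
  by (simp add: nb_def N_zero[OF chart(1)[OF c(1)] vector_field_coord[OF c(1)] c(2)])
 note WS = LS_WS[OF R_LS[OF c(1), of j] c(2)] LS_WS[OF X c(2)]
 show "lad c (Rc c j) X m is p = 0"
  using F.td_wstar[OF WS(1) R_td WS(2) d[OF c(2)], of "Pc c p" "%k. k"]
   F.td_wstar[OF WS(2) d[OF c(2)] WS(1) R_td, of "Pc c p" "%k. k"] l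
  by (simp add: lad_def st_def td_def)
qed

lemma fed_lin:
 assumes c: "c : \<A>" "p : fst c" and X: "X : LS c" and Y: "Y : LS c"
 shows "nb c j (%m is q. X m is q + z *C Y m is q) m is p = nb c j X m is p + z *C nb c j Y m is p"
  and "lad c (Rc c j) (%m is q. X m is q + z *C Y m is q) m is p = lad c (Rc c j) X m is p + z *C lad c (Rc c j) Y m is p"
proof -
 have zY: "(%is q. z *C Y m is q) : L1 c" by (rule L1_scale[OF c(1) LS_L1[OF Y] smooth_fun_const])
 show "nb c j (%m is q. X m is q + z *C Y m is q) m is p = nb c j X m is p + z *C nb c j Y m is p"
  by (simp only: nb_n1 n1_add[OF c(1) LS_L1[OF X] zY c(2)] n1_scale[OF c(1) LS_L1[OF Y] smooth_fun_const c(2)]) (simp add: dirderiv_const)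
 have e: "ev p (%m is q. X m is q + z *C Y m is q) = ev p X + z *C ev p Y" by (simp add: ev_def fun_eq_iff)
 note WS = LS_WS[OF R_LS[OF c(1), of j] c(2)] LS_WS[OF X c(2)] LS_WS[OF Y c(2)]
 show "lad c (Rc c j) (%m is q. X m is q + z *C Y m is q) m is p = lad c (Rc c j) X m is p + z *C lad c (Rc c j) Y m is p"
  unfolding lad_def st_def e
   F.wstar_add_right[OF WS(1,2) F.WS_scale[OF WS(3)]] F.wstar_add_left[OF WS(2) F.WS_scale[OF WS(3)] WS(1)]
   F.wstar_scale_right[OF WS(1,3)] F.wstar_scale_left[OF WS(3,1)]
  by (simp add: scaleC_simps algebra_simps)
qed

lemma fed_cong:
 assumes c: "c : \<A>" "p : fst c" and X: "X : LS c" and eq: "!!m is q. q : fst c ==> Y m is q = X m is q"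
 shows "fed c R j Y m is p = fed c R j X m is p"
proof -
 have "N (cx c j) (Y m is) p = N (cx c j) (X m is) p"
  by (rule N_cong[OF chart(1)[OF c(1)] vector_field_coord[OF c(1)] LS_S[OF X] _ _ c(2)]) (simp_all add: eq)
 moreover have "ev p Y = ev p X" using eq[OF c(2)] by (simp add: ev_def)
 ultimately show ?thesis using eq[OF c(2)] by (simp add: fed_def nb_def lad_def st_def)
qed

text \<open>Each of the three parts of the derivation satisfies the Leibniz rule. For the commutator
  part the division by \<open>\<lambda>\<close> can be moved into either summand, since commutators
  with \<open>r\<close> vanish at order zero.\<close>

lemma fed_st:
 assumes c: "c : \<A>" "p : fst c" and X: "X : LS c" and Y: "Y : LS c"
 shows "fed c (Rc c) j (st c X Y) m is p = st c (fed c (Rc c) j X) Y m is p + st c X (fed c (Rc c) j Y) m is p"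
proof -
 let ?W = "wstar B (Pc c p) (%k. k)" and ?\<rho> = "ev p (Rc c j)"
 define x where "x = ev p X" define y where "y = ev p Y"
 define sh where "sh z = (%m. z (Suc m))" for z :: "nat => 'n list => 'v"
 have WS: "?\<rho> : F.WS p" "x : F.WS p" "y : F.WS p" "ev p (nb c j X) : F.WS p" "ev p (nb c j Y) : F.WS p"
  "(%m. ins j (x m)) : F.WS p" "(%m. ins j (y m)) : F.WS p"
  unfolding x_def y_def by (intro F.WS_ins LS_WS[OF _ c(2)] X Y R_LS[OF c(1)] LS_nb[OF c(1)])+
 have K: "K c p ?\<rho> a : F.WS p" "sh (K c p ?\<rho> a) : F.WS p" "\<i> *C sh (K c p ?\<rho> a) : F.WS p" if "a : F.WS p" for a
  using F.WS_comm[OF WS(1) that] unfolding sh_def by (auto intro: F.WS_shift F.WS_scale)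
 have K0: "K c p ?\<rho> a 0 = 0" if "a : F.WS p" for a
  by (rule F.comm_0[OF WS(1) that]) (simp add: ev_def R_central)
 have evfed: "ev p (fed c (Rc c) j Z) = ev p (nb c j Z) - (%m. ins j (ev p Z m)) + \<i> *C sh (K c p ?\<rho> (ev p Z))" for Z
  using ev_lad[of p c "Rc c j" Z] by (simp add: fun_eq_iff ev_def fed_def sh_def)
 have 1: "lad c (Rc c j) (st c X Y) m is p = \<i> *C ?W (sh (K c p ?\<rho> x)) y m is + \<i> *C ?W x (sh (K c p ?\<rho> y)) m is"
 proof -
  have "lad c (Rc c j) (st c X Y) m is p = \<i> *C K c p ?\<rho> (?W x y) (Suc m) is"
   using fun_cong[OF fun_cong[OF ev_lad[of p c "Rc c j" "st c X Y"]], of m "is"] by (simp add: ev_def[of p "lad _ _ _"] ev_st x_def y_def)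
  also have "K c p ?\<rho> (?W x y) (Suc m) = ?W (sh (K c p ?\<rho> x)) y m + ?W x (sh (K c p ?\<rho> y)) m"
   using F.comm_wstar[OF WS(1-3), of "Pc c p" "%k. k"]
    F.wstar_shift_left[OF K(1)[OF WS(2)] WS(3) K0[OF WS(2)], of "Pc c p" "%k. k" m]
    F.wstar_shift_right[OF WS(2) K(1)[OF WS(3)] K0[OF WS(3)], of "Pc c p" "%k. k" m] by (simp add: sh_def)
  finally show ?thesis by (simp add: scaleC_add_right)
 qed
 have 2: "st c X Y m (j # is) p = ?W (%m. ins j (x m)) y m is + ?W x (%m. ins j (y m)) m is"
  using fun_cong[OF F.ins_wstar[OF WS(2,3), of j "Pc c p" "%k. k" m], of "is"] by (simp add: st_def x_def y_def)
 have 3: "nb c j (st c X Y) m is p = ?W (ev p (nb c j X)) y m is + ?W x (ev p (nb c j Y)) m is"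
  unfolding nb_st[OF c(1) X Y c(2)] by (simp add: st_def x_def y_def)
 have e1: "?W (ev p (nb c j X) - (%m. ins j (x m)) + \<i> *C sh (K c p ?\<rho> x)) y =
   ?W (ev p (nb c j X)) y - ?W (%m. ins j (x m)) y + \<i> *C ?W (sh (K c p ?\<rho> x)) y"
  unfolding F.wstar_add_left[OF F.WS_diff[OF WS(4,6)] K(3)[OF WS(2)] WS(3)] F.wstar_diff_left[OF WS(4,6,3)]
   F.wstar_scale_left[OF K(2)[OF WS(2)] WS(3)] ..
 have e2: "?W x (ev p (nb c j Y) - (%m. ins j (y m)) + \<i> *C sh (K c p ?\<rho> y)) =
   ?W x (ev p (nb c j Y)) - ?W x (%m. ins j (y m)) + \<i> *C ?W x (sh (K c p ?\<rho> y))"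
  unfolding F.wstar_add_right[OF WS(2) F.WS_diff[OF WS(5,7)] K(3)[OF WS(3)]] F.wstar_diff_right[OF WS(2,5,7)]
   F.wstar_scale_right[OF WS(2) K(2)[OF WS(3)]] ..
 show ?thesis
  unfolding fed_def[of c _ j "st c X Y"] 1 2 3 unfolding st_def evfed x_def[symmetric] y_def[symmetric] e1 e2
  by (simp add: algebra_simps)
qed

end

context fedosov_bundle
begin

section \<open>Flat sections\<close>

abbreviation wp :: "('m, 'n, 'v) wform => ('m, 'n, 'v) wform => ('m, 'n, 'v) wform"
 where "wp == wprod \<A> \<omega> B"

text \<open>The part of \<open>Fd\<close> that does not lower the total degree; the equation
  \<open>\<delta> a = Ed a\<close> for flat sections is solved by iterating it.\<close>

definition Ed :: "('m, 'n, 'v) wform => ('m, 'n, 'v) wform"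
 where "Ed a = cov_deriv \<A> nab N a + i_over_lambda (super_commutator wp wp r a)"

definition Fd :: "('m, 'n, 'v) wform => ('m, 'n, 'v) wform"
 where "Fd a = - delta \<A> a + cov_deriv \<A> nab N a + i_over_lambda (super_commutator wp wp r a)"

lemma wp_zero: "wp 0 a = 0" "wp a 0 = 0"
proof -
 have e: "{(i, j, n). (0 :: ('m, 'n, 'v) wform) i ~= 0 & a j ~= 0 & i + j + int n = m} = {}"
  "{(i, j, n). a i ~= 0 & (0 :: ('m, 'n, 'v) wform) j ~= 0 & i + j + int n = m} = {}" for m by auto
 show "wp 0 a = 0" by (intro ext) (unfold wprod_def e(1), simp)
 show "wp a 0 = 0" by (intro ext) (unfold wprod_def e(2), simp)
qed

text \<open>Only the component of degree one of \<open>r\<close> contributes, and against a factor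
  of degree 0 its sign is 1.\<close>

lemma super_commutator_eq:
 assumes a: "a : \<W>" "has_deg_a 0 a"
 shows "super_commutator wp wp r a = wp r a - wp a r"
proof (intro ext)
 fix m p and vs ws :: "('m, 'n) tvec list"
 have part: "part_deg_a k r = (if k = 1 then r else 0)" for k
  using r_deg by (auto simp: part_deg_a_def has_deg_a_def fun_eq_iff)
 have d: "wp r a m p vs ws = 0" "wp a r m p vs ws = 0" if "length ws ~= 1"
  using wprod_deg[OF r_\<W> r_deg a] wprod_deg[OF a r_\<W> r_deg] that by (simp_all add: has_deg_a_def)
 have "super_commutator wp wp r a m p vs ws = (\<Sum>k\<le>length ws. if k = 1 then wp r a m p vs ws
   - (- 1) ^ (length ws - 1) *C wp a r m p vs ws else 0)"
  unfolding super_commutator_def part by (rule sum.cong) (simp_all add: wp_zero)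
 also have "... = (if 1 <= length ws then wp r a m p vs ws - (- 1) ^ (length ws - 1) *C wp a r m p vs ws else 0)"
  by (simp add: Suc_le_eq)
 also have "... = wp r a m p vs ws - wp a r m p vs ws"
  using d by (cases "length ws = 1") (auto simp: scaleC_one)
 finally show "super_commutator wp wp r a m p vs ws = (wp r a - wp a r) m p vs ws" by simp
qed

lemma has_deg_diff: "has_deg_a k (a :: ('m, 'n, 'v) wform) ==> has_deg_a k b ==> has_deg_a k (a - b)"
 and has_deg_add: "has_deg_a k (a :: ('m, 'n, 'v) wform) ==> has_deg_a k b ==> has_deg_a k (a + b)"
 and has_deg_scale: "has_deg_a k (a :: ('m, 'n, 'v) wform) ==> has_deg_a k (z *C a)"
 by (simp_all add: has_deg_a_def)

lemma ad_r:
 assumes a: "a : \<W>" "has_deg_a 0 a"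
 defines "b == i_over_lambda (super_commutator wp wp r a)"
 shows "b : \<W>" "has_deg_a 1 b" "c : \<A> ==> p : fst c ==> comp c b [j] m is p = lad c (Rc c j) (comp c a []) m is p"
proof -
 let ?D = "wp r a - wp a r"
 have b: "b m = \<i> *C ?D (m + 1)" for m by (simp add: b_def super_commutator_eq[OF a] i_over_lambda_def)
 have W: "wp r a : \<W>" "wp a r : \<W>" "has_deg_a 1 (wp r a)" "has_deg_a 1 (wp a r)"
  using wprod_\<W>_deg1[OF r_\<W> r_deg a] wprod_\<W>_deg1[OF a r_\<W> r_deg] by simp_all
 have D: "?D : \<W>" "has_deg_a 1 ?D" by (intro \<W>_diff has_deg_diff W)+
 have cD: "comp c ?D [j] m is p = st c (Rc c j) (comp c a []) m is p - st c (comp c a []) (Rc c j) m is p"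
  if c: "c : \<A>" "p : fst c" for c p j m "is"
  using wprod_comp(2)[OF r_\<W> a(1) c r_deg a(2)] wprod_comp(3)[OF a(1) r_\<W> c a(2) r_deg]
  by (simp add: comp_def)
 \<comment> \<open>Ensures that \<open>(i/\<lambda>) ad(r) a\<close> has no term in
   \<open>1/\<lambda>\<close> and so stays in the space of power series.\<close>
 have D0: "?D 0 = 0"
 proof (intro ext)
  fix p vs ws
  show "?D 0 p vs ws = (0 :: 'm => ('m, 'n, 'v) tensor) p vs ws"
  proof (cases "length ws = 1")
   case True
   then obtain w where w: "ws = [w]" by (metis length_Suc_conv length_0_conv One_nat_def)
   let ?c = "chx p"
   note c = chart_at[of p]
   have K0: "K ?c p (ev p (Rc ?c j)) (ev p (comp ?c a [])) 0 = 0" for j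
    by (rule F.comm_0[OF LS_WS[OF R_LS[OF c(1)] c(2)] LS_WS[OF comp_LS[OF a(1) c(1)] c(2)]]) (simp add: ev_def R_central)
   have z: "comp ?c ?D [j] 0 is p = 0" for j "is"
    using fun_cong[OF K0[of j], of "is"] by (simp add: cD[OF c] st_def F.comm_def)
   have "?D 0 p vs [w] : {0}"
    by (rule form_mem[OF complex_subspace_singleton D(1) c]) (use z in \<open>simp add: comp_def del: minus_apply\<close>)
   thus ?thesis by (simp add: w)
  qed (use D(2) in \<open>simp add: has_deg_a_def\<close>)
 qed
 show "b : \<W>"
  unfolding W_space_def mem_Collect_eq
 proof (intro conjI allI impI)
  show "tensor_field \<A> V S (b m)" for m
   using \<W>_field[OF \<W>_scale[OF D(1), of \<i>], of "m + 1"] by (simp add: b)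
  show "b m = 0" if "m < 0" for m
  proof (cases "m + 1 = 0")
   case True thus ?thesis unfolding b True D0 by simp
  qed (use \<W>_neg[OF D(1), of "m + 1"] that in \<open>simp add: b\<close>)
 qed
 show "has_deg_a 1 b" using D(2) unfolding has_deg_a_def b by (simp del: minus_apply)
 show "comp c b [j] m is p = lad c (Rc c j) (comp c a []) m is p" if "c : \<A>" "p : fst c"
  using cD[OF that, of j "Suc m" "is"] by (simp add: comp_def b lad_def add.commute)
qed

lemma Ed_\<W>:
 assumes a: "a : \<W>" "has_deg_a 0 a"
 shows "Ed a : \<W>" "has_deg_a 1 (Ed a)"
  "c : \<A> ==> p : fst c ==> comp c (Ed a) [j] m is p = nb c j (comp c a []) m is p + lad c (Rc c j) (comp c a []) m is p"
proof -
 show "Ed a : \<W>" unfolding Ed_def by (intro \<W>_add cov_deriv_\<W> ad_r a)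
 show "has_deg_a 1 (Ed a)" unfolding Ed_def using cov_deriv_deg[OF a(2,1)] by (intro has_deg_add ad_r a) simp
 show "comp c (Ed a) [j] m is p = nb c j (comp c a []) m is p + lad c (Rc c j) (comp c a []) m is p" if "c : \<A>" "p : fst c"
  using cov_deriv_comp(1)[OF a(1) that, of j m "is"] ad_r(3)[OF a that, of j m "is"] by (simp add: comp_def Ed_def)
qed

lemma Fd_eq: "Fd a = Ed a - delta \<A> a"
 by (simp add: Fd_def Ed_def)

lemma Fd_\<W>:
 assumes a: "a : \<W>" "has_deg_a 0 a"
 shows "Fd a : \<W>" "has_deg_a 1 (Fd a)"
  "c : \<A> ==> p : fst c ==> comp c (Fd a) [j] m is p = fed c (Rc c) j (comp c a []) m is p"
proof -
 show "Fd a : \<W>" "has_deg_a 1 (Fd a)" unfolding Fd_eq by (intro \<W>_diff has_deg_diff Ed_\<W> delta_\<W> a)+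
 show "comp c (Fd a) [j] m is p = fed c (Rc c) j (comp c a []) m is p" if "c : \<A>" "p : fst c"
  using Ed_\<W>(3)[OF a that, of j m "is"] delta_comp[OF a, of c j m "is" p] by (simp add: comp_def Fd_eq fed_def)
qed

lemma comp_lin: "comp c (a + z *C b) js = (%m is q. comp c a js m is q + z *C comp c b js m is q)"
 by (simp add: comp_def fun_eq_iff)

lemma form_eqI:
 assumes "a : \<W>" "has_deg_a 1 a" "b : \<W>" "has_deg_a 1 b"
  and "!!p j m is. comp (chx p) a [j] m is p = comp (chx p) b [j] m is p"
 shows "a = b"
proof -
 have "a - b = 0"
  by (rule form_zeroI) (use assms in \<open>auto intro: \<W>_diff has_deg_diff simp: comp_def\<close>)
 thus ?thesis by simp
qed

lemma function_eqI:
 assumes "a : \<W>" "has_deg_a 0 a" "b : \<W>" "has_deg_a 0 b"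
  and "!!p m is. comp (chx p) a [] m is p = comp (chx p) b [] m is p"
 shows "a = b"
proof -
 have "a - b = 0"
  by (rule function_zeroI) (use assms in \<open>auto intro: \<W>_diff has_deg_diff simp: comp_def\<close>)
 thus ?thesis by simp
qed

lemma lin_\<W>: "a : \<W> ==> b : \<W> ==> a + z *C b : \<W>"
 and lin_deg: "has_deg_a k a ==> has_deg_a k b ==> has_deg_a k (a + z *C b)"
 by (intro \<W>_add \<W>_scale has_deg_add has_deg_scale; assumption)+

lemma Ed_lin:
 assumes a: "a : \<W>" "has_deg_a 0 a" and b: "b : \<W>" "has_deg_a 0 b"
 shows "Ed (a + z *C b) = Ed a + z *C Ed b"
proof (rule form_eqI)
 have l: "a + z *C b : \<W>" "has_deg_a 0 (a + z *C b)" by (intro lin_\<W> lin_deg a b)+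
 show "Ed (a + z *C b) : \<W>" "has_deg_a 1 (Ed (a + z *C b))" by (intro Ed_\<W> l)+
 show "Ed a + z *C Ed b : \<W>" "has_deg_a 1 (Ed a + z *C Ed b)" by (intro lin_\<W> lin_deg Ed_\<W> a b)+
 show "comp (chx p) (Ed (a + z *C b)) [j] m is p = comp (chx p) (Ed a + z *C Ed b) [j] m is p" for p j m "is"
  unfolding comp_lin Ed_\<W>(3)[OF l chart_at] Ed_\<W>(3)[OF a chart_at] Ed_\<W>(3)[OF b chart_at]
   fed_lin[OF chart_at comp_LS[OF a(1) chart_at(1)] comp_LS[OF b(1) chart_at(1)]]
  by (simp add: scaleC_add_right)
qed

lemma Fd_lin:
 assumes a: "a : \<W>" "has_deg_a 0 a" and b: "b : \<W>" "has_deg_a 0 b"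
 shows "Fd (a + z *C b) = Fd a + z *C Fd b"
proof -
 have l: "a + z *C b : \<W>" "has_deg_a 0 (a + z *C b)" by (intro lin_\<W> lin_deg a b)+
 have "delta \<A> (a + z *C b) = delta \<A> a + z *C delta \<A> b"
  by (intro ext) (simp add: delta_deg0[OF l] delta_deg0[OF a] delta_deg0[OF b])
 thus ?thesis unfolding Fd_eq Ed_lin[OF a b] by (simp add: algebra_simps scaleC_diff_right)
qed

lemma total_degree_td:
 assumes "total_degree_ge (int d) a" shows "td d (ev q (comp c a js))"
 using assms by (simp add: td_def ev_def comp_def total_degree_ge_def)

lemma total_degree_all:
 assumes "!!d. total_degree_ge (int d) (a :: ('m, 'n, 'v) wform)" shows "a = 0"
proof (intro ext)
 fix m p vs ws
 show "a m p vs ws = (0 :: ('m, 'n, 'v) wform) m p vs ws"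
  using assms[of "nat (2 * m + int (length vs) + 1)"] unfolding total_degree_ge_def
  by (auto dest!: spec[of _ m] spec[of _ p] spec[of _ vs] spec[of _ ws])
qed

lemma total_degree_form:
 assumes b: "b : \<W>" "has_deg_a 1 b"
  and z: "!!p j m is. 2 * m + length is < d ==> comp (chx p) b [j] m is p = 0"
 shows "total_degree_ge (int d) b"
 unfolding total_degree_ge_def
proof (intro allI impI)
 fix m p and vs ws :: "('m, 'n) tvec list" assume l: "2 * m + int (length vs) < int d"
 show "b m p vs ws = 0"
 proof (cases "length ws = 1 & m \<ge> 0")
  case True
  then obtain w m' where w: "ws = [w]" "m = int m'" by (metis length_Suc_conv length_0_conv One_nat_def nonneg_int_cases)
  have "b m p vs [w] : {0}"
   by (rule form_mem[OF complex_subspace_singleton b(1) chart_at]) (use z[of m'] l in \<open>simp add: w comp_def\<close>)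
  thus ?thesis by (simp add: w)
 qed (use b(2) \<W>_neg[OF b(1), of m] in \<open>auto simp: has_deg_a_def\<close>)
qed

lemma total_degree_function:
 assumes b: "b : \<W>" "has_deg_a 0 b"
  and z: "!!p m is. 2 * m + length is < d ==> comp (chx p) b [] m is p = 0"
 shows "total_degree_ge (int d) b"
 unfolding total_degree_ge_def
proof (intro allI impI)
 fix m p and vs ws :: "('m, 'n) tvec list" assume l: "2 * m + int (length vs) < int d"
 show "b m p vs ws = 0"
 proof (cases "ws = [] & m \<ge> 0")
  case True
  then obtain m' where w: "m = int m'" by (metis nonneg_int_cases)
  have "b m p vs [] : {0}"
   by (rule SY_mem[OF complex_subspace_singleton tensor_at_slice[OF \<W>_tensor[OF b(1)]] chart_at])
    (use z[of m'] l in \<open>simp add: w comp_def\<close>)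
  thus ?thesis using True by simp
 qed (use b(2) \<W>_neg[OF b(1), of m] in \<open>auto simp: has_deg_a_def\<close>)
qed

text \<open>Since \<open>Fd\<close> squares to zero, \<open>Fd a\<close> vanishes as soon as \<open>\<delta>\<^sup>*\<close> annihilates it.\<close>

lemma Fd_zeroI:
 assumes a: "a : \<W>" "has_deg_a 0 a"
  and dst: "!!p m is. dst (%j is. comp (chx p) (Fd a) [j] m is p) is = 0"
 shows "Fd a = 0"
proof (rule total_degree_all)
 fix d
 show "total_degree_ge (int d) (Fd a)"
 proof (induction d)
  case 0
  show ?case by (rule total_degree_form[OF Fd_\<W>(1,2)[OF a]]) simp
 next
  case (Suc d)
  show ?case
  proof (rule total_degree_form[OF Fd_\<W>(1,2)[OF a]])
   fix p j m and "is" :: "'n list" assume l: "2 * m + length is < Suc d"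
   let ?c = "chx p" and ?A = "comp (chx p) a []"
   let ?X = "%j. fed ?c (Rc ?c) j ?A"
   note c = chart_at[of p]
   have A: "?A : LS ?c" by (rule comp_LS[OF a(1) c(1)])
   have X: "?X j : LS ?c" for j by (rule LS_fed[OF c(1)]) (intro R_LS[OF c(1)] A)+
   have Xb: "?X j m is q = comp ?c (Fd a) [j] m is q" if "q : fst ?c" for j m "is" q
    using Fd_\<W>(3)[OF a c(1) that] by simp
   have Xtd: "td d (ev q (?X j))" if "q : fst ?c" for q j
    using total_degree_td[OF Suc.IH, of q ?c "[j]"] by (simp add: td_def ev_def Xb[OF that])
   have "?X j m is p : {0}"
   proof (rule dst_mem[where x="%j l. ?X j m l p" and j=j and vs="is", OF complex_subspace_singleton])
    show "symm (%l. ?X w m l p)" for w using X[of w] c(2) unfolding LS_def ev_def by auto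
    show "dst (%j l. ?X j m l p) (j # is) : {0}" using dst[of p m "j # is"] by (simp add: Xb[OF c(2)] del: dst.simps)
    fix k and rest :: "'n list" assume r: "Suc (length rest) = length is"
    hence l': "2 * m + length rest < d" using l by simp
    \<comment> \<open>In the degree under consideration only \<open>\<delta>\<close> survives.
      Commutation of the components of the derivation therefore says that \<open>\<delta>\<close>
      annihilates \<open>Fd a\<close> there, as the homotopy demands.\<close>
    have e: "fed ?c (Rc ?c) i (?X k) m rest p = - ?X k m (i # rest) p" for i k
     using nb_lad_td[OF c X Xtd l'] by (simp add: fed_def[of _ _ i])
    have "?X k m (j # rest) p = ?X j m (k # rest) p"
     using fed_commutes[OF A, of j k m rest] by (simp add: e)
    thus "?X k m (j # rest) p - ?X j m (k # rest) p : {0}" by simp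
   qed
   thus "comp ?c (Fd a) [j] m is p = 0" using Xb[OF c(2)] by simp
  qed
 qed
qed

text \<open>Flatness expresses the value on \<open>j # rest\<close> by the values of
  \<open>nb\<close> and \<open>lad\<close> on \<open>rest\<close>, that is, by terms of lower total
  degree. Values without symmetric indices are those of the symbol.\<close>

lemma flat_zeroI:
 assumes a: "a : \<W>" "has_deg_a 0 a" and flat: "Fd a = 0" and sigma: "sigma a = 0"
 shows "a = 0"
proof (rule total_degree_all)
 fix d
 show "total_degree_ge (int d) a"
 proof (induction d)
  case 0
  show ?case by (rule total_degree_function[OF a]) simp
 next
  case (Suc d)
  show ?case
  proof (rule total_degree_function[OF a])
   fix p m and "is" :: "'n list" assume l: "2 * m + length is < Suc d"
   let ?c = "chx p" and ?A = "comp (chx p) a []"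
   note c = chart_at[of p]
   show "?A m is p = 0"
   proof (cases "is")
    case Nil
    thus ?thesis using fun_cong[OF fun_cong[OF sigma], of "int m" p] by (simp add: comp_def sigma_def)
   next
    case (Cons j rest)
    have "comp ?c (Fd a) [j] m rest p = 0" unfolding flat by (simp add: comp_def)
    thus ?thesis
     using nb_lad_td[OF c comp_LS[OF a(1) c(1)] total_degree_td[OF Suc.IH], of m rest j] l Cons
     unfolding Fd_\<W>(3)[OF a c] by (simp add: fed_def)
   qed
  qed
 qed
qed

section \<open>Existence of flat sections with prescribed symbol\<close>

definition cst :: "(int => 'm => 'v) => ('m, 'n, 'v) wform"
 where "cst f m p vs ws = (if vs = [] & ws = [] then f m p else 0)"

lemma cst_\<W>: assumes f: "f : series S" shows "cst f : \<W>" "has_deg_a 0 (cst f)"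
proof -
 have fV: "f m p : V p" for m p using f S_V[of UNIV "f m" p] by (simp add: series_def)
 show "cst f : \<W>"
 proof (rule \<W>_deg0I)
  have "F.const (f m p) : SY p" for m p
   by (rule SYI) (simp_all add: F.W_const fV del: zero_fun_apply, simp add: F.const_def)
  thus "(%vs. cst f m p vs []) : SY p" for m p by (simp add: cst_def F.const_def[abs_def])
  show "S (fst c) (comp c (cst f) [] m is)" if c: "c : \<A>" for c m "is"
   using S_subset[of UNIV "f (int m)" "fst c"] f chart(1)[OF c] S_zero[OF chart(1)[OF c]]
   by (cases "is") (simp_all add: comp_def[abs_def] cst_def series_def)
 qed (use f in \<open>simp_all add: cst_def fun_eq_iff series_def\<close>)
qed (simp add: has_deg_a_def cst_def)

text \<open>Fixed point iteration for \<open>a = f + \<delta>^-1 (Ed a)\<close>, whose solution is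
  the Fedosov-Taylor series of \<open>f\<close>.\<close>

fun It :: "(int => 'm => 'v) => nat => ('m, 'n, 'v) wform" where
 "It f 0 = cst f"
| "It f (Suc n) = cst f + dinv (Ed (It f n))"

lemma It_\<W>: assumes f: "f : series S" shows "It f n : \<W> & has_deg_a 0 (It f n)"
proof (induction n)
 case 0 thus ?case using cst_\<W>[OF f] by simp
next
 case (Suc n)
 hence "Ed (It f n) : \<W>" by (intro Ed_\<W>(1)) auto
 from dinv_\<W>[OF this] show ?case unfolding It.simps by (intro conjI \<W>_add has_deg_add cst_\<W>[OF f])
qed

text \<open>The iteration is contracting: \<open>Ed\<close> does not lower the total degree, and
  \<open>dinv\<close> raises it by one.\<close>

lemma dinv_Ed_degree:
 assumes a: "a : \<W>" "has_deg_a 0 a" and b: "b : \<W>" "has_deg_a 0 b" and d: "total_degree_ge (int d) (a - b)"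
 shows "total_degree_ge (int (Suc d)) (dinv (Ed a) - dinv (Ed b))"
proof -
 have ab: "a - b : \<W>" "has_deg_a 0 (a - b)" by (intro \<W>_diff has_deg_diff a b)+
 have "total_degree_ge (int d) (Ed (a - b))"
  by (rule total_degree_form[OF Ed_\<W>(1,2)[OF ab]])
   (simp add: Ed_\<W>(3)[OF ab chart_at] nb_lad_td[OF chart_at comp_LS[OF ab(1) chart_at(1)] total_degree_td[OF d]])
 moreover have "Ed (a - b) = Ed a - Ed b" using Ed_lin[OF a b, of "-1"] by simp
 ultimately have E: "Ed a m p vs ws = Ed b m p vs ws" if "2 * m + int (length vs) < int d" for m p vs ws
  using that by (simp add: total_degree_ge_def)
 show ?thesis
  unfolding total_degree_ge_def
 proof (intro allI impI)
  fix m p and vs ws :: "('m, 'n) tvec list" assume l: "2 * m + int (length vs) < int (Suc d)"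
  have "dst (%w vs. Ed a m p vs [w]) vs = dst (%w vs. Ed b m p vs [w]) vs"
   by (rule dst_cong, rule E) (use l in linarith)
  thus "(dinv (Ed a) - dinv (Ed b)) m p vs ws = 0" by (simp add: dinv_def)
 qed
qed

text \<open>A coefficient of total degree \<open>t\<close> no longer changes after
  \<open>t + 1\<close> steps. For negative \<open>t\<close> the exponent of \<open>\<lambda>\<close>
  is negative, and all iterates vanish there.\<close>

definition lim :: "(int => 'm => 'v) => ('m, 'n, 'v) wform"
 where "lim f m p vs ws = It f (Suc (nat (2 * m + int (length vs)))) m p vs ws"

lemma It_degree: assumes f: "f : series S" shows "total_degree_ge (int n) (It f (Suc n) - It f n)"
proof (induction n)
 case 0
 have "(It f (Suc 0) - It f 0) m = 0" if "m < 0" for m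
  using \<W>_neg[OF conjunct1[OF It_\<W>[OF f, of "Suc 0"]] that] \<W>_neg[OF conjunct1[OF It_\<W>[OF f, of 0]] that]
  by (simp del: It.simps)
 thus ?case by (simp add: total_degree_ge_def del: It.simps)
next
 case (Suc n)
 have "It f (Suc (Suc n)) - It f (Suc n) = dinv (Ed (It f (Suc n))) - dinv (Ed (It f n))"
  unfolding It.simps(2)[of f "Suc n"] by (subst (3) It.simps(2)) simp
 moreover have "total_degree_ge (int (Suc n)) (dinv (Ed (It f (Suc n))) - dinv (Ed (It f n)))"
  by (rule dinv_Ed_degree[OF _ _ _ _ Suc]) (simp_all only: It_\<W>[OF f])
 ultimately show ?case by (simp only:)
qed

lemma It_lim:
 assumes f: "f : series S" and n: "2 * m + int (length vs) < int n"
 shows "It f n m p vs ws = lim f m p vs ws"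
proof -
 have step: "It f (Suc k) m p vs ws = It f k m p vs ws" if "2 * m + int (length vs) < int k" for k
  using It_degree[OF f, of k] that unfolding total_degree_ge_def by (simp del: It.simps)
 have "It f (Suc (nat (2 * m + int (length vs))) + k) m p vs ws = lim f m p vs ws" for k
 proof (induction k)
  case (Suc k)
  show ?case using step[of "Suc (nat (2 * m + int (length vs))) + k"] Suc.IH by (simp del: It.simps)
 qed (simp add: lim_def)
 moreover have "n = Suc (nat (2 * m + int (length vs))) + (n - Suc (nat (2 * m + int (length vs)))) \<or> 2 * m + int (length vs) < 0"
  using n by (cases "2 * m + int (length vs) < 0") auto
 moreover have "It f n m p vs ws = lim f m p vs ws" if neg: "2 * m + int (length vs) < 0"
 proof -
  have "m < 0" using neg by simp
  thus ?thesis using \<W>_neg[OF conjunct1[OF It_\<W>[OF f]]] by (simp add: lim_def del: It.simps)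
 qed
 ultimately show ?thesis by metis
qed

text \<open>Each defining condition involves argument lists of bounded length, so it passes to
  limits that are eventually constant on every bounded length.\<close>

lemma SY_limit:
 assumes "!!k. EX x:SY p. ALL vs. length vs <= k --> y vs = x vs" shows "y : SY p"
proof -
 have x: "EX x:SY p. y vs = x vs & (ALL v. y (v # vs) = x (v # vs)) & (ALL vs'. length vs' = length vs --> y vs' = x vs')" for vs
 proof -
  obtain x where "x : SY p" "ALL vs'. length vs' <= Suc (length vs) --> y vs' = x vs'" using assms by blast
  thus ?thesis by (intro bexI[of _ x]) auto
 qed
 show ?thesis
 proof (rule SYI)
  have "y vs : V p" for vs using x[of vs] F.W_V[OF SY_W] by metis
  moreover have "symm y"
   unfolding symm_def
  proof (intro allI)
   fix us vs :: "('m, 'n) tvec list" and a b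
   obtain x where "x : SY p" and e: "!!vs'. length vs' = length (us @ a # b # vs) ==> y vs' = x vs'"
    using x[of "us @ a # b # vs"] by auto
   hence "x (us @ a # b # vs) = x (us @ b # a # vs)" using F.W_symm[OF SY_W] unfolding symm_def by blast
   thus "y (us @ a # b # vs) = y (us @ b # a # vs)" by (simp add: e)
  qed
  ultimately show "y : F.W p" by (auto simp: F.W_def)
  show "y (v # vs) = 0" if "v \<notin> T p" for v vs using x[of vs] SY_off[of _ p "v # vs"] that by auto
  show "ins (v + w) y = ins v y + ins w y" if vw: "v : T p" "w : T p" for v w
  proof
   fix vs
   obtain x where xS: "x : SY p" and e: "!!v. y (v # vs) = x (v # vs)" using x[of vs] by auto
   show "ins (v + w) y vs = (ins v y + ins w y) vs" using fun_cong[OF SY_add_arg[OF xS vw], of vs] by (simp add: e ins_def)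
  qed
  show "ins (tscale a v) y = of_real a *C ins v y" if v: "v : T p" for a v
  proof
   fix vs
   obtain x where xS: "x : SY p" and e: "!!v. y (v # vs) = x (v # vs)" using x[of vs] by auto
   show "ins (tscale a v) y vs = (of_real a *C ins v y) vs" using fun_cong[OF SY_scale_arg[OF xS v, where a=a], of vs] by (simp add: e ins_def)
  qed
 qed
qed

lemma lim_\<W>: assumes f: "f : series S" shows "lim f : \<W>" "has_deg_a 0 (lim f)"
proof -
 have I: "It f n : \<W>" "has_deg_a 0 (It f n)" for n using It_\<W>[OF f] by blast+
 show "has_deg_a 0 (lim f)" using I(2) unfolding has_deg_a_def lim_def by (simp del: It.simps)
 show "lim f : \<W>"
 proof (rule \<W>_deg0I)
  show "(%vs. lim f m p vs []) : SY p" for m p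
  proof (rule SY_limit)
   fix k
   let ?x = "%vs. It f (Suc (nat (2 * m + int k))) m p vs []"
   show "EX x:SY p. ALL vs. length vs <= k --> lim f m p vs [] = x vs"
   proof (intro bexI[of _ ?x] allI impI)
    show "lim f m p vs [] = ?x vs" if "length vs <= k" for vs
     by (rule It_lim[OF f, symmetric]) (use that in linarith)
    show "?x : SY p" by (rule tensor_at_slice[OF \<W>_tensor[OF I(1)]])
   qed
  qed
  show "lim f m p vs ws = 0" if "ws ~= []" for m p vs ws using I(2) that by (simp add: has_deg_a_def lim_def del: It.simps)
  show "lim f m = 0" if "m < 0" for m using \<W>_neg[OF I(1) that] by (simp add: lim_def fun_eq_iff del: It.simps)
  show "S (fst c) (comp c (lim f) [] m is)" if "c : \<A>" for c m "is"
   using LS_S[OF comp_LS[OF I(1) that], of "Suc (nat (2 * int m + int (length is)))" "[]" m "is"]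
   by (simp add: comp_def[abs_def] lim_def del: It.simps)
 qed
qed

lemma lim_fixpoint: assumes f: "f : series S" shows "lim f = cst f + dinv (Ed (lim f))"
proof (intro ext)
 fix m p and vs ws :: "('m, 'n) tvec list"
 define n where "n = Suc (nat (2 * m + int (length vs)))"
 have "total_degree_ge (int n) (lim f - It f n)"
  using It_lim[OF f, of _ _ n] by (simp add: total_degree_ge_def)
 from dinv_Ed_degree[OF lim_\<W>[OF f] conjunct1[OF It_\<W>[OF f]] conjunct2[OF It_\<W>[OF f]] this]
 have "dinv (Ed (lim f)) m p vs ws = dinv (Ed (It f n)) m p vs ws"
  unfolding total_degree_ge_def by (simp add: n_def)
 hence "(cst f + dinv (Ed (lim f))) m p vs ws = It f (Suc n) m p vs ws" by simp
 also have "... = lim f m p vs ws" by (rule It_lim[OF f]) (simp add: n_def)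
 finally show "lim f m p vs ws = (cst f + dinv (Ed (lim f))) m p vs ws" by simp
qed

text \<open>By \<open>Fd_zeroI\<close> only \<open>\<delta>\<close>-star of
  \<open>Fd (lim f)\<close> has to vanish. The fixed point equation evaluates it on
  \<open>Ed (lim f)\<close>, Euler's relation on \<open>\<delta> (lim f)\<close>, and both give the
  symmetric degree times the section.\<close>

lemma flat_lim:
 assumes f: "f : series S" shows "Fd (lim f) = 0" "sigma (lim f) = f"
proof -
 have sigma: "lim f m p [] [] = f m p" for m p
  using fun_cong[OF fun_cong[OF fun_cong[OF fun_cong[OF lim_fixpoint[OF f]]]], of m p "[]" "[]"]
  by (simp add: cst_def dinv_def)
 thus "sigma (lim f) = f" by (simp add: sigma_def fun_eq_iff)
 note L = lim_\<W>[OF f]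
 show "Fd (lim f) = 0"
 proof (rule Fd_zeroI[OF L])
  fix p m and "is" :: "'n list"
  let ?c = "chx p" and ?A = "%l. comp (chx p) (lim f) [] m l p"
  let ?E = "%j l. comp ?c (Ed (lim f)) [j] m l p"
  \<comment> \<open>For the empty list both sides are 0; otherwise the constant term
    \<open>cst f\<close> does not contribute.\<close>
  have eA: "of_nat (length is) *C ?A is = dst ?E is"
  proof (cases "is")
   case (Cons i l)
   have "?A is = comp ?c (cst f + dinv (Ed (lim f))) [] m is p" by (subst lim_fixpoint[OF f]) simp
   also have "... = comp ?c (dinv (Ed (lim f))) [] m is p" by (simp add: Cons comp_def cst_def)
   also have "... = (1 / of_nat (length is)) *C dst ?E is" by (rule dinv_comp)
   finally show ?thesis using Cons by (simp add: scaleC_scaleC scaleC_one del: dst.simps of_nat_Suc)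
  qed simp
  have "dst (%j l. ?A (j # l)) is - of_nat (length is) *C ?A is : {0}"
   by (rule dst_degree[OF complex_subspace_singleton])
    (use comp_LS[OF L(1) chart_at(1)[of p], of "[]"] chart_at(2)[of p] in \<open>auto simp: LS_def ev_def\<close>)
  moreover have "dst (%j l. comp ?c (Fd (lim f)) [j] m l p) is = dst ?E is + (- 1) *C dst (%j l. ?A (j # l)) is"
   unfolding dst_scale[symmetric] dst_add[symmetric]
  proof (rule dst_cong)
   fix j and l :: "'n list"
   show "comp ?c (Fd (lim f)) [j] m l p = (?E j + (- 1) *C (%l. ?A (j # l))) l"
    using delta_comp[OF L, of ?c j m l p] by (simp add: comp_def Fd_eq)
  qed
  ultimately show "dst (%j l. comp ?c (Fd (lim f)) [j] m l p) is = 0" using eA by simp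
 qed
qed

end

context fedosov_bundle
begin

section \<open>The deformed algebra\<close>

definition flats :: "('m, 'n, 'v) wform set"
 where "flats = {a : \<W>. Fd a = 0 & has_deg_a 0 a}"

lemma flatsD: "a : flats ==> a : \<W>" "a : flats ==> has_deg_a 0 a" "a : flats ==> Fd a = 0"
 by (simp_all add: flats_def)

lemma flats_lin: "a : flats ==> b : flats ==> a + z *C b : flats"
 using Fd_lin[of a b z] by (auto simp: flats_def del: ext intro: lin_\<W> lin_deg)

lemma sigma_series: assumes a: "a : \<W>" shows "sigma a : series S"
proof -
 have "S UNIV (sigma a m)" for m
  using \<W>_smooth[OF a, of _ m "[]" "[]"] by (intro S_glue) (simp add: sigma_def[abs_def])
 thus ?thesis using \<W>_neg[OF a] by (simp add: series_def sigma_def fun_eq_iff)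
qed

lemma sigma_bij: "bij_betw sigma flats (series S)"
proof (rule bij_betwI[of _ _ _ lim])
 show "sigma : flats \<rightarrow> series S" using sigma_series flatsD(1) by blast
 show "lim : series S \<rightarrow> flats" using lim_\<W> flat_lim by (auto simp: flats_def)
 show "sigma (lim f) = f" if "f : series S" for f by (rule flat_lim(2)[OF that])
 show "lim (sigma a) = a" if a: "a : flats" for a
 proof -
  have l: "lim (sigma a) : flats" using lim_\<W> flat_lim sigma_series[OF flatsD(1)[OF a]] by (simp add: flats_def)
  let ?d = "lim (sigma a) + (- 1) *C a"
  have d: "?d : flats" by (rule flats_lin[OF l a])
  have "sigma ?d = 0"
   using flat_lim(2)[OF sigma_series[OF flatsD(1)[OF a]]] by (simp add: sigma_def fun_eq_iff)
  from flat_zeroI[OF flatsD[OF d] this] show ?thesis by simp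
 qed
qed

definition tau :: "(int => 'm => 'v) => ('m, 'n, 'v) wform"
 where "tau = inv_into flats sigma"

lemma tau_flats: "f : series S ==> tau f : flats"
 and sigma_tau: "f : series S ==> sigma (tau f) = f"
 and tau_sigma: "a : flats ==> tau (sigma a) = a"
 unfolding tau_def
 by (rule bij_betw_apply[OF bij_betw_inv_into[OF sigma_bij]], assumption)
  (rule bij_betw_inv_into_right[OF sigma_bij] bij_betw_inv_into_left[OF sigma_bij], assumption)+

abbreviation (input) cp :: "'m => ('m, 'n, 'v) wform => nat => 'n list => 'v"
 where "cp p a == ev p (comp (chx p) a [])"

lemma cp_eqI: "a : \<W> ==> has_deg_a 0 a ==> b : \<W> ==> has_deg_a 0 b ==> (!!p. cp p a = cp p b) ==> a = b"
 by (rule function_eqI) (auto simp: ev_def fun_eq_iff)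

lemma cp_WS: "a : \<W> ==> cp p a : F.WS p"
 by (rule LS_WS[OF comp_LS[OF _ chart_at(1)] chart_at(2)])

lemma cp_wp: "a : \<W> ==> has_deg_a 0 a ==> b : \<W> ==> has_deg_a 0 b ==>
  cp p (wp a b) = wstar B (Pc (chx p) p) (%k. k) (cp p a) (cp p b)"
 by (intro ext) (simp add: ev_def[of p "comp _ (wp _ _) _"] wprod_comp(1)[OF _ _ chart_at] st_def)

lemma cp_lin: "cp p (a + z *C b) = cp p a + z *C cp p b"
 by (simp add: ev_def comp_def fun_eq_iff)

lemma wp_deg0:
 assumes a: "a : \<W>" "has_deg_a 0 a" and b: "b : \<W>" "has_deg_a 0 b"
 shows "wp a b : \<W>" "has_deg_a 0 (wp a b)"
 using wprod_\<W>[OF assms] wprod_deg[OF assms] by simp_all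

lemma wp_assoc:
 assumes a: "a : \<W>" "has_deg_a 0 a" and b: "b : \<W>" "has_deg_a 0 b" and c: "c : \<W>" "has_deg_a 0 c"
 shows "wp (wp a b) c = wp a (wp b c)"
 by (rule cp_eqI) (simp_all add: wp_deg0 a b c cp_wp F.wstar_assoc[OF cp_WS[OF a(1)] cp_WS[OF b(1)] cp_WS[OF c(1)]])

lemma wp_lin_left:
 assumes a: "a : \<W>" "has_deg_a 0 a" and b: "b : \<W>" "has_deg_a 0 b" and c: "c : \<W>" "has_deg_a 0 c"
 shows "wp (a + z *C b) c = wp a c + z *C wp b c" and "wp c (a + z *C b) = wp c a + z *C wp c b"
proof -
 note l = lin_\<W>[OF a(1) b(1), of z] lin_deg[OF a(2) b(2), of z]
 note WS = cp_WS[OF a(1)] cp_WS[OF b(1)] cp_WS[OF c(1)]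
 show "wp (a + z *C b) c = wp a c + z *C wp b c"
 proof (rule cp_eqI[OF wp_deg0[OF l c] lin_\<W>[OF wp_deg0(1)[OF a c] wp_deg0(1)[OF b c]] lin_deg[OF wp_deg0(2)[OF a c] wp_deg0(2)[OF b c]]])
  show "cp p (wp (a + z *C b) c) = cp p (wp a c + z *C wp b c)" for p
   unfolding cp_lin cp_wp[OF l c] cp_wp[OF a c] cp_wp[OF b c] F.wstar_add_left[OF WS(1) F.WS_scale[OF WS(2)] WS(3)]
    F.wstar_scale_left[OF WS(2,3)] ..
 qed
 show "wp c (a + z *C b) = wp c a + z *C wp c b"
 proof (rule cp_eqI[OF wp_deg0[OF c l] lin_\<W>[OF wp_deg0(1)[OF c a] wp_deg0(1)[OF c b]] lin_deg[OF wp_deg0(2)[OF c a] wp_deg0(2)[OF c b]]])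
  show "cp p (wp c (a + z *C b)) = cp p (wp c a + z *C wp c b)" for p
   unfolding cp_lin cp_wp[OF c l] cp_wp[OF c a] cp_wp[OF c b] F.wstar_add_right[OF WS(3,1) F.WS_scale[OF WS(2)]]
    F.wstar_scale_right[OF WS(3,2)] ..
 qed
qed

lemma flats_wp: assumes a: "a : flats" and b: "b : flats" shows "wp a b : flats"
proof -
 note A = flatsD(1,2)[OF a] and B = flatsD(1,2)[OF b]
 have "Fd (wp a b) = 0"
 proof (rule form_zeroI[OF Fd_\<W>(1,2)[OF wp_deg0[OF A B]]])
  fix p j m "is"
  let ?c = "chx p"
  let ?X = "comp ?c a []" and ?Y = "comp ?c b []"
  note c = chart_at[of p]
  have L: "?X : LS ?c" "?Y : LS ?c" by (intro comp_LS A B c)+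
  have z: "ev p (fed ?c (Rc ?c) j (comp ?c x [])) = 0" if "x : flats" for x
   using Fd_\<W>(3)[OF flatsD(1,2)[OF that] c, symmetric] flatsD(3)[OF that] by (simp add: ev_def fun_eq_iff comp_def[of _ 0])
  have "comp ?c (Fd (wp a b)) [j] m is p = fed ?c (Rc ?c) j (st ?c ?X ?Y) m is p"
   unfolding Fd_\<W>(3)[OF wp_deg0[OF A B] c]
   by (rule fed_cong[OF c LS_st[OF c(1) L]]) (rule wprod_comp(1)[OF A(1) B(1) c(1) _ A(2) B(2)])
  also have "... = 0"
   unfolding fed_st[OF c L] by (simp add: st_def z[OF a] z[OF b] wstar_zero[OF LS_WS[OF L(1) c(2)]] wstar_zero[OF LS_WS[OF L(2) c(2)]])
  finally show "comp ?c (Fd (wp a b)) [j] m is p = 0" .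
 qed
 thus ?thesis using wp_deg0[OF A B] by (simp add: flats_def)
qed

text \<open>A power series as a multiple of the unit section. Since its constant extension is flat
  and multiplication by it is \<open>lambda_scale\<close> (\<open>wp_csec\<close>), linearity over
  power series follows from associativity.\<close>

definition csec :: "complex fps => int => 'm => 'v"
 where "csec z m p = (if m < 0 then 0 else fps_nth z (nat m) *C u p)"

lemma csec_series: "csec z : series S"
proof -
 have "S UNIV (csec z m)" for m
  by (cases "m < 0") (simp_all add: csec_def[abs_def] S_scale_const[OF open_UNIV] S_u S_zero)
 thus ?thesis by (simp add: series_def csec_def fun_eq_iff)
qed

lemma wstar_scalar:
 assumes Y: "Y : F.WS p"
 shows "wstar B P e (%m. F.const (z m *C u p)) Y m vs = (\<Sum>i\<le>m. z i *C Y (m - i) vs)"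
  and "wstar B P e Y (%m. F.const (z m *C u p)) m vs = (\<Sum>i\<le>m. z i *C Y (m - i) vs)"
proof -
 have Yv: "Y j vs : V p" for j by (rule F.W_V[OF F.WS_W[OF Y]])
 have eq: "B (z i *C u p) (Y j vs) = z i *C Y j vs" "B (Y j vs) (z i *C u p) = z i *C Y j vs" for i j
  by (simp_all add: F.B_scale_left[OF F.u_closed Yv] F.B_scale_right[OF Yv F.u_closed] F.B_u_left[OF Yv] F.B_u_right[OF Yv])
 note w = weyl_const_left[OF F.V_scale[OF F.u_closed] F.WS_W[OF Y]]
 have sum: "(\<Sum>(i, j, n)\<in>triples m. if n = 0 then f i j else 0) = (\<Sum>i\<le>m. f i (m - i))" for f :: "nat => nat => 'v"
 proof -
  have "(\<Sum>(i, j, n)\<in>triples m. if n = 0 then f i j else 0) = (\<Sum>(i, j, n)\<in>(%i. (i, m - i, 0 :: nat)) ` {..m}. if n = 0 then f i j else 0)"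
   by (rule sum.mono_neutral_right, simp) (auto simp: triples_def image_iff split: if_splits)
  also have "... = (\<Sum>i\<le>m. f i (m - i))" by (subst sum.reindex) (auto simp: inj_on_def)
  finally show ?thesis .
 qed
 show "wstar B P e (%m. F.const (z m *C u p)) Y m vs = (\<Sum>i\<le>m. z i *C Y (m - i) vs)"
  unfolding wstar_apply w eq by (rule sum)
 have "(\<Sum>(i, j, n)\<in>triples m. weyl B P e n (Y i) (F.const (z j *C u p)) vs) =
   (\<Sum>(i, j, n)\<in>triples m. if n = 0 then z j *C Y i vs else 0)"
  unfolding w eq ..
 also have "... = (\<Sum>(i, j, n)\<in>triples m. if n = 0 then z i *C Y j vs else 0)" by (rule F.triples_swap)
 finally show "wstar B P e Y (%m. F.const (z m *C u p)) m vs = (\<Sum>i\<le>m. z i *C Y (m - i) vs)"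
  unfolding wstar_apply sum .
qed

lemma sl_csec: "sl (cst (csec z)) p [] = (%m. F.const (fps_nth z m *C u p))"
 by (simp add: sl_def cst_def csec_def F.const_def fun_eq_iff)

lemma wp_csec:
 assumes a: "a : \<W>" "has_deg_a 0 a"
 shows "wp (cst (csec z)) a = lambda_scale z a" "wp a (cst (csec z)) = lambda_scale z a"
proof -
 note k = cst_\<W>[OF csec_series[of z]]
 have "wp (cst (csec z)) a m p vs ws = lambda_scale z a m p vs ws & wp a (cst (csec z)) m p vs ws = lambda_scale z a m p vs ws" for m p vs ws
 proof (cases "ws = [] & m \<ge> 0")
  case True
  then obtain m' where m: "m = int m'" by (metis nonneg_int_cases)
  have "lambda_scale z a m p vs ws = (\<Sum>i\<le>m'. fps_nth z i *C sl a p [] (m' - i) vs)"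
   using True by (simp add: lambda_scale_def m sl_def sum_apply of_nat_diff)
  thus ?thesis
   using True wprod_slices[OF k(1) a(1), of m' p vs "[]"] wprod_slices[OF a(1) k(1), of m' p vs "[]"]
   by (simp add: sum_Pow_low sl_csec wstar_scalar[OF sl_WS[OF a(1)]] m)
 next
  case False
  thus ?thesis
   using wp_deg0(2)[OF k a] wp_deg0(2)[OF a k] wprod_neg[OF k(1) a(1), of m] wprod_neg[OF a(1) k(1), of m] a(2)
   by (auto simp: has_deg_a_def lambda_scale_def sum_apply)
 qed
 thus "wp (cst (csec z)) a = lambda_scale z a" "wp a (cst (csec z)) = lambda_scale z a" by blast+
qed

lemma csec_flats: "cst (csec z) : flats"
proof -
 note k = cst_\<W>[OF csec_series[of z]]
 have "Fd (cst (csec z)) = 0"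
 proof (rule form_zeroI[OF Fd_\<W>(1,2)[OF k]])
  fix p j m and "is" :: "'n list"
  let ?c = "chx p"
  let ?X = "comp ?c (cst (csec z)) []"
  note c = chart_at[of p]
  note o = chart(1)[OF c(1)]
  have X: "?X m is q = (if is = [] then fps_nth z m *C u q else 0)" for m "is" q
   by (simp add: comp_def cst_def csec_def)
  have N: "N (cx ?c j) (?X m is) p = 0"
   using N_scale_const[OF o vector_field_coord[OF c(1)] S_u[OF o] c(2)] N_u[OF o vector_field_coord[OF c(1)] c(2)]
    N_zero[OF o vector_field_coord[OF c(1)] c(2)]
   by (cases "is") (simp_all add: X[abs_def])
  have "gam (%i l. Ga ?c j i l p) (ev p ?X m) is : {0}"
  proof (cases "is")
   case (Cons i l)
   show ?thesis by (rule gam_mem[OF complex_subspace_singleton]) (auto simp: ev_def X Cons)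
  qed simp
  moreover have "lad ?c (Rc ?c j) ?X m is p = 0"
  proof -
   have "ev p ?X = (%m. F.const (fps_nth z m *C u p))" by (simp add: ev_def X F.const_def fun_eq_iff)
   thus ?thesis by (simp add: lad_def st_def wstar_scalar[OF LS_WS[OF R_LS[OF c(1)] c(2)]])
  qed
  ultimately show "comp ?c (Fd (cst (csec z))) [j] m is p = 0"
   unfolding Fd_\<W>(3)[OF k c] by (simp add: fed_def nb_def N X)
 qed
 thus ?thesis using k by (simp add: flats_def)
qed

lemma lambda_scale_flats: assumes a: "a : flats" shows "lambda_scale z a : flats"
 using flats_wp[OF csec_flats a, of z] by (simp add: wp_csec(1)[OF flatsD(1,2)[OF a]])

definition fstar :: "(int => 'm => 'v) => (int => 'm => 'v) => int => 'm => 'v"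
 where "fstar f g = sigma (wp (tau f) (tau g))"

lemma tau_eqI: "a : flats ==> sigma a = f ==> tau f = a"
 using tau_sigma by blast

lemma fstar_series: assumes f: "f : series S" and g: "g : series S" shows "fstar f g : series S"
 unfolding fstar_def by (rule sigma_series[OF flatsD(1)[OF flats_wp[OF tau_flats[OF f] tau_flats[OF g]]]])

lemma tau_fstar: assumes f: "f : series S" and g: "g : series S" shows "tau (fstar f g) = wp (tau f) (tau g)"
 unfolding fstar_def by (rule tau_sigma[OF flats_wp[OF tau_flats[OF f] tau_flats[OF g]]])

lemma tau_add: assumes f: "f : series S" and g: "g : series S" shows "tau (f + g) = tau f + tau g"
proof (rule tau_eqI)
 show "tau f + tau g : flats" using flats_lin[OF tau_flats[OF f] tau_flats[OF g], of 1] by (simp add: scaleC_one)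
 show "sigma (tau f + tau g) = f + g" using sigma_tau[OF f] sigma_tau[OF g] by (simp add: sigma_def fun_eq_iff)
qed

lemma tau_lambda_scale: assumes f: "f : series S" shows "tau (lambda_scale z f) = lambda_scale z (tau f)"
proof (rule tau_eqI)
 show "lambda_scale z (tau f) : flats" by (rule lambda_scale_flats[OF tau_flats[OF f]])
 show "sigma (lambda_scale z (tau f)) = lambda_scale z f"
  using sigma_tau[OF f] by (simp add: sigma_def fun_eq_iff lambda_scale_def sum_apply)
qed

lemma sigma_lambda_scale: "sigma (lambda_scale z a) = lambda_scale z (sigma a)"
 by (simp add: sigma_def fun_eq_iff lambda_scale_def sum_apply)

lemma fstar_laws:
 assumes f: "f : series S" and g: "g : series S" and h: "h : series S"
 shows fstar_assoc: "fstar (fstar f g) h = fstar f (fstar g h)"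
  and fstar_add_left: "fstar (f + g) h = fstar f h + fstar g h"
  and fstar_add_right: "fstar h (f + g) = fstar h f + fstar h g"
  and fstar_lambda_left: "fstar (lambda_scale z f) g = lambda_scale z (fstar f g)"
  and fstar_lambda_right: "fstar f (lambda_scale z g) = lambda_scale z (fstar f g)"
  and fstar_unit_left: "fstar (const_series u) f = f"
  and fstar_unit_right: "fstar f (const_series u) = f"
proof -
 note F = flatsD(1,2)[OF tau_flats[OF f]] and G = flatsD(1,2)[OF tau_flats[OF g]] and H = flatsD(1,2)[OF tau_flats[OF h]]
 note k = flatsD(1,2)[OF csec_flats]
 show "fstar (fstar f g) h = fstar f (fstar g h)"
  unfolding fstar_def[of "fstar f g"] fstar_def[of f "fstar g h"] tau_fstar[OF f g] tau_fstar[OF g h] wp_assoc[OF F G H] ..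
 show "fstar (f + g) h = fstar f h + fstar g h" "fstar h (f + g) = fstar h f + fstar h g"
  unfolding fstar_def tau_add[OF f g] using wp_lin_left[OF F G H, of 1]
  by (simp_all add: scaleC_one) (simp_all add: sigma_def fun_eq_iff)
 show "fstar (lambda_scale z f) g = lambda_scale z (fstar f g)"
  unfolding fstar_def tau_lambda_scale[OF f] wp_csec(1)[OF F, symmetric] wp_assoc[OF k F G] wp_csec(1)[OF wp_deg0[OF F G]]
  by (rule sigma_lambda_scale)
 show "fstar f (lambda_scale z g) = lambda_scale z (fstar f g)"
  unfolding fstar_def tau_lambda_scale[OF g] wp_csec(2)[OF G, symmetric] wp_assoc[OF F G k, symmetric] wp_csec(2)[OF wp_deg0[OF F G]]
  by (rule sigma_lambda_scale)
 have one: "lambda_scale 1 a = a" if "a : \<W>" for a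
 proof (rule ext)
  fix m
  show "lambda_scale 1 a m = a m"
   using \<W>_neg[OF that, of m] by (auto simp: lambda_scale_def fps_one_nth if_distrib[of "%z. z *C _"] scaleC_one cong: if_cong)
 qed
 have "const_series u = csec 1" by (auto simp: const_series_def csec_def fun_eq_iff scaleC_one)
 hence "tau (const_series u) = cst (csec 1)" by (intro tau_eqI csec_flats) (simp add: sigma_def cst_def fun_eq_iff)
 thus "fstar (const_series u) f = f" "fstar f (const_series u) = f"
  unfolding fstar_def by (simp_all add: wp_csec[OF F] one[OF F(1)] sigma_tau[OF f])
qed

end

section \<open>Sections of a vector bundle\<close>

lemma Ck_on_local:
 assumes "!!x. x : S ==> EX T. open T & x : T & Ck_on k T f"
 shows "Ck_on k S f"
 using assms
proof (induction k arbitrary: f)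
 case 0
 have "isCont f x" if x: "x : S" for x
 proof -
  obtain T where "open T" "x : T" "continuous_on T f" using 0[OF x] by auto
  thus ?thesis using continuous_on_eq_continuous_at by blast
 qed
 thus ?case by (simp add: continuous_at_imp_continuous_on)
next
 case (Suc k)
 have "f differentiable (at x)" if "x : S" for x using Suc.prems[OF that] by auto
 moreover have "Ck_on k S (%x. FD f (at x) v)" for v
  by (rule Suc.IH) (use Suc.prems in fastforce)
 ultimately show ?case by simp
qed

context manifold
begin

lemma smooth_fun_glue:
 assumes "!!p. p : U ==> EX U'. open U' & p : U' & sfu U' f"
 shows "sfu U f"
 unfolding smooth_fun_def smooth_on_def
proof (intro ballI allI Ck_on_local)
 fix c k x assume c: "c : \<A>" and "x : snd c ` (U Int fst c)"
 then obtain p where p: "p : U" "p : fst c" "x = snd c p" by blast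
 obtain U' where U': "open U'" "p : U'" "sfu U' f" using assms[OF p(1)] by blast
 hence "Ck_on k (snd c ` (U' Int fst c)) (f \<circ> chart_inv c)"
  using c unfolding smooth_fun_def smooth_on_def by blast
 thus "EX T. open T & x : T & Ck_on k T (f \<circ> chart_inv c)"
  using open_chart_image[OF c U'(1)] U'(2) p by blast
qed

end

locale vbundle = manifold \<A> for \<A> :: "('m::topological_space, 'n::finite) chart set" +
 fixes E :: "'m => 'e::complex_space set" and F :: "('m, 'e) frame set"
  and NE :: "('m => ('m, 'n) tvec) => ('m => 'e) => 'm => 'e"
 assumes vb: "vector_bundle \<A> E F" and conn: "linear_connection \<A> E F NE"
begin

abbreviation SE where "SE == smooth_section \<A> E F"
abbreviation SA where "SA == smooth_End \<A> E F"

lemmas vb_parts = vb[unfolded vector_bundle_def]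

lemma E_zero: "0 : E p" and E_add: "x : E p ==> y : E p ==> x + y : E p" and E_scale: "x : E p ==> a *C x : E p"
 using vb_parts[THEN conjunct1, THEN spec[of _ p]] by blast+

lemma E_diff: "x : E p ==> y : E p ==> x - y : E p"
 using E_add[of x p "- y"] E_scale[of y p "-1"] by simp

lemma E_sum: "(!!i. i : I ==> f i : E p) ==> (SUM i:I. f i) : E p"
 by (induction I rule: ifi) (auto intro: E_zero E_add)

lemma frame_cover: obtains V k e where "(V, k, e) : F" "p : V"
proof -
 have "\<exists>(V, k, e)\<in>F. p : V" by (rule vb_parts[THEN conjunct2, THEN conjunct1, THEN spec[of _ p]])
 thus ?thesis using that by auto
qed

lemma frame:
 assumes "(V, k, e) : F"
 shows frame_open: "open V" and frame_E: "p : V ==> i < k ==> e i p : E p"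
  and frame_ex1: "p : V ==> x : E p ==> \<exists>!a :: nat => complex. (\<forall>i\<ge>k. a i = 0) & x = (\<Sum>i<k. a i *C e i p)"
proof -
 note v = bspec[OF vb_parts[THEN conjunct2, THEN conjunct2, THEN conjunct1] assms, unfolded prod.case]
 note w = bspec[OF v[THEN conjunct2]]
 show "open V" by (rule v[THEN conjunct1])
 show "p : V ==> i < k ==> e i p : E p" using w[THEN conjunct1] by simp
 show "p : V ==> x : E p ==> \<exists>!a :: nat => complex. (\<forall>i\<ge>k. a i = 0) & x = (\<Sum>i<k. a i *C e i p)"
  by (rule bspec[OF w[THEN conjunct2]])
qed

definition coef :: "(nat => 'm => 'e) => nat => 'm => 'e => nat => complex"
 where "coef e k p x = (THE a. (\<forall>i\<ge>k. a i = 0) & x = (\<Sum>i<k. a i *C e i p))"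

lemma coef_expand:
 assumes "(V, k, e) : F" "p : V" "x : E p" shows "x = (\<Sum>i<k. coef e k p x i *C e i p)"
 using theI'[OF frame_ex1[OF assms]] unfolding coef_def by blast

lemma coef_combination:
 assumes f: "(V, k, e) : F" "p : V" and i: "i < k" and x: "x = (\<Sum>i<k. a i *C e i p)"
 shows "coef e k p x i = a i"
proof -
 have xE: "x : E p" unfolding x by (intro E_sum E_scale frame_E[OF f]) auto
 have "coef e k p x = (%i. if i < k then a i else 0)"
  unfolding coef_def by (rule the1_equality[OF frame_ex1[OF f xE]]) (simp add: x)
 thus ?thesis using i by simp
qed

text \<open>The definition of smooth sections only asserts that smooth coefficients exist in every
  frame; as coefficients are unique, they are those of \<open>coef\<close>.\<close>

lemma SE_iff:
 assumes U: "open U"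
 shows "SE U s \<longleftrightarrow> (ALL p:U. s p : E p) & (ALL V k e i. (V, k, e) : F --> i < k --> sfu (U Int V) (%p. coef e k p (s p) i))"
  (is "?l \<longleftrightarrow> ?r")
proof
 assume l: ?l
 have "sfu (U Int V) (%p. coef e k p (s p) i)" if f: "(V, k, e) : F" and i: "i < k" for V k e i
 proof -
  obtain g where g: "\<forall>i<k. sfu (U Int V) (g i)" "ALL p:U Int V. s p = (\<Sum>i<k. g i p *C e i p)"
   using l f unfolding smooth_section_def combination_on_def by blast
  have "coef e k p (s p) i = g i p" if "p : U Int V" for p
   using that g(2) by (intro coef_combination[OF f _ i]) auto
  thus ?thesis using smooth_fun_cong[of "U Int V" "%p. coef e k p (s p) i" "g i"] g(1) i U frame_open[OF f] by auto
 qed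
 thus ?r using l by (auto simp: smooth_section_def)
next
 assume r: ?r
 have "combination_on \<A> (U Int V) k e s" if f: "(V, k, e) : F" for V k e
  unfolding combination_on_def
  by (intro exI[of _ "%i p. coef e k p (s p) i"]) (use r coef_expand[OF f] f in auto)
 thus ?l using r unfolding smooth_section_def by auto
qed

lemma SE_E: "SE U s ==> p : U ==> s p : E p"
 by (simp add: smooth_section_def)

lemma SE_glue:
 assumes U: "open U" and l: "!!p. p : U ==> EX U'. open U' & p : U' & SE U' s" shows "SE U s"
 unfolding SE_iff[OF U]
proof (intro conjI allI impI ballI smooth_fun_glue)
 show "s p : E p" if "p : U" for p using l[OF that] SE_E by blast
 fix V k e i p assume f: "(V, k, e) : F" "i < k" and p: "p : U Int V"
 obtain U' where U': "open U'" "p : U'" "SE U' s" using l p by blast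
 thus "EX U'. open U' & p : U' & sfu U' (%p. coef e k p (s p) i)"
  using f p frame_open[OF f(1)] SE_iff[OF U'(1)] by (intro exI[of _ "U' Int V"]) auto
qed

lemma SE_cong: assumes U: "open U" and s: "SE U s" and eq: "!!p. p : U ==> s p = t p" shows "SE U t"
 unfolding SE_iff[OF U]
proof (intro conjI allI impI ballI)
 show "t p : E p" if "p : U" for p using SE_E[OF s that] eq[OF that] by simp
 fix V k e i assume f: "(V, k, e) : F" "i < k"
 have "sfu (U Int V) (%p. coef e k p (s p) i)" using s f unfolding SE_iff[OF U] by blast
 thus "sfu (U Int V) (%p. coef e k p (t p) i)"
  using smooth_fun_cong[of "U Int V" "%p. coef e k p (s p) i" "%p. coef e k p (t p) i"] eq U frame_open[OF f(1)] by auto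
qed

lemma SE_subset: assumes s: "SE U s" and U': "U' <= U" shows "SE U' s"
proof -
 have "combination_on \<A> (U' Int V) k e s" if "combination_on \<A> (U Int V) k e s" for V k e
 proof -
  obtain g where g: "\<forall>i<k. sfu (U Int V) (g i)" "ALL p:U Int V. s p = (\<Sum>i<k. g i p *C e i p)"
   using \<open>combination_on \<A> (U Int V) k e s\<close> unfolding combination_on_def by blast
  thus ?thesis unfolding combination_on_def using U'
   by (intro exI[of _ g]) (auto intro: smooth_fun_subset)
 qed
 thus ?thesis using assms unfolding smooth_section_def by fast
qed

lemma coef_lin:
 assumes f: "(V, k, e) : F" "p : V" "i < k" and x: "x : E p" and y: "y : E p"
 shows "coef e k p (x + y) i = coef e k p x i + coef e k p y i" and "coef e k p (a *C x) i = a * coef e k p x i"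
proof -
 have "x + y = (\<Sum>i<k. coef e k p x i *C e i p) + (\<Sum>i<k. coef e k p y i *C e i p)"
  using coef_expand[OF f(1,2) x] coef_expand[OF f(1,2) y] by simp
 hence "x + y = (\<Sum>i<k. (coef e k p x i + coef e k p y i) *C e i p)" by (simp add: scaleC_add_left sum.distrib)
 thus "coef e k p (x + y) i = coef e k p x i + coef e k p y i"
  by (rule coef_combination[OF f, where a="%i. coef e k p x i + coef e k p y i"])
 have "a *C x = a *C (\<Sum>i<k. coef e k p x i *C e i p)" using coef_expand[OF f(1,2) x] by simp
 hence "a *C x = (\<Sum>i<k. (a * coef e k p x i) *C e i p)" by (simp add: scaleC_sum_right scaleC_scaleC)
 thus "coef e k p (a *C x) i = a * coef e k p x i"
  by (rule coef_combination[OF f, where a="%i. a * coef e k p x i"])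
qed

lemma SE_add: assumes U: "open U" and s: "SE U s" and t: "SE U t" shows "SE U (%p. s p + t p)"
 unfolding SE_iff[OF U]
proof (intro conjI allI impI ballI)
 show "s p + t p : E p" if "p : U" for p using SE_E[OF s that] SE_E[OF t that] by (rule E_add)
 fix V k e i assume f: "(V, k, e) : F" "i < k"
 have o: "open (U Int V)" using U frame_open[OF f(1)] by auto
 have "sfu (U Int V) (%p. coef e k p (s p) i + coef e k p (t p) i)"
  using s t f unfolding SE_iff[OF U] by (intro smooth_fun_add[OF o]) blast+
 thus "sfu (U Int V) (%p. coef e k p (s p + t p) i)"
  by (subst smooth_fun_cong[OF o]) (use coef_lin(1)[OF f(1) _ f(2)] SE_E[OF s] SE_E[OF t] in auto)
qed

lemma SE_scale: assumes U: "open U" and h: "sfu U h" and s: "SE U s" shows "SE U (%p. h p *C s p)"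
 unfolding SE_iff[OF U]
proof (intro conjI allI impI ballI)
 show "h p *C s p : E p" if "p : U" for p using SE_E[OF s that] by (rule E_scale)
 fix V k e i assume f: "(V, k, e) : F" "i < k"
 have o: "open (U Int V)" using U frame_open[OF f(1)] by auto
 have "sfu (U Int V) (%p. coef e k p (s p) i)" using s f unfolding SE_iff[OF U] by blast
 hence "sfu (U Int V) (%p. h p * coef e k p (s p) i)"
  by (intro smooth_fun_mult[OF o] smooth_fun_subset[OF h]) auto
 thus "sfu (U Int V) (%p. coef e k p (h p *C s p) i)"
  by (subst smooth_fun_cong[OF o]) (use coef_lin(2)[OF f(1) _ f(2) _ E_zero] SE_E[OF s] in auto)
qed

lemma SE_frame: assumes f: "(V, k, e) : F" and i: "i < k" shows "SE V (e i)"
proof -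
 have "combination_on \<A> (V Int V') k' e' (e i)" if "(V', k', e') : F" for V' k' e'
  using bspec[OF bspec[OF vb_parts[THEN conjunct2, THEN conjunct2, THEN conjunct2] f, unfolded prod.case] that, unfolded prod.case] i
  by simp
 thus ?thesis using frame_E[OF f _ i] unfolding smooth_section_def by auto
qed

lemma SE_zero: "open U ==> SE U (%p. 0)"
proof (rule SE_glue)
 assume "open U"
 fix p
 obtain V k e where f: "(V, k, e) : F" "p : V" by (rule frame_cover)
 have "SE V (%p. 0)" unfolding SE_iff[OF frame_open[OF f(1)]]
 proof (intro conjI allI impI ballI)
  fix V' k' e' i assume f': "(V', k', e') : F" "i < k'"
  have o: "open (V Int V')" using frame_open[OF f(1)] frame_open[OF f'(1)] by auto
  have "coef e' k' p 0 i = 0" if "p : V'" for p using coef_lin(2)[OF f'(1) that f'(2) E_zero E_zero, of 0] by simp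
  thus "sfu (V Int V') (%p. coef e' k' p 0 i)"
   by (subst smooth_fun_cong[OF o, of _ "%p. 0"]) (auto simp: smooth_fun_const)
 qed (rule E_zero)
 thus "EX U'. open U' & p : U' & SE U' (%p. 0)" using frame_open[OF f(1)] f(2) by blast
qed

lemma SE_sum: "open U ==> (!!i. i : I ==> SE U (s i)) ==> SE U (%p. SUM i:I. s i p)"
 by (induction I rule: ifi) (auto intro: SE_zero SE_add)

lemma SE_diff: "open U ==> SE U s ==> SE U t ==> SE U (%p. s p - t p)"
 using SE_add[of U s "%p. (- 1) *C t p"] SE_scale[of U "%p. - 1" t] smooth_fun_const[of U "- 1 :: complex"] by simp

text \<open>Constant coefficients in a local frame. Local sections suffice because connections are
  operators on local sections, so no cut-off functions are involved.\<close>

lemma section_through: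
 assumes "x : E p"
 obtains U s where "open U" "p : U" "SE U s" "s p = x"
proof -
 obtain V k e where f: "(V, k, e) : F" "p : V" by (rule frame_cover)
 let ?s = "%q. \<Sum>i<k. coef e k p x i *C e i q"
 have "SE V ?s" by (intro SE_sum SE_scale frame_open[OF f(1)] smooth_fun_const SE_frame[OF f(1)]) auto
 thus ?thesis using that[OF frame_open[OF f(1)] f(2)] coef_expand[OF f assms] by metis
qed

section \<open>The connection on sections\<close>

lemma NE:
 assumes "open U" "vfd U X" "SE U s"
 shows NE_SE: "SE U (NE X s)"
  and NE_cong: "!!Y t p. (!!p. p : U ==> Y p = X p) ==> (!!p. p : U ==> t p = s p) ==> p : U ==> NE Y t p = NE X s p"
  and NE_addX: "!!Y p. vfd U Y ==> p : U ==> NE (X + Y) s p = NE X s p + NE Y s p"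
  and NE_scaleX: "!!f p. sfu U f ==> p : U ==> NE (%q. tscale (f q) (X q)) s p = of_real (f p) *C NE X s p"
  and NE_add': "!!t p. SE U t ==> p : U ==> NE X (s + t) p = NE X s p + NE X t p"
  and NE_scale: "!!f p. sfu U f ==> p : U ==>
   NE X (%q. f q *C s q) p = dd (X p) f p *C s p + f p *C NE X s p"
 using conn[unfolded linear_connection_def, rule_format, OF assms] by blast+

lemma NE_add: "open U ==> vfd U X ==> SE U s ==> SE U t ==> p : U ==>
  NE X (%q. s q + t q) p = NE X s p + NE X t p"
 using NE_add'[of U X s t p] by (simp add: plus_fun_def)

lemma NE_zero: "open U ==> vfd U X ==> p : U ==> NE X (%q. 0) p = 0"
 using NE_scale[OF _ _ SE_zero smooth_fun_const, of U X p 0] by simp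

lemma NE_scale_const: "open U ==> vfd U X ==> SE U s ==> p : U ==> NE X (%q. a *C s q) p = a *C NE X s p"
 using NE_scale[OF _ _ _ smooth_fun_const, of U X s p a] by simp

lemma NE_diff: "open U ==> vfd U X ==> SE U s ==> SE U t ==> p : U ==>
  NE X (%q. s q - t q) p = NE X s p - NE X t p"
 using NE_add[of U X s "%q. (- 1) *C t q" p] NE_scale_const[of U X t p "-1"]
  SE_scale[of U "%p. - 1" t] smooth_fun_const[of U "- 1 :: complex"] by simp

text \<open>Near \<open>p\<close> a section is a combination of frame sections, so by linearity over
  functions \<open>D s\<close> depends only on the coefficients at \<open>p\<close>. The open sets
  \<open>U'\<close> are shrunk to a common frame domain.\<close>

lemma tensorial:
 fixes D :: "('m => 'e) => 'e"
 assumes cong: "!!U' s t. open U' ==> p : U' ==> U' <= U ==> SE U' s ==> (!!q. q : U' ==> t q = s q) ==> D t = D s"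
  and add: "!!U' s t. open U' ==> p : U' ==> U' <= U ==> SE U' s ==> SE U' t ==> D (%q. s q + t q) = D s + D t"
  and scale: "!!U' f s. open U' ==> p : U' ==> U' <= U ==> SE U' s ==> sfu U' f ==> D (%q. f q *C s q) = f p *C D s"
  and U: "open U" "p : U" and s: "open U1" "p : U1" "SE U1 s" and t: "open U2" "p : U2" "SE U2 t" and eq: "s p = t p"
 shows "D s = D t"
proof -
 let ?U = "U Int U1 Int U2"
 have o: "open ?U" "p : ?U" using U s t by auto
 obtain V k e where f: "(V, k, e) : F" "p : V" by (rule frame_cover)
 let ?W = "?U Int V"
 have W: "open ?W" "p : ?W" "?W <= U" using o frame_open[OF f(1)] f(2) by auto
 have D0: "D (%q. 0) = 0" using scale[OF W SE_zero[OF W(1)] smooth_fun_const, of 0] by simp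
 have Dsum: "D (%q. SUM i:I. x i q) = (SUM i:I. D (x i))" if "!!i. i : I ==> SE ?W (x i)" for x and I :: "nat set"
  using that by (induction I rule: ifi) (simp_all add: D0 add[OF W] SE_sum[OF W(1)])
 have e: "SE ?W (e i)" if "i < k" for i by (rule SE_subset[OF SE_frame[OF f(1) that]]) auto
 have "D x = (\<Sum>i<k. coef e k p (x p) i *C D (e i))" if x: "SE ?W x" for x
 proof -
  have g: "sfu ?W (%q. coef e k q (x q) i)" if "i < k" for i
  proof -
   have "?W Int V = ?W" by auto
   thus ?thesis using x f that SE_iff[OF W(1), of x] by metis
  qed
  have ge: "SE ?W (%q. coef e k q (x q) i *C e i q)" if "i < k" for i by (rule SE_scale[OF W(1) g[OF that] e[OF that]])
  have "D x = D (%q. \<Sum>i<k. coef e k q (x q) i *C e i q)"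
   by (rule cong[OF W SE_sum[OF W(1)]]) (use ge coef_expand[OF f(1)] SE_E[OF x] in auto)
  also have "... = (\<Sum>i<k. D (%q. coef e k q (x q) i *C e i q))" by (rule Dsum) (use ge in auto)
  also have "... = (\<Sum>i<k. coef e k p (x p) i *C D (e i))"
   by (rule sum.cong[OF refl]) (use scale[OF W e g] in auto)
  finally show ?thesis .
 qed
 moreover have "SE ?W s" "SE ?W t" using s t by (auto intro: SE_subset)
 ultimately show ?thesis using eq by simp
qed

section \<open>Endomorphisms\<close>

lemma EndD:
 assumes "A : End_fibre E p"
 shows End_E: "x : E p ==> A x : E p" and End_add: "x : E p ==> y : E p ==> A (x + y) = A x + A y"
  and End_scale: "x : E p ==> A (a *C x) = a *C A x" and End_off: "x \<notin> E p ==> A x = 0" and End_zero: "A 0 = 0"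
proof -
 show "x : E p ==> A x : E p" "x : E p ==> y : E p ==> A (x + y) = A x + A y"
  "x : E p ==> A (a *C x) = a *C A x" "x \<notin> E p ==> A x = 0" for x y a
  using assms by (auto simp: End_fibre_def)
 from this(3)[OF E_zero, of 0] show "A 0 = 0" by simp
qed

lemma End_always: "A : End_fibre E p ==> A x : E p"
 by (cases "x : E p") (simp_all add: End_E End_off E_zero)

lemma SA_End: "SA U A ==> p : U ==> A p : End_fibre E p"
 by (simp add: smooth_End_def)

lemma SA_frame: "SA U A ==> (V, k, e) : F ==> i < k ==> SE (U Int V) (%p. A p (e i p))"
 unfolding smooth_End_def by fast

lemma SAI: "(!!p. p : U ==> A p : End_fibre E p) ==>
  (!!V k e i. (V, k, e) : F ==> i < k ==> SE (U Int V) (%p. A p (e i p))) ==> SA U A"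
 unfolding smooth_End_def by fast

lemma SA_subset: assumes A: "SA U A" and U': "U' <= U" shows "SA U' A"
proof (rule SAI)
 show "A p : End_fibre E p" if "p : U'" for p using SA_End[OF A] that U' by auto
 show "SE (U' Int V) (%p. A p (e i p))" if f: "(V, k, e) : F" "i < k" for V k e i
  by (rule SE_subset[OF SA_frame[OF A f]]) (use U' in auto)
qed

lemma SA_apply:
 assumes U: "open U" and A: "SA U A" and s: "SE U s" shows "SE U (%p. A p (s p))"
proof (rule SE_glue[OF U])
 fix p assume p: "p : U"
 obtain V k e where f: "(V, k, e) : F" "p : V" by (rule frame_cover)
 define g where "g i q = coef e k q (s q) i" for i q
 have g: "sfu (U Int V) (g i)" if "i < k" for i
  using s f that unfolding SE_iff[OF U] g_def by blast
 have sg: "s q = (\<Sum>i<k. g i q *C e i q)" if "q : U Int V" for q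
  using coef_expand[OF f(1), of q "s q"] SE_E[OF s] that by (simp add: g_def)
 have o: "open (U Int V)" using U frame_open[OF f(1)] by auto
 have "SE (U Int V) (%p. A p (s p))"
 proof (rule SE_cong[OF o])
  show "SE (U Int V) (%q. \<Sum>i<k. g i q *C A q (e i q))"
   by (intro SE_sum SE_scale o g SA_frame[OF A f(1)]) auto
  show "(\<Sum>i<k. g i q *C A q (e i q)) = A q (s q)" if q: "q : U Int V" for q
  proof -
   have Aq: "A q : End_fibre E q" using SA_End[OF A] q by auto
   have eE: "e i q : E q" if "i < k" for i using frame_E[OF f(1) _ that] q by auto
   have "A q (SUM i:I. g i q *C e i q) = (SUM i:I. g i q *C A q (e i q))" if "I <= {..<k}" "finite I" for I
    using that(2,1)
   proof (induction I rule: finite_induct)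
    case empty thus ?case by (simp add: End_zero[OF Aq])
   next
    case (insert x I)
    have "(SUM i:I. g i q *C e i q) : E q" using insert.prems by (intro E_sum E_scale eE) auto
    moreover have "e x q : E q" using insert.prems by (intro eE) auto
    ultimately show ?case
     using insert by (simp add: End_add[OF Aq] E_scale End_scale[OF Aq])
   qed
   thus ?thesis using sg[OF q] by simp
  qed
 qed
 thus "EX U'. open U' & p : U' & SE U' (%p. A p (s p))" using o p f(2) by blast
qed

lemma SA_comp: assumes U: "open U" and A: "SA U A" and A': "SA U A'" shows "SA U (%p. A p \<circ> A' p)"
proof (rule SAI)
 show "A p \<circ> A' p : End_fibre E p" if "p : U" for p
  using EndD[OF SA_End[OF A that]] EndD[OF SA_End[OF A' that]] by (simp add: End_fibre_def)
 show "SE (U Int V) (%p. (A p \<circ> A' p) (e i p))" if f: "(V, k, e) : F" "i < k" for V k e i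
 proof -
  have "SA (U Int V) A" by (rule SA_subset[OF A]) auto
  from SA_apply[OF _ this SA_frame[OF A' f]] U frame_open[OF f(1)] show ?thesis by (simp add: open_Int)
 qed
qed

lemma SA_cong: assumes U: "open U" and A: "SA U A" and eq: "!!p. p : U ==> A p = A' p" shows "SA U A'"
proof (rule SAI)
 show "A' p : End_fibre E p" if "p : U" for p using SA_End[OF A that] eq[OF that] by simp
 show "SE (U Int V) (%p. A' p (e i p))" if f: "(V, k, e) : F" "i < k" for V k e i
  by (rule SE_cong[OF _ SA_frame[OF A f]]) (use U frame_open[OF f(1)] eq in auto)
qed

lemma SA_add: assumes U: "open U" and A: "SA U A" and A': "SA U A'" shows "SA U (%p. A p + A' p)"
proof (rule SAI)
 show "A p + A' p : End_fibre E p" if "p : U" for p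
  using EndD[OF SA_End[OF A that]] EndD[OF SA_End[OF A' that]]
  by (simp add: End_fibre_def E_add scaleC_add_right algebra_simps)
 show "SE (U Int V) (%p. (A p + A' p) (e i p))" if f: "(V, k, e) : F" "i < k" for V k e i
  using SE_add[OF _ SA_frame[OF A f] SA_frame[OF A' f]] U frame_open[OF f(1)] by (simp add: open_Int)
qed

lemma SA_scale: assumes U: "open U" and h: "sfu U h" and A: "SA U A" shows "SA U (%p. h p *C A p)"
proof (rule SAI)
 show "h p *C A p : End_fibre E p" if "p : U" for p
  using EndD[OF SA_End[OF A that]] by (simp add: End_fibre_def E_scale scaleC_add_right scaleC_scaleC mult.commute)
 show "SE (U Int V) (%p. (h p *C A p) (e i p))" if f: "(V, k, e) : F" "i < k" for V k e i
  using SE_scale[OF _ smooth_fun_subset[OF h] SA_frame[OF A f]] U frame_open[OF f(1)] by (simp add: open_Int)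
qed

lemma SA_id: "open U ==> SA U (id_End E)"
proof (rule SAI)
 assume U: "open U"
 show "id_End E p : End_fibre E p" for p by (simp add: id_End_def End_fibre_def E_add E_scale)
 show "SE (U Int V) (%p. id_End E p (e i p))" if f: "(V, k, e) : F" "i < k" for V k e i
  by (rule SE_cong[OF _ SE_subset[OF SE_frame[OF f]]])
   (use U frame_open[OF f(1)] frame_E[OF f(1) _ f(2)] in \<open>auto simp: id_End_def\<close>)
qed

lemma SA_glue:
 assumes U: "open U" and l: "!!p. p : U ==> EX U'. open U' & p : U' & SA U' A" shows "SA U A"
proof (rule SAI)
 show "A p : End_fibre E p" if "p : U" for p using l[OF that] SA_End by blast
 show "SE (U Int V) (%p. A p (e i p))" if f: "(V, k, e) : F" "i < k" for V k e i
 proof (rule SE_glue)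
  fix p assume p: "p : U Int V"
  obtain U' where "open U'" "p : U'" "SA U' A" using l p by blast
  thus "EX U'. open U' & p : U' & SE U' (%p. A p (e i p))"
   using SA_frame[OF _ f, of U'] p frame_open[OF f(1)] by (intro exI[of _ "U' Int V"]) auto
 qed (use U frame_open[OF f(1)] in auto)
qed

end

context vbundle
begin

section \<open>The induced connection on endomorphisms\<close>

text \<open>\<open>locs\<close>, \<open>NA\<close> and \<open>RE\<close> restate
  \<open>local_section\<close>, \<open>EndConn\<close> and \<open>R_E_comp\<close> for the data of
  this locale; they are identified later by \<open>EndConn_NA\<close> and
  \<open>R_E_comp_RE\<close>.\<close>

definition locs :: "'m => 'e => 'm => 'e"
 where "locs p x = (SOME s. (EX U. open U & p : U & SE U s) & s p = x)"

definition NA :: "('m => ('m, 'n) tvec) => ('m => 'e => 'e) => 'm => 'e => 'e"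
 where "NA X A p x = (if x : E p then (let s = locs p x in NE X (%q. A q (s q)) p - A p (NE X s p)) else 0)"

lemma locs:
 assumes "x : E p" obtains U where "open U" "p : U" "SE U (locs p x)" "locs p x p = x"
proof -
 obtain U s where "open U" "p : U" "SE U s" "s p = x" by (rule section_through[OF assms])
 hence "EX s. (EX U. open U & p : U & SE U s) & s p = x" by blast
 from someI_ex[OF this] show ?thesis using that unfolding locs_def by blast
qed

definition cD :: "('m => ('m, 'n) tvec) => ('m => 'e => 'e) => 'm => ('m => 'e) => 'e"
 where "cD X A p s = NE X (%q. A q (s q)) p - A p (NE X s p)"

lemma cD:
 assumes U: "open U" "p : U" and X: "vfd U X" and A: "SA U A" and s: "SE U s"
 shows cD_cong: "(!!q. q : U ==> t q = s q) ==> cD X A p t = cD X A p s"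
  and cD_E: "cD X A p s : E p"
  and cD_add: "SE U t ==> cD X A p (%q. s q + t q) = cD X A p s + cD X A p t"
  and cD_scale: "sfu U f ==> cD X A p (%q. f q *C s q) = f p *C cD X A p s"
proof -
 note As = SA_apply[OF U(1) A s]
 note Ap = SA_End[OF A]
 note Ns = SE_E[OF NE_SE[OF U(1) X s]]
 show "cD X A p t = cD X A p s" if "!!q. q : U ==> t q = s q"
  unfolding cD_def using NE_cong[OF U(1) X s, of X t p] NE_cong[OF U(1) X As, of X "%q. A q (t q)" p] that U(2) by simp
 show "cD X A p s : E p"
  unfolding cD_def by (intro E_diff End_E[OF Ap[OF U(2)]] Ns U(2) SE_E[OF NE_SE[OF U(1) X As]])
 show "cD X A p (%q. s q + t q) = cD X A p s + cD X A p t" if t: "SE U t"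
 proof -
  note At = SA_apply[OF U(1) A t]
  have "NE X (%q. A q (s q + t q)) p = NE X (%q. A q (s q) + A q (t q)) p"
   by (rule NE_cong[OF U(1) X SE_add[OF U(1) As At] _ _ U(2)]) (simp_all add: End_add[OF Ap SE_E[OF s] SE_E[OF t]])
  thus ?thesis
   unfolding cD_def
   by (simp add: NE_add[OF U(1) X As At U(2)] NE_add[OF U(1) X s t U(2)] End_add[OF Ap[OF U(2)] Ns[OF U(2)] SE_E[OF NE_SE[OF U(1) X t] U(2)]])
 qed
 show "cD X A p (%q. f q *C s q) = f p *C cD X A p s" if f: "sfu U f"
 proof -
  have "NE X (%q. A q (f q *C s q)) p = NE X (%q. f q *C A q (s q)) p"
   by (rule NE_cong[OF U(1) X SE_scale[OF U(1) f As] _ _ U(2)]) (simp_all add: End_scale[OF Ap SE_E[OF s]])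
  thus ?thesis
   unfolding cD_def
   by (simp add: NE_scale[OF U(1) X As f U(2)] NE_scale[OF U(1) X s f U(2)] scaleC_diff_right
     End_add[OF Ap[OF U(2)] E_scale[OF SE_E[OF s U(2)]] E_scale[OF Ns[OF U(2)]]]
     End_scale[OF Ap[OF U(2)] SE_E[OF s U(2)]] End_scale[OF Ap[OF U(2)] Ns[OF U(2)]])
 qed
qed

text \<open>The definition of \<open>NA\<close> uses an arbitrarily chosen section through a given
  vector. The commutator of the derivative with \<open>A\<close> is linear over functions, so by
  \<open>tensorial\<close> any section may be used.\<close>

lemma NA_apply:
 assumes U: "open U" "p : U" and X: "vfd U X" and A: "SA U A" and s: "open U1" "p : U1" "SE U1 s"
 shows "NA X A p (s p) = NE X (%q. A q (s q)) p - A p (NE X s p)"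
proof -
 have sp: "s p : E p" by (rule SE_E[OF s(3,2)])
 obtain U2 where t: "open U2" "p : U2" "SE U2 (locs p (s p))" "locs p (s p) p = s p" by (rule locs[OF sp])
 have "cD X A p (locs p (s p)) = cD X A p s"
 proof (rule tensorial[OF _ _ _ U t(1-3) s t(4)])
  fix U' assume U': "open U'" "p : U'" "U' <= U"
  note XA = vector_field_subset[OF X U'(3)] SA_subset[OF A U'(3)]
  show "cD X A p t = cD X A p s" if "SE U' s" "!!q. q : U' ==> t q = s q" for s t by (rule cD_cong[OF U'(1,2) XA that])
  show "cD X A p (%q. s q + t q) = cD X A p s + cD X A p t" if "SE U' s" "SE U' t" for s t by (rule cD_add[OF U'(1,2) XA that])
  show "cD X A p (%q. f q *C s q) = f p *C cD X A p s" if "SE U' s" "sfu U' f" for s f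
   by (rule cD_scale[OF U'(1,2) XA that])
 qed
 thus ?thesis by (simp add: NA_def sp cD_def Let_def)
qed

lemma NA_eqI:
 assumes U: "open U" "p : U" and "!!x. x \<notin> E p ==> f x = g x"
  and "!!U' s. open U' ==> p : U' ==> U' <= U ==> SE U' s ==> f (s p) = g (s p)"
 shows "f = g"
proof
 fix x
 show "f x = g x"
 proof (cases "x : E p")
  case True
  obtain U1 s where s: "open U1" "p : U1" "SE U1 s" "s p = x" by (rule section_through[OF True])
  have "f (s p) = g (s p)" by (rule assms(4)[of "U Int U1"]) (use U s in \<open>auto intro: SE_subset\<close>)
  thus ?thesis by (simp add: s)
 qed (rule assms(3))
qed

lemma NA_off: "x \<notin> E p ==> NA X A p x = 0"
 by (simp add: NA_def)

lemma NA_End: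
 assumes U: "open U" "p : U" and X: "vfd U X" and A: "SA U A" shows "NA X A p : End_fibre E p"
proof -
 have ap: "NA X A p (s p) = cD X A p s" if "open U1" "p : U1" "SE U1 s" for U1 s
  unfolding cD_def by (rule NA_apply[OF U X A that])
 have E: "NA X A p x : E p & NA X A p (x + y) = NA X A p x + NA X A p y & NA X A p (a *C x) = a *C NA X A p x"
  if x: "x : E p" and y: "y : E p" for x y a
 proof -
  obtain U1 s where s: "open U1" "p : U1" "SE U1 s" "s p = x" by (rule section_through[OF x])
  obtain U2 t where t: "open U2" "p : U2" "SE U2 t" "t p = y" by (rule section_through[OF y])
  let ?U = "U Int U1 Int U2"
  have o: "open ?U" "p : ?U" "?U <= U" using U s t by auto
  note XA = vector_field_subset[OF X o(3)] SA_subset[OF A o(3)]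
  have S: "SE ?U s" "SE ?U t" using s t by (auto intro: SE_subset)
  show ?thesis
   using ap[OF o(1,2) S(1)] ap[OF o(1,2) S(2)] ap[OF o(1,2) SE_add[OF o(1) S]] ap[OF o(1,2) SE_scale[OF o(1) smooth_fun_const S(1)], of a]
    cD_E[OF o(1,2) XA S(1)] cD_add[OF o(1,2) XA S(1,2)] cD_scale[OF o(1,2) XA S(1) smooth_fun_const, of a]
   by (simp add: s t)
 qed
 show ?thesis using E[OF _ E_zero] E NA_off by (auto simp: End_fibre_def)
qed

lemma NA_SA:
 assumes U: "open U" and X: "vfd U X" and A: "SA U A" shows "SA U (NA X A)"
proof (rule SAI)
 show "NA X A p : End_fibre E p" if "p : U" for p by (rule NA_End[OF U that X A])
 fix V k e i assume f: "(V, k, e) : F" "i < k"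
 let ?W = "U Int V"
 have o: "open ?W" "?W <= U" using U frame_open[OF f(1)] by auto
 have e: "SE ?W (e i)" by (rule SE_subset[OF SE_frame[OF f]]) auto
 note XA = vector_field_subset[OF X o(2)] SA_subset[OF A o(2)]
 show "SE ?W (%p. NA X A p (e i p))"
 proof (rule SE_cong[OF o(1)])
  show "SE ?W (%p. NE X (%q. A q (e i q)) p - A p (NE X (e i) p))"
   by (intro SE_diff o(1) NE_SE[OF o(1) XA(1)] SA_apply[OF o(1) XA(2)] e)
  show "NE X (%q. A q (e i q)) p - A p (NE X (e i) p) = NA X A p (e i p)" if "p : ?W" for p
   by (rule NA_apply[OF o(1) that XA o(1) that e, symmetric])
 qed
qed

lemma NA:
 assumes U: "open U" "p : U" and X: "vfd U X" and A: "SA U A"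
 shows NA_cong: "(!!q. q : U ==> Y q = X q) ==> (!!q. q : U ==> A' q = A q) ==> NA Y A' p = NA X A p"
  and NA_addX: "vfd U Y ==> NA (X + Y) A p = NA X A p + NA Y A p"
  and NA_scaleX: "sfu U g ==> NA (%q. tscale (g q) (X q)) A p = of_real (g p) *C NA X A p"
  and NA_add: "SA U A' ==> NA X (%q. A q + A' q) p = NA X A p + NA X A' p"
  and NA_scale: "sfu U f ==> NA X (%q. f q *C A q) p = dd (X p) f p *C A p + f p *C NA X A p"
  and NA_comp: "SA U A' ==> NA X (%q. A q \<circ> A' q) p = (NA X A p \<circ> A' p) + (A p \<circ> NA X A' p)"
proof -
 note Ap = SA_End[OF A U(2)]
 show "NA Y A' p = NA X A p" if Y: "!!q. q : U ==> Y q = X q" and A': "!!q. q : U ==> A' q = A q"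
 proof (rule NA_eqI[OF U])
  fix U' s assume U': "open U'" "p : U'" "U' <= U" and s: "SE U' s"
  note XA = vector_field_subset[OF X U'(3)] SA_subset[OF A U'(3)]
  have V': "vfd U' Y" "SA U' A'"
  proof -
   show "SA U' A'" by (rule SA_cong[OF U'(1) XA(2)]) (use A' U' in auto)
   have eq: "Y q = X q" if "q : U'" for q using Y U'(3) that by auto
   show "vfd U' Y"
    using XA(1) U'(1) smooth_fun_cong[of "U' Int fst _" "%p. Y p _" "%p. X p _"] eq chart(1)
    unfolding vector_field_def by (metis (no_types, lifting) IntD1 open_Int)
  qed
  have "NE Y (%q. A' q (s q)) p = NE X (%q. A q (s q)) p" "NE Y s p = NE X s p"
   by (rule NE_cong[OF U'(1) XA(1) SA_apply[OF U'(1) XA(2) s]], use Y A' U' in auto)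
    (rule NE_cong[OF U'(1) XA(1) s], use Y A' U' in auto)
  thus "NA Y A' p (s p) = NA X A p (s p)"
   unfolding NA_apply[OF U'(1,2) V' U'(1,2) s] NA_apply[OF U'(1,2) XA U'(1,2) s] using A'[OF U(2)] by simp
 qed (simp add: NA_off)
 show "NA (X + Y) A p = NA X A p + NA Y A p" if Y: "vfd U Y"
 proof (rule NA_eqI[OF U])
  fix U' s assume U': "open U'" "p : U'" "U' <= U" and s: "SE U' s"
  note XA = vector_field_subset[OF X U'(3)] SA_subset[OF A U'(3)]
  note Y' = vector_field_subset[OF Y U'(3)]
  note As = SA_apply[OF U'(1) XA(2) s]
  show "NA (X + Y) A p (s p) = (NA X A p + NA Y A p) (s p)"
   unfolding plus_fun_apply[of "NA X A p"] NA_apply[OF U'(1,2) XA U'(1,2) s] NA_apply[OF U'(1,2) Y' XA(2) U'(1,2) s]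
    NA_apply[OF U'(1,2) vector_field_add[OF U'(1) XA(1) Y'] XA(2) U'(1,2) s]
    NE_addX[OF U'(1) XA(1) s Y' U'(2)] NE_addX[OF U'(1) XA(1) As Y' U'(2)]
    End_add[OF Ap SE_E[OF NE_SE[OF U'(1) XA(1) s] U'(2)] SE_E[OF NE_SE[OF U'(1) Y' s] U'(2)]]
   by simp
 qed (simp add: NA_off)
 show "NA (%q. tscale (g q) (X q)) A p = of_real (g p) *C NA X A p" if g: "sfu U g"
 proof (rule NA_eqI[OF U])
  fix U' s assume U': "open U'" "p : U'" "U' <= U" and s: "SE U' s"
  note XA = vector_field_subset[OF X U'(3)] SA_subset[OF A U'(3)]
  note g' = smooth_fun_subset[OF g U'(3)]
  note As = SA_apply[OF U'(1) XA(2) s]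
  show "NA (%q. tscale (g q) (X q)) A p (s p) = (of_real (g p) *C NA X A p) (s p)"
   unfolding scaleC_fun_apply[of _ "NA X A p"] NA_apply[OF U'(1,2) XA U'(1,2) s]
    NA_apply[OF U'(1,2) vector_field_scale[OF U'(1) XA(1) g'] XA(2) U'(1,2) s]
    NE_scaleX[OF U'(1) XA(1) s g' U'(2)] NE_scaleX[OF U'(1) XA(1) As g' U'(2)]
    End_scale[OF Ap SE_E[OF NE_SE[OF U'(1) XA(1) s] U'(2)]]
   by (simp add: scaleC_diff_right)
 qed (simp add: NA_off)
 show "NA X (%q. A q + A' q) p = NA X A p + NA X A' p" if A': "SA U A'"
 proof (rule NA_eqI[OF U])
  fix U' s assume U': "open U'" "p : U'" "U' <= U" and s: "SE U' s"
  note XA = vector_field_subset[OF X U'(3)] SA_subset[OF A U'(3)]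
  note A'' = SA_subset[OF A' U'(3)]
  show "NA X (%q. A q + A' q) p (s p) = (NA X A p + NA X A' p) (s p)"
   unfolding plus_fun_apply[of "NA X A p"] NA_apply[OF U'(1,2) XA U'(1,2) s] NA_apply[OF U'(1,2) XA(1) A'' U'(1,2) s]
    NA_apply[OF U'(1,2) XA(1) SA_add[OF U'(1) XA(2) A''] U'(1,2) s] plus_fun_apply[of "A _"]
    NE_add[OF U'(1) XA(1) SA_apply[OF U'(1) XA(2) s] SA_apply[OF U'(1) A'' s] U'(2)]
   by simp
 qed (simp add: NA_off)
 show "NA X (%q. f q *C A q) p = dd (X p) f p *C A p + f p *C NA X A p" if f: "sfu U f"
 proof (rule NA_eqI[OF U])
  fix U' s assume U': "open U'" "p : U'" "U' <= U" and s: "SE U' s"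
  note XA = vector_field_subset[OF X U'(3)] SA_subset[OF A U'(3)]
  note f' = smooth_fun_subset[OF f U'(3)]
  have "NA X (%q. f q *C A q) p (s p) = NE X (%q. f q *C A q (s q)) p - f p *C A p (NE X s p)"
   using NA_apply[OF U'(1,2) XA(1) SA_scale[OF U'(1) f' XA(2)] U'(1,2) s] by simp
  thus "NA X (%q. f q *C A q) p (s p) = (dd (X p) f p *C A p + f p *C NA X A p) (s p)"
   unfolding NE_scale[OF U'(1) XA(1) SA_apply[OF U'(1) XA(2) s] f' U'(2)]
   by (simp add: NA_apply[OF U'(1,2) XA U'(1,2) s] scaleC_diff_right)
 qed (simp add: NA_off End_off[OF Ap])
 show "NA X (%q. A q \<circ> A' q) p = (NA X A p \<circ> A' p) + (A p \<circ> NA X A' p)" if A': "SA U A'"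
 proof (rule NA_eqI[OF U])
  fix U' s assume U': "open U'" "p : U'" "U' <= U" and s: "SE U' s"
  note XA = vector_field_subset[OF X U'(3)] SA_subset[OF A U'(3)]
  note A'' = SA_subset[OF A' U'(3)]
  note A's = SA_apply[OF U'(1) A'' s]
  have 1: "NA X (%q. A q \<circ> A' q) p (s p) = NE X (%q. A q (A' q (s q))) p - A p (A' p (NE X s p))"
   using NA_apply[OF U'(1,2) XA(1) SA_comp[OF U'(1) XA(2) A''] U'(1,2) s] by simp
  have 2: "NA X A p (A' p (s p)) = NE X (%q. A q (A' q (s q))) p - A p (NE X (%q. A' q (s q)) p)"
   by (rule NA_apply[OF U'(1,2) XA U'(1,2) A's])
  have e: "NE X (%q. A' q (s q)) p = NA X A' p (s p) + A' p (NE X s p)"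
   using NA_apply[OF U'(1,2) XA(1) A'' U'(1,2) s] by simp
  have 3: "A p (NE X (%q. A' q (s q)) p) = A p (NA X A' p (s p)) + A p (A' p (NE X s p))"
   unfolding e by (rule End_add[OF Ap End_always[OF NA_End[OF U X A']] End_always[OF SA_End[OF A' U(2)]]])
  show "NA X (%q. A q \<circ> A' q) p (s p) = ((NA X A p \<circ> A' p) + (A p \<circ> NA X A' p)) (s p)"
   using 1 2 3 by simp
 qed (use NA_End[OF U X A] End_off[OF SA_End[OF A' U(2)]] in \<open>simp add: NA_off End_zero[OF Ap] End_zero[OF NA_End[OF U X A]]\<close>)
qed

section \<open>Curvature\<close>

definition RE :: "('m, 'n) chart => 'n => 'n => 'm => 'e => 'e"
 where "RE c i j p x = (if x : E p then curvature \<A> NE (cx c i) (cx c j) (locs p x) p else 0)"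

text \<open>The curvature applied to a section; the bracket term is absent because coordinate fields
  commute.\<close>

definition cR :: "('m, 'n) chart => 'n => 'n => 'm => ('m => 'e) => 'e"
 where "cR c i j p s = NE (cx c i) (NE (cx c j) s) p - NE (cx c j) (NE (cx c i) s) p"

lemma cR:
 assumes c: "c : \<A>" and U: "open U" "p : U" "U <= fst c" and s: "SE U s"
 shows cR_cong: "(!!q. q : U ==> t q = s q) ==> cR c i j p t = cR c i j p s"
  and cR_E: "cR c i j p s : E p"
  and cR_add: "SE U t ==> cR c i j p (%q. s q + t q) = cR c i j p s + cR c i j p t"
  and cR_scale: "sfu U f ==> cR c i j p (%q. f q *C s q) = f p *C cR c i j p s"
proof -
 have X: "vfd U (cx c i)" for i by (rule vector_field_subset[OF vector_field_coord[OF c] U(3)])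
 note N = NE_SE[OF U(1) X]
 show "cR c i j p t = cR c i j p s" if eq: "!!q. q : U ==> t q = s q"
 proof -
  have "NE (cx c i) (NE (cx c j) t) p = NE (cx c i) (NE (cx c j) s) p" for i j
   by (rule NE_cong[OF U(1) X N[OF s] _ _ U(2)]) (simp_all add: NE_cong[OF U(1) X s _ eq])
  thus ?thesis by (simp add: cR_def)
 qed
 show "cR c i j p s : E p" unfolding cR_def by (intro E_diff SE_E[OF N[OF N[OF s]] U(2)])
 show "cR c i j p (%q. s q + t q) = cR c i j p s + cR c i j p t" if t: "SE U t"
 proof -
  have "NE (cx c i) (NE (cx c j) (%q. s q + t q)) p = NE (cx c i) (%q. NE (cx c j) s q + NE (cx c j) t q) p" for i j
   by (rule NE_cong[OF U(1) X SE_add[OF U(1) N[OF s] N[OF t]] _ _ U(2)]) (simp_all add: NE_add[OF U(1) X s t])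
  thus ?thesis by (simp add: cR_def NE_add[OF U(1) X N[OF s] N[OF t] U(2)])
 qed
 show "cR c i j p (%q. f q *C s q) = f p *C cR c i j p s" if f: "sfu U f"
 proof -
  let ?d = "%i q. dd (cx c i q) f q"
  have d: "sfu U (?d i)" for i by (rule smooth_dirderiv[OF U(1) X f])
  have "NE (cx c i) (NE (cx c j) (%q. f q *C s q)) p =
    NE (cx c i) (%q. ?d j q *C s q + f q *C NE (cx c j) s q) p" for i j
   by (rule NE_cong[OF U(1) X SE_add[OF U(1) SE_scale[OF U(1) d s] SE_scale[OF U(1) f N[OF s]]] _ _ U(2)])
    (simp_all add: NE_scale[OF U(1) X s f])
  hence "NE (cx c i) (NE (cx c j) (%q. f q *C s q)) p =
    dd (cx c i p) (?d j) p *C s p + ?d j p *C NE (cx c i) s p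
    + (?d i p *C NE (cx c j) s p + f p *C NE (cx c i) (NE (cx c j) s) p)" for i j
   by (simp add: NE_add[OF U(1) X SE_scale[OF U(1) d s] SE_scale[OF U(1) f N[OF s]] U(2)] NE_scale[OF U(1) X s d U(2)]
    NE_scale[OF U(1) X N[OF s] f U(2)])
  thus ?thesis
   using dirderiv_coord_commute[OF U(1) f c U(2,3), of i j] by (simp add: cR_def scaleC_diff_right)
 qed
qed

lemma RE_apply:
 assumes c: "c : \<A>" "p : fst c" and s: "open U1" "p : U1" "SE U1 s"
 shows "RE c i j p (s p) = cR c i j p s"
proof -
 have sp: "s p : E p" by (rule SE_E[OF s(3,2)])
 obtain U2 where t: "open U2" "p : U2" "SE U2 (locs p (s p))" "locs p (s p) p = s p" by (rule locs[OF sp])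
 let ?t = "locs p (s p)" and ?U = "U2 Int fst c"
 have o: "open ?U" "p : ?U" using t c chart(1)[OF c(1)] by auto
 have tU: "SE ?U ?t" by (rule SE_subset[OF t(3)]) auto
 have "NE (lie_bracket \<A> (cx c i) (cx c j)) ?t p = NE 0 ?t p"
  by (rule NE_cong[OF o(1) vector_field_zero tU _ _ o(2)]) (simp_all add: lie_bracket_coord[OF c(1)])
 also have "... = 0" using NE_addX[OF o(1) vector_field_zero tU vector_field_zero o(2)] by simp
 finally have "RE c i j p (s p) = cR c i j p ?t"
  by (simp add: RE_def sp curvature_def cR_def)
 also have "... = cR c i j p s"
 proof (rule tensorial[OF _ _ _ chart(1)[OF c(1)] c(2) t(1-3) s t(4)])
  fix U' assume U': "open U'" "p : U'" "U' <= fst c"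
  show "cR c i j p t = cR c i j p s" if "SE U' s" "!!q. q : U' ==> t q = s q" for s t by (rule cR_cong[OF c(1) U' that])
  show "cR c i j p (%q. s q + t q) = cR c i j p s + cR c i j p t" if "SE U' s" "SE U' t" for s t by (rule cR_add[OF c(1) U' that])
  show "cR c i j p (%q. f q *C s q) = f p *C cR c i j p s" if "SE U' s" "sfu U' f" for s f
   by (rule cR_scale[OF c(1) U' that])
 qed
 finally show ?thesis .
qed

lemma RE_End:
 assumes c: "c : \<A>" "p : fst c" shows "RE c i j p : End_fibre E p"
proof -
 have E: "RE c i j p x : E p & RE c i j p (x + y) = RE c i j p x + RE c i j p y & RE c i j p (a *C x) = a *C RE c i j p x"
  if x: "x : E p" and y: "y : E p" for x y a
 proof -
  obtain U1 s where s: "open U1" "p : U1" "SE U1 s" "s p = x" by (rule section_through[OF x])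
  obtain U2 t where t: "open U2" "p : U2" "SE U2 t" "t p = y" by (rule section_through[OF y])
  let ?U = "fst c Int U1 Int U2"
  have o: "open ?U" "p : ?U" "?U <= fst c" using c chart(1)[OF c(1)] s t by auto
  have S: "SE ?U s" "SE ?U t" using s t by (auto intro: SE_subset)
  note ap = RE_apply[OF c o(1,2)]
  show ?thesis
   using ap[OF S(1)] ap[OF S(2)] ap[OF SE_add[OF o(1) S]] ap[OF SE_scale[OF o(1) smooth_fun_const S(1)], of _ _ a]
    cR_E[OF c(1) o S(1)] cR_add[OF c(1) o S(1,2)] cR_scale[OF c(1) o S(1) smooth_fun_const, of _ _ a]
   by (simp add: s t)
 qed
 show ?thesis using E[OF _ E_zero] E by (auto simp: End_fibre_def RE_def)
qed

text \<open>In applying both second derivatives to a section, the terms that differentiate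
  \<open>A\<close> and the section once each cancel. What remains makes the induced curvature
  inner.\<close>

lemma NA_curvature:
 assumes c: "c : \<A>" "p : fst c" and A: "SA (fst c) A"
 shows "NA (cx c i) (NA (cx c j) A) p - NA (cx c j) (NA (cx c i) A) p = (RE c i j p \<circ> A p) - (A p \<circ> RE c i j p)"
proof (rule NA_eqI[OF chart(1)[OF c(1)] c(2)])
 fix U' s assume U': "open U'" "p : U'" "U' <= fst c" and s: "SE U' s"
 have X: "vfd U' (cx c i)" for i by (rule vector_field_subset[OF vector_field_coord[OF c(1)] U'(3)])
 note A' = SA_subset[OF A U'(3)]
 note N = NE_SE[OF U'(1) X] and NA' = NA_SA[OF U'(1) X A']
 note As = SA_apply[OF U'(1) A' s]
 have ANs: "SE U' (%q. A q (NE (cx c i) s q))" for i by (rule SA_apply[OF U'(1) A' N[OF s]])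
 have 1: "NA (cx c i) (NA (cx c j) A) p (s p) =
   NE (cx c i) (NE (cx c j) (%q. A q (s q))) p - NE (cx c i) (%q. A q (NE (cx c j) s q)) p
   - (NE (cx c j) (%q. A q (NE (cx c i) s q)) p - A p (NE (cx c j) (NE (cx c i) s) p))" for i j
 proof -
  have "NE (cx c i) (%q. NA (cx c j) A q (s q)) p =
    NE (cx c i) (%q. NE (cx c j) (%q. A q (s q)) q - A q (NE (cx c j) s q)) p"
   by (rule NE_cong[OF U'(1) X SE_diff[OF U'(1) N[OF As] ANs] _ _ U'(2)]) (simp_all add: NA_apply[OF U'(1) _ X A' U'(1) _ s])
  thus ?thesis
   using NA_apply[OF U'(1,2) X NA' U'(1,2) s, of i j] NA_apply[OF U'(1,2) X A' U'(1,2) N[OF s], of j i]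
   by (simp add: NE_diff[OF U'(1) X N[OF As] ANs U'(2)])
 qed
 have Ap: "A p : End_fibre E p" by (rule SA_End[OF A c(2)])
 have "A p (cR c i j p s) = A p (NE (cx c i) (NE (cx c j) s) p) - A p (NE (cx c j) (NE (cx c i) s) p)"
  using End_add[OF Ap cR_E[OF c(1) U' s] SE_E[OF N[OF N[OF s]] U'(2)], of i j j i] by (simp add: cR_def)
 moreover have "NA (cx c i) (NA (cx c j) A) p (s p) - NA (cx c j) (NA (cx c i) A) p (s p) =
   cR c i j p (%q. A q (s q)) - (A p (NE (cx c i) (NE (cx c j) s) p) - A p (NE (cx c j) (NE (cx c i) s) p))"
  unfolding 1 cR_def by (simp add: algebra_simps)
 ultimately have "NA (cx c i) (NA (cx c j) A) p (s p) - NA (cx c j) (NA (cx c i) A) p (s p) =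
   RE c i j p (A p (s p)) - A p (RE c i j p (s p))"
  by (simp only: RE_apply[OF c U'(1,2) s, of i j] RE_apply[OF c U'(1,2) As, of i j])
 thus "(NA (cx c i) (NA (cx c j) A) p - NA (cx c j) (NA (cx c i) A) p) (s p) =
   ((RE c i j p \<circ> A p) - (A p \<circ> RE c i j p)) (s p)"
  by (simp only: minus_apply o_apply)
qed (use End_off[OF SA_End[OF A c(2)]] End_zero[OF SA_End[OF A c(2)]] End_zero[OF RE_End[OF c]] End_off[OF RE_End[OF c]] in \<open>simp add: NA_off\<close>)

end

section \<open>The triangular algebra\<close>

locale fedosov_geometry = vbundle \<A> E F NE
 for \<A> :: "('m::topological_space, 'n::finite) chart set" and E :: "'m => 'e::complex_space set" and F NE +
 fixes \<omega> :: "'m => ('m, 'n, complex) tensor"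
  and nab :: "('m => ('m, 'n) tvec) => ('m => ('m, 'n) tvec) => 'm => ('m, 'n) tvec"
 assumes symplectic: "symplectic_form \<A> \<omega>" "symplectic_connection \<A> \<omega> nab" "torsion_free \<A> nab"
begin

definition TV :: "'m => (('e => 'e) \<times> 'e \<times> complex) set"
 where "TV p = {t. fst t : End_fibre E p & fst (snd t) : E p}"

definition TS :: "'m set => ('m => ('e => 'e) \<times> 'e \<times> complex) => bool"
 where "TS U t \<longleftrightarrow> SA U (%p. fst (t p)) & SE U (%p. fst (snd (t p))) & sfu U (%p. snd (snd (t p)))"

definition TN :: "('m => ('m, 'n) tvec) => ('m => ('e => 'e) \<times> 'e \<times> complex) => 'm => ('e => 'e) \<times> 'e \<times> complex"
 where "TN X t p = (NA X (%q. fst (t q)) p, NE X (%q. fst (snd (t q))) p, dd (X p) (%q. snd (snd (t q))) p)"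

definition TB :: "('e => 'e) \<times> 'e \<times> complex => ('e => 'e) \<times> 'e \<times> complex => ('e => 'e) \<times> 'e \<times> complex"
 where "TB s t = (fst s \<circ> fst t, fst s (fst (snd t)) + snd (snd t) *C fst (snd s), snd (snd s) * snd (snd t))"

definition Tu :: "'m => ('e => 'e) \<times> 'e \<times> complex"
 where "Tu p = (id_End E p, 0, 1)"

lemma End_sub: "0 : End_fibre E p" "A : End_fibre E p ==> A' : End_fibre E p ==> A + A' : End_fibre E p"
 "A : End_fibre E p ==> a *C A : End_fibre E p" "A : End_fibre E p ==> A' : End_fibre E p ==> A \<circ> A' : End_fibre E p"
 "id_End E p : End_fibre E p"
 by (auto simp: End_fibre_def id_End_def E_zero E_add E_scale scaleC_add_right scaleC_scaleC mult.commute algebra_simps)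
  (metis E_zero scaleC_zero_left)+

lemma T_fibre_algebra: "fibre_algebra (TV p) TB (Tu p)"
proof
 note D = EndD[of _ p] End_always[of _ p] End_sub
 show "0 : TV p" by (simp add: TV_def D E_zero)
 show "x + y : TV p" if "x : TV p" "y : TV p" for x y using that by (simp add: TV_def D E_add)
 show "a *C x : TV p" if "x : TV p" for x a using that by (simp add: TV_def D E_scale)
 show "TB x y : TV p" if "x : TV p" "y : TV p" for x y using that by (simp add: TV_def TB_def D E_add E_scale)
 show "TB (x + x') y = TB x y + TB x' y" if "x : TV p" "x' : TV p" "y : TV p" for x x' y
  using that by (simp add: TB_def prod_eq_iff fun_eq_iff scaleC_add_right algebra_simps)
 show "TB x (y + y') = TB x y + TB x y'" if "x : TV p" "y : TV p" "y' : TV p" for x y y'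
  using that by (simp add: TV_def TB_def prod_eq_iff fun_eq_iff D scaleC_add_left algebra_simps)
 show "TB (a *C x) y = a *C TB x y" if "x : TV p" "y : TV p" for a x y
  using that by (simp add: TB_def prod_eq_iff fun_eq_iff scaleC_add_right scaleC_scaleC scaleC_complex_def mult.commute)
 show "TB x (a *C y) = a *C TB x y" if "x : TV p" "y : TV p" for a x y
  using that by (simp add: TV_def TB_def prod_eq_iff fun_eq_iff D scaleC_add_right scaleC_scaleC scaleC_complex_def mult.commute)
 show "TB (TB x y) z = TB x (TB y z)" if "x : TV p" "y : TV p" "z : TV p" for x y z
  using that by (simp add: TV_def TB_def prod_eq_iff fun_eq_iff D E_scale scaleC_add_right scaleC_scaleC mult.commute mult.left_commute add.assoc)
 show "Tu p : TV p" by (simp add: TV_def Tu_def D E_zero)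
 show "TB (Tu p) x = x" if "x : TV p" for x
  using that by (simp add: TV_def TB_def Tu_def prod_eq_iff fun_eq_iff id_End_def D)
 show "TB x (Tu p) = x" if "x : TV p" for x
  using that by (auto simp: TV_def TB_def Tu_def prod_eq_iff fun_eq_iff id_End_def D scaleC_one)
qed

lemma T_bundle: "symplectic_bundle \<A> TV TS TN TB Tu \<omega> nab"
proof (intro symplectic_bundle.intro algebra_bundle.intro symplectic_bundle_axioms.intro algebra_bundle_axioms.intro
  manifold_axioms T_fibre_algebra symplectic)
 fix U s t assume U: "open U" and s: "TS U s"
 note s' = s[unfolded TS_def, THEN conjunct1] s[unfolded TS_def, THEN conjunct2, THEN conjunct1] s[unfolded TS_def, THEN conjunct2, THEN conjunct2]
 show "TS U t" if "!!p. p : U ==> s p = t p"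
  unfolding TS_def using SA_cong[OF U s'(1)] SE_cong[OF U s'(2)] smooth_fun_cong[OF U, of "%p. snd (snd (s p))"] s'(3) that
  by (metis (no_types, lifting))
 show "TS U (%p. f p *C s p)" if f: "sfu U f" for f
  using SA_scale[OF U f s'(1)] SE_scale[OF U f s'(2)] smooth_fun_mult[OF U f s'(3)] by (simp add: TS_def scaleC_complex_def)
 show "TS U (TN X s)" if X: "vfd U X" for X
  using NA_SA[OF U X s'(1)] NE_SE[OF U X s'(2)] smooth_dirderiv[OF U X s'(3)] by (simp add: TS_def TN_def)
 assume t: "TS U t"
 note t' = t[unfolded TS_def, THEN conjunct1] t[unfolded TS_def, THEN conjunct2, THEN conjunct1] t[unfolded TS_def, THEN conjunct2, THEN conjunct2]
 show "TS U (%p. s p + t p)"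
  using SA_add[OF U s'(1) t'(1)] SE_add[OF U s'(2) t'(2)] smooth_fun_add[OF U s'(3) t'(3)] by (simp add: TS_def)
 show "TS U (%p. TB (s p) (t p))"
  using SA_comp[OF U s'(1) t'(1)] SE_add[OF U SA_apply[OF U s'(1) t'(2)] SE_scale[OF U t'(3) s'(2)]] smooth_fun_mult[OF U s'(3) t'(3)]
  by (simp add: TS_def TB_def)
next
 show "TS U' s" if "TS U s" "open U'" "U' <= U" for U U' s
  using that by (auto simp: TS_def intro: SA_subset SE_subset smooth_fun_subset)
 show "s p : TV p" if "TS U s" "p : U" for U s p using that SA_End SE_E by (auto simp: TS_def TV_def)
 show "TS U Tu" if "open U" for U
  using SA_id[OF that] SE_zero[OF that] by (simp add: TS_def Tu_def[abs_def] smooth_fun_const eta_contract_eq)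
 show "affine_connection \<A> nab" using symplectic(2) by (simp add: symplectic_connection_def)
next
 fix U X s p assume U: "open U" and X: "vfd U X" and s: "TS U s"
 note s' = s[unfolded TS_def, THEN conjunct1] s[unfolded TS_def, THEN conjunct2, THEN conjunct1] s[unfolded TS_def, THEN conjunct2, THEN conjunct2]
 show "TN Y t p = TN X s p" if "!!p. p : U ==> Y p = X p" "!!p. p : U ==> t p = s p" "p : U" for Y t p
  unfolding TN_def
  using NA_cong[OF U that(3) X s'(1), of Y "%q. fst (t q)"] NE_cong[OF U X s'(2), of Y "%q. fst (snd (t q))" p]
   dirderiv_cong[OF U, of "%q. snd (snd (t q))" "%q. snd (snd (s q))" p "X p"] that by simp
 assume p: "p : U"
 show "TN (X + Y) s p = TN X s p + TN Y s p" if Y: "vfd U Y" for Y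
  using NA_addX[OF U p X s'(1) Y] NE_addX[OF U X s'(2) Y p] dirderiv_vec_add[OF s'(3) p] by (simp add: TN_def del: plus_fun_apply) simp
 show "TN (%q. tscale (g q) (X q)) s p = of_real (g p) *C TN X s p" if g: "sfu U g" for g
  using NA_scaleX[OF U p X s'(1) g] NE_scaleX[OF U X s'(2) g p] dirderiv_vec_scale[OF s'(3) p]
  by (simp add: TN_def prod_eq_iff scaleC_complex_def scaleR_conv_of_real)
 show "TN X (%q. f q *C s q) p = dd (X p) f p *C s p + f p *C TN X s p" if f: "sfu U f" for f
  using NA_scale[OF U p X s'(1) f] NE_scale[OF U X s'(2) f p] dirderiv_bilinear[OF f s'(3) p bounded_bilinear_mult]
  by (simp add: TN_def prod_eq_iff scaleC_complex_def)
 fix t assume t: "TS U t"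
 note t' = t[unfolded TS_def, THEN conjunct1] t[unfolded TS_def, THEN conjunct2, THEN conjunct1] t[unfolded TS_def, THEN conjunct2, THEN conjunct2]
 show "TN X (%q. s q + t q) p = TN X s p + TN X t p"
  using NA_add[OF U p X s'(1) t'(1)] NE_add[OF U X s'(2) t'(2) p] dirderiv_add[OF s'(3) t'(3) p] by (simp add: TN_def prod_eq_iff)
 show "TN X (%q. TB (s q) (t q)) p = TB (TN X s p) (t p) + TB (s p) (TN X t p)"
 proof -
  note sA = SA_apply[OF U s'(1) t'(2)] and cs = SE_scale[OF U t'(3) s'(2)]
  have "NE X (%q. fst (s q) (fst (snd (t q))) + snd (snd (t q)) *C fst (snd (s q))) p =
    (NA X (%q. fst (s q)) p (fst (snd (t p))) + fst (s p) (NE X (%q. fst (snd (t q))) p)) +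
    (dd (X p) (%q. snd (snd (t q))) p *C fst (snd (s p)) + snd (snd (t p)) *C NE X (%q. fst (snd (s q))) p)"
   unfolding NE_add[OF U X sA cs p] NE_scale[OF U X s'(2) t'(3) p] using NA_apply[OF U p X s'(1) U p t'(2)] by simp
  thus ?thesis
   using NA_comp[OF U p X s'(1) t'(1)] dirderiv_bilinear[OF s'(3) t'(3) p bounded_bilinear_mult] by (simp add: TN_def TB_def prod_eq_iff algebra_simps)
 qed
qed

sublocale T: symplectic_bundle \<A> TV TS TN TB Tu \<omega> nab
 by (rule T_bundle)

lemma T_scalar:
 assumes U: "open U" and X: "vfd U X" and s: "TS U s" and sc: "!!q. q : U ==> EX z. s q = z *C Tu q" and p: "p : U"
 shows "EX z. TN X s p = z *C Tu p"
proof -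
 let ?f = "%q. snd (snd (s q))"
 have f: "sfu U ?f" using s by (simp add: TS_def)
 have sf: "s q = ?f q *C Tu q" if q: "q : U" for q
 proof -
  obtain z where "s q = z *C Tu q" using sc[OF q] by blast
  thus ?thesis by (simp add: Tu_def prod_eq_iff scaleC_complex_def)
 qed
 have "TN X s p = TN X (%q. ?f q *C Tu q) p"
  by (rule T.N_cong[OF U X T.S_scale[OF U f T.S_u[OF U]] _ _ p], rule refl, rule sf, assumption)
 also have "... = dd (X p) ?f p *C Tu p"
  by (simp add: T.N_scale[OF U X T.S_u[OF U] f p] T.N_u[OF U X p])
 finally show ?thesis by blast
qed

lemma T_glue: assumes "!!c. c : \<A> ==> TS (fst c) s" shows "TS UNIV s"
proof -
 have c: "open (fst (chx p))" "p : fst (chx p)" "TS (fst (chx p)) s" for p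
  by (rule chart(1)[OF chart_at(1)], rule chart_at(2), rule assms[OF chart_at(1)])
 note t = c(3)[unfolded TS_def]
 have "SA UNIV (%p. fst (s p))"
  by (rule SA_glue[OF open_UNIV]) (intro exI conjI, rule c(1), rule c(2), rule t[THEN conjunct1])
 moreover have "SE UNIV (%p. fst (snd (s p)))"
  by (rule SE_glue[OF open_UNIV]) (intro exI conjI, rule c(1), rule c(2), rule t[THEN conjunct2, THEN conjunct1])
 moreover have "sfu UNIV (%p. snd (snd (s p)))"
  by (rule smooth_fun_glue) (intro exI conjI, rule c(1), rule c(2), rule t[THEN conjunct2, THEN conjunct2])
 ultimately show ?thesis by (simp add: TS_def)
qed

text \<open>The curvature of the triangular bundle is inner: \<open>(RE, 0, 0)\<close> acts by
  commutator on endomorphisms, from the left only on vectors, and by zero on functions, in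
  accordance with the three connections.\<close>

lemma T_curvature:
 assumes c: "c : \<A>" "p : fst c" and s: "TS (fst c) s"
 shows "TN (cx c i) (TN (cx c j) s) p - TN (cx c j) (TN (cx c i) s) p =
  TB (RE c i j p, 0, 0) (s p) - TB (s p) (RE c i j p, 0, 0)"
proof -
 note s' = s[unfolded TS_def, THEN conjunct1] s[unfolded TS_def, THEN conjunct2, THEN conjunct1] s[unfolded TS_def, THEN conjunct2, THEN conjunct2]
 note o = chart(1)[OF c(1)]
 show ?thesis
  using NA_curvature[OF c s'(1), of i j] RE_apply[OF c o c(2) s'(2), of i j] End_zero[OF SA_End[OF s'(1) c(2)]]
   dirderiv_coord_commute[OF o s'(3) c(1,2) order_refl, of i j]
  by (simp add: TN_def TB_def prod_eq_iff cR_def eta_contract_eq)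
qed

lemma RE_TV: "c : \<A> ==> p : fst c ==> (RE c i j p, 0, 0) : TV p"
 using RE_End by (simp add: TV_def E_zero)

end

section \<open>Components of forms with values in a product\<close>

definition hat :: "('m, 'n, 'a) wform => ('m, 'n, 'b) wform => ('m, 'n, 'c) wform => ('m, 'n, 'a \<times> 'b \<times> 'c) wform"
 where "hat A x f m p vs ws = (A m p vs ws, x m p vs ws, f m p vs ws)"

lemma wform_hat: "a = hat (%m p vs ws. fst (a m p vs ws)) (%m p vs ws. fst (snd (a m p vs ws))) (%m p vs ws. snd (snd (a m p vs ws)))"
 by (simp add: hat_def fun_eq_iff)

lemma hat_eq_iff: "hat A x f = hat A' x' f' \<longleftrightarrow> A = A' & x = x' & f = f'"
 by (auto simp: hat_def fun_eq_iff)

lemma hat_zero_iff: "hat A x f = 0 \<longleftrightarrow> A = 0 & x = 0 & f = 0"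
 by (auto simp: hat_def fun_eq_iff zero_prod_def)

lemma hat_lin:
 "hat A x f + hat A' x' f' = hat (A + A') (x + x') (f + f')" "hat A x f - hat A' x' f' = hat (A - A') (x - x') (f - f')"
 "- hat A x f = hat (- A) (- x) (- f)"
 by (simp_all add: hat_def fun_eq_iff)

lemma hat_i_over_lambda: "i_over_lambda (hat A x f) = hat (i_over_lambda A) (i_over_lambda x) (i_over_lambda f)"
 by (simp add: hat_def fun_eq_iff i_over_lambda_def prod_eq_iff)

lemma hat_deg: "has_deg_a k (hat A x f) \<longleftrightarrow> has_deg_a k A & has_deg_a k x & has_deg_a k f"
 by (auto simp: has_deg_a_def hat_def zero_prod_def)

lemma hat_total: "total_degree_ge d (hat A x f) \<longleftrightarrow> total_degree_ge d A & total_degree_ge d x & total_degree_ge d f"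
 by (auto simp: total_degree_ge_def hat_def zero_prod_def)

lemma hat_delta: "delta \<A> (hat A x f) = hat (delta \<A> A) (delta \<A> x) (delta \<A> f)"
 by (simp add: fun_eq_iff prod_eq_iff delta_def Let_def tmul_def sum_apply hat_def fst_sum snd_sum)

lemma hat_delta_inv: "delta_inv \<A> (hat A x f) = hat (delta_inv \<A> A) (delta_inv \<A> x) (delta_inv \<A> f)"
 by (simp add: fun_eq_iff prod_eq_iff delta_inv_def delta_star_def Let_def tmul_def sum_apply hat_def fst_sum snd_sum)

lemma tmul_zero:
 assumes "!!vs ws vs' ws'. B (x vs ws) (y vs' ws') = 0" shows "tmul B x y vs ws = 0"
 by (simp add: tmul_def assms)

lemma if_mult_if: "(if P then 1 else 0) * (if Q then 1 else 0) = (if P & Q then 1 else (0 :: complex))"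
 by auto

text \<open>The sum in \<open>wprod\<close> runs over nonzero coefficients, a set that differs
  between a triple and its components. This is an index set common to all of them.\<close>

definition itriples :: "int => (int \<times> int \<times> nat) set"
 where "itriples m = {(i, j, n). 0 <= i & 0 <= j & i + j + int n = m}"

lemma finite_itriples: "finite (itriples m)"
 by (rule finite_subset[of _ "{0..m} \<times> {0..m} \<times> {..nat m}"]) (auto simp: itriples_def)

lemma wprod_itriples:
 assumes "!!i. i < 0 ==> f i = 0" "!!j. j < 0 ==> g j = 0"
  and "!!j p vs ws. B 0 (g j p vs ws) = 0" "!!i p vs ws. B (f i p vs ws) 0 = 0"
 shows "wprod \<A> \<omega> B f g m p vs ws = (\<Sum>(i, j, n)\<in>itriples m. ((\<i> / 2) ^ n / fact n) *C weyl_term \<A> \<omega> B n p (f i p) (g j p) vs ws)"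
proof -
 have z: "weyl_term \<A> \<omega> B n p (f i p) (g j p) vs ws = 0" if "f i = 0 \<or> g j = 0" for i j n
  unfolding weyl_term_def Let_def sum_apply scaleC_fun_apply
 proof (intro sum.neutral ballI)
  fix ks ls
  show "(\<Prod>q<n. poisson \<A> \<omega> (chart_at \<A> p) p (ks ! q) (ls ! q)) *C
   tmul B (%vs ws. f i p (map (%k. coord \<A> (chart_at \<A> p) k p) ks @ vs) ws)
    (%vs ws. g j p (map (%l. coord \<A> (chart_at \<A> p) l p) ls @ vs) ws) vs ws = 0"
   by (subst tmul_zero) (use that assms(3,4) in auto)
 qed
 have "wprod \<A> \<omega> B f g m p vs ws = (\<Sum>(i, j, n) | f i ~= 0 & g j ~= 0 & i + j + int n = m.
   ((\<i> / 2) ^ n / fact n) *C weyl_term \<A> \<omega> B n p (f i p) (g j p) vs ws)"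
  by (simp add: wprod_def sum_apply split_def)
 also have "... = (\<Sum>(i, j, n)\<in>itriples m. ((\<i> / 2) ^ n / fact n) *C weyl_term \<A> \<omega> B n p (f i p) (g j p) vs ws)"
 proof (rule sum.mono_neutral_left[OF finite_itriples])
  show "{(i, j, n). f i ~= 0 & g j ~= 0 & i + j + int n = m} <= itriples m"
   using assms(1,2) by (auto simp: itriples_def not_less[symmetric])
  show "ALL t:itriples m - {(i, j, n). f i ~= 0 & g j ~= 0 & i + j + int n = m}.
    (case t of (i, j, n) => ((\<i> / 2) ^ n / fact n) *C weyl_term \<A> \<omega> B n p (f i p) (g j p) vs ws) = 0"
  proof
   fix t assume t: "t : itriples m - {(i, j, n). f i ~= 0 & g j ~= 0 & i + j + int n = m}"
   obtain i j n where tt: "t = (i, j, n)" by (cases t)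
   have "f i = 0 \<or> g j = 0" using t by (auto simp: tt itriples_def)
   from z[OF this] show "(case t of (i, j, n) => ((\<i> / 2) ^ n / fact n) *C weyl_term \<A> \<omega> B n p (f i p) (g j p) vs ws) = 0"
    by (simp add: tt)
  qed
 qed
 finally show ?thesis .
qed

lemma wprod_zero: "wprod \<A> \<omega> B 0 g = 0" "wprod \<A> \<omega> B f 0 = 0"
proof -
 have e: "{(i, j, n). (0 :: int => _) i ~= (0 :: _ => _) & h j & i + j + int n = m} = {}"
  "{(i, j, n). h i & (0 :: int => _) j ~= (0 :: _ => _) & i + j + int n = m} = {}" for m h by auto
 show "wprod \<A> \<omega> B 0 g = 0" by (intro ext) (unfold wprod_def e(1), simp)
 show "wprod \<A> \<omega> B f 0 = 0" by (intro ext) (unfold wprod_def e(2), simp)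
qed

text \<open>Version of \<open>super_commutator_eq\<close> for left and right actions on a different
  space, needed where \<open>r\<close> acts on vectors from both sides.\<close>

lemma super_commutator_deg1:
 fixes r :: "('m, 'n, 'u::zero) wform" and a :: "('m, 'n, 'w::complex_space) wform"
  and pl :: "('m, 'n, 'u) wform => ('m, 'n, 'w) wform => ('m, 'n, 'w) wform"
  and pr :: "('m, 'n, 'w) wform => ('m, 'n, 'u) wform => ('m, 'n, 'w) wform"
 assumes r: "has_deg_a 1 r" and z: "!!b. pl 0 b = 0" "!!b. pr b 0 = 0" and d: "has_deg_a 1 (pl r a)" "has_deg_a 1 (pr a r)"
 shows "super_commutator pl pr r a = pl r a - pr a r"
proof (intro ext)
 fix m p vs and ws :: "('m, 'n) tvec list"
 have part: "part_deg_a k r = (if k = 1 then r else 0)" for k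
  using r by (auto simp: part_deg_a_def has_deg_a_def fun_eq_iff)
 have d: "pl r a m p vs ws = 0" "pr a r m p vs ws = 0" if "length ws ~= 1"
  using d that by (simp_all add: has_deg_a_def)
 have "super_commutator pl pr r a m p vs ws = (\<Sum>k\<le>length ws. if k = 1 then pl r a m p vs ws
   - (- 1) ^ (length ws - 1) *C pr a r m p vs ws else 0)"
  unfolding super_commutator_def part by (rule sum.cong) (simp_all add: z)
 also have "... = (if 1 <= length ws then pl r a m p vs ws - (- 1) ^ (length ws - 1) *C pr a r m p vs ws else 0)"
  by (simp add: Suc_le_eq)
 also have "... = pl r a m p vs ws - pr a r m p vs ws"
  using d by (cases "length ws = 1") (auto simp: scaleC_one)
 finally show "super_commutator pl pr r a m p vs ws = (pl r a - pr a r) m p vs ws" by simp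
qed

lemma tensor_at_map:
 assumes hV: "!!x. x : V ==> h x : V'" and add: "!!x y. h (x + y) = h x + h y" and scale: "!!a x. h (a *C x) = a *C h x"
  and t: "tensor_at \<A> V p t"
 shows "tensor_at \<A> V' p (%vs ws. h (t vs ws))"
proof -
 have h0: "h 0 = 0" using scale[of 0 0] by simp
 note t = t[unfolded tensor_at_def Let_def]
 note c2 = t[THEN conjunct2] note c3 = c2[THEN conjunct2] note c4 = c3[THEN conjunct2] note c5 = c4[THEN conjunct2]
 note c6 = c5[THEN conjunct2] note c7 = c6[THEN conjunct2] note c8 = c7[THEN conjunct2]
 show ?thesis
  unfolding tensor_at_def Let_def
 proof (intro conjI allI ballI impI)
  show "h (t vs ws) : V'" for vs ws by (rule hV, rule t[THEN conjunct1, rule_format])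
  show "h (t vs ws) = 0" if "~ set vs \<union> set ws <= tangent_space \<A> p" for vs ws
   by (simp only: c2[THEN conjunct1, rule_format, OF that] h0)
  show "h (t (us @ (x + y) # us') ws) = h (t (us @ x # us') ws) + h (t (us @ y # us') ws)"
   if "x : tangent_space \<A> p" "y : tangent_space \<A> p" for us us' ws x y
   by (simp only: c3[THEN conjunct1, rule_format, OF that] add)
  show "h (t (us @ tscale a x # us') ws) = of_real a *C h (t (us @ x # us') ws)" if "x : tangent_space \<A> p" for us us' ws a x
   by (simp only: c4[THEN conjunct1, rule_format, OF that] scale)
  show "h (t vs (us @ (x + y) # us')) = h (t vs (us @ x # us')) + h (t vs (us @ y # us'))"
   if "x : tangent_space \<A> p" "y : tangent_space \<A> p" for vs us us' x y
   by (simp only: c5[THEN conjunct1, rule_format, OF that] add)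
  show "h (t vs (us @ tscale a x # us')) = of_real a *C h (t vs (us @ x # us'))" if "x : tangent_space \<A> p" for vs us us' a x
   by (simp only: c6[THEN conjunct1, rule_format, OF that] scale)
  show "h (t vs ws) = h (t vs' ws)" if "mset vs = mset vs'" for vs vs' ws
   by (simp only: c7[THEN conjunct1, rule_format, OF that])
  show "h (t vs ws) = 0" if "~ distinct ws" for vs ws by (simp only: c8[rule_format, OF that] h0)
 qed
qed

text \<open>A purely symmetric times a purely antisymmetric tensor: only the shuffle giving all
  symmetric arguments to \<open>x\<close> and all form arguments to \<open>y\<close>
  survives.\<close>

lemma tmul_separate:
 assumes "!!vs ws. ws ~= [] ==> x vs ws = 0" "!!vs ws. vs ~= [] ==> y vs ws = 0"
 shows "tmul (*) x y vs ws = x vs [] * (y [] ws :: complex)"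
proof -
 have 1: "x (nths vs I) (nths ws J) * y (nths vs (- I)) (nths ws (- J)) = 0" if J: "J <= {..<length ws}" "J ~= {}" for I J
 proof -
  obtain j where "j : J" "j < length ws" using J by auto
  hence "ws ! j : set (nths ws J)" by (auto simp: set_nths)
  hence "nths ws J ~= []" by auto
  thus ?thesis using assms(1) by simp
 qed
 have 2: "x (nths vs I) (nths ws J) * y (nths vs (- I)) (nths ws (- J)) = 0" if I: "I <= {..<length vs}" "I ~= {..<length vs}" for I J
 proof -
  obtain j where "j : - I" "j < length vs" using I by auto
  hence "vs ! j : set (nths vs (- I))" by (auto simp: set_nths)
  hence "nths vs (- I) ~= []" by auto
  thus ?thesis using assms(2) by simp
 qed
 have n: "nths vs {..<length vs} = vs" "nths vs (- {..<length vs}) = []" "nths ws (- {}) = ws"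
  by (simp_all add: nths_all length_0_conv[symmetric] length_nths del: length_0_conv)
 have "tmul (*) x y vs ws = (SUM I:{{..<length vs}}. SUM J:{{}}. shuffle_sign (length ws) J *C
   (x (nths vs I) (nths ws J) * y (nths vs (- I)) (nths ws (- J))))"
  unfolding tmul_def
 proof (rule sum.mono_neutral_cong_right)
  show "(SUM J:Pow {..<length ws}. shuffle_sign (length ws) J *C (x (nths vs I) (nths ws J) * y (nths vs (- I)) (nths ws (- J)))) =
    (SUM J:{{}}. shuffle_sign (length ws) J *C (x (nths vs I) (nths ws J) * y (nths vs (- I)) (nths ws (- J))))" for I
  proof (rule sum.mono_neutral_right)
   show "ALL J:Pow {..<length ws} - {{}}. shuffle_sign (length ws) J *C
     (x (nths vs I) (nths ws J) * y (nths vs (- I)) (nths ws (- J))) = 0"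
   proof
    fix J assume "J : Pow {..<length ws} - {{}}"
    hence "x (nths vs I) (nths ws J) * y (nths vs (- I)) (nths ws (- J)) = 0" by (intro 1) auto
    thus "shuffle_sign (length ws) J *C (x (nths vs I) (nths ws J) * y (nths vs (- I)) (nths ws (- J))) = 0"
     by (simp only: scaleC_zero_right)
   qed
  qed auto
  show "ALL I:Pow {..<length vs} - {{..<length vs}}. (SUM J:Pow {..<length ws}. shuffle_sign (length ws) J *C
    (x (nths vs I) (nths ws J) * y (nths vs (- I)) (nths ws (- J)))) = 0"
  proof
   fix I assume "I : Pow {..<length vs} - {{..<length vs}}"
   hence "x (nths vs I) (nths ws J) * y (nths vs (- I)) (nths ws (- J)) = 0" for J by (intro 2) auto
   thus "(SUM J:Pow {..<length ws}. shuffle_sign (length ws) J *C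
     (x (nths vs I) (nths ws J) * y (nths vs (- I)) (nths ws (- J)))) = 0"
    by (simp only: scaleC_zero_right sum.neutral_const)
  qed
 qed auto
 moreover have "(SUM I:{A}. g I) = g A" for g :: "nat set => complex" and A by simp
 ultimately show ?thesis by (simp only: n nths_empty shuffle_sign_low(1) scaleC_one)
qed

section \<open>The given Fedosov elements as one element of the triangular bundle\<close>

locale fedosov_elements =
 fixes G :: "('m::{t2_space, second_countable_topology}, 'n::finite, 'e::complex_space) fedosov_data"
  and r :: "('m, 'n, complex) wform" and r' :: "('m, 'n, 'e => 'e) wform"
 assumes G: "smooth_atlas (Atlas G)" "symplectic_form (Atlas G) (Symp G)" "symplectic_connection (Atlas G) (Symp G) (Conn G)"
   "torsion_free (Atlas G) (Conn G)" "vector_bundle (Atlas G) (Fibre G) (Frames G)"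
   "linear_connection (Atlas G) (Fibre G) (Frames G) (EConn G)" "ALL i. closed_two_form (Atlas G) (Omega G i)"
  and r: "fedosov_element G r" and r': "fedosov_element_End G r'"

sublocale fedosov_elements < fedosov_geometry "Atlas G" "Fibre G" "Frames G" "EConn G" "Symp G" "Conn G"
 using G by unfold_locales

context fedosov_elements
begin

abbreviation (input) "atl == Atlas G"

lemma EndConn_NA: "EndConn G = NA"
 by (intro ext) (simp add: EndConn_def NA_def local_section_def locs_def Let_def)

lemma R_E_comp_RE: "R_E_comp G = RE"
 by (intro ext) (simp add: R_E_comp_def RE_def local_section_def locs_def)

lemma hat_W: "hat A x f : W_space atl TV TS \<longleftrightarrow> A : W_End G & x : W_E G & f : W_C G"
proof -
 have t: "tensor_at atl (TV p) p (hat A x f m p) \<longleftrightarrow> tensor_at atl (End_fibre (Fibre G) p) p (A m p) &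
   tensor_at atl (Fibre G p) p (x m p) & tensor_at atl UNIV p (f m p)" for m p
 proof
  assume h: "tensor_at atl (TV p) p (hat A x f m p)"
  from tensor_at_map[OF _ _ _ h, of fst "End_fibre (Fibre G) p"] tensor_at_map[OF _ _ _ h, of "%t. fst (snd t)" "Fibre G p"]
   tensor_at_map[OF _ _ _ h, of "%t. snd (snd t)" UNIV]
  show "tensor_at atl (End_fibre (Fibre G) p) p (A m p) & tensor_at atl (Fibre G p) p (x m p) & tensor_at atl UNIV p (f m p)"
   by (simp add: TV_def hat_def)
 next
  assume "tensor_at atl (End_fibre (Fibre G) p) p (A m p) & tensor_at atl (Fibre G p) p (x m p) & tensor_at atl UNIV p (f m p)"
  hence h: "tensor_at atl (End_fibre (Fibre G) p) p (A m p)" "tensor_at atl (Fibre G p) p (x m p)" "tensor_at atl UNIV p (f m p)"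
   by auto
  have "tensor_at atl (TV p) p (%vs ws. (A m p vs ws, 0 :: 'e, 0 :: complex))"
   by (rule tensor_at_map[OF _ _ _ h(1), of "%A. (A, 0, 0)"]) (simp_all add: TV_def E_zero prod_eq_iff)
  moreover have "tensor_at atl (TV p) p (%vs ws. (0 :: 'e => 'e, x m p vs ws, 0 :: complex))"
   by (rule tensor_at_map[OF _ _ _ h(2), of "%x. (0, x, 0)"]) (simp_all add: TV_def End_sub prod_eq_iff del: zero_fun_apply)
  moreover have "tensor_at atl (TV p) p (%vs ws. (0 :: 'e => 'e, 0 :: 'e, f m p vs ws))"
   by (rule tensor_at_map[OF _ _ _ h(3), of "%x. (0, 0, x)"]) (simp_all add: TV_def End_sub E_zero prod_eq_iff del: zero_fun_apply)
  ultimately have "tensor_at atl (TV p) p ((%vs ws. (A m p vs ws, 0, 0)) + ((%vs ws. (0, x m p vs ws, 0)) + (%vs ws. (0, 0, f m p vs ws))))"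
   by (intro T.tensor_at_add)
  moreover have "(%vs ws. (A m p vs ws, 0, 0)) + ((%vs ws. (0, x m p vs ws, 0)) + (%vs ws. (0, 0, f m p vs ws))) = hat A x f m p"
   by (simp add: hat_def fun_eq_iff)
  ultimately show "tensor_at atl (TV p) p (hat A x f m p)" by simp
 qed
 have s: "TS (fst c) (%p. hat A x f m p (vs p) (ws p)) \<longleftrightarrow> SA (fst c) (%p. A m p (vs p) (ws p)) &
  SE (fst c) (%p. x m p (vs p) (ws p)) & smooth_fun atl (fst c) (%p. f m p (vs p) (ws p))" for c m vs ws
  by (simp add: TS_def hat_def)
 have n: "hat A x f m = 0 \<longleftrightarrow> A m = 0 & x m = 0 & f m = 0" for m
  by (auto simp: hat_def fun_eq_iff zero_prod_def)
 show ?thesis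
  unfolding W_space_def tensor_field_def W_End_def W_E_def W_C_def mem_Collect_eq t s n by blast
qed

lemma hat_D: "cov_deriv atl (Conn G) TN (hat A x f) = hat (DEnd G A) (DE G x) (DC G f)"
proof -
 have TN: "TN X (%q. hat A x f m q (vs q) (ws q)) p =
   (NA X (%q. A m q (vs q) (ws q)) p, EConn G X (%q. x m q (vs q) (ws q)) p, dirderiv atl (X p) (%q. f m q (vs q) (ws q)) p)"
  for X m vs ws p by (simp add: TN_def hat_def)
 have t: "cov_tensor atl (Conn G) TN c X (hat A x f m) p vs ws = (cov_tensor atl (Conn G) NA c X (A m) p vs ws,
   cov_tensor atl (Conn G) (EConn G) c X (x m) p vs ws, cov_tensor atl (Conn G) (CConn G) c X (f m) p vs ws)" for c X m p vs ws
  unfolding cov_tensor_def TN CConn_def by (simp add: prod_eq_iff hat_def fst_sum snd_sum)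
 show ?thesis
  by (simp add: fun_eq_iff prod_eq_iff cov_deriv_def DEnd_def DE_def DC_def EndConn_NA Let_def tmul_def sum_apply t fst_sum snd_sum hat_def)
qed

lemma hat_wprod:
 assumes W: "hat A x f : W_space atl TV TS" "hat A' x' f' : W_space atl TV TS"
 shows "wprod atl (Symp G) TB (hat A x f) (hat A' x' f') = hat (mul_AA G A A') (mul_AE G A x' + mul_EC G x f') (mul_CC G f f')"
proof -
 have neg: "hat A x f i = 0" "hat A' x' f' i = 0" if "i < 0" for i using T.\<W>_neg[OF W(1) that] T.\<W>_neg[OF W(2) that] .
 have neg': "A i = 0" "x i = 0" "f i = 0" "A' i = 0" "x' i = 0" "f' i = 0" if "i < 0" for i
  using neg[OF that] by (auto simp: hat_def fun_eq_iff zero_prod_def)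
 have V: "hat A x f m p vs ws : TV p" "hat A' x' f' m p vs ws : TV p" for m p vs ws
  using T.tensor_atD(1)[OF T.\<W>_tensor[OF W(1)]] T.tensor_atD(1)[OF T.\<W>_tensor[OF W(2)]] by auto
 have A0: "A m p vs ws 0 = 0" for m p vs ws using V(1)[of m p vs ws] End_zero by (auto simp: TV_def hat_def)
 have z: "TB 0 (hat A' x' f' j p vs ws) = 0" "TB (hat A x f i p vs ws) 0 = 0" for i j p vs ws
  using V T.F.B_zero_left T.F.B_zero_right by blast+
 have e: "wprod atl (Symp G) TB (hat A x f) (hat A' x' f') m p vs ws =
   (\<Sum>(i, j, n)\<in>itriples m. ((\<i> / 2) ^ n / fact n) *C weyl_term atl (Symp G) TB n p (hat A x f i p) (hat A' x' f' j p) vs ws)" for m p vs ws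
  by (rule wprod_itriples[OF neg z])
 have e1: "mul_AA G A A' m p vs ws =
   (\<Sum>(i, j, n)\<in>itriples m. ((\<i> / 2) ^ n / fact n) *C weyl_term atl (Symp G) (\<circ>) n p (A i p) (A' j p) vs ws)" for m p vs ws
  unfolding mul_AA_def by (rule wprod_itriples) (simp_all add: neg' fun_eq_iff A0)
 have e2: "mul_AE G A x' m p vs ws =
   (\<Sum>(i, j, n)\<in>itriples m. ((\<i> / 2) ^ n / fact n) *C weyl_term atl (Symp G) (%A x. A x) n p (A i p) (x' j p) vs ws)" for m p vs ws
  unfolding mul_AE_def by (rule wprod_itriples) (simp_all add: neg' A0)
 have e3: "mul_EC G x f' m p vs ws =
   (\<Sum>(i, j, n)\<in>itriples m. ((\<i> / 2) ^ n / fact n) *C weyl_term atl (Symp G) (%x z. z *C x) n p (x i p) (f' j p) vs ws)" for m p vs ws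
  unfolding mul_EC_def by (rule wprod_itriples) (simp_all add: neg')
 have e4: "mul_CC G f f' m p vs ws =
   (\<Sum>(i, j, n)\<in>itriples m. ((\<i> / 2) ^ n / fact n) *C weyl_term atl (Symp G) (*) n p (f i p) (f' j p) vs ws)" for m p vs ws
  unfolding mul_CC_def by (rule wprod_itriples) (simp_all add: neg')
 have w: "weyl_term atl (Symp G) TB n p (hat A x f i p) (hat A' x' f' j p) vs ws =
   (weyl_term atl (Symp G) (\<circ>) n p (A i p) (A' j p) vs ws,
    weyl_term atl (Symp G) (%A x. A x) n p (A i p) (x' j p) vs ws + weyl_term atl (Symp G) (%x z. z *C x) n p (x i p) (f' j p) vs ws,
    weyl_term atl (Symp G) (*) n p (f i p) (f' j p) vs ws)" for n p i j vs ws
  by (simp add: prod_eq_iff weyl_term_def Let_def tmul_def sum_apply fst_sum snd_sum TB_def hat_def scaleC_add_right sum.distrib)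
 show ?thesis
  by (simp add: fun_eq_iff prod_eq_iff e e1 e2 e3 e4 w hat_def split_def fst_sum snd_sum scaleC_add_right sum.distrib)
qed

definition rh :: "('m, 'n, ('e => 'e) \<times> 'e \<times> complex) wform"
 where "rh = hat r' 0 r"

lemmas r_parts = r[unfolded fedosov_element_def] r'[unfolded fedosov_element_End_def]

lemma zero_W: "0 : W_End G" "0 : W_E G" "0 : W_C G"
proof -
 have "hat 0 0 0 : W_space atl TV TS"
 proof -
  have "(0 :: ('m, 'n, ('e => 'e) \<times> 'e \<times> complex) wform) : W_space atl TV TS"
   using T.\<W>_zero by simp
  moreover have "hat 0 0 0 = (0 :: ('m, 'n, ('e => 'e) \<times> 'e \<times> complex) wform)" by (simp add: hat_zero_iff)
  ultimately show ?thesis by (simp only:)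
 qed
 thus "0 : W_End G" "0 : W_E G" "0 : W_C G" by (simp_all add: hat_W)
qed

lemma rh_W: "rh : W_space atl TV TS" "has_deg_a 1 rh" "total_degree_ge 3 rh" "delta_inv atl rh = 0"
proof -
 show "rh : W_space atl TV TS" unfolding rh_def hat_W using r_parts zero_W by blast
 show "has_deg_a 1 rh" unfolding rh_def hat_deg using r_parts by (simp add: has_deg_a_def)
 show "total_degree_ge 3 rh" unfolding rh_def hat_total using r_parts by (simp add: total_degree_ge_def)
 have "delta_inv atl (0 :: ('m, 'n, 'e) wform) = 0"
  by (simp add: fun_eq_iff delta_inv_def delta_star_def Let_def sum_apply tmul_def)
 thus "delta_inv atl rh = 0" unfolding rh_def hat_delta_inv hat_zero_iff using r_parts by simp
qed

section \<open>The curvature terms in the equations for the Fedosov elements\<close>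

context
 fixes c p assumes c: "c : atl" "p : fst c"
begin

lemma dx_coord: "coord atl c i p c $ j = (if j = i then 1 else 0)"
 using coord_self[OF c, of i] by (simp add: axis_def)

lemma alt_part: "tmul (*) (dx_alt atl c i p) (dx_alt atl c j p) [] [coord atl c a p, coord atl c b p] =
  (if i = a & j = b then 1 else 0) - (if i = b & j = a then 1 else (0 :: complex))"
proof -
 have sc: "(*) = (scaleC :: complex => complex => complex)"
  by (intro ext) (simp only: scaleC_complex_def)
 have d: "dx_alt atl c j p [] [coord atl c x p] = (if j = x then 1 else 0)" for j x
  unfolding dx_alt_def using dx_coord[of x j] coord_tangent[of c x p] by (auto simp del: coord_self)
 have r: "complex_of_real (if P then 1 else 0) = (if P then 1 else 0)" for P by simp
 have "tmul scaleC (dx_alt atl c i p) (dx_alt atl c j p) [] [coord atl c a p, coord atl c b p] =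
   (if i = a then 1 else 0) * (if j = b then 1 else 0) - (if i = b then 1 else 0) * (if j = a then 1 else 0)"
  by (simp only: tmul_dx_alt(3) coord_tangent dx_coord if_True scaleC_complex_def d r)
 moreover have "tmul (*) (dx_alt atl c i p) (dx_alt atl c j p) = tmul scaleC (dx_alt atl c i p) (dx_alt atl c j p)"
  by (simp only: sc)
 ultimately show ?thesis by (simp only: if_mult_if)
qed

lemma dx_forms:
 "ws ~= [] ==> tmul (*) (dx_sym atl c l p) (dx_sym atl c k p) vs ws = 0"
 "vs ~= [] ==> tmul (*) (dx_alt atl c l p) (dx_alt atl c k p) vs ws = 0"
 "length vs ~= 2 ==> tmul (*) (dx_sym atl c l p) (dx_sym atl c k p) vs [] = 0"
proof -
 have len: "length (nths xs I) + length (nths xs (- I)) = length xs" for xs :: "'x list" and I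
 proof -
  have "{i. i < length xs & i : I} \<union> {i. i < length xs & i : - I} = {..<length xs}" by auto
  thus ?thesis unfolding length_nths by (subst card_Un_disjoint[symmetric]) auto
 qed
 have z: "nths xs I = [] & nths xs (- I) = [] ==> xs = []" for xs :: "'x list" and I
  using len[of xs I] by simp
 show "ws ~= [] ==> tmul (*) (dx_sym atl c l p) (dx_sym atl c k p) vs ws = 0"
  unfolding tmul_def by (intro sum.neutral ballI) (use z[of ws] in \<open>auto simp: dx_sym_def\<close>)
 show "vs ~= [] ==> tmul (*) (dx_alt atl c l p) (dx_alt atl c k p) vs ws = 0"
  unfolding tmul_def by (intro sum.neutral ballI) (use z[of vs] in \<open>auto simp: dx_alt_def\<close>)
 show "length vs ~= 2 ==> tmul (*) (dx_sym atl c l p) (dx_sym atl c k p) vs [] = 0"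
  unfolding tmul_def
 proof (intro sum.neutral ballI)
  fix I J assume "length vs ~= 2"
  hence "length (nths vs I) ~= 1 \<or> length (nths vs (- I)) ~= 1" using len[of vs I] by auto
  thus "shuffle_sign (length []) J *C (dx_sym atl c l p (nths vs I) (nths [] J) * dx_sym atl c k p (nths vs (- I)) (nths [] (- J))) = 0"
   by (auto simp: dx_sym_def)
 qed
qed

lemma sym_part: "tmul (*) (dx_sym atl c l p) (dx_sym atl c k p) [coord atl c a p, coord atl c b p] [] =
  (if l = a & k = b then 1 else 0) + (if l = b & k = a then 1 else (0 :: complex))"
proof -
 have d: "dx_sym atl c l p [] [] = 0" "dx_sym atl c l p [v, w] [] = 0" for l v w by (simp_all add: dx_sym_def)
 have d1: "dx_sym atl c l p [coord atl c a p] [] = (if l = a then 1 else 0)" for l a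
  unfolding dx_sym_def using dx_coord[of a l] coord_tangent[of c a p] by (auto simp del: coord_self)
 have n: "nths [v, w] {} = []" "nths [v, w] {0} = [v]" "nths [v, w] {Suc 0} = [w]" "nths [v, w] {0, Suc 0} = [v, w]"
  "nths [v, w] (- {}) = [v, w]" "nths [v, w] (- {0}) = [w]" "nths [v, w] (- {Suc 0}) = [v]" "nths [v, w] (- {0, Suc 0}) = []"
  for v w :: "('m, 'n) tvec" by (simp_all add: nths_Cons)
 have "tmul (*) (dx_sym atl c l p) (dx_sym atl c k p) [coord atl c a p, coord atl c b p] [] =
   0 * 0 + (if l = a then 1 else 0) * (if k = b then 1 else 0) + (if l = b then 1 else 0) * (if k = a then 1 else 0) + 0 * 0"
  by (simp only: tmul_def length_Cons list.size(3) sum_Pow_low n nths_nil shuffle_sign_low(1) scaleC_one d d1)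
 thus ?thesis by (simp only: if_mult_if mult_zero_left add_0_left add_0_right)
qed

lemma RE_antisym: "RE c j i p = - RE c i j p"
proof
 fix x
 show "RE c j i p x = (- RE c i j p) x"
 proof (cases "x : Fibre G p")
  case True
  obtain U s where s: "open U" "p : U" "SE U s" "s p = x" by (rule section_through[OF True])
  show ?thesis using RE_apply[OF c s(1-3), of i j] RE_apply[OF c s(1-3), of j i] by (simp add: s cR_def)
 qed (simp add: RE_def)
qed

lemma Ri_antisym: "T.Ri c k j i m p = - T.Ri c k i j m p"
 using T.curvature_coord[OF c vector_field_coord[OF c(1)], of i j k] T.curvature_coord[OF c vector_field_coord[OF c(1)], of j i k]
 by (simp add: T.Ri_def)

end

text \<open>The factor \<open>1/2\<close> of the form compensates that every unordered pair of
  indices is summed twice.\<close>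

lemma R_E_form_coord:
 fixes p defines "c == chart_at atl p"
 shows "R_E_form G p (map (%i. coord atl c i p) is) [coord atl c a p, coord atl c b p] = (if is = [] then RE c a b p else 0)"
proof -
 have c: "c : atl" "p : fst c" unfolding c_def by (rule chart_at)+
 show ?thesis
 proof (cases "is = []")
  case True
  have "R_E_form G p (map (%i. coord atl c i p) is) [coord atl c a p, coord atl c b p] =
    (1 / 2) *C (SU i. SU j. (if i = a & j = b then 1 else 0 :: complex) *C RE c i j p - (if i = b & j = a then 1 else 0 :: complex) *C RE c i j p)"
   unfolding True by (simp add: R_E_form_def Let_def c_def[symmetric] alt_part[OF c] R_E_comp_RE scaleC_diff_left)
  also have "... = (1 / 2) *C (RE c a b p - RE c b a p)"
  proof -
   have d: "(SU i. SU j. (if i = a & j = b then 1 else 0 :: complex) *C RE c i j p) = RE c a b p" for a b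
   proof -
    have "(SU j. (if i = a & j = b then 1 else 0 :: complex) *C RE c i j p) = (if i = a then RE c i b p else 0)" for i
     by (cases "i = a") (simp_all add: if_distrib[of "%z. z *C _"] scaleC_one cong: if_cong)
    thus ?thesis by simp
   qed
   show ?thesis by (simp only: sum_subtractf d)
  qed
  also have "... = RE c a b p"
   unfolding RE_antisym[OF c, of b a] using scaleC_add_left[of "1/2" "1/2" "RE c a b p"]
   by (simp add: scaleC_one scaleC_add_right)
  finally show ?thesis using True by simp
 next
  case False
  thus ?thesis by (simp add: R_E_form_def Let_def c_def[symmetric] dx_forms(2)[OF c])
 qed
qed

text \<open>The factor \<open>1/4\<close> is used up by two doublings: antisymmetry of the curvature
  in the form indices, and the symmetry \<open>Ri_sym\<close> in the symmetric ones.\<close>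

lemma R_M_coord:
 fixes p defines "c == chart_at atl p"
 shows "R_M G m p (map (%i. coord atl c i p) is) [coord atl c a p, coord atl c b p] =
  (if m = 0 & length is = 2 then (SU k. T.om c p $ (is ! 0) $ k * T.Ri c (is ! 1) a b k p) else 0)"
proof -
 have c: "c : atl" "p : fst c" unfolding c_def by (rule chart_at)+
 define S where "S l k = tmul (*) (dx_sym atl c l p) (dx_sym atl c k p) (map (%i. coord atl c i p) is) []" for l k
 have sep: "tmul (*) (tmul (*) (dx_sym atl c l p) (dx_sym atl c k p)) (tmul (*) (dx_alt atl c i p) (dx_alt atl c j p))
   (map (%i. coord atl c i p) is) [coord atl c a p, coord atl c b p] =
   S l k * ((if i = a & j = b then 1 else 0) - (if i = b & j = a then 1 else 0))" for l k i j
  unfolding S_def alt_part[OF c, symmetric] by (rule tmul_separate) (simp_all add: dx_forms[OF c])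
 have R0: "R_M G 0 p (map (%i. coord atl c i p) is) [coord atl c a p, coord atl c b p] =
   (1 / 4) * (SU l. SU m. SU k. SU i. SU j. T.om c p $ l $ m * T.Ri c k i j m p *
    (S l k * ((if i = a & j = b then 1 else 0) - (if i = b & j = a then 1 else 0))))"
  by (simp add: R_M_def const_series_def Let_def c_def[symmetric] sum_apply sep scaleC_complex_def T.Ri_def)
 have d: "(SU i. SU j. x * T.Ri c k i j m p * (s * ((if i = a & j = b then 1 else 0) - (if i = b & j = a then 1 else 0)))) =
   2 * (s * (x * T.Ri c k a b m p))" for x s k m
 proof -
  have 1: "(SU i. SU j. x * T.Ri c k i j m p * (s * (if i = a & j = b then 1 else 0))) = s * (x * T.Ri c k a b m p)" for a b
  proof -
   have "(SU j. x * T.Ri c k i j m p * (s * (if i = a & j = b then 1 else 0))) =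
     (SU j. if j = b then (if i = a then s * (x * T.Ri c k a b m p) else 0) else 0)" for i
    by (rule sum.cong[OF refl]) auto
   thus ?thesis by simp
  qed
  have "(SU i. SU j. x * T.Ri c k i j m p * (s * ((if i = a & j = b then 1 else 0) - (if i = b & j = a then 1 else 0)))) =
    s * (x * T.Ri c k a b m p) - s * (x * T.Ri c k b a m p)"
   unfolding right_diff_distrib sum_subtractf 1 ..
  thus ?thesis by (simp add: Ri_antisym[OF c, of k b a])
 qed
 have R1: "R_M G 0 p (map (%i. coord atl c i p) is) [coord atl c a p, coord atl c b p] =
   (1 / 2) * (SU l. SU k. S l k * (SU m. T.om c p $ l $ m * T.Ri c k a b m p))"
 proof -
  have "(SU m. SU k. 2 * (S l k * (T.om c p $ l $ m * T.Ri c k a b m p))) =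
    2 * (SU k. S l k * (SU m. T.om c p $ l $ m * T.Ri c k a b m p))" for l
   by (subst sum.swap) (simp add: sum_distrib_left)
  thus ?thesis unfolding R0 d by (simp add: sum_distrib_left)
 qed
 show ?thesis
 proof (cases "m = 0")
  case m: True
  show ?thesis
  proof (cases "length is = 2")
   case True
   then obtain e f where is_eq: "is = [e, f]" by (metis length_0_conv length_Suc_conv numeral_2_eq_2)
   let ?X = "%l k. SU m. T.om c p $ l $ m * T.Ri c k a b m p"
   have S: "S l k = (if l = e & k = f then 1 else 0) + (if l = f & k = e then 1 else 0)" for l k
    unfolding S_def is_eq by (simp add: sym_part[OF c])
   have 1: "(SU l. SU k. (if l = e & k = f then 1 else 0) * ?X l k) = ?X e f" for e f
   proof -
    have "(SU k. (if l = e & k = f then 1 else 0) * ?X l k) = (if l = e then ?X l f else 0)" for l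
     by (cases "l = e") (simp_all add: if_distrib[of "%z. z * _"] cong: if_cong)
    thus ?thesis by simp
   qed
   have "R_M G 0 p (map (%i. coord atl c i p) is) [coord atl c a p, coord atl c b p] = (1 / 2) * (?X e f + ?X f e)"
    unfolding R1 S distrib_right sum.distrib 1 ..
   also have "... = ?X e f" using T.Ri_sym[OF c, of e f a b] by simp
   finally show ?thesis by (simp add: m is_eq)
  next
   case False
   hence "S l k = 0" for l k unfolding S_def by (intro dx_forms(3)[OF c]) simp
   thus ?thesis using R1 False m by simp
  qed
 qed (simp add: R_M_def const_series_def)
qed

lemma Omega_coord: "vs ~= [] ==> Omega G m p vs ws = 0"
 using G(7) unfolding closed_two_form_def two_form_def by blast

text \<open>The two equations for \<open>r\<close> and \<open>r'\<close> are the diagonal components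
  of one equation. The terms with \<open>R_M\<close> and \<open>Omega\<close> occur in both and form
  a multiple of the unit, whereas \<open>-i \<lambda> R^E\<close> occurs only among the
  endomorphisms.\<close>

lemma rh_eq:
 fixes p i j defines "c == chart_at atl p"
 shows "T.comp c (delta atl rh) [i, j] m is p =
  T.Hc c i j p (RE c i j p, 0, 0) (%m. Omega G (int m) p [] [coord atl c i p, coord atl c j p]) m is
  + T.comp c (cov_deriv atl (Conn G) TN rh) [i, j] m is p
  + T.comp c (i_over_lambda (wprod atl (Symp G) TB rh rh)) [i, j] m is p"
proof -
 have c: "c : atl" "p : fst c" unfolding c_def by (rule chart_at)+
 let ?vs = "map (%i. coord atl c i p) is" and ?ws = "[coord atl c i p, coord atl c j p]"
 define Hh where "Hh = hat (emb G (R_M G) - \<i> *C lambda_R_E G + emb G (Omega G)) (0 :: ('m, 'n, 'e) wform) (R_M G + Omega G)"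
 have E0: "DE G 0 = 0"
 proof -
  have "EConn G (coord atl (chart_at atl p) i) (%q. 0) p = 0" for p i
   by (rule NE_zero[OF chart(1)[OF chart_at(1)] vector_field_coord[OF chart_at(1)] chart_at(2)])
  hence "cov_tensor atl (Conn G) (EConn G) (chart_at atl p) (coord atl (chart_at atl p) i) 0 p = (%_ _. 0)" for p i
   by (intro ext) (simp add: cov_tensor_def)
  thus ?thesis by (simp add: DE_def cov_deriv_def Let_def fun_eq_iff sum_apply tmul_def zero_fun_def)
 qed
 have d0: "delta atl (0 :: ('m, 'n, 'e) wform) = 0"
  by (simp add: fun_eq_iff delta_def Let_def sum_apply tmul_def)
 have io0: "i_over_lambda (0 :: ('m, 'n, 'e) wform) = 0" by (simp add: i_over_lambda_def fun_eq_iff)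
 have "delta atl rh = Hh + cov_deriv atl (Conn G) TN rh + i_over_lambda (wprod atl (Symp G) TB rh rh)"
  unfolding rh_def hat_delta hat_D hat_wprod[OF rh_W(1)[unfolded rh_def] rh_W(1)[unfolded rh_def]] hat_i_over_lambda Hh_def hat_lin hat_eq_iff
  using r_parts by (simp add: d0 E0 mul_AE_def mul_EC_def wprod_zero io0 add_ac)
 hence 1: "T.comp c (delta atl rh) [i, j] m is p = Hh (int m) p ?vs ?ws
   + T.comp c (cov_deriv atl (Conn G) TN rh) [i, j] m is p + T.comp c (i_over_lambda (wprod atl (Symp G) TB rh rh)) [i, j] m is p"
  by (simp add: T.comp_def)
 have lR: "lambda_R_E G (int m) p ?vs ?ws = (if m = 1 & is = [] then RE c i j p else 0)"
  using R_E_form_coord[of p "is" i j] by (cases "is = []") (auto simp: lambda_R_E_def c_def)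
 have Om: "Omega G (int m) p ?vs ?ws = (if is = [] then Omega G (int m) p [] ?ws else 0)"
  using Omega_coord[of ?vs] by auto
 have RM: "R_M G (int m) p ?vs ?ws = (if m = 0 & length is = 2 then (SU k. T.om c p $ (is ! 0) $ k * T.Ri c (is ! 1) i j k p) else 0)"
  using R_M_coord[of "int m" p "is" i j] by (simp add: c_def)
 have "Hh (int m) p ?vs ?ws = T.Hc c i j p (RE c i j p, 0, 0) (%m. Omega G (int m) p [] ?ws) m is"
  unfolding Hh_def hat_def emb_def plus_fun_apply[of "_ :: int => _"] T.Hc_def Tu_def
  by (simp add: prod_eq_iff emb_def lR Om RM scaleC_complex_def algebra_simps)
 thus ?thesis using 1 by simp
qed

end

text \<open>The witnesses are \<open>(RE, 0, 0)\<close> for \<open>\<rho>\<close> and the values of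
  \<open>Omega\<close> for \<open>w\<close>; the latter are inferred from
  \<open>rh_eq\<close>.\<close>

sublocale fedosov_elements < FB: fedosov_bundle "Atlas G" TV TS TN TB Tu "Symp G" "Conn G" rh
proof (intro fedosov_bundle.intro T_bundle fedosov_bundle_axioms.intro rh_W T_scalar T_glue)
 fix p i j
 let ?c = "chart_at (Atlas G) p"
 note c = chart_at[of p]
 show "\<exists>\<rho>\<in>TV p. EX w. (ALL s. TS (fst ?c) s -->
    TN (coord (Atlas G) ?c i) (TN (coord (Atlas G) ?c j) s) p - TN (coord (Atlas G) ?c j) (TN (coord (Atlas G) ?c i) s) p = TB \<rho> (s p) - TB (s p) \<rho>) &
   (ALL m is. T.comp ?c (delta (Atlas G) rh) [i, j] m is p = T.Hc ?c i j p \<rho> w m is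
    + T.comp ?c (cov_deriv (Atlas G) (Conn G) TN rh) [i, j] m is p
    + T.comp ?c (i_over_lambda (wprod (Atlas G) (Symp G) TB rh rh)) [i, j] m is p)"
  by (intro bexI[OF _ RE_TV[OF c]] exI conjI allI impI, rule T_curvature[OF c], assumption, rule rh_eq)
qed assumption+

section \<open>The bimodule\<close>

lemma weyl_term_lin:
 "weyl_term \<A> \<omega> (%A x. A x) n p (a *C y) z vs ws = a *C weyl_term \<A> \<omega> (%A x. A x) n p y z vs ws"
 "weyl_term \<A> \<omega> (%A x. A x) n p (y - y') z vs ws = weyl_term \<A> \<omega> (%A x. A x) n p y z vs ws - weyl_term \<A> \<omega> (%A x. A x) n p y' z vs ws"
 by (simp_all add: weyl_term_def Let_def tmul_def sum_apply scaleC_sum_right scaleC_scaleC scaleC_diff_right sum_subtractf ac_simps)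

definition hats :: "(int => 'm => 'a) => (int => 'm => 'b) => (int => 'm => 'c) => int => 'm => 'a \<times> 'b \<times> 'c"
 where "hats f g h m p = (f m p, g m p, h m p)"

lemma hats_eq_iff: "hats f g h = hats f' g' h' \<longleftrightarrow> f = f' & g = g' & h = h'"
 by (auto simp: hats_def fun_eq_iff)

lemma hats_add: "hats f g h + hats f' g' h' = hats (f + f') (g + g') (h + h')"
 by (simp add: hats_def fun_eq_iff)

lemma hats_lambda_scale: "lambda_scale z (hats f g h) = hats (lambda_scale z f) (lambda_scale z g) (lambda_scale z h)"
 by (simp add: hats_def fun_eq_iff prod_eq_iff lambda_scale_def sum_apply fst_sum snd_sum)

lemma lambda_scale_zero: "lambda_scale z 0 = 0"
 by (simp add: lambda_scale_def fun_eq_iff)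

lemma sigma_hat: "sigma (hat A x f) = hats (sigma A) (sigma x) (sigma f)"
 by (simp add: sigma_def hat_def hats_def fun_eq_iff)

lemma sigma_add: "sigma (a + b) = sigma a + sigma b" and sigma_zero: "sigma 0 = 0"
 by (simp_all add: sigma_def fun_eq_iff)

section \<open>The three Fedosov derivations as components of one\<close>

context fedosov_elements
begin

lemma mul_zero: "mul_AA G 0 = (%_. 0)" "mul_AA G A 0 = 0" "mul_AE G 0 = (%_. 0)" "mul_AE G A 0 = 0"
 "mul_EC G 0 = (%_. 0)" "mul_EC G x 0 = 0" "mul_CC G 0 = (%_. 0)" "mul_CC G f 0 = 0" "mul_CE G 0 = (%_. 0)" "mul_CE G f 0 = 0"
 by (rule ext | simp add: mul_AA_def mul_AE_def mul_EC_def mul_CC_def mul_CE_def wprod_zero)+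

lemma emb_W: assumes f: "f : W_C G" shows "emb G f : W_End G"
proof -
 have W: "tensor_field atl (%_. UNIV) (smooth_fun atl) (f m)" "m < 0 ==> f m = 0" for m
  using f by (auto simp: W_C_def W_space_def)
 have "tensor_at atl (End_fibre (Fibre G) p) p (emb G f m p)" for m p
  using tensor_at_map[of UNIV "%z. z *C id_End (Fibre G) p" "End_fibre (Fibre G) p" atl p "f m p"] W(1)[of m]
  by (simp add: emb_def[abs_def] tensor_field_def End_sub scaleC_add_left scaleC_scaleC scaleC_complex_def)
 moreover have "SA (fst c) (%p. emb G f m p (map (%i. coord atl c i p) is) (map (%j. coord atl c j p) js))" if c: "c : atl" for c m "is" js
  unfolding emb_def by (rule SA_scale[OF chart(1)[OF c] _ SA_id[OF chart(1)[OF c]]]) (use W(1)[of m] c in \<open>simp add: tensor_field_def\<close>)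
 moreover have "emb G f m = 0" if "m < 0" for m using W(2)[OF that] by (simp add: emb_def fun_eq_iff)
 ultimately show ?thesis by (simp add: W_End_def W_space_def tensor_field_def)
qed

lemma r_W: "r : W_C G" "r' : W_End G" "has_deg_a 1 r" "has_deg_a 1 r'" "emb G r : W_End G" "has_deg_a 1 (emb G r)"
 using r_parts emb_W by (auto simp: has_deg_a_def emb_def)

lemma neg: "A : W_End G ==> m < 0 ==> A m = 0" "x : W_E G ==> m < 0 ==> x m = 0" "f : W_C G ==> m < 0 ==> f m = 0"
 by (auto simp: W_End_def W_E_def W_C_def W_space_def)

lemma fibre_values: "A : W_End G ==> A m p vs ws : End_fibre (Fibre G) p" "x : W_E G ==> x m p vs ws : Fibre G p"
proof -
 have fst_conj: "t vs ws : X" if "tensor_at atl X p t" for X :: "'z::complex_space set" and t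
  by (rule that[unfolded tensor_at_def Let_def, THEN conjunct1, rule_format])
 show "A : W_End G ==> A m p vs ws : End_fibre (Fibre G) p"
  by (rule fst_conj) (simp add: W_End_def W_space_def tensor_field_def)
 show "x : W_E G ==> x m p vs ws : Fibre G p"
  by (rule fst_conj) (simp add: W_E_def W_space_def tensor_field_def)
qed

lemma AE_itriples:
 assumes A: "A : W_End G" and x: "x : W_E G"
 shows "mul_AE G A x m p vs ws = (\<Sum>(i, j, n)\<in>itriples m. ((\<i> / 2) ^ n / fact n) *C
  weyl_term atl (Symp G) (%A x. A x) n p (A i p) (x j p) vs ws)"
 unfolding mul_AE_def by (rule wprod_itriples) (simp_all add: neg(1)[OF A] neg(2)[OF x] End_zero[OF fibre_values(1)[OF A]])

text \<open>The values of \<open>x\<close> lie in the fibres, where \<open>id_End\<close> is the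
  identity. So the left action of \<open>r\<close> can be compared with that of
  \<open>r'\<close>.\<close>

lemma CE_emb: assumes x: "x : W_E G" shows "mul_CE G r x = mul_AE G (emb G r) x"
proof (intro ext)
 fix m p vs ws
 have "mul_CE G r x m p vs ws = (\<Sum>(i, j, n)\<in>itriples m. ((\<i> / 2) ^ n / fact n) *C
   weyl_term atl (Symp G) scaleC n p (r i p) (x j p) vs ws)"
  unfolding mul_CE_def by (rule wprod_itriples) (simp_all add: neg(3)[OF r_W(1)] neg(2)[OF x])
 moreover have "emb G r i p vs ws (x j p vs' ws') = r i p vs ws *C x j p vs' ws'" for i j vs ws vs' ws'
  using fibre_values(2)[OF x] by (simp add: emb_def id_End_def)
 hence "weyl_term atl (Symp G) scaleC n p (r i p) (x j p) vs ws = weyl_term atl (Symp G) (%A x. A x) n p (emb G r i p) (x j p) vs ws" for i j n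
  by (simp add: weyl_term_def Let_def tmul_def sum_apply)
 ultimately show "mul_CE G r x m p vs ws = mul_AE G (emb G r) x m p vs ws"
  by (simp add: AE_itriples[OF r_W(5) x])
qed

text \<open>The factor \<open>i/\<lambda>\<close> may be taken out of the product because
  \<open>r'\<close> and \<open>r\<close> agree at order zero, so no coefficient of the difference is
  lost in the shift.\<close>

lemma AE_r_E: assumes x: "x : W_E G" shows "mul_AE G (r_E G r r') x = i_over_lambda (mul_AE G r' x - mul_AE G (emb G r) x)"
proof (intro ext)
 fix m p vs ws
 let ?d = "r' - emb G r"
 \<comment> \<open>At order zero \<open>rh\<close> is a multiple of the unit
   \<open>(id, 0, 1)\<close> by \<open>r_scalar\<close>; comparison of its first and last entry
   gives the claim.\<close>
 have d: "?d i = 0" if "i <= 0" for i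
 proof (cases "i = 0")
  case True
  have "r' 0 p vs ws = r 0 p vs ws *C id_End (Fibre G) p" for p vs ws
  proof (cases "length ws = 1")
   case True
   then obtain w where w: "ws = [w]" by (metis length_Suc_conv length_0_conv One_nat_def)
   obtain z where "rh 0 p vs [w] = z *C Tu p" using FB.r_scalar[of p vs w] by (auto simp: FB.scalars_def)
   thus ?thesis by (simp add: rh_def hat_def Tu_def prod_eq_iff w scaleC_complex_def)
  qed (use r_W(3,4) in \<open>simp add: has_deg_a_def\<close>)
  thus ?thesis using True by (simp add: emb_def fun_eq_iff)
 qed (use neg(1)[OF r_W(2), of i] neg(1)[OF r_W(5), of i] that in simp)
 have dV: "?d i p vs ws 0 = 0" for i p vs ws
  using End_zero[OF fibre_values(1)[OF r_W(2)]] End_zero[OF fibre_values(1)[OF r_W(5)]] by simp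
 let ?h = "%(i, j, n). ((\<i> / 2) ^ n / fact n) *C weyl_term atl (Symp G) (%A x. A x) n p (?d i p) (x j p) vs ws"
 let ?g = "%(i, j, n). (i + 1, j, n :: nat)"
 have "mul_AE G (r_E G r r') x m p vs ws = (\<Sum>(i, j, n)\<in>itriples m. ((\<i> / 2) ^ n / fact n) *C
   weyl_term atl (Symp G) (%A x. A x) n p (r_E G r r' i p) (x j p) vs ws)"
  unfolding mul_AE_def
 proof (rule wprod_itriples)
  have rE: "r_E G r r' i = \<i> *C ?d (i + 1)" for i by (simp only: r_E_def i_over_lambda_def)
  show "r_E G r r' i = 0" if "i < 0" for i unfolding rE using d[of "i + 1"] that by simp
  show "x j = 0" if "j < 0" for j by (rule neg(2)[OF x that])
  show "(0 :: 'e => 'e) (x j p vs ws) = 0" for j p vs ws by simp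
  show "r_E G r r' i p vs ws 0 = 0" for i p vs ws unfolding rE using dV[of "i + 1" p vs ws] by simp
 qed
 also have "... = (SUM t:itriples m. \<i> *C ?h (?g t))"
 proof (rule sum.cong[OF refl])
  fix t assume "t : itriples m"
  obtain i j n where tt: "t = (i, j, n)" by (cases t)
  have eq: "r_E G r r' i p = \<i> *C ?d (i + 1) p" by (simp add: r_E_def i_over_lambda_def fun_eq_iff)
  show "(case t of (i, j, n) => ((\<i> / 2) ^ n / fact n) *C weyl_term atl (Symp G) (%A x. A x) n p (r_E G r r' i p) (x j p) vs ws) =
    \<i> *C ?h (?g t)"
   unfolding tt prod.case eq weyl_term_lin(1) by (simp only: scaleC_scaleC mult.commute)
 qed
 also have "... = \<i> *C (SUM t:?g ` itriples m. ?h t)"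
  by (subst sum.reindex) (auto simp: inj_on_def scaleC_sum_right)
 \<comment> \<open>The shifted index set omits the triples whose first exponent is 0, where the
   difference vanishes by \<open>d\<close>.\<close>
 also have "(SUM t:?g ` itriples m. ?h t) = (SUM t:itriples (m + 1). ?h t)"
 proof (rule sum.mono_neutral_left[OF finite_itriples])
  show "?g ` itriples m <= itriples (m + 1)" by (auto simp: itriples_def)
  show "ALL t:itriples (m + 1) - ?g ` itriples m. ?h t = 0"
  proof
   fix t assume t: "t : itriples (m + 1) - ?g ` itriples m"
   obtain i j n where tt: "t = (i, j, n)" by (cases t)
   have "i <= 0"
   proof (rule ccontr)
    assume "~ i <= 0"
    hence "(i - 1, j, n) : itriples m" "t = ?g (i - 1, j, n)" using t by (auto simp: tt itriples_def)
    thus False using t by blast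
   qed
   hence "?d i p = 0" using d by simp
   hence "?h t = ((\<i> / 2) ^ n / fact n) *C weyl_term atl (Symp G) (%A x. A x) n p (0 *C 0) (x j p) vs ws" by (simp add: tt del: minus_apply)
   thus "?h t = 0" unfolding weyl_term_lin(1) by simp
  qed
 qed
 also have "(SUM t:itriples (m + 1). ?h t) = mul_AE G r' x (m + 1) p vs ws - mul_AE G (emb G r) x (m + 1) p vs ws"
 proof -
  have "?d i p = r' i p - emb G r i p" for i by simp
  thus ?thesis
   unfolding AE_itriples[OF r_W(2) x] AE_itriples[OF r_W(5) x] sum_subtractf[symmetric]
   by (intro sum.cong refl) (clarify, simp only: prod.case weyl_term_lin(2) scaleC_diff_right)
 qed
 finally show "mul_AE G (r_E G r r') x m p vs ws = i_over_lambda (mul_AE G r' x - mul_AE G (emb G r) x) m p vs ws"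
  by (simp add: i_over_lambda_def)
qed

lemma i_over_lambda_add: "i_over_lambda (a + b) = i_over_lambda a + i_over_lambda b" for a b :: "('m, 'n, 'e) wform"
 by (simp add: i_over_lambda_def fun_eq_iff scaleC_add_right)

text \<open>Off the diagonal the commutator with \<open>rh\<close> is \<open>r' x - x r\<close>.
  Inserting \<open>r x\<close> with both signs splits it into the commutator with \<open>r\<close>
  and the left multiplication by \<open>r' - r\<close>, which are the two last terms of
  \<open>fedosov_E\<close>.\<close>

lemma Fd_hat:
 assumes A: "A : W_End G" "has_deg_a 0 A" and x: "x : W_E G" "has_deg_a 0 x" and f: "f : W_C G" "has_deg_a 0 f"
 shows "FB.Fd (hat A x f) = hat (fedosov_End G r' A) (fedosov_E G r r' x) (fedosov_C G r f)"
proof -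
 have W: "hat A x f : T.\<W>" "has_deg_a 0 (hat A x f)" using assms by (simp_all add: hat_W hat_deg)
 have p1: "wprod atl (Symp G) TB rh (hat A x f) = hat (mul_AA G r' A) (mul_AE G r' x) (mul_CC G r f)"
  unfolding rh_def hat_wprod[OF rh_W(1)[unfolded rh_def] W(1)] by (simp add: mul_zero)
 have p2: "wprod atl (Symp G) TB (hat A x f) rh = hat (mul_AA G A r') (mul_EC G x r) (mul_CC G f r)"
  unfolding rh_def hat_wprod[OF W(1) rh_W(1)[unfolded rh_def]] by (simp add: mul_zero)
 have D: "has_deg_a 1 (mul_AA G r' A)" "has_deg_a 1 (mul_CC G r f)" "has_deg_a 1 (mul_AA G A r')" "has_deg_a 1 (mul_EC G x r)" "has_deg_a 1 (mul_CC G f r)"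
  using T.wprod_deg[OF rh_W(1,2) W] T.wprod_deg[OF W rh_W(1,2)] unfolding p1 p2 hat_deg by auto
 have "hat (emb G r) 0 0 : T.\<W>" "has_deg_a 1 (hat (emb G r) (0 :: ('m, 'n, 'e) wform) (0 :: ('m, 'n, complex) wform))"
  using r_W zero_W by (simp_all add: hat_W hat_deg) (simp add: has_deg_a_def)
 from T.wprod_deg[OF this W] hat_wprod[OF this(1) W(1)] have D': "has_deg_a 1 (mul_CE G r x)"
  by (simp add: hat_deg mul_zero CE_emb[OF x(1)])
 have sE: "super_commutator (mul_CE G) (mul_EC G) r x = mul_CE G r x - mul_EC G x r"
  by (rule super_commutator_deg1[where pl="mul_CE G" and pr="mul_EC G" and a=x, OF r_W(3) _ _ D' D(4)]) (simp_all add: mul_zero)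
 have sA: "super_commutator (mul_AA G) (mul_AA G) r' A = mul_AA G r' A - mul_AA G A r'"
  by (rule super_commutator_deg1[where pl="mul_AA G" and pr="mul_AA G" and a=A, OF r_W(4) _ _ D(1,3)]) (simp_all add: mul_zero)
 have sC: "super_commutator (mul_CC G) (mul_CC G) r f = mul_CC G r f - mul_CC G f r"
  by (rule super_commutator_deg1[where pl="mul_CC G" and pr="mul_CC G" and a=f, OF r_W(3) _ _ D(2,5)]) (simp_all add: mul_zero)
 have "i_over_lambda (mul_CE G r x - mul_EC G x r) + mul_AE G (r_E G r r') x = i_over_lambda (mul_AE G r' x - mul_EC G x r)"
  unfolding AE_r_E[OF x(1)] CE_emb[OF x(1)] i_over_lambda_add[symmetric] by simp
 thus ?thesis
  unfolding FB.Fd_def FB.super_commutator_eq[OF W] p1 p2 hat_delta hat_D hat_i_over_lambda hat_lin hat_eq_iff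
   fedosov_End_def fedosov_E_def fedosov_C_def sE sA sC
  by (simp add: add.assoc)
qed

lemma flats_hat: "hat A x f : FB.flats \<longleftrightarrow> A : ker_End G r' & x : ker_E G r r' & f : ker_C G r"
proof (cases "A : W_End G & has_deg_a 0 A & x : W_E G & has_deg_a 0 x & f : W_C G & has_deg_a 0 f")
 case True
 thus ?thesis using Fd_hat[of A x f] hat_zero_iff[of "fedosov_End G r' A"]
  by (auto simp: FB.flats_def hat_W hat_deg ker_End_def ker_E_def ker_C_def)
next
 case False
 thus ?thesis by (auto simp: FB.flats_def hat_W hat_deg ker_End_def ker_E_def ker_C_def)
qed

lemma ker_zero: "0 : ker_End G r'" "0 : ker_E G r r'" "0 : ker_C G r"
proof -
 have "0 : FB.flats" using FB.flats_lin[OF FB.csec_flats FB.csec_flats, of 0 "-1" 0] by simp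
 moreover have "hat 0 0 0 = (0 :: ('m, 'n, ('e => 'e) \<times> 'e \<times> complex) wform)" by (simp add: hat_zero_iff)
 ultimately have "hat 0 0 0 : FB.flats" by (simp only:)
 thus "0 : ker_End G r'" "0 : ker_E G r r'" "0 : ker_C G r" by (simp_all add: flats_hat)
qed

lemma sigma_inj:
 assumes "hat A x f : FB.flats" "hat A' x' f' : FB.flats" "sigma A = sigma A'" "sigma x = sigma x'" "sigma f = sigma f'"
 shows "A = A' & x = x' & f = f'"
 using FB.tau_sigma[OF assms(1)] FB.tau_sigma[OF assms(2)] assms(3-5) unfolding sigma_hat hat_eq_iff[symmetric] by simp

abbreviation (input) "PA == series (smooth_EndE G)"
abbreviation (input) "PE == series (smooth_E G)"
abbreviation (input) "PC == series (smooth_C G)"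

lemma series_hats: "hats f g h : series TS \<longleftrightarrow> f : PA & g : PE & h : PC"
proof -
 have "hats f g h m = 0 \<longleftrightarrow> f m = 0 & g m = 0 & h m = 0" for m
  by (auto simp: hats_def fun_eq_iff zero_prod_def)
 moreover have "TS UNIV (hats f g h m) \<longleftrightarrow> SA UNIV (f m) & SE UNIV (g m) & smooth_fun atl UNIV (h m)" for m
  by (simp add: TS_def hats_def eta_contract_eq)
 ultimately show ?thesis unfolding series_def mem_Collect_eq by blast
qed

lemma tau_hats:
 assumes f: "f : PA" and g: "g : PE" and h: "h : PC"
 shows "FB.tau (hats f g h) = hat (tau_End G r' f) (tau_E G r r' g) (tau_C G r h)"
proof -
 have s: "hats f g h : series TS" using assms by (simp add: series_hats)
 obtain A x a where t: "FB.tau (hats f g h) = hat A x a" using wform_hat by blast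
 have fl: "hat A x a : FB.flats" using FB.tau_flats[OF s] by (simp add: t)
 hence k: "A : ker_End G r'" "x : ker_E G r r'" "a : ker_C G r" by (simp_all add: flats_hat)
 have "hats (sigma A) (sigma x) (sigma a) = hats f g h" using FB.sigma_tau[OF s] unfolding t sigma_hat .
 hence sg: "sigma A = f" "sigma x = g" "sigma a = h" by (simp_all add: hats_eq_iff)
 \<comment> \<open>Injectivity on each kernel separately follows by padding with zeros, which are
   flat (\<open>ker_zero\<close>). It makes \<open>inv_into\<close> return the components
   found.\<close>
 have "inj_on sigma (ker_End G r')" "inj_on sigma (ker_E G r r')" "inj_on sigma (ker_C G r)"
  using sigma_inj[of _ 0 0 _ 0 0] sigma_inj[of 0 _ 0 0 _ 0] sigma_inj[of 0 0 _ 0 0] ker_zero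
  by (auto simp: inj_on_def flats_hat)
 hence "tau_End G r' f = A" "tau_E G r r' g = x" "tau_C G r h = a"
  unfolding tau_End_def tau_E_def tau_C_def sg[symmetric] using k by (simp_all add: inv_into_f_f)
 thus ?thesis by (simp add: t)
qed

lemma P_zero: "0 : PA" "0 : PE" "0 : PC"
proof -
 have "hats 0 0 0 = FB.csec 0" by (simp add: hats_def FB.csec_def fun_eq_iff zero_prod_def)
 hence "hats 0 0 0 : series TS" using FB.csec_series[of 0] by simp
 thus "0 : PA" "0 : PE" "0 : PC" by (simp_all add: series_hats)
qed

lemma tau_zero: "tau_End G r' 0 = 0" "tau_E G r r' 0 = 0" "tau_C G r 0 = 0"
proof -
 have fl: "hat 0 0 0 : FB.flats" using ker_zero by (simp add: flats_hat)
 have "FB.tau (hats 0 0 0) = hat 0 0 0"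
  using FB.tau_sigma[OF fl] by (simp add: sigma_hat sigma_zero)
 thus "tau_End G r' 0 = 0" "tau_E G r r' 0 = 0" "tau_C G r 0 = 0"
  by (simp_all add: tau_hats[OF P_zero] hat_eq_iff)
qed

lemma act_zero: "left_act G r r' a 0 = 0" "left_act G r r' 0 = (%_. 0)" "right_act G r r' x 0 = 0" "right_act G r r' 0 = (%_. 0)"
 "star_End G r' a 0 = 0" "star_End G r' 0 = (%_. 0)" "star G r f 0 = 0" "star G r 0 = (%_. 0)"
 by (rule ext | simp add: left_act_def right_act_def star_End_def star_def tau_zero mul_zero sigma_zero)+

lemma fstar_hats:
 assumes f: "f : PA" "f' : PA" and g: "g : PE" "g' : PE" and h: "h : PC" "h' : PC"
 shows "FB.fstar (hats f g h) (hats f' g' h') =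
  hats (star_End G r' f f') (left_act G r r' f g' + right_act G r r' g h') (star G r h h')"
proof -
 have W: "hat (tau_End G r' f) (tau_E G r r' g) (tau_C G r h) : T.\<W>" if "f : PA" "g : PE" "h : PC" for f g h
  using FB.flatsD(1)[OF FB.tau_flats, of "hats f g h"] that by (simp add: series_hats tau_hats)
 show ?thesis
  unfolding FB.fstar_def tau_hats[OF f(1) g(1) h(1)] tau_hats[OF f(2) g(2) h(2)]
   hat_wprod[OF W[OF f(1) g(1) h(1)] W[OF f(2) g(2) h(2)]] sigma_hat sigma_add
   star_End_def left_act_def right_act_def star_def ..
qed

text \<open>Endomorphisms, vectors and functions are embedded as the three kinds of matrices with a
  single nonzero entry. Each law becomes a law of \<open>fstar\<close> for such matrices, and
  injectivity of \<open>iE\<close> leads back.\<close>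

lemma bimodule_laws:
 "bimodule PA (star_End G r') (const_series (id_End (Fibre G))) PC (star G r) (const_series (%p. 1))
  PE (left_act G r r') (right_act G r r')"
proof -
 define iA where "iA a = hats a (0 :: int => 'm => 'e) (0 :: int => 'm => complex)" for a :: "int => 'm => 'e => 'e"
 define iE where "iE x = hats (0 :: int => 'm => 'e => 'e) x (0 :: int => 'm => complex)" for x :: "int => 'm => 'e"
 define iC where "iC f = hats (0 :: int => 'm => 'e => 'e) (0 :: int => 'm => 'e) f" for f :: "int => 'm => complex"
 note i_defs = iA_def iE_def iC_def
 have s: "iA a : series TS" "iE x : series TS" "iC f : series TS" if "a : PA" "x : PE" "f : PC" for a x f
  using that P_zero by (simp_all add: i_defs series_hats)
 note sA = s(1)[OF _ P_zero(2,3)] and sE = s(2)[OF P_zero(1) _ P_zero(3)] and sC = s(3)[OF P_zero(1,2)]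
 have inj: "iE x = iE y ==> x = y" for x y by (simp add: iE_def hats_eq_iff)
 have add: "iA (a + b) = iA a + iA b" "iE (x + y) = iE x + iE y" "iC (f + g) = iC f + iC g" for a b x y f g
  by (simp_all add: i_defs hats_add)
 have lam: "iA (lambda_scale z a) = lambda_scale z (iA a)" "iE (lambda_scale z x) = lambda_scale z (iE x)"
  "iC (lambda_scale z f) = lambda_scale z (iC f)" for z a x f
  by (simp_all add: i_defs hats_lambda_scale lambda_scale_zero)
 have AE: "iE (left_act G r r' a x) = FB.fstar (iA a) (iE x)" if "a : PA" "x : PE" for a x
  unfolding i_defs using that by (subst fstar_hats) (simp_all add: P_zero act_zero)
 have EC: "iE (right_act G r r' x f) = FB.fstar (iE x) (iC f)" if "x : PE" "f : PC" for x f
  unfolding i_defs using that by (subst fstar_hats) (simp_all add: P_zero act_zero)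
 have AA: "iA (star_End G r' a b) = FB.fstar (iA a) (iA b)" if "a : PA" "b : PA" for a b
  unfolding i_defs using that by (subst fstar_hats) (simp_all add: P_zero act_zero)
 have CC: "iC (star G r f g) = FB.fstar (iC f) (iC g)" if "f : PC" "g : PC" for f g
  unfolding i_defs using that by (subst fstar_hats) (simp_all add: P_zero act_zero)
 have cl: "left_act G r r' a x : PE" "star_End G r' a b : PA" "right_act G r r' x f : PE" "star G r f g : PC"
  if "a : PA" "b : PA" "x : PE" "f : PC" "g : PC" for a b x f g
  using FB.fstar_series[OF sA sE, of a x] FB.fstar_series[OF sA sA, of a b] FB.fstar_series[OF sE sC, of x f]
   FB.fstar_series[OF sC sC, of f g] that AE[of a x] EC[of x f] AA[of a b] CC[of f g]
  by (metis (no_types, lifting) i_defs series_hats)+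
 note clE = cl(1)[OF _ P_zero(1) _ P_zero(3,3)] cl(3)[OF P_zero(1,1) _ _ P_zero(3)]
 have sum: "u + v : series TS" "lambda_scale z u : series TS" if "u : series TS" "v : series TS" for u v z
 proof -
  show "u + v : series TS"
   using FB.sigma_series[OF FB.flatsD(1)[OF FB.flats_lin[OF FB.tau_flats[OF that(1)] FB.tau_flats[OF that(2)], of 1]]]
   by (simp add: scaleC_one sigma_add FB.sigma_tau that)
  show "lambda_scale z u : series TS"
   using FB.sigma_series[OF FB.flatsD(1)[OF FB.lambda_scale_flats[OF FB.tau_flats[OF that(1)]]], of z]
   by (simp add: FB.sigma_lambda_scale FB.sigma_tau that)
 qed
 have Padd: "a + b : PA" "x + y : PE" "f + g : PC" "lambda_scale z a : PA" "lambda_scale z x : PE" "lambda_scale z f : PC"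
  if "a : PA" "b : PA" "x : PE" "y : PE" "f : PC" "g : PC" for a b x y f g z
  using sum(1)[of "hats a x f" "hats b y g"] sum(2)[of "hats a x f" "hats b y g" z] that
  by (simp_all add: series_hats hats_add hats_lambda_scale)
 note PA_add = Padd(1)[OF _ _ P_zero(2,2,3,3)] and PE_add = Padd(2)[OF P_zero(1,1) _ _ P_zero(3,3)]
  and PC_add = Padd(3)[OF P_zero(1,1,2,2)] and PA_scale = Padd(4)[OF _ P_zero(1,2,2,3,3)]
  and PE_scale = Padd(5)[OF P_zero(1,1) _ P_zero(2,3,3)] and PC_scale = Padd(6)[OF P_zero(1,1,2,2) _ P_zero(3)]
 have unit: "const_series Tu = hats (const_series (id_End (Fibre G))) 0 (const_series (%p. 1))"
  by (simp add: const_series_def hats_def Tu_def fun_eq_iff prod_eq_iff)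
 have "const_series Tu : series TS"
  using T.S_u[OF open_UNIV] T.S_zero[OF open_UNIV] by (simp add: series_def const_series_def zero_fun_def)
 hence one: "const_series (id_End (Fibre G)) : PA" "const_series (%p. 1) : PC"
  unfolding unit series_hats by auto
 \<comment> \<open>The unit of the triangular algebra has both diagonal entries. On a matrix with
   only the vector entry, its endomorphism entry acts from the left and its function entry from the
   right, the other products being zero.\<close>
 have uL: "left_act G r r' (const_series (id_End (Fibre G))) x = x" "right_act G r r' x (const_series (%p. 1)) = x" if x: "x : PE" for x
  using FB.fstar_unit_left[OF sE[OF x] sE[OF x] sE[OF x]] FB.fstar_unit_right[OF sE[OF x] sE[OF x] sE[OF x]]
  unfolding unit iE_def by (simp_all add: fstar_hats one x P_zero act_zero hats_eq_iff)
 show ?thesis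
  unfolding bimodule_def left_module_def right_module_def
  by (intro conjI ballI allI; (rule inj)?;
   simp add: clE uL AE EC AA CC add lam PA_add PE_add PC_add PA_scale PE_scale PC_scale one
    cl(2)[OF _ _ P_zero(2,3,3)] cl(4)[OF P_zero(1,1,2)]
    FB.fstar_add_left FB.fstar_add_right FB.fstar_lambda_left[OF _ _ sA[OF P_zero(1)]] FB.fstar_lambda_right[OF _ _ sA[OF P_zero(1)]] FB.fstar_assoc sA sE sC)
qed

end

theorem corollary1:
  fixes G :: "('m::{t2_space, second_countable_topology}, 'n::finite, 'e::complex_space) fedosov_data"
    and r :: "('m, 'n, complex) wform"
    and r' :: "('m, 'n, 'e \<Rightarrow> 'e) wform"
  assumes "smooth_atlas (Atlas G)"
    and "symplectic_form (Atlas G) (Symp G)"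
    and "symplectic_connection (Atlas G) (Symp G) (Conn G)"
    and "torsion_free (Atlas G) (Conn G)"
    and "vector_bundle (Atlas G) (Fibre G) (Frames G)"
    and "linear_connection (Atlas G) (Fibre G) (Frames G) (EConn G)"
    and "\<forall>i. closed_two_form (Atlas G) (Omega G i)"
    and "\<forall>i\<le>0. Omega G i = 0"
    and "fedosov_element G r"
    and "fedosov_element_End G r'"
  shows "bimodule
      (series (smooth_EndE G)) (star_End G r') (const_series (id_End (Fibre G)))
      (series (smooth_C G)) (star G r) (const_series (\<lambda>p. 1))
      (series (smooth_E G)) (left_act G r r') (right_act G r r')"
proof -
  interpret fedosov_elements G r r'
    using assms by unfold_locales
  show ?thesis by (rule bimodule_laws)
qed

end
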